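(* Let $n\ge2$. Let $V\subseteq\mathbb{R}^{n+1}\times(\mathbb{R}^n\setminus\{0\})$ be an open conic subset, and let $\Phi\in C^\infty(V)$ be real-valued and positively homogeneous of degree $1$ in the fiber variable $\eta$. Let $m\in\mathbb{R}$ and $a\in S^m(\mathbb{R}^{n+1}\times\mathbb{R}^n)$ be such that $(z,\eta)\in V$ whenever $(z,\eta)\in\operatorname{supp}(a)$ and $\eta\ne0$. Writing $z=(x,t)\in\mathbb{R}^n\times\mathbb{R}$, suppose that $\operatorname{rank}\partial^2_{x\eta}\Phi(z_0,\eta_0)=n$ for all $(z_0,\eta_0)\in\operatorname{supp}(a)$ with $\eta_0\ne0$. For $f\in\mathcal{S}(\mathbb{R}^n)$, $x\in\mathbb{R}^n$ and $t\in\mathbb{R}$ set $$T_tf(x):=\int_{\mathbb{R}^n}e^{i\Phi(x,t,\eta)}a(x,t,\eta)\widehat f(\eta)\,d\eta.$$ Let $p\in[1,\infty]$ and $s\in\mathbb{R}$. Suppose that there exist a $z_0=(x_0,t_0)\in\mathbb{R}^{n+1}$, a non-empty open conic set $V'\subseteq\mathbb{R}^n\setminus\{0\}$ and $c',C'>0$ such that $|a(z_0,\eta)|\ge c'|\eta|^m$ and $\partial_t\Phi(x_0,t,\eta)|_{t=t_0}\ne0$ for all $\eta\in V'$ with $|\eta|\ge C'$. If there exists a $C\ge0$ such that $$\Big\|\sup_{t\in\mathbb{R}}|T_tf|\Big\|_{L^p(\mathbb{R}^n)}\le C\|f\|_{\mathcal{H}^{s,p}_{FIO}(\mathbb{R}^n)}$$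 for all $f\in\mathcal{S}(\mathbb{R}^n)$, then $s\ge\frac{n-1}{2}\big(\frac1p-\frac12\big)+\frac1p+m$.
   Context: A set $V\subseteq\mathbb{R}^{n+1}\times(\mathbb{R}^n\setminus\{0\})$ is conic if $(z,\lambda\eta)\in V$ whenever $(z,\eta)\in V$ and $\lambda>0$; $V'\subseteq\mathbb{R}^n\setminus\{0\}$ is conic if $\lambda\eta\in V'$ for all $\eta\in V'$, $\lambda>0$. $S^m(\mathbb{R}^{n+1}\times\mathbb{R}^n)$ is the set of $a\in C^\infty(\mathbb{R}^{n+1}\times\mathbb{R}^n)$ with $\sup_{z,\eta}\langle\eta\rangle^{|\beta|-m}|\partial_z^\alpha\partial_\eta^\beta a(z,\eta)|<\infty$ for all $\alpha\in\mathbb{Z}_+^{n+1}$, $\beta\in\mathbb{Z}_+^n$. $\partial^2_{x\eta}\Phi$ is the mixed Hessian. Notation: $\widehat f(\xi)=\int_{\mathbb{R}^n}e^{-ix\cdot\xi}f(x)\,dx$; $m(D)$ is the Fourier multiplier with symbol $m$; $\langle\xi\rangle=(1+|\xi|^2)^{1/2}$; $\hat\xi=\xi/|\xi|$ for $\xi\ne0$; $\mathbb{Z}_+=\{0,1,2,\dots\}$. Hardy spaces for Fourier integral operators: fix $q\in C_c^\infty(\mathbb{R}^n)$ with $q(\xi)=1$ for $|\xi|\le2$. For $1<p<\infty$ let $\mathcal{H}^p(\mathbb{R}^n):=L^p(\mathbb{R}^n)$, and let $\mathcal{H}^1(\mathbb{R}^n)$ be the local real Hardy space with norm $\|q(D)f\|_{L^1}+\|(1-q)(D)f\|_{H^1}$,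 where $H^1(\mathbb{R}^n)$ is the classical real Hardy space. Fix a family $(\varphi_\omega)_{\omega\in S^{n-1}}\subseteq C^\infty(\mathbb{R}^n)$ such that: (1) for all $\omega\in S^{n-1}$ and $\xi\neq0$, $\varphi_\omega(\xi)=0$ if $|\xi|<\frac14$ or $|\hat\xi-\omega|>|\xi|^{-1/2}$; (2) for all $\alpha\in\mathbb{Z}_+^n$, $\beta\in\mathbb{Z}_+$ there is $C_{\alpha,\beta}\ge0$ with $|(\omega\cdot\partial_\xi)^\beta\partial_\xi^\alpha\varphi_\omega(\xi)|\le C_{\alpha,\beta}|\xi|^{\frac{n-1}{4}-\frac{|\alpha|}{2}-\beta}$ for all $\omega\in S^{n-1}$, $\xi\ne0$; (3) $(\xi,\omega)\mapsto\varphi_\omega(\xi)$ is measurable and $\int_{S^{n-1}}\varphi_\omega(\xi)^2\,d\omega=1$ for $|\xi|\ge1$. For $p\in[1,\infty)$, $\mathcal{H}^p_{FIO}(\mathbb{R}^n)$ consists of all $f\in\mathcal{S}'(\mathbb{R}^n)$ with $q(D)f\in L^p(\mathbb{R}^n)$, $\varphi_\omega(D)f\in\mathcal{H}^p(\mathbb{R}^n)$ for almost all $\omega$, and finite norm $\|f\|_{\mathcal{H}^p_{FIO}}:=\|q(D)f\|_{L^p}+\big(\int_{S^{n-1}}\|\varphi_\omega(D)f\|_{\mathcal{H}^p}^p\,d\omega\big)^{1/p}$. Moreover $\mathcal{H}^\infty_{FIO}(\mathbb{R}^n):=(\mathcal{H}^1_{FIO}(\mathbb{R}^n))^*$, viewed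 as a space of tempered distributions. For $p\in[1,\infty]$ and $s\in\mathbb{R}$, $\mathcal{H}^{s,p}_{FIO}(\mathbb{R}^n)$ consists of all $f\in\mathcal{S}'(\mathbb{R}^n)$ with $\langle D\rangle^sf\in\mathcal{H}^p_{FIO}(\mathbb{R}^n)$, with norm $\|\langle D\rangle^sf\|_{\mathcal{H}^p_{FIO}}$. *)

theory Defs
  imports "HOL-Probability.Probability"
begin

section \<open>Smooth functions and symbols\<close>

definition pderiv_dir :: "'a::euclidean_space \<Rightarrow> ('a \<Rightarrow> 'b::real_normed_vector) \<Rightarrow> 'a \<Rightarrow> 'b"
  where "pderiv_dir v f x = frechet_derivative f (at x) v"

text \<open>Iterated partial derivatives are indexed by lists \<open>vs\<close> of (basis) directions. For smooth
  functions the order is immaterial, so quantifying over all lists of basis vectors is the same as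
  quantifying over all multi-indices, the order of a multi-index being the length of the list.\<close>

definition pderivs :: "'a::euclidean_space list \<Rightarrow> ('a \<Rightarrow> 'b::real_normed_vector) \<Rightarrow> 'a \<Rightarrow> 'b"
  where "pderivs vs f = foldr pderiv_dir vs f"

text \<open>\<open>C\<^sup>\<infinity>\<close>; only meant for open \<open>S\<close>.\<close>

definition smooth_on :: "'a::euclidean_space set \<Rightarrow> ('a \<Rightarrow> 'b::real_normed_vector) \<Rightarrow> bool"
  where "smooth_on S f \<longleftrightarrow> (\<forall>vs. set vs \<subseteq> Basis \<longrightarrow> pderivs vs f differentiable_on S)"

definition supp :: "('a::topological_space \<Rightarrow> 'b::zero) \<Rightarrow> 'a set"
  where "supp f = closure {x. f x \<noteq> 0}"

definition japanese :: "'a::real_normed_vector \<Rightarrow> real"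
  where "japanese x = sqrt (1 + (norm x)\<^sup>2)"

definition symbol_class :: "real \<Rightarrow> ('z::euclidean_space \<times> 'a::euclidean_space \<Rightarrow> complex) set"
  where "symbol_class m = {a. smooth_on UNIV a \<and>
    (\<forall>vs ws. set vs \<subseteq> Basis \<and> set ws \<subseteq> Basis \<longrightarrow>
      bounded (range (\<lambda>(z, \<eta>). japanese \<eta> powr (real (length ws) - m) *
        norm (pderivs (map (\<lambda>v. (v, 0)) vs @ map (\<lambda>w. (0, w)) ws) a (z, \<eta>)))))}"

text \<open>Not \<^const>\<open>conic\<close> from the library, which also allows the dilation factor 0.\<close>

definition pos_conic :: "'a::real_vector set \<Rightarrow> bool"
  where "pos_conic V \<longleftrightarrow> (\<forall>\<eta>\<in>V. \<forall>c>0. c *\<^sub>R \<eta> \<in> V)"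

definition fiber_conic :: "('z \<times> 'a::real_vector) set \<Rightarrow> bool"
  where "fiber_conic V \<longleftrightarrow> (\<forall>(z, \<eta>)\<in>V. \<forall>c>0. (z, c *\<^sub>R \<eta>) \<in> V)"

text \<open>For \<open>\<Phi>\<close> a function of \<open>((x, t), \<eta>)\<close>: entry \<open>(i, j)\<close> is
  \<open>\<partial>\<^bsub>x\<^sub>i\<^esub> \<partial>\<^bsub>\<eta>\<^sub>j\<^esub> \<Phi>\<close>.\<close>

definition mixed_hessian ::
    "(((real^'n) \<times> real) \<times> (real^'n) \<Rightarrow> real) \<Rightarrow> ((real^'n) \<times> real) \<times> (real^'n) \<Rightarrow> real^'n^'n"
  where "mixed_hessian \<Phi> p = (\<chi> i j. pderivs [((axis i 1, 0), 0), ((0, 0), axis j 1)] \<Phi> p)"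

section \<open>Schwartz functions, tempered distributions, Fourier multipliers\<close>

definition schwartz :: "('a::euclidean_space \<Rightarrow> complex) set"
  where "schwartz = {f. smooth_on UNIV f \<and>
    (\<forall>N vs. set vs \<subseteq> Basis \<longrightarrow> bounded (range (\<lambda>x. (1 + norm x) ^ N * norm (pderivs vs f x))))}"

definition schwartz_seminorm :: "nat \<Rightarrow> ('a::euclidean_space \<Rightarrow> complex) \<Rightarrow> real"
  where "schwartz_seminorm N f =
    (SUP (x, vs) \<in> UNIV \<times> {vs. set vs \<subseteq> Basis \<and> length vs \<le> N}.
      (1 + norm x) ^ N * norm (pderivs vs f x))"

text \<open>Tempered distributions are normalised to vanish on functions outside the Schwartz space, so
  that two of them are equal iff they agree on Schwartz functions, and so that they form a vector
  space under the pointwise operations.\<close>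

type_synonym 'a distribution = "('a \<Rightarrow> complex) \<Rightarrow> complex"

definition tempered :: "'a::euclidean_space distribution set"
  where "tempered = {u.
    (\<forall>f\<in>schwartz. \<forall>g\<in>schwartz. \<forall>c d. u (\<lambda>x. c * f x + d * g x) = c * u f + d * u g) \<and>
    (\<exists>C N. \<forall>f\<in>schwartz. norm (u f) \<le> C * schwartz_seminorm N f) \<and>
    (\<forall>f. f \<notin> schwartz \<longrightarrow> u f = 0)}"

definition distr_of :: "('a::euclidean_space \<Rightarrow> complex) \<Rightarrow> 'a distribution"
  where "distr_of g = (\<lambda>f. if f \<in> schwartz then (\<integral>x. g x * f x \<partial>lborel) else 0)"

definition fourier :: "('a::euclidean_space \<Rightarrow> complex) \<Rightarrow> 'a \<Rightarrow> complex"
  where "fourier f \<xi> = (\<integral>x. exp (- \<i> * of_real (x \<bullet> \<xi>)) * f x \<partial>lborel)"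

definition inv_fourier :: "('a::euclidean_space \<Rightarrow> complex) \<Rightarrow> 'a \<Rightarrow> complex"
  where "inv_fourier f x =
    (\<integral>\<xi>. exp (\<i> * of_real (x \<bullet> \<xi>)) * f \<xi> \<partial>lborel) / of_real ((2 * pi) ^ DIM('a))"

text \<open>\<open>m(D) u\<close> is the inverse Fourier transform of \<open>m\<close> times the Fourier transform of \<open>u\<close>. Moving
  the three operations to the test function \<open>f\<close> by duality gives the formula below. It is used
  for smooth \<open>m\<close> all of whose derivatives grow at most polynomially.\<close>

definition fmult :: "('a::euclidean_space \<Rightarrow> complex) \<Rightarrow> 'a distribution \<Rightarrow> 'a distribution"
  where "fmult m u =
    (\<lambda>f. if f \<in> schwartz then u (fourier (\<lambda>\<xi>. m \<xi> * inv_fourier f \<xi>)) else 0)"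

section \<open>Lebesgue and Hardy norms\<close>

text \<open>All norms take values in \<open>[0, \<infinity>]\<close>, with value \<open>\<infinity>\<close> outside the space in question.\<close>

text \<open>The power \<open>x\<^sup>r\<close> for \<open>x \<in> [0, \<infinity>]\<close> and \<open>r > 0\<close>.\<close>

definition epowr :: "ennreal \<Rightarrow> real \<Rightarrow> ennreal"
  where "epowr x r = (if x = \<infinity> then \<infinity> else ennreal (enn2real x powr r))"

definition Lp_norm_fun :: "ennreal \<Rightarrow> ('a::euclidean_space \<Rightarrow> ennreal) \<Rightarrow> ennreal"
  where "Lp_norm_fun p g =
    (if p = \<infinity> then esssup lborel g
     else epowr (\<integral>\<^sup>+x. epowr (g x) (enn2real p) \<partial>lborel) (1 / enn2real p))"

text \<open>The infimum is over the functions in \<open>L\<^sup>p\<close> that represent \<open>u\<close>; they all agree almost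
  everywhere.\<close>

definition Lp_norm :: "ennreal \<Rightarrow> 'a::euclidean_space distribution \<Rightarrow> ennreal"
  where "Lp_norm p u =
    Inf {Lp_norm_fun p (\<lambda>x. ennreal (norm (g x))) | g.
      g \<in> borel_measurable borel \<and> Lp_norm_fun p (\<lambda>x. ennreal (norm (g x))) < \<infinity> \<and> u = distr_of g}"

text \<open>The classical real Hardy space \<open>H\<^sup>1\<close>, normed by the (Fefferman-Stein) heat maximal function:
  \<open>u (\<lambda>y. heat_kernel \<tau> (x - y))\<close> is the convolution of \<open>u\<close> with the heat kernel at \<open>x\<close>.\<close>

definition heat_kernel :: "real \<Rightarrow> 'a::euclidean_space \<Rightarrow> complex"
  where "heat_kernel \<tau> x =
    of_real ((4 * pi * \<tau>) powr (- real DIM('a) / 2) * exp (- (norm x)\<^sup>2 / (4 * \<tau>)))"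

definition H1_norm :: "'a::euclidean_space distribution \<Rightarrow> ennreal"
  where "H1_norm u =
    (\<integral>\<^sup>+x. (SUP \<tau>\<in>{0<..}. ennreal (norm (u (\<lambda>y. heat_kernel \<tau> (x - y))))) \<partial>lborel)"

text \<open>For \<open>p = 1\<close> the local real Hardy space, for \<open>1 < p < \<infinity>\<close> the Lebesgue space.\<close>

definition hardy_norm ::
    "('a::euclidean_space \<Rightarrow> complex) \<Rightarrow> ennreal \<Rightarrow> 'a distribution \<Rightarrow> ennreal"
  where "hardy_norm q p u =
    (if p = 1 then Lp_norm 1 (fmult q u) + H1_norm (fmult (\<lambda>\<xi>. 1 - q \<xi>) u) else Lp_norm p u)"

section \<open>Hardy spaces for Fourier integral operators\<close>

text \<open>The (unnormalised) surface measure on the unit sphere, as the cone measure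
  \<open>A \<mapsto> n |{r \<omega> : 0 < r < 1, \<omega> \<in> A}|\<close>.\<close>

definition sphere_measure :: "'a::euclidean_space measure"
  where "sphere_measure = scale_measure (ennreal (real DIM('a)))
    (distr (restrict_space lborel (ball 0 1 - {0})) (restrict_space borel (sphere 0 1)) sgn)"

definition low_freq_cutoff :: "('a::euclidean_space \<Rightarrow> complex) \<Rightarrow> bool"
  where "low_freq_cutoff q \<longleftrightarrow>
    smooth_on UNIV q \<and> compact (supp q) \<and> (\<forall>\<xi>. norm \<xi> \<le> 2 \<longrightarrow> q \<xi> = 1)"

text \<open>\<open>\<phi> \<omega> \<xi>\<close> is \<open>\<phi>\<^sub>\<omega>(\<xi>)\<close>; only \<open>\<omega>\<close> in the unit sphere matters. Note that \<open>sgn \<xi> = \<xi> / |\<xi>|\<close>.\<close>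

definition wave_packets :: "('a::euclidean_space \<Rightarrow> 'a \<Rightarrow> complex) \<Rightarrow> bool"
  where "wave_packets \<phi> \<longleftrightarrow>
    (\<forall>\<omega>\<in>sphere 0 1. smooth_on UNIV (\<phi> \<omega>)) \<and>
    (\<forall>\<omega>\<in>sphere 0 1. \<forall>\<xi>. \<xi> \<noteq> 0 \<and>
      (norm \<xi> < 1/4 \<or> norm (sgn \<xi> - \<omega>) > norm \<xi> powr (-1/2)) \<longrightarrow> \<phi> \<omega> \<xi> = 0) \<and>
    (\<forall>vs k. set vs \<subseteq> Basis \<longrightarrow>
      (\<exists>C\<ge>0. \<forall>\<omega>\<in>sphere 0 1. \<forall>\<xi>. \<xi> \<noteq> 0 \<longrightarrow>
        norm (pderivs (replicate k \<omega> @ vs) (\<phi> \<omega>) \<xi>)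
          \<le> C * norm \<xi> powr ((real DIM('a) - 1) / 4 - real (length vs) / 2 - real k))) \<and>
    (\<lambda>(\<xi>, \<omega>). \<phi> \<omega> \<xi>) \<in> borel_measurable (borel \<Otimes>\<^sub>M sphere_measure) \<and>
    (\<forall>\<xi>. norm \<xi> \<ge> 1 \<longrightarrow> (\<integral>\<omega>. (\<phi> \<omega> \<xi>)\<^sup>2 \<partial>sphere_measure) = 1)"

text \<open>The norm and the space for \<open>1 \<le> p < \<infinity>\<close>.\<close>

definition HFIO_fin_norm ::
    "('a::euclidean_space \<Rightarrow> complex) \<Rightarrow> ('a \<Rightarrow> 'a \<Rightarrow> complex) \<Rightarrow> ennreal \<Rightarrow> 'a distribution \<Rightarrow> ennreal"
  where "HFIO_fin_norm q \<phi> p u = Lp_norm p (fmult q u) +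
    epowr (\<integral>\<^sup>+\<omega>. epowr (hardy_norm q p (fmult (\<phi> \<omega>) u)) (enn2real p) \<partial>sphere_measure)
      (1 / enn2real p)"

definition HFIO_fin ::
    "('a::euclidean_space \<Rightarrow> complex) \<Rightarrow> ('a \<Rightarrow> 'a \<Rightarrow> complex) \<Rightarrow> ennreal \<Rightarrow> 'a distribution set"
  where "HFIO_fin q \<phi> p = {u \<in> tempered. Lp_norm p (fmult q u) < \<infinity> \<and>
    (AE \<omega> in sphere_measure. hardy_norm q p (fmult (\<phi> \<omega>) u) < \<infinity>) \<and> HFIO_fin_norm q \<phi> p u < \<infinity>}"

text \<open>The dual of the space for \<open>p = 1\<close>. A functional \<open>L\<close> in the dual is viewed as the tempered
  distribution \<open>g \<mapsto> L g\<close>, for Schwartz functions \<open>g\<close> (bilinear pairing); these are dense, so at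
  most one element of the dual occurs in the infimum defining \<open>HFIO_inf_norm\<close>.\<close>

definition HFIO1_dual_norm ::
    "('a::euclidean_space \<Rightarrow> complex) \<Rightarrow> ('a \<Rightarrow> 'a \<Rightarrow> complex) \<Rightarrow> ('a distribution \<Rightarrow> complex) \<Rightarrow> ennreal"
  where "HFIO1_dual_norm q \<phi> L =
    (SUP v\<in>{v \<in> HFIO_fin q \<phi> 1. HFIO_fin_norm q \<phi> 1 v \<le> 1}. ennreal (norm (L v)))"

definition HFIO1_dual ::
    "('a::euclidean_space \<Rightarrow> complex) \<Rightarrow> ('a \<Rightarrow> 'a \<Rightarrow> complex) \<Rightarrow> ('a distribution \<Rightarrow> complex) set"
  where "HFIO1_dual q \<phi> = {L.
    (\<forall>u\<in>HFIO_fin q \<phi> 1. \<forall>v\<in>HFIO_fin q \<phi> 1. \<forall>c d.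
      L (\<lambda>f. c * u f + d * v f) = c * L u + d * L v) \<and> HFIO1_dual_norm q \<phi> L < \<infinity>}"

definition HFIO_inf_norm ::
    "('a::euclidean_space \<Rightarrow> complex) \<Rightarrow> ('a \<Rightarrow> 'a \<Rightarrow> complex) \<Rightarrow> 'a distribution \<Rightarrow> ennreal"
  where "HFIO_inf_norm q \<phi> u =
    (INF L\<in>{L \<in> HFIO1_dual q \<phi>. \<forall>g\<in>schwartz. u g = L (distr_of g)}. HFIO1_dual_norm q \<phi> L)"

definition HFIO_norm ::
    "('a::euclidean_space \<Rightarrow> complex) \<Rightarrow> ('a \<Rightarrow> 'a \<Rightarrow> complex) \<Rightarrow> real \<Rightarrow> ennreal \<Rightarrow> 'a distribution \<Rightarrow> ennreal"
  where "HFIO_norm q \<phi> s p u =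
    (let v = fmult (\<lambda>\<xi>. of_real (japanese \<xi> powr s)) u
     in if p = \<infinity> then HFIO_inf_norm q \<phi> v else HFIO_fin_norm q \<phi> p v)"

section \<open>The Fourier integral operators\<close>

definition fio ::
    "(((real^'n) \<times> real) \<times> (real^'n) \<Rightarrow> real) \<Rightarrow> (((real^'n) \<times> real) \<times> (real^'n) \<Rightarrow> complex) \<Rightarrow>
     real \<Rightarrow> (real^'n \<Rightarrow> complex) \<Rightarrow> real^'n \<Rightarrow> complex"
  where "fio \<Phi> a t f x =
    (\<integral>\<eta>. exp (\<i> * of_real (\<Phi> ((x, t), \<eta>))) * a ((x, t), \<eta>) * fourier f \<eta> \<partial>lborel)"

end

theory Submission
 imports Defs
begin

text \<open>
The exponent is forced by a single wave packet. Fix a unit vector \<open>\<omega>\<close> in \<open>V'\<close> and let the Fourier transform of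
\<open>f\<close> be \<open>exp (- \<i> \<eta> \<bullet> y)\<close> times a nonnegative bump adapted to the plank of all \<open>\<eta>\<close> near \<open>R \<omega>\<close>, of length about \<open>R\<close> in
the direction \<open>\<omega>\<close> and of width about \<open>sqrt R\<close> across it. The plank has measure about \<open>R powr ((n + 1) / 2)\<close>. Both sides of the
assumed inequality are estimated as \<open>R\<close> tends to infinity.

Upper bound for the norm of \<open>f\<close>. The piece \<open>\<phi> \<theta> (D) f\<close> vanishes unless \<open>\<theta>\<close> lies in a cap of radius \<open>3 / sqrt R\<close> around
\<open>\<omega>\<close>. For such \<open>\<theta>\<close> it has size at most \<open>R\<close> to the power \<open>(n - 1) / 4 + (n + 1) / 2\<close> and decays rapidly away from a box of side
\<open>1 / R\<close> along \<open>\<theta>\<close> and \<open>1 / sqrt R\<close> across it (\<open>packet_multiplier_decay\<close>). Hence the norm is at most a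
constant times \<open>R\<close> to the power \<open>(n - 1) / 4 + s + (n + 1) / 2 - n / p\<close>. For \<open>p = 1\<close> this uses that the heat
semigroup acts by symbols with uniform bounds (\<open>HFIO_fin_upper\<close>). For \<open>p = \<infinity>\<close> the norm is a dual norm. The
normalisation of the \<open>\<phi> \<theta>\<close> provides a set of directions, of measure comparable to that of the cap, on which \<open>|\<phi> \<theta>|\<close>
is at least a multiple of \<open>R\<close> to the power \<open>(n - 1) / 4\<close> on the plank (\<open>wave_packets_lower\<close>). For these \<open>\<theta>\<close>
the packet can be divided by \<open>\<phi> \<theta>\<close>, and averaging over them gives the same power with \<open>1 / p = 0\<close>
(\<open>HFIO_inf_upper\<close>).

Lower bound for the maximal function. The point \<open>y\<close> is at our disposal. If \<open>\<Phi> ((x, t), \<omega>) = y \<bullet> \<omega>\<close>, and if the components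
across \<open>\<omega>\<close> of the \<open>\<eta>\<close>-gradient of \<open>\<Phi>\<close> at \<open>((x, t), \<omega>)\<close> agree with those of \<open>y\<close> up to \<open>O(1 / sqrt R)\<close>, then by
homogeneity and a Taylor expansion the phase \<open>\<Phi> ((x, t), \<eta>) - \<eta> \<bullet> y\<close> is as small as desired on a sufficiently narrow
plank (\<open>oscillation_controlled_on_cell\<close>), there is no cancellation in the integral, and \<open>T\<^sub>t f (x)\<close> is at least a multiple of
\<open>R\<close> to the power \<open>m + (n + 1) / 2\<close> (\<open>fio_packet_lower\<close>). Since the time derivative of \<open>\<Phi>\<close> does not vanish, for each \<open>x\<close> near \<open>x0\<close> there is
a time at which \<open>\<Phi> ((x, t), \<omega>)\<close> takes its value at \<open>(x0, t0)\<close>: choosing the time with \<open>x\<close> satisfies the first condition for free. The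
remaining \<open>n - 1\<close> conditions at scale \<open>1 / sqrt R\<close> are met by pigeonholing: one of about \<open>R powr ((n - 1) / 2)\<close> choices of \<open>y\<close> works for a set
of \<open>x\<close> of measure at least a multiple of \<open>R powr (- (n - 1) / 2)\<close> (\<open>transversal_cell\<close>). So the left-hand side is at least a multiple of \<open>R\<close>
to the power \<open>m + (n + 1) / 2 - (n - 1) / (2 p)\<close>, and comparing the two powers of \<open>R\<close> gives the claim.
\<close>

section \<open>Calculus of directional derivatives\<close>

abbreviation smooth :: "('a::euclidean_space => 'b::real_normed_vector) => bool"
 where "smooth f \<equiv> smooth_on UNIV f"

lemma pderivs_Nil [simp]: "pderivs [] f = f"
 by (simp add: pderivs_def)

lemma pderivs_Cons: "pderivs (v # vs) f = pderiv_dir v (pderivs vs f)"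
 by (simp add: pderivs_def)

lemma pderivs_append: "pderivs (vs @ ws) f = pderivs vs (pderivs ws f)"
 by (simp add: pderivs_def)

lemma has_derivative_pderiv:
 "f differentiable (at x) ==> (f has_derivative (\<lambda>v. pderiv_dir v f x)) (at x)"
 unfolding pderiv_dir_def using frechet_derivative_works by fastforce

lemma pderiv_dir_eqI: "(f has_derivative D) (at x) ==> pderiv_dir v f x = D v"
 unfolding pderiv_dir_def using frechet_derivative_at by metis

lemma pderiv_dir_expand:
 fixes f :: "'a::euclidean_space => 'b::real_normed_vector"
 assumes "f differentiable (at x)"
 shows "pderiv_dir v f x = (\<Sum>b\<in>Basis. (v \<bullet> b) *\<^sub>R pderiv_dir b f x)"
proof -
 have lin: "linear (\<lambda>v. pderiv_dir v f x)"
  using has_derivative_pderiv[OF assms] has_derivative_linear by blast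
 have "pderiv_dir v f x = pderiv_dir (\<Sum>b\<in>Basis. (v \<bullet> b) *\<^sub>R b) f x"
  by (simp add: euclidean_representation)
 also have "... = (\<Sum>b\<in>Basis. (v \<bullet> b) *\<^sub>R pderiv_dir b f x)"
  using linear_sum[OF lin] linear_scale[OF lin] by (metis (mono_tags, lifting) sum.cong)
 finally show ?thesis .
qed

lemma pderiv_dir_scale:
 assumes "f differentiable (at x)"
 shows "pderiv_dir (c *\<^sub>R v) f x = c *\<^sub>R pderiv_dir v f x"
 using has_derivative_linear[OF has_derivative_pderiv[OF assms]] linear_scale by blast

lemma smooth_differentiable: "smooth f ==> f differentiable (at x)"
 unfolding smooth_on_def differentiable_on_def by (drule spec[of _ "[]"]) auto

lemma smooth_continuous: "smooth f ==> continuous_on S f"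
 by (meson continuous_at_imp_continuous_on differentiable_imp_continuous_within smooth_differentiable)

lemma smooth_pderiv_Basis: "smooth f ==> b \<in> Basis ==> smooth (pderiv_dir b f)"
 unfolding smooth_on_def
proof (intro allI impI)
 fix vs :: "'a list"
 assume "\<forall>vs. set vs \<subseteq> Basis --> pderivs vs f differentiable_on UNIV" "b \<in> Basis" "set vs \<subseteq> Basis"
 then have "pderivs (vs @ [b]) f differentiable_on UNIV"
  by auto
 then show "pderivs vs (pderiv_dir b f) differentiable_on UNIV"
  by (simp add: pderivs_append pderivs_Cons)
qed

lemma pderivs_in_closed:
 assumes "f \<in> X" "\<And>f b. f \<in> X ==> b \<in> Basis ==> pderiv_dir b f \<in> X" "set vs \<subseteq> Basis"
 shows "pderivs vs f \<in> X"
 using assms(3) by (induction vs) (auto simp: pderivs_Cons assms)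

text \<open>Smoothness is proved coinductively: it suffices to exhibit a set of differentiable functions that
contains \<open>f\<close> and is closed under the partial derivatives. This avoids formulas for iterated derivatives
of sums, products and compositions.\<close>

lemma smooth_coinduct:
 assumes "f \<in> X" "\<And>f x. f \<in> X ==> f differentiable (at x)"
  "\<And>f b. f \<in> X ==> b \<in> Basis ==> pderiv_dir b f \<in> X"
 shows "smooth f"
 unfolding smooth_on_def differentiable_on_def
 using pderivs_in_closed[OF assms(1,3)] assms(2) by simp

lemma smooth_const [simp]: "smooth (\<lambda>_. c)"
proof (rule smooth_coinduct[of _ "range (\<lambda>c _. c)"])
 fix f :: "'a => 'b" and b :: 'a assume "f \<in> range (\<lambda>c _. c)"
 then obtain c where f: "f = (\<lambda>_. c)" by auto
 have "pderiv_dir b f = (\<lambda>_. 0)"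
  unfolding f by (rule ext, rule pderiv_dir_eqI[where D="\<lambda>_. 0"]) simp
 then show "pderiv_dir b f \<in> range (\<lambda>c _. c)" by auto
qed auto

lemma pderiv_dir_const [simp]: "pderiv_dir v (\<lambda>_. c) = (\<lambda>_. 0)"
 by (rule ext, rule pderiv_dir_eqI[where D="\<lambda>_. 0"]) simp

lemma pderiv_dir_add:
 assumes "f differentiable (at x)" "g differentiable (at x)"
 shows "pderiv_dir v (\<lambda>x. f x + g x) x = pderiv_dir v f x + pderiv_dir v g x"
 by (rule pderiv_dir_eqI[where D="\<lambda>v. pderiv_dir v f x + pderiv_dir v g x"])
   (intro has_derivative_add has_derivative_pderiv assms)

lemma pderiv_dir_linear_image:
 assumes "bounded_linear T" "f differentiable (at x)"
 shows "pderiv_dir v (\<lambda>x. T (f x)) x = T (pderiv_dir v f x)"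
 by (rule pderiv_dir_eqI[where D="\<lambda>v. T (pderiv_dir v f x)"])
   (rule bounded_linear.has_derivative[OF assms(1) has_derivative_pderiv[OF assms(2)]])

lemma pderiv_dir_mult:
 fixes f g :: "'a::euclidean_space => 'b::real_normed_algebra"
 assumes "f differentiable (at x)" "g differentiable (at x)"
 shows "pderiv_dir v (\<lambda>x. f x * g x) x = f x * pderiv_dir v g x + pderiv_dir v f x * g x"
 by (rule pderiv_dir_eqI[where D="\<lambda>v. f x * pderiv_dir v g x + pderiv_dir v f x * g x"])
   (intro has_derivative_mult has_derivative_pderiv assms)

lemma pderiv_dir_affine:
 assumes "linear L" "f differentiable (at (L x + c))"
 shows "pderiv_dir v (\<lambda>x. f (L x + c)) x = pderiv_dir (L v) f (L x + c)"
proof (rule pderiv_dir_eqI[where D="\<lambda>v. pderiv_dir (L v) f (L x + c)"])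
 have "((\<lambda>x. L x + c) has_derivative L) (at x)"
  using linear_imp_has_derivative[OF assms(1)] by (auto intro!: derivative_eq_intros)
 then show "((\<lambda>x. f (L x + c)) has_derivative (\<lambda>v. pderiv_dir (L v) f (L x + c))) (at x)"
  using has_derivative_compose has_derivative_pderiv[OF assms(2)] by fastforce
qed

lemma smooth_add:
 assumes "smooth f" "smooth g" shows "smooth (\<lambda>x. f x + g x)"
proof (rule smooth_coinduct[of _ "{\<lambda>x. f x + g x | f g. smooth f \<and> smooth g}"])
 fix h :: "'a => 'b" and b :: 'a
 assume "h \<in> {\<lambda>x. f x + g x | f g. smooth f \<and> smooth g}" and b: "b \<in> Basis"
 then obtain f g where h: "h = (\<lambda>x. f x + g x)" and fg: "smooth f" "smooth g" by auto
 have "pderiv_dir b h = (\<lambda>x. pderiv_dir b f x + pderiv_dir b g x)"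
  unfolding h by (rule ext, rule pderiv_dir_add) (auto intro: smooth_differentiable fg)
 then show "pderiv_dir b h \<in> {\<lambda>x. f x + g x | f g. smooth f \<and> smooth g}"
  using fg b smooth_pderiv_Basis by auto
next
 fix h x assume "h \<in> {\<lambda>x. f x + g x | f g. smooth f \<and> smooth g}"
 then show "h differentiable (at x)"
  by (auto intro!: differentiable_add dest: smooth_differentiable)
qed (use assms in blast)

lemma smooth_linear_image:
 fixes f :: "'a::euclidean_space => 'b::real_normed_vector" and T :: "'b => 'c::real_normed_vector"
 assumes T: "bounded_linear T" and f: "smooth f" shows "smooth (\<lambda>x. T (f x))"
proof (rule smooth_coinduct[of _ "{\<lambda>x. T (f x) | f. smooth f}"])
 fix h :: "'a => 'c" and b :: 'a
 assume "h \<in> {\<lambda>x. T (f x) | f. smooth f}" and b: "b \<in> Basis"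
 then obtain f where h: "h = (\<lambda>x. T (f x))" and f: "smooth f" by auto
 have "pderiv_dir b h = (\<lambda>x. T (pderiv_dir b f x))"
  unfolding h by (rule ext, rule pderiv_dir_linear_image) (auto intro: smooth_differentiable f T)
 then show "pderiv_dir b h \<in> {\<lambda>x. T (f x) | f. smooth f}"
  using f b smooth_pderiv_Basis by auto
next
 fix h x assume "h \<in> {\<lambda>x. T (f x) | f. smooth f}"
 then obtain f where h: "h = (\<lambda>x. T (f x))" and f: "smooth f" by auto
 show "h differentiable at x"
  unfolding h using bounded_linear.has_derivative[OF T has_derivative_pderiv[OF smooth_differentiable[OF f]]]
  by (auto simp: differentiable_def)
qed (use f in auto)

lemma smooth_scaleR: "smooth f ==> smooth (\<lambda>x. c *\<^sub>R f x)"
 by (rule smooth_linear_image[OF bounded_linear_scaleR_right])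

lemma smooth_sum: "finite A ==> (\<And>i. i \<in> A ==> smooth (f i)) ==> smooth (\<lambda>x. \<Sum>i\<in>A. f i x)"
 by (induction A rule: finite_induct) (auto intro: smooth_add)

lemma smooth_pderiv: assumes "smooth f" shows "smooth (pderiv_dir v f)"
proof -
 have "pderiv_dir v f = (\<lambda>x. \<Sum>b\<in>Basis. (v \<bullet> b) *\<^sub>R pderiv_dir b f x)"
  using pderiv_dir_expand[OF smooth_differentiable[OF assms]] by blast
 then show ?thesis
  using assms by (auto intro!: smooth_sum smooth_scaleR smooth_pderiv_Basis)
qed

lemma smooth_pderivs: "smooth f ==> smooth (pderivs vs f)"
 by (induction vs) (auto simp: pderivs_Cons smooth_pderiv)

text \<open>The Leibniz rule does not produce products but sums of products, so the set used for the coinduction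
is the additive closure of the products.\<close>

inductive_set mult_span :: "('a::euclidean_space => 'b::real_normed_algebra) set => ('a => 'b) set => ('a => 'b) set"
 for A B where
 mult: "f \<in> A ==> g \<in> B ==> (\<lambda>x. f x * g x) \<in> mult_span A B"
| add: "f \<in> mult_span A B ==> g \<in> mult_span A B ==> (\<lambda>x. f x + g x) \<in> mult_span A B"

lemma mult_span_differentiable:
 assumes "h \<in> mult_span A B" "A \<subseteq> {f. smooth f}" "B \<subseteq> {f. smooth f}"
 shows "h differentiable (at x)"
 using assms(1)
proof induction
 case (mult f g)
 then have "f differentiable (at x)" "g differentiable (at x)" using assms(2,3) by (auto intro: smooth_differentiable)
 then show ?case by (intro derivative_intros)
qed (auto intro: derivative_intros)

lemma mult_span_pderiv:
 assumes h: "h \<in> mult_span A B" and A: "A \<subseteq> {f. smooth f}" and B: "B \<subseteq> {f. smooth f}" and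
  dA: "\<And>f. f \<in> A ==> pderiv_dir b f \<in> A" and dB: "\<And>f. f \<in> B ==> pderiv_dir b f \<in> B"
 shows "pderiv_dir b h \<in> mult_span A B"
 using h
proof induction
 case (mult f g)
 then have "f differentiable (at x)" "g differentiable (at x)" for x
  using A B by (auto intro: smooth_differentiable)
 then have "pderiv_dir b (\<lambda>x. f x * g x) = (\<lambda>x. f x * pderiv_dir b g x + pderiv_dir b f x * g x)"
  by (auto simp: pderiv_dir_mult)
 then show ?case
  using mult dA dB by (auto intro!: mult_span.intros)
next
 case (add f g)
 have "pderiv_dir b (\<lambda>x. f x + g x) = (\<lambda>x. pderiv_dir b f x + pderiv_dir b g x)"
  by (rule ext, rule pderiv_dir_add) (use add A B in \<open>auto intro!: mult_span_differentiable\<close>)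
 then show ?case using add by (auto intro: mult_span.intros)
qed

lemma smooth_mult:
 fixes f g :: "'a::euclidean_space => 'b::real_normed_algebra"
 assumes "smooth f" "smooth g" shows "smooth (\<lambda>x. f x * g x)"
 by (rule smooth_coinduct[of _ "mult_span {f. smooth f} {f. smooth f}"])
   (auto intro: mult_span.intros assms mult_span_differentiable mult_span_pderiv smooth_pderiv)

lemma smooth_affine:
 assumes L: "linear L" and f: "smooth f" shows "smooth (\<lambda>x. f (L x + c))"
proof (rule smooth_coinduct[of _ "{\<lambda>x. f (L x + c) | f. smooth f}"])
 fix h b assume "h \<in> {\<lambda>x. f (L x + c) | f. smooth f}"
 then obtain f where h: "h = (\<lambda>x. f (L x + c))" and f: "smooth f" by auto
 have "pderiv_dir b h = (\<lambda>x. pderiv_dir (L b) f (L x + c))"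
  unfolding h by (rule ext, rule pderiv_dir_affine) (auto intro: smooth_differentiable f L)
 then show "pderiv_dir b h \<in> {\<lambda>x. f (L x + c) | f. smooth f}"
  using f smooth_pderiv by auto
next
 fix h x assume "h \<in> {\<lambda>x. f (L x + c) | f. smooth f}"
 then obtain f where h: "h = (\<lambda>x. f (L x + c))" and f: "smooth f" by auto
 have "((\<lambda>x. L x + c) has_derivative L) (at x)"
  using linear_imp_has_derivative[OF L] by (auto intro!: derivative_eq_intros)
 from has_derivative_compose[OF this has_derivative_pderiv[OF smooth_differentiable[OF f]]]
 show "h differentiable at x"
  unfolding h differentiable_def by blast
qed (use f in auto)

lemma pderivs_affine:
 assumes L: "linear L" and f: "smooth f"
 shows "pderivs vs (\<lambda>x. f (L x + c)) = (\<lambda>x. pderivs (map L vs) f (L x + c))"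
 by (induction vs)
   (auto simp: pderivs_Cons pderiv_dir_affine[OF L smooth_differentiable[OF smooth_pderivs[OF f]]])

lemma pderivs_add:
 assumes "smooth f" "smooth g"
 shows "pderivs vs (\<lambda>x. f x + g x) = (\<lambda>x. pderivs vs f x + pderivs vs g x)"
 by (induction vs) (auto simp: pderivs_Cons pderiv_dir_add smooth_differentiable[OF smooth_pderivs] assms)

lemma pderivs_linear_image:
 assumes "bounded_linear T" "smooth f"
 shows "pderivs vs (\<lambda>x. T (f x)) = (\<lambda>x. T (pderivs vs f x))"
 by (induction vs)
   (auto simp: pderivs_Cons pderiv_dir_linear_image[OF assms(1)] smooth_differentiable[OF smooth_pderivs[OF assms(2)]])

lemma norm_pderiv_dir_le:
 assumes "f differentiable (at x)"
 shows "norm (pderiv_dir v f x) \<le> (\<Sum>b\<in>Basis. \<bar>v \<bullet> b\<bar> * norm (pderiv_dir b f x))"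
 by (subst pderiv_dir_expand[OF assms], rule order_trans[OF norm_sum]) simp

text \<open>Expanding each direction in the basis turns iterated directional derivatives into iterated partial
derivatives.\<close>

lemma norm_pderivs_le:
 fixes f :: "'a::euclidean_space => 'b::real_normed_vector"
 assumes "smooth f" "\<And>bs. set bs \<subseteq> Basis ==> length bs = k ==> norm (pderivs bs f x) \<le> C"
  "\<And>v. v \<in> set vs ==> (\<Sum>b\<in>Basis. \<bar>v \<bullet> b\<bar>) \<le> r" "length vs = k" "0 \<le> r"
 shows "norm (pderivs vs f x) \<le> r ^ k * C"
 using assms
proof (induction k arbitrary: vs f C)
 case 0
 then show ?case using "0.prems"(2)[of "[]"] by simp
next
 case (Suc k)
 then obtain us v where vs: "vs = us @ [v]" "length us = k"
  by (metis append_butlast_last_id length_Suc_conv_rev)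
 have "pderivs vs f = pderivs us (pderiv_dir v f)"
  by (simp add: vs pderivs_append pderivs_Cons)
 moreover have "norm (pderivs us (pderiv_dir v f) x) \<le> r ^ k * (r * C)"
 proof (rule Suc.IH)
  fix bs :: "'a list" assume bs: "set bs \<subseteq> Basis" "length bs = k"
  have sm: "smooth (\<lambda>x. (v \<bullet> b) *\<^sub>R pderiv_dir b f x)" for b
   by (intro smooth_scaleR smooth_pderiv Suc)
  note lin = pderivs_linear_image[OF bounded_linear_scaleR_right] and add = pderivs_add
  have zero: "pderivs bs (\<lambda>x. 0 :: 'b) = (\<lambda>x. 0)" by (induction bs) (auto simp: pderivs_Cons)
  have sum: "pderivs bs (\<lambda>x. \<Sum>i\<in>A. h i x) = (\<lambda>x. \<Sum>i\<in>A. pderivs bs (h i) x)" if "finite A" "\<And>i. smooth (h i)"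
   for A :: "'a set" and h :: "'a => 'a => 'b"
   using that by (induction A rule: finite_induct) (auto simp: zero add smooth_sum)
  have e: "pderiv_dir v f = (\<lambda>x. \<Sum>b\<in>Basis. (v \<bullet> b) *\<^sub>R pderiv_dir b f x)"
   using pderiv_dir_expand[OF smooth_differentiable[OF Suc(2)]] by blast
  have "pderivs bs (pderiv_dir v f) x = (\<Sum>b\<in>Basis. (v \<bullet> b) *\<^sub>R pderivs bs (pderiv_dir b f) x)"
   unfolding e by (subst sum[OF _ sm]) (auto simp: lin smooth_pderiv Suc.prems(1))
  also have "norm ... \<le> (\<Sum>b\<in>Basis. \<bar>v \<bullet> b\<bar> * C)"
  proof (rule order_trans[OF norm_sum], rule sum_mono)
   fix b :: 'a assume b: "b \<in> Basis"
   have "norm (pderivs (bs @ [b]) f x) \<le> C" using bs b by (intro Suc.prems) auto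
   then show "norm ((v \<bullet> b) *\<^sub>R pderivs bs (pderiv_dir b f) x) \<le> \<bar>v \<bullet> b\<bar> * C"
    by (simp add: pderivs_append pderivs_Cons mult_left_mono)
  qed
  also have "... \<le> r * C"
  proof -
   have "norm (pderivs (replicate (Suc k) (SOME b. b \<in> Basis)) f x) \<le> C"
    by (rule Suc.prems) (auto simp: some_in_eq)
   then have "0 \<le> C" using norm_ge_zero order_trans by blast
   then show ?thesis
    unfolding sum_distrib_right[symmetric]
    by (intro mult_right_mono) (auto simp: vs Suc.prems)
  qed
  finally show "norm (pderivs bs (pderiv_dir v f) x) \<le> r * C" .
 qed (use Suc vs in \<open>auto intro: smooth_pderiv\<close>)
 ultimately show ?case by (simp add: algebra_simps)
qed

lemma pderivs_replicate_mult_le: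
 fixes f g :: "'a::euclidean_space => 'b::real_normed_algebra"
 assumes "smooth f" "smooth g"
  "\<And>j. j \<le> k ==> norm (pderivs (replicate j u) f x) \<le> C"
  "\<And>j. j \<le> k ==> norm (pderivs (replicate j u) g x) \<le> D"
 shows "norm (pderivs (replicate k u) (\<lambda>x. f x * g x) x) \<le> 2 ^ k * (C * D)"
 using assms
proof (induction k arbitrary: f g)
 case 0
 then show ?case using "0.prems"(3,4)[of 0]
  by (auto intro!: order_trans[OF norm_mult_ineq] mult_mono intro: order_trans[OF norm_ge_zero])
next
 case (Suc k)
 have rs: "pderivs (replicate (Suc j) u) h = pderivs (replicate j u) (pderiv_dir u h)" for j and h :: "'a => 'b"
  by (metis pderivs_append pderivs_Cons pderivs_Nil replicate_Suc replicate_append_same)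
 have e: "pderiv_dir u (\<lambda>x. f x * g x) = (\<lambda>x. f x * pderiv_dir u g x + pderiv_dir u f x * g x)"
  by (rule ext, rule pderiv_dir_mult) (auto intro: smooth_differentiable Suc.prems)
 have "pderivs (replicate (Suc k) u) (\<lambda>x. f x * g x) x =
   pderivs (replicate k u) (\<lambda>x. f x * pderiv_dir u g x) x + pderivs (replicate k u) (\<lambda>x. pderiv_dir u f x * g x) x"
  unfolding rs e by (subst pderivs_add) (auto intro!: smooth_mult smooth_pderiv Suc.prems)
 also have "norm ... \<le> 2 ^ k * (C * D) + 2 ^ k * (C * D)"
  by (intro order_trans[OF norm_triangle_ineq] add_mono Suc.IH)
    (use Suc.prems in \<open>auto intro: smooth_pderiv simp flip: rs simp del: replicate_Suc\<close>)
 finally show ?case unfolding power_Suc by linarith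
qed

lemma pderivs_replicate_scale:
 assumes "smooth f"
 shows "pderivs (replicate k (c *\<^sub>R u)) f = (\<lambda>x. c ^ k *\<^sub>R pderivs (replicate k u) f x)"
 by (induction k)
  (auto simp: pderivs_Cons pderiv_dir_linear_image[OF bounded_linear_scaleR_right smooth_differentiable[OF smooth_pderivs[OF assms]]]
   pderiv_dir_scale smooth_differentiable[OF smooth_pderivs[OF assms]] smooth_differentiable[OF smooth_scaleR[OF smooth_pderivs[OF assms]]])

lemma has_vector_derivative_line:
 assumes "f differentiable (at (x + s *\<^sub>R v))"
 shows "((\<lambda>s. f (x + s *\<^sub>R v)) has_vector_derivative pderiv_dir v f (x + s *\<^sub>R v)) (at s)"
proof -
 have "((\<lambda>s. x + s *\<^sub>R v) has_derivative (\<lambda>h. h *\<^sub>R v)) (at s)"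
  by (auto intro!: derivative_eq_intros)
 from has_derivative_compose[OF this has_derivative_pderiv[OF assms]]
 show ?thesis
  unfolding has_vector_derivative_def by (simp add: pderiv_dir_scale assms)
qed

lemma pderiv_mvt:
 assumes "\<And>s. 0 \<le> s ==> s \<le> 1 ==> f differentiable (at (x + s *\<^sub>R v))"
  "\<And>s. 0 \<le> s ==> s \<le> 1 ==> norm (pderiv_dir v f (x + s *\<^sub>R v)) \<le> C"
 shows "norm (f (x + v) - f x) \<le> C"
proof -
 have "norm ((\<lambda>s. f (x + s *\<^sub>R v)) 1 - (\<lambda>s. f (x + s *\<^sub>R v)) 0) \<le> C * norm (1 - 0 :: real)"
 proof (rule differentiable_bound[where S="{0..1}" and f'="\<lambda>s h. h *\<^sub>R pderiv_dir v f (x + s *\<^sub>R v)"])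
  fix s :: real assume s: "s \<in> {0..1}"
  show "((\<lambda>s. f (x + s *\<^sub>R v)) has_derivative (\<lambda>h. h *\<^sub>R pderiv_dir v f (x + s *\<^sub>R v))) (at s within {0..1})"
   using has_vector_derivative_line[OF assms(1)] s
   by (auto simp: has_vector_derivative_def intro: has_derivative_at_withinI)
  show "onorm (\<lambda>h. h *\<^sub>R pderiv_dir v f (x + s *\<^sub>R v)) \<le> C"
   by (rule onorm_le) (use assms(2)[of s] s in \<open>auto simp: mult.commute[of C] intro: mult_left_mono\<close>)
 qed auto
 then show ?thesis by simp
qed

lemma pderiv_taylor2:
 assumes f: "\<And>s. 0 \<le> s ==> s \<le> 1 ==> f differentiable (at (x + s *\<^sub>R v))"
  and f': "\<And>s. 0 \<le> s ==> s \<le> 1 ==> pderiv_dir v f differentiable (at (x + s *\<^sub>R v))"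
  and C: "\<And>s. 0 \<le> s ==> s \<le> 1 ==> norm (pderiv_dir v (pderiv_dir v f) (x + s *\<^sub>R v)) \<le> C"
 shows "norm (f (x + v) - f x - pderiv_dir v f x) \<le> C"
proof -
 define h where "h s = f (x + s *\<^sub>R v) - s *\<^sub>R pderiv_dir v f x" for s
 have C0: "0 \<le> C" using C[of 0] by (auto intro: order_trans[OF norm_ge_zero])
 have "norm (h 1 - h 0) \<le> C * norm (1 - 0 :: real)"
 proof (rule differentiable_bound[where S="{0..1}" and f'="\<lambda>s t. t *\<^sub>R (pderiv_dir v f (x + s *\<^sub>R v) - pderiv_dir v f x)"])
  fix s :: real assume s: "s \<in> {0..1}"
  have "(h has_vector_derivative (pderiv_dir v f (x + s *\<^sub>R v) - pderiv_dir v f x)) (at s)"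
   unfolding h_def
   using has_vector_derivative_line[OF f] s by (auto intro!: derivative_eq_intros)
  then show "(h has_derivative (\<lambda>t. t *\<^sub>R (pderiv_dir v f (x + s *\<^sub>R v) - pderiv_dir v f x))) (at s within {0..1})"
   by (auto simp: has_vector_derivative_def intro: has_derivative_at_withinI)
  have "norm (pderiv_dir v f (x + s *\<^sub>R v) - pderiv_dir v f x) \<le> C"
  proof (rule pderiv_mvt)
   fix r :: real assume r: "0 \<le> r" "r \<le> 1"
   have rs: "0 \<le> r * s" "r * s \<le> 1" using r s by (auto simp: mult_le_one)
   show d: "pderiv_dir v f differentiable at (x + r *\<^sub>R s *\<^sub>R v)"
    using f'[OF rs] by simp
   have "norm (pderiv_dir (s *\<^sub>R v) (pderiv_dir v f) (x + r *\<^sub>R s *\<^sub>R v)) = s * norm (pderiv_dir v (pderiv_dir v f) (x + (r * s) *\<^sub>R v))"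
    using s pderiv_dir_scale[OF d] by simp
   also have "... \<le> 1 * C" using s C[OF rs] by (intro mult_mono) auto
   finally show "norm (pderiv_dir (s *\<^sub>R v) (pderiv_dir v f) (x + r *\<^sub>R s *\<^sub>R v)) \<le> C" by simp
  qed
  then show "onorm (\<lambda>t. t *\<^sub>R (pderiv_dir v f (x + s *\<^sub>R v) - pderiv_dir v f x)) \<le> C"
   by (intro onorm_le) (auto simp: mult.commute[of C] intro: mult_left_mono)
 qed auto
 then show ?thesis by (simp add: h_def algebra_simps)
qed

section \<open>Schwartz functions and moderate multipliers\<close>

lemma schwartzI:
 assumes "f \<in> X" "\<And>f x. f \<in> X ==> f differentiable (at x)"
  "\<And>f b. f \<in> X ==> b \<in> Basis ==> pderiv_dir b f \<in> X"
  "\<And>f N. f \<in> X ==> \<exists>C. \<forall>x. (1 + norm x) ^ N * norm (f x) \<le> C"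
 shows "f \<in> schwartz"
 unfolding schwartz_def
proof (rule CollectI, intro conjI allI impI)
 show "smooth f" using assms(1-3) by (rule smooth_coinduct)
 fix N and vs :: "'a list" assume "set vs \<subseteq> Basis"
 then have "pderivs vs f \<in> X" using pderivs_in_closed[OF assms(1,3)] by blast
 then obtain C where C: "\<forall>x. (1 + norm x) ^ N * norm (pderivs vs f x) \<le> C" using assms(4) by blast
 show "bounded (range (\<lambda>x. (1 + norm x) ^ N * norm (pderivs vs f x)))"
  unfolding bounded_iff using C by (auto intro!: exI[of _ C] simp: abs_mult)
qed

lemma schwartz_smooth: "f \<in> schwartz ==> smooth f"
 by (simp add: schwartz_def)

lemma schwartz_pderiv_Basis:
 assumes "f \<in> schwartz" "b \<in> Basis" shows "pderiv_dir b f \<in> schwartz"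
 unfolding schwartz_def
proof safe
 show "smooth (pderiv_dir b f)" using assms by (simp add: schwartz_smooth smooth_pderiv)
 fix N and vs :: "'a list" assume "set vs \<subseteq> Basis"
 then have "set (vs @ [b]) \<subseteq> Basis" using assms by auto
 then have "bounded (range (\<lambda>x. (1 + norm x) ^ N * norm (pderivs (vs @ [b]) f x)))"
  using assms(1) unfolding schwartz_def by blast
 then show "bounded (range (\<lambda>x. (1 + norm x) ^ N * norm (pderivs vs (pderiv_dir b f) x)))"
  by (simp add: pderivs_append pderivs_Cons)
qed

lemma schwartz_bound:
 assumes "f \<in> schwartz"
 obtains C where "0 \<le> C" "\<And>x. (1 + norm x) ^ N * norm (f x) \<le> C"
proof -
 have "\<forall>N vs. set vs \<subseteq> Basis --> bounded (range (\<lambda>x. (1 + norm x) ^ N * norm (pderivs vs f x)))"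
  using assms unfolding schwartz_def by blast
 from this[rule_format, of "[]" N]
 have "bounded (range (\<lambda>x. (1 + norm x) ^ N * norm (pderivs [] f x)))"
  by simp
 then obtain C where C: "\<And>x. norm ((1 + norm x) ^ N * norm (f x)) \<le> C"
  unfolding bounded_iff by auto
 then have *: "(1 + norm x) ^ N * norm (f x) \<le> C" for x
  using abs_ge_self order_trans by (metis real_norm_def)
 moreover have "0 \<le> C" using norm_ge_zero order_trans C by blast
 ultimately show ?thesis using that by blast
qed

text \<open>The symbols for which the Fourier multiplier acts on tempered distributions: smooth functions all of
whose derivatives grow at most polynomially.\<close>

definition moderate :: "('a::euclidean_space => complex) set"
 where "moderate = {m. smooth m \<and>
  (\<forall>vs. set vs \<subseteq> Basis --> (\<exists>C N. \<forall>x. norm (pderivs vs m x) \<le> C * (1 + norm x) ^ N))}"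

lemma moderateI:
 assumes "f \<in> X" "\<And>f x. f \<in> X ==> f differentiable (at x)"
  "\<And>f b. f \<in> X ==> b \<in> Basis ==> pderiv_dir b f \<in> X"
  "\<And>f. f \<in> X ==> \<exists>C N. \<forall>x. norm (f x) \<le> C * (1 + norm x) ^ N"
 shows "f \<in> moderate"
 unfolding moderate_def using smooth_coinduct[OF assms(1-3)] pderivs_in_closed[OF assms(1,3)] assms(4) by blast

lemma moderate_smooth: "f \<in> moderate ==> smooth f"
 by (simp add: moderate_def)

lemma moderate_pderiv_Basis:
 assumes "f \<in> moderate" "b \<in> Basis" shows "pderiv_dir b f \<in> moderate"
 unfolding moderate_def
proof safe
 show "smooth (pderiv_dir b f)" using assms by (simp add: moderate_smooth smooth_pderiv)
 fix vs :: "'a list" assume "set vs \<subseteq> Basis"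
 then have "set (vs @ [b]) \<subseteq> Basis" using assms by auto
 then have "\<exists>C N. \<forall>x. norm (pderivs (vs @ [b]) f x) \<le> C * (1 + norm x) ^ N"
  using assms(1) unfolding moderate_def by blast
 then show "\<exists>C N. \<forall>x. norm (pderivs vs (pderiv_dir b f) x) \<le> C * (1 + norm x) ^ N"
  by (simp add: pderivs_append pderivs_Cons)
qed

lemma moderate_bound:
 assumes "f \<in> moderate"
 obtains C N where "0 \<le> C" "\<And>x. norm (f x) \<le> C * (1 + norm x) ^ N"
proof -
 have "\<forall>vs. set vs \<subseteq> Basis --> (\<exists>C N. \<forall>x. norm (pderivs vs f x) \<le> C * (1 + norm x) ^ N)"
  using assms unfolding moderate_def by blast
 from this[rule_format, of "[]"]
 obtain C N where C: "\<forall>x. norm (pderivs [] f x) \<le> C * (1 + norm x) ^ N" by auto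
 have "0 \<le> C" using C[rule_format, of 0] by (auto intro: order_trans[OF norm_ge_zero])
 then show ?thesis using C that by auto
qed

lemma schwartz_subset_moderate: "f \<in> schwartz ==> f \<in> moderate"
proof (rule moderateI[of _ schwartz])
 fix f :: "'a => complex" assume "f \<in> schwartz"
 then obtain C where "\<And>x. (1 + norm x) ^ 0 * norm (f x) \<le> C" using schwartz_bound by blast
 then show "\<exists>C N. \<forall>x. norm (f x) \<le> C * (1 + norm x) ^ N" by (intro exI[of _ C] exI[of _ 0]) simp
qed (auto intro: schwartz_pderiv_Basis smooth_differentiable schwartz_smooth)

lemma moderate_add:
 assumes "f \<in> moderate" "g \<in> moderate" shows "(\<lambda>x. f x + g x) \<in> moderate"
proof (rule moderateI[of _ "{\<lambda>x. f x + g x | f g. f \<in> moderate \<and> g \<in> moderate}"])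
 show "(\<lambda>x. f x + g x) \<in> {\<lambda>x. f x + g x | f g. f \<in> moderate \<and> g \<in> moderate}" using assms by blast
next
 fix h :: "'a => complex" assume "h \<in> {\<lambda>x. f x + g x | f g. f \<in> moderate \<and> g \<in> moderate}"
 then obtain f g where h: "h = (\<lambda>x. f x + g x)" and fg: "f \<in> moderate" "g \<in> moderate" by blast
 have d: "f differentiable at x" "g differentiable at x" for x
  using fg by (auto intro: moderate_smooth smooth_differentiable)
 show "h differentiable at x" for x unfolding h by (intro differentiable_add d)
 show "pderiv_dir b h \<in> {\<lambda>x. f x + g x | f g. f \<in> moderate \<and> g \<in> moderate}" if "b \<in> Basis" for b
 proof -
  have "pderiv_dir b h = (\<lambda>x. pderiv_dir b f x + pderiv_dir b g x)"
   unfolding h by (rule ext, rule pderiv_dir_add) (rule d)+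
  then show ?thesis using fg that moderate_pderiv_Basis by blast
 qed
 obtain C N where 1: "0 \<le> C" "\<And>x. norm (f x) \<le> C * (1 + norm x) ^ N" using moderate_bound[OF fg(1)] by blast
 obtain D M where 2: "0 \<le> D" "\<And>x. norm (g x) \<le> D * (1 + norm x) ^ M" using moderate_bound[OF fg(2)] by blast
 have "norm (h x) \<le> (C + D) * (1 + norm x) ^ (N + M)" for x
 proof -
  have "norm (h x) \<le> C * (1 + norm x) ^ N + D * (1 + norm x) ^ M"
   unfolding h by (intro order_trans[OF norm_triangle_ineq] add_mono 1 2)
  also have "... \<le> C * (1 + norm x) ^ (N + M) + D * (1 + norm x) ^ (N + M)"
   by (intro add_mono mult_left_mono power_increasing 1 2) auto
  finally show ?thesis by (simp add: algebra_simps)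
 qed
 then show "\<exists>C N. \<forall>x. norm (h x) \<le> C * (1 + norm x) ^ N" by blast
qed

lemma moderate_const [simp]: "(\<lambda>_. c) \<in> moderate"
proof (rule moderateI[of _ "range (\<lambda>c _. c)"])
 fix f :: "'a => complex" assume "f \<in> range (\<lambda>c _. c)"
 then obtain c where f: "f = (\<lambda>_. c)" by auto
 show "\<exists>C N. \<forall>x. norm (f x) \<le> C * (1 + norm x) ^ N"
  by (rule exI[of _ "norm c"], rule exI[of _ 0]) (simp add: f)
qed auto

lemma moderate_mult:
 assumes "f \<in> moderate" "g \<in> moderate" shows "(\<lambda>x. f x * g x) \<in> moderate"
proof (rule moderateI[of _ "mult_span moderate moderate"])
 have sub: "moderate \<subseteq> {f. smooth f}" by (auto intro: moderate_smooth)
 show "(\<lambda>x. f x * g x) \<in> mult_span moderate moderate" using assms by (rule mult_span.mult)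
 fix h :: "'a => complex" assume h: "h \<in> mult_span moderate moderate"
 show "h differentiable at x" for x using mult_span_differentiable[OF h sub sub] .
 show "pderiv_dir b h \<in> mult_span moderate moderate" if "b \<in> Basis" for b
  using mult_span_pderiv[OF h sub sub] moderate_pderiv_Basis that by blast
 show "\<exists>C N. \<forall>x. norm (h x) \<le> C * (1 + norm x) ^ N"
  using h
 proof induction
  case (mult f g)
  obtain C N where 1: "0 \<le> C" "\<And>x. norm (f x) \<le> C * (1 + norm x) ^ N" using moderate_bound[OF mult(1)] by blast
  obtain D M where 2: "0 \<le> D" "\<And>x. norm (g x) \<le> D * (1 + norm x) ^ M" using moderate_bound[OF mult(2)] by blast
  have "norm (f x * g x) \<le> (C * D) * (1 + norm x) ^ (N + M)" for x
   using mult_mono[OF 1(2) 2(2), of x x] 1 2 by (simp add: norm_mult power_add mult_ac)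
  then show ?case by blast
 next
  case (add f g)
  then obtain C N D M where 1: "\<And>x. norm (f x) \<le> C * (1 + norm x) ^ N" and 2: "\<And>x. norm (g x) \<le> D * (1 + norm x) ^ M" by blast
  have C: "0 \<le> C" "0 \<le> D" using 1[of 0] 2[of 0] by (auto intro: order_trans[OF norm_ge_zero])
  have "norm (f x + g x) \<le> (C + D) * (1 + norm x) ^ (N + M)" for x
  proof -
   have "norm (f x + g x) \<le> C * (1 + norm x) ^ N + D * (1 + norm x) ^ M"
    by (intro order_trans[OF norm_triangle_ineq] add_mono 1 2)
   also have "... \<le> C * (1 + norm x) ^ (N + M) + D * (1 + norm x) ^ (N + M)"
    by (intro add_mono mult_left_mono power_increasing C) auto
   finally show ?thesis by (simp add: algebra_simps)
  qed
  then show ?case by blast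
 qed
qed

lemma schwartz_mult:
 assumes "m \<in> moderate" "f \<in> schwartz" shows "(\<lambda>x. m x * f x) \<in> schwartz"
proof (rule schwartzI[of _ "mult_span moderate schwartz"])
 have sub: "moderate \<subseteq> {f. smooth f}" "schwartz \<subseteq> {f. smooth f}"
  by (auto intro: moderate_smooth schwartz_smooth)
 show "(\<lambda>x. m x * f x) \<in> mult_span moderate schwartz" using assms by (rule mult_span.mult)
 fix h :: "'a => complex" assume h: "h \<in> mult_span moderate schwartz"
 show "h differentiable at x" for x using mult_span_differentiable[OF h sub] .
 show "pderiv_dir b h \<in> mult_span moderate schwartz" if "b \<in> Basis" for b
  using mult_span_pderiv[OF h sub] moderate_pderiv_Basis schwartz_pderiv_Basis that by blast
 show "\<exists>C. \<forall>x. (1 + norm x) ^ N * norm (h x) \<le> C" for N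
  using h
 proof induction
  case (mult f g)
  obtain C M where 1: "0 \<le> C" "\<And>x. norm (f x) \<le> C * (1 + norm x) ^ M" using moderate_bound[OF mult(1)] by blast
  obtain D where 2: "0 \<le> D" "\<And>x. (1 + norm x) ^ (N + M) * norm (g x) \<le> D" using schwartz_bound[OF mult(2)] by blast
  have "(1 + norm x) ^ N * norm (f x * g x) \<le> C * D" for x
  proof -
   have "(1 + norm x) ^ N * norm (f x * g x) \<le> (1 + norm x) ^ N * (C * (1 + norm x) ^ M * norm (g x))"
    unfolding norm_mult by (intro mult_left_mono mult_right_mono 1) auto
   also have "... = C * ((1 + norm x) ^ (N + M) * norm (g x))" by (simp add: power_add)
   also have "... \<le> C * D" by (intro mult_left_mono 1 2)
   finally show ?thesis .
  qed
  then show ?case by blast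
 next
  case (add f g)
  then obtain C D where 1: "\<And>x. (1 + norm x) ^ N * norm (f x) \<le> C" and 2: "\<And>x. (1 + norm x) ^ N * norm (g x) \<le> D" by blast
  have "(1 + norm x) ^ N * norm (f x + g x) \<le> C + D" for x
  proof -
   have "(1 + norm x) ^ N * norm (f x + g x) \<le> (1 + norm x) ^ N * (norm (f x) + norm (g x))"
    by (intro mult_left_mono norm_triangle_ineq) auto
   also have "... \<le> C + D" unfolding distrib_left by (intro add_mono 1 2)
   finally show ?thesis .
  qed
  then show ?case by blast
 qed
qed

lemma schwartz_cmult: "f \<in> schwartz ==> (\<lambda>x. c * f x) \<in> schwartz"
 by (rule schwartz_mult[OF moderate_const])

lemma schwartz_add:
 assumes "f \<in> schwartz" "g \<in> schwartz" shows "(\<lambda>x. f x + g x) \<in> schwartz"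
proof (rule schwartzI[of _ "{\<lambda>x. f x + g x | f g. f \<in> schwartz \<and> g \<in> schwartz}"])
 show "(\<lambda>x. f x + g x) \<in> {\<lambda>x. f x + g x | f g. f \<in> schwartz \<and> g \<in> schwartz}" using assms by blast
next
 fix h :: "'a => complex" assume "h \<in> {\<lambda>x. f x + g x | f g. f \<in> schwartz \<and> g \<in> schwartz}"
 then obtain f g where h: "h = (\<lambda>x. f x + g x)" and fg: "f \<in> schwartz" "g \<in> schwartz" by blast
 have d: "f differentiable at x" "g differentiable at x" for x
  using fg by (auto intro: schwartz_smooth smooth_differentiable)
 show "h differentiable at x" for x unfolding h by (intro differentiable_add d)
 show "pderiv_dir b h \<in> {\<lambda>x. f x + g x | f g. f \<in> schwartz \<and> g \<in> schwartz}" if "b \<in> Basis" for b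
 proof -
  have "pderiv_dir b h = (\<lambda>x. pderiv_dir b f x + pderiv_dir b g x)"
   unfolding h by (rule ext, rule pderiv_dir_add) (rule d)+
  then show ?thesis using fg that schwartz_pderiv_Basis by blast
 qed
 fix N
 obtain C where 1: "\<And>x. (1 + norm x) ^ N * norm (f x) \<le> C" using schwartz_bound[OF fg(1)] by blast
 obtain D where 2: "\<And>x. (1 + norm x) ^ N * norm (g x) \<le> D" using schwartz_bound[OF fg(2)] by blast
 have "(1 + norm x) ^ N * norm (h x) \<le> C + D" for x
 proof -
  have "(1 + norm x) ^ N * norm (h x) \<le> (1 + norm x) ^ N * (norm (f x) + norm (g x))"
   unfolding h by (intro mult_left_mono norm_triangle_ineq) auto
  also have "... \<le> C + D" unfolding distrib_left by (intro add_mono 1 2)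
  finally show ?thesis .
 qed
 then show "\<exists>C. \<forall>x. (1 + norm x) ^ N * norm (h x) \<le> C" by blast
qed

lemma schwartz_zero [simp]: "(\<lambda>_. 0) \<in> schwartz"
 by (rule schwartzI[of _ "{\<lambda>_. 0}"]) auto

lemma schwartz_sum: "finite A ==> (\<And>i. i \<in> A ==> f i \<in> schwartz) ==> (\<lambda>x. \<Sum>i\<in>A. f i x) \<in> schwartz"
 by (induction A rule: finite_induct) (auto intro: schwartz_add)

lemma schwartz_diff: "f \<in> schwartz ==> g \<in> schwartz ==> (\<lambda>x. f x - g x) \<in> schwartz"
 using schwartz_add[OF _ schwartz_cmult[of g "-1"], of f] by simp

lemma schwartz_pderiv: assumes "f \<in> schwartz" shows "pderiv_dir v f \<in> schwartz"
proof -
 have "pderiv_dir v f = (\<lambda>x. \<Sum>b\<in>Basis. of_real (v \<bullet> b) * pderiv_dir b f x)"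
 proof
  fix x
  show "pderiv_dir v f x = (\<Sum>b\<in>Basis. of_real (v \<bullet> b) * pderiv_dir b f x)"
   using pderiv_dir_expand[OF smooth_differentiable[OF schwartz_smooth[OF assms]], of v x]
   unfolding scaleR_conv_of_real .
 qed
 then show ?thesis
  using assms by (auto intro!: schwartz_sum schwartz_cmult schwartz_pderiv_Basis)
qed

lemma schwartz_pderivs: "f \<in> schwartz ==> pderivs vs f \<in> schwartz"
 by (induction vs) (auto simp: pderivs_Cons schwartz_pderiv)

lemma pderiv_dir_coord:
 "pderiv_dir v (\<lambda>x. of_real (x \<bullet> y) :: complex) = (\<lambda>_. of_real (v \<bullet> y))" and
 coord_differentiable: "(\<lambda>x. of_real (x \<bullet> y) :: complex) differentiable (at x)"
proof -
 have *: "((\<lambda>x. of_real (x \<bullet> y) :: complex) has_derivative (\<lambda>v. of_real (v \<bullet> y))) (at x)" for x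
  by (auto intro!: derivative_eq_intros)
 show "pderiv_dir v (\<lambda>x. of_real (x \<bullet> y) :: complex) = (\<lambda>_. of_real (v \<bullet> y))"
  by (rule ext, rule pderiv_dir_eqI[OF *])
 show "(\<lambda>x. of_real (x \<bullet> y) :: complex) differentiable (at x)"
  using * differentiable_def by blast
qed

lemma moderate_coord: "(\<lambda>x. of_real (x \<bullet> y)) \<in> moderate"
proof (rule moderateI[of _ "insert (\<lambda>x. of_real (x \<bullet> y)) (range (\<lambda>c _. c))"])
 fix f :: "'a => complex" assume "f \<in> insert (\<lambda>x. of_real (x \<bullet> y)) (range (\<lambda>c _. c))"
 then consider "f = (\<lambda>x. of_real (x \<bullet> y))" | c where "f = (\<lambda>_. c)" by blast
 then show "\<exists>C N. \<forall>x. norm (f x) \<le> C * (1 + norm x) ^ N"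
 proof cases
  case 1
  have "norm (f x) \<le> norm y * (1 + norm x) ^ 1" for x
  proof -
   have "norm (f x) \<le> norm y * norm x" using Cauchy_Schwarz_ineq2[of x y] by (simp add: 1 mult.commute)
   also have "... \<le> norm y * (1 + norm x) ^ 1" by (intro mult_left_mono) auto
   finally show ?thesis .
  qed
  then show ?thesis by blast
 next
  case 2
  show ?thesis by (rule exI[of _ "norm c"], rule exI[of _ 0]) (simp add: 2)
 qed
qed (auto simp: pderiv_dir_coord coord_differentiable)

lemma pderiv_dir_wave:
 "pderiv_dir v (\<lambda>x. iexp (x \<bullet> y)) x = \<i> * of_real (v \<bullet> y) * iexp (x \<bullet> y)" and
 wave_differentiable: "(\<lambda>x. iexp (x \<bullet> y)) differentiable (at x)"
proof -
 have "((\<lambda>x. \<i> * of_real (x \<bullet> y)) has_derivative (\<lambda>v. \<i> * of_real (v \<bullet> y))) (at x)"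
  by (auto intro!: derivative_eq_intros)
 from has_derivative_compose[OF this has_field_derivative_imp_has_derivative[OF DERIV_exp]]
 have *: "((\<lambda>x. iexp (x \<bullet> y)) has_derivative (\<lambda>v. iexp (x \<bullet> y) * (\<i> * of_real (v \<bullet> y)))) (at x)" .
 then show "(\<lambda>x. iexp (x \<bullet> y)) differentiable (at x)" by (auto simp: differentiable_def)
 show "pderiv_dir v (\<lambda>x. iexp (x \<bullet> y)) x = \<i> * of_real (v \<bullet> y) * iexp (x \<bullet> y)"
  using pderiv_dir_eqI[OF *] by simp
qed

lemma norm_wave [simp]: "norm (iexp r) = 1"
 by (simp add: norm_exp_eq_Re)

lemma moderate_wave: "(\<lambda>x. iexp (x \<bullet> y)) \<in> moderate"
proof (rule moderateI[of _ "{\<lambda>x. c * iexp (x \<bullet> y) | c. True}"])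
 show "(\<lambda>x. iexp (x \<bullet> y)) \<in> {\<lambda>x. c * iexp (x \<bullet> y) | c. True}"
  by (auto intro!: exI[of _ 1])
 fix f assume "f \<in> {\<lambda>x. c * iexp (x \<bullet> y) | c. True}"
 then obtain c where f: "f = (\<lambda>x. c * iexp (x \<bullet> y))" by auto
 show "f differentiable at x" for x unfolding f by (intro differentiable_mult differentiable_const wave_differentiable)
 have "pderiv_dir b f = (\<lambda>x. (c * (\<i> * of_real (b \<bullet> y))) * iexp (x \<bullet> y))" for b
  unfolding f by (rule ext, subst pderiv_dir_mult) (auto simp: wave_differentiable pderiv_dir_wave)
 then show "pderiv_dir b f \<in> {\<lambda>x. c * iexp (x \<bullet> y) | c. True}" for b by blast
 show "\<exists>C N. \<forall>x. norm (f x) \<le> C * (1 + norm x) ^ N"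
  by (rule exI[of _ "norm c"], rule exI[of _ 0]) (simp add: f norm_mult)
qed

lemma one_plus_le_mult:
 assumes "a \<le> b + c" "0 \<le> b" "0 \<le> (c::real)" shows "1 + a \<le> (1 + b) * (1 + c)"
proof -
 have "(1 + b) * (1 + c) = 1 + (b + c) + b * c" by (simp add: algebra_simps)
 moreover have "0 \<le> b * c" using assms by simp
 ultimately show ?thesis using assms(1) by linarith
qed

lemma schwartz_shift_reflect:
 fixes \<sigma> :: real
 assumes "f \<in> schwartz" "\<bar>\<sigma>\<bar> = 1"
 shows "(\<lambda>x. f (\<sigma> *\<^sub>R x + c)) \<in> schwartz"
proof (rule schwartzI[of _ "{\<lambda>x. f (\<sigma> *\<^sub>R x + c) | f. f \<in> schwartz}"])
 show "(\<lambda>x. f (\<sigma> *\<^sub>R x + c)) \<in> {\<lambda>x. f (\<sigma> *\<^sub>R x + c) | f. f \<in> schwartz}" using assms by blast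
 have L: "linear ((*\<^sub>R) \<sigma>)" by simp
 fix h assume "h \<in> {\<lambda>x. f (\<sigma> *\<^sub>R x + c) | f. f \<in> schwartz}"
 then obtain f where h: "h = (\<lambda>x. f (\<sigma> *\<^sub>R x + c))" and f: "f \<in> schwartz" by blast
 show "h differentiable at x" for x
  unfolding h using smooth_differentiable[OF smooth_affine[OF L schwartz_smooth[OF f]]] .
 have "pderiv_dir b h = (\<lambda>x. pderiv_dir (\<sigma> *\<^sub>R b) f (\<sigma> *\<^sub>R x + c))" for b
  unfolding h using pderiv_dir_affine[OF L smooth_differentiable[OF schwartz_smooth[OF f]]] by blast
 then show "pderiv_dir b h \<in> {\<lambda>x. f (\<sigma> *\<^sub>R x + c) | f. f \<in> schwartz}" for b
  using schwartz_pderiv[OF f] by blast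
 fix N
 obtain C where C: "0 \<le> C" "\<And>x. (1 + norm x) ^ N * norm (f x) \<le> C" using schwartz_bound[OF f] by blast
 have "(1 + norm x) ^ N * norm (h x) \<le> (1 + norm c) ^ N * C" for x
 proof -
  have "norm x = norm ((\<sigma> *\<^sub>R x + c) - c)" using assms(2) by simp
  also have "... \<le> norm (\<sigma> *\<^sub>R x + c) + norm c" by (rule norm_triangle_ineq4)
  finally have "norm x \<le> norm c + norm (\<sigma> *\<^sub>R x + c)" by simp
  then have "1 + norm x \<le> (1 + norm c) * (1 + norm (\<sigma> *\<^sub>R x + c))"
   by (rule one_plus_le_mult) auto
  then have "(1 + norm x) ^ N \<le> (1 + norm c) ^ N * (1 + norm (\<sigma> *\<^sub>R x + c)) ^ N"
   by (metis power_mono power_mult_distrib add_nonneg_nonneg norm_ge_zero zero_le_one)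
  then have "(1 + norm x) ^ N * norm (h x) \<le> (1 + norm c) ^ N * (1 + norm (\<sigma> *\<^sub>R x + c)) ^ N * norm (h x)"
   by (rule mult_right_mono) simp
  also have "... = (1 + norm c) ^ N * ((1 + norm (\<sigma> *\<^sub>R x + c)) ^ N * norm (h x))" by simp
  also have "... \<le> (1 + norm c) ^ N * C" unfolding h by (intro mult_left_mono C) auto
  finally show ?thesis .
 qed
 then show "\<exists>C. \<forall>x. (1 + norm x) ^ N * norm (h x) \<le> C" by blast
qed

lemma schwartz_compact_support:
 fixes f :: "'a::euclidean_space => complex"
 assumes "smooth f" "\<And>x. r < norm x ==> f x = 0"
 shows "f \<in> schwartz"
proof (rule schwartzI[of _ "{f. smooth f \<and> (\<forall>x. r < norm x --> f x = 0)}"])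
 show "f \<in> {f. smooth f \<and> (\<forall>x. r < norm x --> f x = 0)}" using assms by blast
 fix f :: "'a => complex" assume "f \<in> {f. smooth f \<and> (\<forall>x. r < norm x --> f x = 0)}"
 then have f: "smooth f" "\<And>x. r < norm x ==> f x = 0" by auto
 show "f differentiable at x" for x using f by (simp add: smooth_differentiable)
 have "pderiv_dir b f x = 0" if "r < norm x" for b x
 proof (rule pderiv_dir_eqI[where D="\<lambda>_. 0"])
  have "open {x::'a. r < norm x}" by (intro open_Collect_less continuous_intros)
  moreover have "((\<lambda>_. 0) has_derivative (\<lambda>_. 0)) (at x)" by simp
  ultimately show "(f has_derivative (\<lambda>_. 0)) (at x)"
   using has_derivative_transform_within_open[of "\<lambda>_. 0" "\<lambda>_. 0" x UNIV "{x. r < norm x}" f] that f(2) by simp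
 qed
 then show "pderiv_dir b f \<in> {f. smooth f \<and> (\<forall>x. r < norm x --> f x = 0)}" for b
  using f smooth_pderiv by blast
 fix N
 have "continuous_on (cball 0 r) (\<lambda>x. (1 + norm x) ^ N * norm (f x))"
  by (intro continuous_intros smooth_continuous f)
 then have "bounded ((\<lambda>x. (1 + norm x) ^ N * norm (f x)) ` cball 0 r)"
  using compact_continuous_image compact_cball compact_imp_bounded by blast
 then obtain C where C: "\<And>x. norm x \<le> r ==> \<bar>(1 + norm x) ^ N * norm (f x)\<bar> \<le> C"
  unfolding bounded_iff real_norm_def by (meson image_eqI mem_cball_0)
 have "(1 + norm x) ^ N * norm (f x) \<le> max C 0" for x
  using C[of x] f(2)[of x] by (cases "norm x \<le> r") auto
 then show "\<exists>C. \<forall>x. (1 + norm x) ^ N * norm (f x) \<le> C" by blast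
qed

lemma integrable_decay: "integrable lborel (\<lambda>x::'a::euclidean_space. 1 / (1 + norm x) ^ (2 * DIM('a)))"
proof (rule integrableI_bounded)
 have 1: "(\<integral>\<^sup>+(x::real). ennreal (inverse (1 + x\<^sup>2)) \<partial>lborel) < \<infinity>"
 proof -
  have "integrable lborel (\<lambda>x::real. inverse (1 + x\<^sup>2))"
   using integrable_inverse_1_plus_square by (simp add: set_integrable_def einterval_def)
  from nn_integral_eq_integral[OF this] show ?thesis by simp
 qed
 have "(\<integral>\<^sup>+(x::'a). ennreal (norm (1 / (1 + norm x) ^ (2 * DIM('a)))) \<partial>lborel)
   \<le> (\<integral>\<^sup>+(x::'a). (\<Prod>b\<in>Basis. ennreal (inverse (1 + (x \<bullet> b)\<^sup>2))) \<partial>lborel)"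
 proof (rule nn_integral_mono)
  fix x :: 'a
  have "(\<Prod>b\<in>(Basis::'a set). 1 + (x \<bullet> b)\<^sup>2) \<le> (\<Prod>b\<in>(Basis::'a set). (1 + norm x)\<^sup>2)"
  proof (rule prod_mono)
   fix b :: 'a assume b: "b \<in> Basis"
   have "(x \<bullet> b)\<^sup>2 \<le> (norm x)\<^sup>2" using Basis_le_norm[OF b, of x] by (metis power2_abs power_mono abs_ge_zero)
   then show "0 \<le> 1 + (x \<bullet> b)\<^sup>2 \<and> 1 + (x \<bullet> b)\<^sup>2 \<le> (1 + norm x)\<^sup>2"
    using zero_le_power2[of "x \<bullet> b"] norm_ge_zero[of x]
    unfolding power2_sum one_power2 by (intro conjI; linarith)
  qed
  also have "... = (1 + norm x) ^ (2 * DIM('a))" by (simp add: power_mult)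
  finally have "(\<Prod>b\<in>(Basis::'a set). 1 + (x \<bullet> b)\<^sup>2) \<le> (1 + norm x) ^ (2 * DIM('a))" .
  moreover have "0 < (\<Prod>b\<in>(Basis::'a set). 1 + (x \<bullet> b)\<^sup>2)" by (intro prod_pos) (auto intro: add_pos_nonneg)
  ultimately have "norm (1 / (1 + norm x) ^ (2 * DIM('a))) \<le> (\<Prod>b\<in>(Basis::'a set). inverse (1 + (x \<bullet> b)\<^sup>2))"
   using prod_inversef[of "\<lambda>b. 1 + (x \<bullet> b)\<^sup>2" Basis]
   by (simp add: comp_def divide_inverse le_imp_inverse_le)
  then show "ennreal (norm (1 / (1 + norm x) ^ (2 * DIM('a)))) \<le> (\<Prod>b\<in>(Basis::'a set). ennreal (inverse (1 + (x \<bullet> b)\<^sup>2)))"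
   by (subst prod_ennreal) (auto simp: ennreal_leI)
 qed
 also have "... = (\<Prod>b\<in>(Basis::'a set). (\<integral>\<^sup>+x. ennreal (inverse (1 + x\<^sup>2)) \<partial>lborel))"
  by (rule nn_integral_lborel_prod) auto
 also have "... < \<infinity>" using 1 by (simp add: power_less_top_ennreal)
 finally show "(\<integral>\<^sup>+(x::'a). ennreal (norm (1 / (1 + norm x) ^ (2 * DIM('a)))) \<partial>lborel) < \<infinity>" .
qed simp

lemma schwartz_measurable: "f \<in> schwartz ==> f \<in> borel_measurable borel"
 by (intro borel_measurable_continuous_onI smooth_continuous schwartz_smooth)

lemma schwartz_decay:
 fixes f :: "'a::euclidean_space => complex"
 assumes "f \<in> schwartz" obtains C where "0 \<le> C" "\<And>x. norm (f x) \<le> C * (1 / (1 + norm x) ^ N)"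
proof -
 obtain C where C: "0 \<le> C" "\<And>x. (1 + norm x) ^ N * norm (f x) \<le> C"
  using schwartz_bound[OF assms] by blast
 have "norm (f x) \<le> C * (1 / (1 + norm x) ^ N)" for x
 proof -
  have "0 < (1 + norm x) ^ N" by (simp add: add_pos_nonneg)
  then show ?thesis using C(2)[of x] by (simp add: field_simps)
 qed
 then show ?thesis using that C(1) by blast
qed

lemma integrable_decayI:
 fixes f :: "'a::euclidean_space => 'b::{banach, second_countable_topology}"
 assumes "f \<in> borel_measurable borel" "\<And>x. norm (f x) \<le> C * (1 / (1 + norm x) ^ (2 * DIM('a)))"
 shows "integrable lborel f"
 by (rule Bochner_Integration.integrable_bound[OF integrable_mult_right[OF integrable_decay, of "C"]])
   (use assms in \<open>auto intro!: AE_I2 intro: order_trans[OF _ divide_right_mono[OF abs_ge_self]]\<close>)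

lemma schwartz_integrable:
 fixes f :: "'a::euclidean_space => complex"
 assumes "f \<in> schwartz" shows "integrable lborel f"
 using schwartz_decay[OF assms, of "2 * DIM('a)"] schwartz_measurable[OF assms] by (metis integrable_decayI)

lemma integral_lborel_shift:
 fixes f :: "'a::euclidean_space => 'b::{banach, second_countable_topology}"
 assumes "f \<in> borel_measurable borel"
 shows "(\<integral>x. f (x + c) \<partial>lborel) = (\<integral>x. f x \<partial>lborel)"
  and "integrable lborel f ==> integrable lborel (\<lambda>x. f (x + c))"
proof -
 have d: "distr lborel borel (\<lambda>x. x + c) = (lborel :: 'a measure)"
 proof -
  have "(\<lambda>x. x + c) = (+) c" by (auto simp: add.commute)
  then show ?thesis using lborel_distr_plus[of c] by metis
 qed
 show "(\<integral>x. f (x + c) \<partial>lborel) = (\<integral>x. f x \<partial>lborel)"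
  using integral_distr[of "\<lambda>x. x + c" lborel borel f] assms by (simp add: d)
 show "integrable lborel (\<lambda>x. f (x + c))" if "integrable lborel f"
  using integrable_distr[of "\<lambda>x. x + c" lborel borel f] that by (simp add: d)
qed

lemma integral_lborel_reflect:
 fixes f :: "'a::euclidean_space => 'b::{banach, second_countable_topology}"
 assumes "f \<in> borel_measurable borel"
 shows "(\<integral>x. f (- x) \<partial>lborel) = (\<integral>x. f x \<partial>lborel)"
proof -
 have d: "distr lborel borel (\<lambda>x. - x) = (lborel :: 'a measure)"
  using lborel_affine[of "-1" "0::'a"] by (simp add: density_1)
 show ?thesis using integral_distr[of "\<lambda>x. - x" lborel borel f] assms by (simp add: d)
qed

text \<open>The integral of \<open>f\<close> is translation invariant, so the integral of each difference quotient of \<open>f\<close> along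
\<open>v\<close> vanishes. By the second-order Taylor estimate the quotients converge to the derivative with an error
that is dominated by an integrable function times the step.\<close>

lemma integral_pderiv_zero:
 fixes f :: "'a::euclidean_space => complex"
 assumes f: "f \<in> schwartz"
 shows "(\<integral>x. pderiv_dir v f x \<partial>lborel) = 0"
proof -
 define w where "w x = 1 / (1 + norm x) ^ (2 * DIM('a))" for x :: 'a
 have sm: "smooth f" "smooth (pderiv_dir v f)" using f by (auto intro: schwartz_smooth smooth_pderiv)
 obtain C where C: "0 \<le> C" "\<And>x. norm (pderiv_dir v (pderiv_dir v f) x) \<le> C * w x"
  using schwartz_decay[OF schwartz_pderiv[OF schwartz_pderiv[OF f]], of v v "2 * DIM('a)"] unfolding w_def by blast
 define K where "K = C * (1 + norm v) ^ (2 * DIM('a))"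
 have bound: "norm (f (x + h *\<^sub>R v) - f x - h *\<^sub>R pderiv_dir v f x) \<le> h\<^sup>2 * (K * w x)" if h: "0 < h" "h \<le> 1" for x h
 proof -
  have e: "pderiv_dir (h *\<^sub>R v) f = (\<lambda>x. h *\<^sub>R pderiv_dir v f x)"
   using pderiv_dir_scale smooth_differentiable[OF sm(1)] by blast
  have "norm (f (x + h *\<^sub>R v) - f x - pderiv_dir (h *\<^sub>R v) f x) \<le> h\<^sup>2 * (K * w x)"
  proof (rule pderiv_taylor2)
   fix s :: real assume s: "0 \<le> s" "s \<le> 1"
   let ?y = "x + s *\<^sub>R h *\<^sub>R v"
   show "f differentiable at ?y" "pderiv_dir (h *\<^sub>R v) f differentiable at ?y"
    using f by (auto intro: smooth_differentiable smooth_pderiv schwartz_smooth)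
   have "pderiv_dir (h *\<^sub>R v) (pderiv_dir (h *\<^sub>R v) f) ?y = h\<^sup>2 *\<^sub>R pderiv_dir v (pderiv_dir v f) ?y"
    unfolding e by (simp add: pderiv_dir_scale pderiv_dir_linear_image[OF bounded_linear_scaleR_right]
     smooth_differentiable sm smooth_scaleR power2_eq_square)
   then have "norm (pderiv_dir (h *\<^sub>R v) (pderiv_dir (h *\<^sub>R v) f) ?y) \<le> h\<^sup>2 * (C * w ?y)"
    using C(2)[of ?y] by (simp add: mult_left_mono)
   also have "w ?y \<le> (1 + norm v) ^ (2 * DIM('a)) * w x"
   proof -
    have "norm x \<le> norm ?y + norm (s *\<^sub>R h *\<^sub>R v)" by (metis add_diff_cancel_right' norm_triangle_ineq4)
    also have "norm (s *\<^sub>R h *\<^sub>R v) \<le> norm v"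
     using s h by (auto intro!: mult_left_le_one_le simp: mult_le_one mult.assoc[symmetric])
    finally have "norm x \<le> norm v + norm ?y" by simp
    then have "1 + norm x \<le> (1 + norm v) * (1 + norm ?y)" by (rule one_plus_le_mult) auto
    then have "(1 + norm x) ^ (2 * DIM('a)) \<le> (1 + norm v) ^ (2 * DIM('a)) * (1 + norm ?y) ^ (2 * DIM('a))"
     by (metis power_mono power_mult_distrib add_nonneg_nonneg norm_ge_zero zero_le_one)
    moreover have "0 < (1 + norm x) ^ (2 * DIM('a))" "0 < (1 + norm ?y) ^ (2 * DIM('a))" by (simp_all add: add_pos_nonneg)
    ultimately show ?thesis unfolding w_def by (simp add: field_simps)
   qed
   finally show "norm (pderiv_dir (h *\<^sub>R v) (pderiv_dir (h *\<^sub>R v) f) ?y) \<le> h\<^sup>2 * (K * w x)"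
    using C(1) by (simp add: K_def mult_left_mono mult.assoc)
  qed
  then show ?thesis by (simp add: e)
 qed
 have wi: "integrable lborel (\<lambda>x. K * w x)" unfolding w_def using integrable_mult_right[OF integrable_decay] by blast
 have fm: "f \<in> borel_measurable borel" using f by (rule schwartz_measurable)
 have fi: "integrable lborel f" "integrable lborel (pderiv_dir v f)" "integrable lborel (\<lambda>x. f (x + c))" for c
  using f fm by (auto intro: schwartz_integrable schwartz_pderiv integral_lborel_shift)
 have "norm (\<integral>x. pderiv_dir v f x \<partial>lborel) \<le> h * (\<integral>x. K * w x \<partial>lborel)" if h: "0 < h" "h \<le> 1" for h
 proof -
  have "(\<integral>x. f (x + h *\<^sub>R v) - f x - h *\<^sub>R pderiv_dir v f x \<partial>lborel) = - h *\<^sub>R (\<integral>x. pderiv_dir v f x \<partial>lborel)"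
   using fi by (simp add: integral_lborel_shift[OF fm])
  then have "h * norm (\<integral>x. pderiv_dir v f x \<partial>lborel) = norm (\<integral>x. f (x + h *\<^sub>R v) - f x - h *\<^sub>R pderiv_dir v f x \<partial>lborel)"
   using h by simp
  also have "... \<le> (\<integral>x. h\<^sup>2 * (K * w x) \<partial>lborel)"
  proof (rule order_trans[OF integral_norm_bound integral_mono])
   show "integrable lborel (\<lambda>x. norm (f (x + h *\<^sub>R v) - f x - h *\<^sub>R pderiv_dir v f x))"
    using fi by (intro integrable_norm Bochner_Integration.integrable_diff integrable_scaleR_right)
   show "integrable lborel (\<lambda>x. h\<^sup>2 * (K * w x))" using wi by (rule integrable_mult_right)
  qed (rule bound[OF h])
  also have "... = h * (h * (\<integral>x. K * w x \<partial>lborel))" by (simp add: power2_eq_square)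
  finally show ?thesis using h by (simp add: mult_le_cancel_left_pos)
 qed
 then have "((\<lambda>h. h * (\<integral>x. K * w x \<partial>lborel)) \<longlongrightarrow> 0) (at_right 0) ==> norm (\<integral>x. pderiv_dir v f x \<partial>lborel) \<le> 0"
  by (intro tendsto_lowerbound[where F="at_right 0"])
    (auto simp: eventually_at_right[of 0 1] intro!: exI[of _ "1/2"])
 moreover have "((\<lambda>h. h * (\<integral>x. K * w x \<partial>lborel)) \<longlongrightarrow> 0) (at_right 0)"
  by (auto intro!: tendsto_eq_intros)
 ultimately show ?thesis by simp
qed

section \<open>The Fourier transform on Schwartz functions\<close>

lemma wave_neg: "exp (- \<i> * of_real (x \<bullet> \<xi>)) = iexp (x \<bullet> (- \<xi>))"
 by simp

lemma schwartz_wave: "f \<in> schwartz ==> (\<lambda>x. iexp (x \<bullet> \<xi>) * f x) \<in> schwartz"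
 by (rule schwartz_mult[OF moderate_wave])

lemma schwartz_fourier_integrand: "f \<in> schwartz ==> (\<lambda>x. exp (- \<i> * of_real (x \<bullet> \<xi>)) * f x) \<in> schwartz"
 unfolding wave_neg by (rule schwartz_wave)

lemma schwartz_coord: "f \<in> schwartz ==> (\<lambda>x. of_real (x \<bullet> v) * f x) \<in> schwartz"
 by (rule schwartz_mult[OF moderate_coord])

lemma norm_wave_neg [simp]: "norm (exp (- (\<i> * of_real r))) = 1"
 by (simp add: norm_exp_eq_Re)

lemma norm_fourier_le:
 "norm (fourier f \<xi>) \<le> (\<integral>x. norm (f x) \<partial>lborel)"
 unfolding fourier_def by (rule order_trans[OF integral_norm_bound]) (simp add: norm_mult)

lemma fourier_cmult: "fourier (\<lambda>x. c * f x) \<xi> = c * fourier f \<xi>"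
 unfolding fourier_def by (simp add: mult.left_commute)

lemma fourier_add:
 assumes "f \<in> schwartz" "g \<in> schwartz"
 shows "fourier (\<lambda>x. f x + g x) \<xi> = fourier f \<xi> + fourier g \<xi>"
 unfolding fourier_def distrib_left
 by (rule Bochner_Integration.integral_add)
   (intro schwartz_integrable schwartz_fourier_integrand assms)+

lemma fourier_of_pderiv:
 assumes f: "f \<in> schwartz"
 shows "fourier (pderiv_dir v f) \<xi> = \<i> * of_real (v \<bullet> \<xi>) * fourier f \<xi>"
proof -
 have fd: "f differentiable (at x)" for x using f by (intro smooth_differentiable schwartz_smooth)
 have "pderiv_dir v (\<lambda>x. iexp (x \<bullet> (-\<xi>)) * f x) =
  (\<lambda>x. iexp (x \<bullet> (-\<xi>)) * pderiv_dir v f x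
   + (- \<i> * of_real (v \<bullet> \<xi>)) * (iexp (x \<bullet> (-\<xi>)) * f x))"
  by (rule ext, subst pderiv_dir_mult[OF wave_differentiable fd], subst pderiv_dir_wave) (simp add: algebra_simps)
 then have "0 = (\<integral>x. iexp (x \<bullet> (-\<xi>)) * pderiv_dir v f x
   + (- \<i> * of_real (v \<bullet> \<xi>)) * (iexp (x \<bullet> (-\<xi>)) * f x) \<partial>lborel)"
  using integral_pderiv_zero[OF schwartz_wave[OF f, of "-\<xi>"], of v] by simp
 also have "... = fourier (pderiv_dir v f) \<xi> + (- \<i> * of_real (v \<bullet> \<xi>)) * fourier f \<xi>"
  unfolding fourier_def wave_neg
  by (subst Bochner_Integration.integral_add)
    (intro schwartz_integrable schwartz_wave schwartz_pderiv schwartz_cmult f | simp)+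
 finally show ?thesis by (simp add: algebra_simps)
qed

text \<open>Differentiation under the integral sign, with an explicit quadratic bound on the remainder of the exponential.\<close>

lemma fourier_has_derivative:
 assumes f: "f \<in> schwartz"
 shows "(fourier f has_derivative (\<lambda>v. fourier (\<lambda>x. - \<i> * of_real (x \<bullet> v) * f x) \<xi>)) (at \<xi>)"
proof -
 define D where "D v = fourier (\<lambda>x. - \<i> * of_real (x \<bullet> v) * f x) \<xi>" for v
 have fi: "(\<lambda>x. - \<i> * of_real (x \<bullet> v) * f x) \<in> schwartz" for v
  using schwartz_cmult[OF schwartz_coord[OF f, of v], of "- \<i>"] by (simp add: mult.assoc)
 have nf: "(\<lambda>x. of_real (norm x ^ 2) * f x) \<in> schwartz"
 proof -
  have "(\<lambda>x. of_real (norm x ^ 2) * f x) = (\<lambda>x. \<Sum>b\<in>Basis. of_real (x \<bullet> b) * (of_real (x \<bullet> b) * f x))"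
   by (rule ext) (simp add: norm_Basis power2_norm_eq_inner euclidean_inner[of x x for x] sum_distrib_right mult.assoc)
  then show ?thesis using f by (simp add: schwartz_sum schwartz_coord)
 qed
 define K where "K = (\<integral>x. norm (of_real (norm x ^ 2) * f x) \<partial>lborel)"
 have D: "bounded_linear D"
 proof (rule bounded_linear_intro)
  fix v w r
  show "D (v + w) = D v + D w"
   unfolding D_def by (subst fourier_add[symmetric, OF fi fi]) (simp add: inner_add_right algebra_simps)
  show "D (r *\<^sub>R v) = r *\<^sub>R D v"
   unfolding D_def scaleR_conv_of_real fourier_cmult[symmetric] by (simp add: algebra_simps)
  have "norm (D v) \<le> (\<integral>x. norm (- \<i> * of_real (x \<bullet> v) * f x) \<partial>lborel)"
   unfolding D_def by (rule norm_fourier_le)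
  also have "... \<le> (\<integral>x. norm v * (norm (f x) + norm (of_real (norm x ^ 2) * f x)) \<partial>lborel)"
  proof (rule integral_mono)
   show "integrable lborel (\<lambda>x. norm (- \<i> * of_real (x \<bullet> v) * f x))"
    using schwartz_integrable[OF fi] by (rule integrable_norm)
   show "integrable lborel (\<lambda>x. norm v * (norm (f x) + norm (of_real (norm x ^ 2) * f x)))"
    by (intro integrable_mult_right Bochner_Integration.integrable_add integrable_norm schwartz_integrable f nf)
   fix x
   have "\<bar>x \<bullet> v\<bar> \<le> norm x * norm v" by (rule Cauchy_Schwarz_ineq2)
   also have "... \<le> (1 + norm x ^ 2) * norm v"
   proof (rule mult_right_mono)
    have "0 \<le> (norm x - 1) ^ 2" by simp
    then have "2 * norm x \<le> 1 + norm x ^ 2" unfolding power2_diff by simp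
    then show "norm x \<le> 1 + norm x ^ 2" using norm_ge_zero[of x] by linarith
   qed simp
   finally have "\<bar>x \<bullet> v\<bar> * norm (f x) \<le> (1 + norm x ^ 2) * norm v * norm (f x)" by (rule mult_right_mono) simp
   then show "norm (- \<i> * of_real (x \<bullet> v) * f x) \<le> norm v * (norm (f x) + norm (of_real (norm x ^ 2) * f x))"
    by (simp add: norm_mult norm_power algebra_simps)
  qed
  also have "... = norm v * (\<integral>x. norm (f x) + norm (of_real (norm x ^ 2) * f x) \<partial>lborel)"
   by simp
  finally show "norm (D v) \<le> norm v * (\<integral>x. norm (f x) + norm (of_real (norm x ^ 2) * f x) \<partial>lborel)" .
 qed
 have key: "norm (fourier f y - fourier f \<xi> - D (y - \<xi>)) \<le> K * norm (y - \<xi>) ^ 2" for y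
 proof -
  define v where "v = y - \<xi>"
  have i: "integrable lborel (\<lambda>x. exp (- \<i> * of_real (x \<bullet> y)) * f x)"
    "integrable lborel (\<lambda>x. exp (- \<i> * of_real (x \<bullet> \<xi>)) * f x)"
    "integrable lborel (\<lambda>x. exp (- \<i> * of_real (x \<bullet> \<xi>)) * (- \<i> * of_real (x \<bullet> v) * f x))"
   by (rule schwartz_integrable[OF schwartz_fourier_integrand[OF f]]
      schwartz_integrable[OF schwartz_fourier_integrand[OF fi]])+
  have "fourier f y - fourier f \<xi> - D v =
   (\<integral>x. exp (- \<i> * of_real (x \<bullet> y)) * f x - exp (- \<i> * of_real (x \<bullet> \<xi>)) * f x
    - exp (- \<i> * of_real (x \<bullet> \<xi>)) * (- \<i> * of_real (x \<bullet> v) * f x) \<partial>lborel)"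
   unfolding D_def fourier_def using i by simp
  also have "norm ... \<le> (\<integral>x. norm v ^ 2 * norm (of_real (norm x ^ 2) * f x) \<partial>lborel)"
  proof (rule order_trans[OF integral_norm_bound integral_mono])
   show "integrable lborel (\<lambda>x. norm v ^ 2 * norm (of_real (norm x ^ 2) * f x))"
    by (intro integrable_mult_right integrable_norm schwartz_integrable nf)
   show "integrable lborel (\<lambda>x. norm (exp (- \<i> * of_real (x \<bullet> y)) * f x - exp (- \<i> * of_real (x \<bullet> \<xi>)) * f x
    - exp (- \<i> * of_real (x \<bullet> \<xi>)) * (- \<i> * of_real (x \<bullet> v) * f x)))"
    using i by (intro integrable_norm Bochner_Integration.integrable_diff)
   fix x
   have y: "y = \<xi> + v" by (simp add: v_def)
   have "exp (- \<i> * of_real (x \<bullet> y)) * f x - exp (- \<i> * of_real (x \<bullet> \<xi>)) * f x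
    - exp (- \<i> * of_real (x \<bullet> \<xi>)) * (- \<i> * of_real (x \<bullet> v) * f x)
    = exp (- \<i> * of_real (x \<bullet> \<xi>)) * f x * (iexp (- (x \<bullet> v)) - (\<Sum>k\<le>1. (\<i> * of_real (- (x \<bullet> v)))^k / fact k))"
   proof -
    have e: "exp (- \<i> * of_real (x \<bullet> y)) = exp (- \<i> * of_real (x \<bullet> \<xi>)) * iexp (- (x \<bullet> v))"
     unfolding y inner_add_right exp_add[symmetric] by (simp add: algebra_simps)
    show ?thesis unfolding e by (simp add: algebra_simps)
   qed
   also have "norm ... = norm (f x) * norm (iexp (- (x \<bullet> v)) - (\<Sum>k\<le>1. (\<i> * of_real (- (x \<bullet> v)))^k / fact k))"
    by (simp add: norm_mult)
   also have "... \<le> norm (f x) * (\<bar>- (x \<bullet> v)\<bar> ^ Suc 1 / fact (Suc 1))"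
    by (intro mult_left_mono iexp_approx1) auto
   also have "... \<le> norm (f x) * (norm x * norm v) ^ 2"
   proof (intro mult_left_mono)
    have "\<bar>- (x \<bullet> v)\<bar> ^ 2 \<le> (norm x * norm v) ^ 2"
     using Cauchy_Schwarz_ineq2[of x v] by (intro power_mono) auto
    moreover have "\<bar>- (x \<bullet> v)\<bar> ^ Suc 1 / fact (Suc 1) \<le> \<bar>- (x \<bullet> v)\<bar> ^ 2" by (simp add: power2_eq_square)
    ultimately show "\<bar>- (x \<bullet> v)\<bar> ^ Suc 1 / fact (Suc 1) \<le> (norm x * norm v) ^ 2" by linarith
   qed auto
   also have "... = norm v ^ 2 * norm (of_real (norm x ^ 2) * f x)"
    by (simp add: norm_mult norm_power power_mult_distrib algebra_simps)
   finally show "norm (exp (- \<i> * of_real (x \<bullet> y)) * f x - exp (- \<i> * of_real (x \<bullet> \<xi>)) * f x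
    - exp (- \<i> * of_real (x \<bullet> \<xi>)) * (- \<i> * of_real (x \<bullet> v) * f x)) \<le> norm v ^ 2 * norm (of_real (norm x ^ 2) * f x)" .
  qed
  also have "... = K * norm v ^ 2" by (simp add: K_def)
  finally show ?thesis by (simp add: v_def)
 qed
 have "(fourier f has_derivative D) (at \<xi>)"
 proof (rule has_derivativeI_sandwich[where e=1 and H="\<lambda>y. K * norm (y - \<xi>)"])
  show "((\<lambda>y. K * norm (y - \<xi>)) \<longlongrightarrow> 0) (at \<xi>)" by (auto intro!: tendsto_eq_intros)
  fix y assume "y \<noteq> \<xi>"
  then have "0 < norm (y - \<xi>)" by simp
  then show "norm (fourier f y - fourier f \<xi> - D (y - \<xi>)) / norm (y - \<xi>) \<le> K * norm (y - \<xi>)"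
   using key[of y] by (simp add: divide_le_eq power2_eq_square mult.assoc)
 qed (simp_all add: D)
 then show ?thesis by (simp add: D_def[abs_def])
qed

lemma pderiv_dir_fourier:
 assumes "f \<in> schwartz"
 shows "pderiv_dir v (fourier f) = fourier (\<lambda>x. - \<i> * of_real (x \<bullet> v) * f x)"
 by (rule ext, rule pderiv_dir_eqI[OF fourier_has_derivative[OF assms]])

lemma fourier_pderivs_replicate:
 assumes "f \<in> schwartz"
 shows "fourier (pderivs (replicate k v) f) \<xi> = (\<i> * of_real (v \<bullet> \<xi>)) ^ k * fourier f \<xi>"
 by (induction k) (auto simp: pderivs_Cons fourier_of_pderiv schwartz_pderivs assms)

lemma one_plus_norm_power_le:
 fixes x :: "'a::euclidean_space"
 shows "(1 + norm x) ^ N \<le> (1 + real DIM('a)) ^ N * (1 + (\<Sum>b\<in>Basis. \<bar>x \<bullet> b\<bar> ^ N))"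
proof -
 define M where "M = Max (insert 1 ((\<lambda>b. \<bar>x \<bullet> b\<bar>) ` Basis))"
 have M: "1 \<le> M" "b \<in> Basis ==> \<bar>x \<bullet> b\<bar> \<le> M" for b unfolding M_def by (rule Max_ge; simp)+
 have "norm x \<le> (\<Sum>b\<in>Basis. \<bar>x \<bullet> b\<bar>)" by (rule norm_le_l1)
 also have "... \<le> real DIM('a) * M" using sum_bounded_above[of Basis "\<lambda>b. \<bar>x \<bullet> b\<bar>" M] M(2) by simp
 finally have "1 + norm x \<le> (1 + real DIM('a)) * M" using M(1) by (simp add: algebra_simps)
 then have "(1 + norm x) ^ N \<le> ((1 + real DIM('a)) * M) ^ N" by (intro power_mono) auto
 also have "... = (1 + real DIM('a)) ^ N * M ^ N" by (rule power_mult_distrib)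
 also have "M ^ N \<le> 1 + (\<Sum>b\<in>Basis. \<bar>x \<bullet> b\<bar> ^ N)"
 proof -
  have "M \<in> insert 1 ((\<lambda>b. \<bar>x \<bullet> b\<bar>) ` Basis)" unfolding M_def by (rule Max_in) auto
  then consider "M = 1" | b where "b \<in> Basis" "M = \<bar>x \<bullet> b\<bar>" by blast
  then show ?thesis
  proof cases
   case 1
   then show ?thesis by (simp add: sum_nonneg)
  next
   case 2
   have "\<bar>x \<bullet> b\<bar> ^ N \<le> (\<Sum>b\<in>Basis. \<bar>x \<bullet> b\<bar> ^ N)"
    using 2(1) by (intro member_le_sum[of b Basis "\<lambda>b. \<bar>x \<bullet> b\<bar> ^ N"]) auto
   then show ?thesis using 2 by simp
  qed
 qed
 finally show ?thesis by (simp add: mult_left_mono)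
qed

lemma schwartz_fourier:
 fixes f :: "'a::euclidean_space => complex"
 assumes "f \<in> schwartz" shows "fourier f \<in> schwartz"
proof (rule schwartzI[of _ "fourier ` schwartz"])
 fix g assume "g \<in> fourier ` (schwartz :: ('a => complex) set)"
 then obtain f where g: "g = fourier f" and f: "f \<in> schwartz" by blast
 show "g differentiable at \<xi>" for \<xi>
  unfolding g using fourier_has_derivative[OF f] differentiable_def by blast
 have "(\<lambda>x. - \<i> * of_real (x \<bullet> v) * f x) \<in> schwartz" for v
  using schwartz_cmult[OF schwartz_coord[OF f, of v], of "- \<i>"] by (simp add: mult.assoc)
 then show "pderiv_dir b g \<in> fourier ` schwartz" for b
  unfolding g pderiv_dir_fourier[OF f] by blast
 fix N
 define C where "C k = (\<Sum>b\<in>(Basis::'a set). (\<integral>x. norm (pderivs (replicate N b) f x) \<partial>lborel))" for k :: nat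
 have C: "\<bar>\<xi> \<bullet> b\<bar> ^ N * norm (g \<xi>) \<le> (\<integral>x. norm (pderivs (replicate N b) f x) \<partial>lborel)" for \<xi> b
  using norm_fourier_le[of "pderivs (replicate N b) f" \<xi>]
  by (simp add: fourier_pderivs_replicate[OF f] norm_mult norm_power g inner_commute)
 have "(1 + norm \<xi>) ^ N * norm (g \<xi>) \<le> (1 + real DIM('a)) ^ N * ((\<integral>x. norm (f x) \<partial>lborel) + C N)" for \<xi>
 proof -
  have "(1 + norm \<xi>) ^ N * norm (g \<xi>) \<le> (1 + real DIM('a)) ^ N * (1 + (\<Sum>b\<in>Basis. \<bar>\<xi> \<bullet> b\<bar> ^ N)) * norm (g \<xi>)"
   by (intro mult_right_mono one_plus_norm_power_le) auto
  also have "... = (1 + real DIM('a)) ^ N * (norm (g \<xi>) + (\<Sum>b\<in>Basis. \<bar>\<xi> \<bullet> b\<bar> ^ N * norm (g \<xi>)))"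
   by (simp add: algebra_simps sum_distrib_left)
  also have "... \<le> (1 + real DIM('a)) ^ N * ((\<integral>x. norm (f x) \<partial>lborel) + C N)"
   unfolding C_def by (intro mult_left_mono add_mono sum_mono C) (auto simp: g norm_fourier_le)
  finally show ?thesis .
 qed
 then show "\<exists>C. \<forall>\<xi>. (1 + norm \<xi>) ^ N * norm (g \<xi>) \<le> C" by blast
qed (use assms in auto)

section \<open>Gaussians and the heat kernel\<close>

definition gauss :: "real => 'a::euclidean_space => complex"
 where "gauss \<tau> x = of_real (exp (- \<tau> * (norm x)\<^sup>2))"

lemma gauss_has_derivative:
 "(gauss \<tau> has_derivative (\<lambda>v. - 2 * of_real \<tau> * of_real (x \<bullet> v) * gauss \<tau> x)) (at x)"
 unfolding gauss_def power2_norm_eq_inner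
 by (auto intro!: derivative_eq_intros simp: inner_commute algebra_simps)

lemma pderiv_dir_gauss: "pderiv_dir v (gauss \<tau>) x = - 2 * of_real \<tau> * of_real (x \<bullet> v) * gauss \<tau> x"
 by (rule pderiv_dir_eqI[OF gauss_has_derivative])

lemma gauss_differentiable: "gauss \<tau> differentiable (at x)"
 using gauss_has_derivative differentiable_def by blast

lemma power_le_fact_exp: "0 \<le> y ==> y ^ k \<le> fact k * exp (y::real)"
proof -
 assume y: "0 \<le> y"
 have "y ^ k / fact k = (\<Sum>i\<in>{k}. y ^ i /\<^sub>R fact i)" by (simp add: divide_inverse mult.commute)
 also have "... \<le> (\<Sum>i. y ^ i /\<^sub>R fact i)"
  using y by (intro sum_le_suminf summable_exp_generic) auto
 also have "... = exp y" by (simp add: exp_def)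
 finally show ?thesis by (simp add: field_simps)
qed

lemma schwartz_gauss:
 assumes \<tau>: "0 < \<tau>"
 shows "gauss \<tau> \<in> schwartz"
proof (rule schwartzI[of _ "{\<lambda>x. m x * gauss \<tau> x | m. m \<in> moderate}"])
 show "gauss \<tau> \<in> {\<lambda>x. m x * gauss \<tau> x | m. m \<in> moderate}"
  by (auto intro!: exI[of _ "\<lambda>_. 1"])
 fix h :: "'a => complex" assume "h \<in> {\<lambda>x. m x * gauss \<tau> x | m. m \<in> moderate}"
 then obtain m where h: "h = (\<lambda>x. m x * gauss \<tau> x)" and m: "m \<in> moderate" by blast
 have md: "m differentiable at x" for x using m by (intro smooth_differentiable moderate_smooth)
 show "h differentiable at x" for x unfolding h by (intro differentiable_mult md gauss_differentiable)
 show "pderiv_dir b h \<in> {\<lambda>x. m x * gauss \<tau> x | m. m \<in> moderate}" if b: "b \<in> Basis" for b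
 proof -
  have "pderiv_dir b h = (\<lambda>x. (m x * (- 2 * of_real \<tau> * of_real (x \<bullet> b)) + pderiv_dir b m x) * gauss \<tau> x)"
   unfolding h by (rule ext, subst pderiv_dir_mult[OF md gauss_differentiable])
    (simp add: pderiv_dir_gauss algebra_simps)
  moreover have "(\<lambda>x. m x * (- 2 * of_real \<tau> * of_real (x \<bullet> b)) + pderiv_dir b m x) \<in> moderate"
   by (intro moderate_add moderate_mult moderate_coord moderate_const moderate_pderiv_Basis m b)
  ultimately show ?thesis
   by (intro CollectI exI[of _ "\<lambda>x. m x * (- 2 * of_real \<tau> * of_real (x \<bullet> b)) + pderiv_dir b m x"] conjI)
 qed
 fix N
 obtain C M where C: "0 \<le> C" "\<And>x. norm (m x) \<le> C * (1 + norm x) ^ M" using moderate_bound[OF m] by blast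
 define k where "k = N + M"
 have "(1 + norm x) ^ N * norm (h x) \<le> C * (2 ^ k * (1 + fact k / \<tau> ^ k))" for x
 proof -
  have g: "(1 + norm x) ^ k * exp (- \<tau> * (norm x)\<^sup>2) \<le> 2 ^ k * (1 + fact k / \<tau> ^ k)"
  proof (cases "norm x \<le> 1")
   case True
   have "(1 + norm x) ^ k * exp (- \<tau> * (norm x)\<^sup>2) \<le> 2 ^ k * 1"
    using True \<tau> by (intro mult_mono power_mono) auto
   also have "... \<le> 2 ^ k * (1 + fact k / \<tau> ^ k)" using \<tau> by (intro mult_left_mono) auto
   finally show ?thesis .
  next
   case False
   then have "norm x * 1 \<le> norm x * norm x" by (intro mult_left_mono) auto
   then have "1 + norm x \<le> 2 * (norm x)\<^sup>2" using False by (simp add: power2_eq_square)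
   then have "(1 + norm x) ^ k * exp (- \<tau> * (norm x)\<^sup>2) \<le> (2 * (norm x)\<^sup>2) ^ k * exp (- \<tau> * (norm x)\<^sup>2)"
    by (intro mult_right_mono power_mono) auto
   also have "... = 2 ^ k / \<tau> ^ k * ((\<tau> * (norm x)\<^sup>2) ^ k * exp (- \<tau> * (norm x)\<^sup>2))"
    using \<tau> by (simp add: power_mult_distrib)
   also have "... \<le> 2 ^ k / \<tau> ^ k * ((fact k * exp (\<tau> * (norm x)\<^sup>2)) * exp (- \<tau> * (norm x)\<^sup>2))"
    using \<tau> by (intro mult_left_mono mult_right_mono power_le_fact_exp) auto
   also have "... = 2 ^ k * (fact k / \<tau> ^ k)" by (simp add: exp_minus_inverse mult.assoc exp_add[symmetric])
   also have "... \<le> 2 ^ k * (1 + fact k / \<tau> ^ k)" by (intro mult_left_mono) auto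
   finally show ?thesis .
  qed
  have "(1 + norm x) ^ N * norm (h x) \<le> (1 + norm x) ^ N * ((C * (1 + norm x) ^ M) * exp (- \<tau> * (norm x)\<^sup>2))"
   unfolding h gauss_def norm_mult using C by (intro mult_left_mono mult_right_mono) auto
  also have "... = C * ((1 + norm x) ^ k * exp (- \<tau> * (norm x)\<^sup>2))" by (simp add: k_def power_add)
  also have "... \<le> C * (2 ^ k * (1 + fact k / \<tau> ^ k))" by (intro mult_left_mono g C)
  finally show ?thesis .
 qed
 then show "\<exists>C. \<forall>x. (1 + norm x) ^ N * norm (h x) \<le> C" by blast
qed

lemma integral_gauss_real: "0 < \<tau> ==> (\<integral>\<^sup>+(x::real). ennreal (exp (- \<tau> * x\<^sup>2)) \<partial>lborel) = ennreal (sqrt (pi / \<tau>))"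
proof -
 assume \<tau>: "0 < \<tau>"
 define \<sigma> where "\<sigma> = sqrt (1 / (2 * \<tau>))"
 have \<sigma>: "0 < \<sigma>" "\<sigma>\<^sup>2 = 1 / (2 * \<tau>)" using \<tau> by (auto simp: \<sigma>_def)
 have e: "exp (- \<tau> * x\<^sup>2) = sqrt (pi / \<tau>) * normal_density 0 \<sigma> x" for x
  unfolding normal_density_def \<sigma>(2) using \<tau> by (simp add: real_sqrt_divide field_simps)
 have "(\<integral>\<^sup>+(x::real). ennreal (exp (- \<tau> * x\<^sup>2)) \<partial>lborel) = ennreal (\<integral>x. sqrt (pi / \<tau>) * normal_density 0 \<sigma> x \<partial>lborel)"
  unfolding e using \<tau> \<sigma> by (intro nn_integral_eq_integral integrable_mult_right integrable_normal_density) auto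
 also have "... = ennreal (sqrt (pi / \<tau>))" using \<sigma> by simp
 finally show ?thesis .
qed

lemma integral_gauss:
 assumes \<tau>: "0 < \<tau>"
 shows "(\<integral>x. gauss \<tau> (x::'a::euclidean_space) \<partial>lborel) = of_real ((pi / \<tau>) powr (real DIM('a) / 2))"
proof -
 have s: "exp (- \<tau> * (norm x)\<^sup>2) = (\<Prod>b\<in>Basis. exp (- \<tau> * (x \<bullet> b)\<^sup>2))" for x :: 'a
 proof -
  have "- \<tau> * (norm x)\<^sup>2 = (\<Sum>b\<in>Basis. - \<tau> * (x \<bullet> b)\<^sup>2)"
   unfolding sum_distrib_left[symmetric] power2_norm_eq_inner
   by (subst euclidean_inner) (simp add: power2_eq_square)
  then show ?thesis by (simp only: exp_sum[OF finite_Basis])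
 qed
 have "(\<integral>\<^sup>+(x::'a). ennreal (exp (- \<tau> * (norm x)\<^sup>2)) \<partial>lborel) = (\<integral>\<^sup>+(x::'a). (\<Prod>b\<in>Basis. ennreal (exp (- \<tau> * (x \<bullet> b)\<^sup>2))) \<partial>lborel)"
  unfolding s by (simp add: prod_ennreal)
 also have "... = (\<Prod>b\<in>(Basis::'a set). (\<integral>\<^sup>+x. ennreal (exp (- \<tau> * x\<^sup>2)) \<partial>lborel))"
  by (rule nn_integral_lborel_prod) auto
 also have "... = ennreal (sqrt (pi / \<tau>) ^ DIM('a))"
  unfolding integral_gauss_real[OF \<tau>] using \<tau> by (simp add: ennreal_power)
 finally have *: "(\<integral>\<^sup>+(x::'a). ennreal (exp (- \<tau> * (norm x)\<^sup>2)) \<partial>lborel) = ennreal (sqrt (pi / \<tau>) ^ DIM('a))" .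
 have "(\<integral>x. exp (- \<tau> * (norm (x::'a))\<^sup>2) \<partial>lborel) = sqrt (pi / \<tau>) ^ DIM('a)"
  using \<tau> * by (subst integral_eq_nn_integral) auto
 also have "... = (pi / \<tau>) powr (real DIM('a) / 2)"
  using \<tau> by (simp add: powr_half_sqrt[symmetric] powr_realpow[symmetric] powr_powr)
 finally show ?thesis unfolding gauss_def by simp
qed

text \<open>In each direction the transform of a Gaussian satisfies the first-order equation of a Gaussian,
which fixes it up to its value at the origin.\<close>

lemma fourier_gauss:
 fixes \<xi> :: "'a::euclidean_space"
 assumes \<tau>: "0 < \<tau>"
 shows "fourier (gauss \<tau>) \<xi> = of_real ((pi / \<tau>) powr (real DIM('a) / 2)) * gauss (1 / (4 * \<tau>)) \<xi>"
proof -
 have g: "gauss \<tau> \<in> schwartz" using \<tau> by (rule schwartz_gauss)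
 define h where "h x = fourier (gauss \<tau>) x * gauss (- 1 / (4 * \<tau>)) x" for x :: 'a
 have fd: "fourier (gauss \<tau>) differentiable (at x)" for x :: 'a
  using smooth_differentiable[OF schwartz_smooth[OF schwartz_fourier[OF g]]] .
 have d: "pderiv_dir v (fourier (gauss \<tau>)) x = - (of_real (x \<bullet> v) / (2 * of_real \<tau>)) * fourier (gauss \<tau>) x" for v x :: 'a
 proof -
  have "(\<lambda>y. - \<i> * of_real (y \<bullet> v) * gauss \<tau> y) = (\<lambda>y. \<i> / (2 * of_real \<tau>) * pderiv_dir v (gauss \<tau>) y)"
   using \<tau> by (auto simp: pderiv_dir_gauss)
  then have "pderiv_dir v (fourier (gauss \<tau>)) x = \<i> / (2 * of_real \<tau>) * (\<i> * of_real (v \<bullet> x) * fourier (gauss \<tau>) x)"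
   by (simp only: pderiv_dir_fourier[OF g] fourier_cmult fourier_of_pderiv[OF g])
  then show ?thesis using \<tau> by (simp add: field_simps inner_commute)
 qed
 have "pderiv_dir v h x = 0" for v x
  unfolding h_def by (subst pderiv_dir_mult[OF fd gauss_differentiable])
   (use \<tau> in \<open>simp add: d pderiv_dir_gauss field_simps\<close>)
 moreover have "h differentiable (at x)" for x
  unfolding h_def by (intro differentiable_mult fd gauss_differentiable)
 ultimately have "norm (h (0 + \<xi>) - h 0) \<le> 0" by (intro pderiv_mvt) auto
 then have "h \<xi> = h 0" by simp
 also have "h 0 = of_real ((pi / \<tau>) powr (real DIM('a) / 2))"
  unfolding h_def using integral_gauss[OF \<tau>, where 'a='a] by (simp add: fourier_def gauss_def)
 finally have *: "fourier (gauss \<tau>) \<xi> * gauss (- 1 / (4 * \<tau>)) \<xi> = of_real ((pi / \<tau>) powr (real DIM('a) / 2))"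
  unfolding h_def .
 have "gauss (- 1 / (4 * \<tau>)) \<xi> * gauss (1 / (4 * \<tau>)) \<xi> = 1"
  unfolding gauss_def by (simp add: exp_add[symmetric] of_real_mult[symmetric] del: of_real_mult)
 then have "fourier (gauss \<tau>) \<xi> = fourier (gauss \<tau>) \<xi> * gauss (- 1 / (4 * \<tau>)) \<xi> * gauss (1 / (4 * \<tau>)) \<xi>"
  by (simp add: mult.assoc)
 then show ?thesis unfolding * .
qed

lemma heat_kernel_gauss:
 "heat_kernel \<tau> = (\<lambda>x::'a::euclidean_space. of_real ((4 * pi * \<tau>) powr (- real DIM('a) / 2)) * gauss (1 / (4 * \<tau>)) x)"
 unfolding heat_kernel_def gauss_def by (simp add: fun_eq_iff)

lemma schwartz_heat_kernel: "0 < \<tau> ==> heat_kernel \<tau> \<in> schwartz"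
 unfolding heat_kernel_gauss by (intro schwartz_cmult schwartz_gauss) simp

lemma fourier_heat_kernel:
 assumes "0 < \<tau>" shows "fourier (heat_kernel \<tau>) \<xi> = gauss \<tau> (\<xi>::'a::euclidean_space)"
proof -
 have "fourier (heat_kernel \<tau>) \<xi> = of_real ((4 * pi * \<tau>) powr (- real DIM('a) / 2)) *
   (of_real ((pi / (1 / (4 * \<tau>))) powr (real DIM('a) / 2)) * gauss (1 / (4 * (1 / (4 * \<tau>)))) \<xi>)"
  unfolding heat_kernel_gauss fourier_cmult using assms by (subst fourier_gauss) auto
 also have "... = of_real ((4 * pi * \<tau>) powr (- real DIM('a) / 2) * (4 * pi * \<tau>) powr (real DIM('a) / 2)) * gauss \<tau> \<xi>"
  using assms by (simp add: mult_ac)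
 also have "(4 * pi * \<tau>) powr (- real DIM('a) / 2) * (4 * pi * \<tau>) powr (real DIM('a) / 2) = 1"
  using assms by (simp add: powr_add[symmetric])
 finally show ?thesis by simp
qed

lemma fourier_gauss_heat:
 assumes "0 < \<tau>" shows "fourier (gauss \<tau>) \<xi> = (2 * pi) ^ DIM('a) * heat_kernel \<tau> (\<xi>::'a::euclidean_space)"
proof -
 have "(pi / \<tau>) powr (real DIM('a) / 2) = ((2 * pi) * (2 * pi) / (4 * pi * \<tau>)) powr (real DIM('a) / 2)"
  using assms by (simp add: field_simps)
 also have "... = ((2 * pi) * (2 * pi)) powr (real DIM('a) / 2) / (4 * pi * \<tau>) powr (real DIM('a) / 2)"
  by (rule powr_divide)
 also have "((2 * pi) * (2 * pi)) powr (real DIM('a) / 2) = (2 * pi) ^ DIM('a)"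
 proof -
  have "(2 * pi) * (2 * pi) = (2 * pi) powr 2" by (simp add: powr_numeral power2_eq_square)
  then have "((2 * pi) * (2 * pi)) powr (real DIM('a) / 2) = (2 * pi) powr real DIM('a)"
   by (simp only: powr_powr) simp
  then show ?thesis by (simp add: powr_realpow)
 qed
 finally have e1: "(pi / \<tau>) powr (real DIM('a) / 2) = (2 * pi) ^ DIM('a) / (4 * pi * \<tau>) powr (real DIM('a) / 2)" .
 have e2: "(4 * pi * \<tau>) powr (- real DIM('a) / 2) = inverse ((4 * pi * \<tau>) powr (real DIM('a) / 2))"
  by (metis minus_divide_left powr_minus)
 show ?thesis
  unfolding fourier_gauss[OF assms] heat_kernel_gauss e1 e2
  by (simp only: divide_inverse of_real_mult of_real_power of_real_numeral mult.assoc)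
qed

section \<open>Fourier inversion\<close>

lemma fubini_kernel:
 fixes f :: "'a::euclidean_space => complex" and g :: "'b::euclidean_space => complex"
 assumes f: "f \<in> schwartz" and g: "g \<in> schwartz"
  and k: "continuous_on UNIV (\<lambda>p. k (fst p) (snd p))" and B: "\<And>x y. norm (k x y) \<le> B"
 shows "(\<integral>y. (\<integral>x. k x y * f x \<partial>lborel) * g y \<partial>lborel) = (\<integral>x. f x * (\<integral>y. k x y * g y \<partial>lborel) \<partial>lborel)"
proof -
 define F where "F p = k (fst p) (snd p) * f (fst p) * g (snd p)" for p
 have "continuous_on UNIV F"
  unfolding F_def by (intro continuous_intros k continuous_on_compose2[OF smooth_continuous[OF schwartz_smooth[OF f]]]
   continuous_on_compose2[OF smooth_continuous[OF schwartz_smooth[OF g]]]) auto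
 then have Fm: "F \<in> borel_measurable (lborel \<Otimes>\<^sub>M lborel)"
  by (simp add: lborel_prod borel_measurable_continuous_onI)
 have Fi: "integrable (lborel \<Otimes>\<^sub>M lborel) F"
 proof (rule lborel_pair.Fubini_integrable[OF Fm])
  have B0: "0 \<le> B" using B[of undefined undefined] norm_ge_zero order_trans by blast
  have km: "(\<lambda>y. k x y) \<in> borel_measurable borel" for x
   by (intro borel_measurable_continuous_onI continuous_on_compose2[OF k, of UNIV "\<lambda>y. (x, y)", simplified] continuous_intros)
  have i2: "integrable lborel (\<lambda>y. F (x, y))" for x
  proof (rule Bochner_Integration.integrable_bound[OF integrable_mult_right[OF integrable_norm[OF schwartz_integrable[OF g]], of "B * norm (f x)"]])
   show "(\<lambda>y. F (x, y)) \<in> borel_measurable lborel"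
    unfolding F_def using km[of x] schwartz_measurable[OF g] by simp
   show "AE y in lborel. norm (F (x, y)) \<le> norm (B * norm (f x) * norm (g y))"
    unfolding F_def using B B0 by (auto simp: norm_mult abs_mult intro!: mult_right_mono)
  qed
  then show "AE x in lborel. integrable lborel (\<lambda>y. F (x, y))" by simp
  show "integrable lborel (\<lambda>x. \<integral>y. norm (F (x, y)) \<partial>lborel)"
  proof (rule Bochner_Integration.integrable_bound[OF integrable_mult_left[OF integrable_norm[OF schwartz_integrable[OF f]], of "B * (\<integral>y. norm (g y) \<partial>lborel)"]])
   show "(\<lambda>x. \<integral>y. norm (F (x, y)) \<partial>lborel) \<in> borel_measurable lborel"
    by (intro lborel.borel_measurable_lebesgue_integral) (use Fm in \<open>simp add: split_beta\<close>)
   have "norm (\<integral>y. norm (F (x, y)) \<partial>lborel) \<le> norm (norm (f x) * (B * (\<integral>y. norm (g y) \<partial>lborel)))" for x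
   proof -
    have "(\<integral>y. norm (F (x, y)) \<partial>lborel) \<le> (\<integral>y. B * norm (f x) * norm (g y) \<partial>lborel)"
    proof (rule integral_mono)
     show "integrable lborel (\<lambda>y. norm (F (x, y)))" using i2 by (rule integrable_norm)
     show "integrable lborel (\<lambda>y. B * norm (f x) * norm (g y))"
      by (intro integrable_mult_right integrable_norm schwartz_integrable g)
    qed (auto simp: F_def norm_mult intro!: mult_right_mono B)
    also have "... = norm (f x) * (B * (\<integral>y. norm (g y) \<partial>lborel))" by simp
    finally show ?thesis by (simp add: B0 abs_mult)
   qed
   then show "AE x in lborel. norm (\<integral>y. norm (F (x, y)) \<partial>lborel) \<le> norm (norm (f x) * (B * (\<integral>y. norm (g y) \<partial>lborel)))" by simp
  qed
 qed
 have "(\<integral>y. (\<integral>x. F (x, y) \<partial>lborel) \<partial>lborel) = (\<integral>x. (\<integral>y. F (x, y) \<partial>lborel) \<partial>lborel)"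
  using lborel_pair.Fubini_integral[of "\<lambda>x y. F (x, y)"] Fi by (simp add: split_beta)
 moreover have "(\<integral>x. F (x, y) \<partial>lborel) = (\<integral>x. k x y * f x \<partial>lborel) * g y" for y
  unfolding F_def by simp
 moreover have "(\<integral>y. F (x, y) \<partial>lborel) = f x * (\<integral>y. k x y * g y \<partial>lborel)" for x
 proof -
  have "F (x, y) = f x * (k x y * g y)" for y unfolding F_def by simp
  then show ?thesis by simp
 qed
 ultimately show ?thesis by simp
qed

lemma fourier_mult_formula:
 assumes "f \<in> schwartz" "g \<in> schwartz"
 shows "(\<integral>\<xi>. fourier f \<xi> * g \<xi> \<partial>lborel) = (\<integral>x. f x * fourier g x \<partial>lborel)"
proof -
 have "continuous_on UNIV (\<lambda>p::'a \<times> 'a. exp (- \<i> * of_real (fst p \<bullet> snd p)))"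
  by (intro continuous_intros)
 from fubini_kernel[OF assms this, of 1] show ?thesis
  unfolding fourier_def by (simp add: inner_commute)
qed

lemma schwartz_pderiv_bound:
 fixes f :: "'a::euclidean_space => complex"
 assumes f: "f \<in> schwartz"
 obtains C where "0 \<le> C" "\<And>v x. (1 + norm x) ^ N * norm (pderiv_dir v f x) \<le> C * norm v"
proof -
 have "\<exists>C. \<forall>x. (1 + norm x) ^ N * norm (pderiv_dir b f x) \<le> C" for b
  using schwartz_bound[OF schwartz_pderiv[OF f]] by metis
 then obtain C where C: "\<And>b x. (1 + norm x) ^ N * norm (pderiv_dir b f x) \<le> C b" by metis
 have C0: "0 \<le> C b" for b by (rule order_trans[OF _ C[of 0]]) simp
 have "(1 + norm x) ^ N * norm (pderiv_dir v f x) \<le> (\<Sum>b\<in>Basis. C b) * norm v" for v x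
 proof -
  have "(1 + norm x) ^ N * norm (pderiv_dir v f x) \<le> (1 + norm x) ^ N * (\<Sum>b\<in>Basis. \<bar>v \<bullet> b\<bar> * norm (pderiv_dir b f x))"
   by (intro mult_left_mono norm_pderiv_dir_le smooth_differentiable schwartz_smooth f) auto
  also have "... = (\<Sum>b\<in>Basis. \<bar>v \<bullet> b\<bar> * ((1 + norm x) ^ N * norm (pderiv_dir b f x)))"
   by (simp add: sum_distrib_left algebra_simps)
  also have "... \<le> (\<Sum>b\<in>Basis. norm v * C b)"
   by (intro sum_mono mult_mono C Basis_le_norm) auto
  also have "... = (\<Sum>b\<in>Basis. C b) * norm v"
   by (subst sum_distrib_left[symmetric]) (rule mult.commute)
  finally show ?thesis .
 qed
 then show ?thesis using that C0 by (meson sum_nonneg)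
qed

lemma schwartz_lipschitz:
 fixes f :: "'a::euclidean_space => complex"
 assumes f: "f \<in> schwartz"
 obtains L where "0 \<le> L" "\<And>x v. norm (f (x + v) - f x) \<le> L * norm v"
proof -
 obtain C where C: "0 \<le> C" "\<And>v x. (1 + norm x) ^ 0 * norm (pderiv_dir v f x) \<le> C * norm v"
  using schwartz_pderiv_bound[OF f] by blast
 have "norm (f (x + v) - f x) \<le> C * norm v" for x v
  by (rule pderiv_mvt) (use C f in \<open>auto intro: smooth_differentiable schwartz_smooth\<close>)
 then show ?thesis using that C(1) by blast
qed

lemma schwartz_lipschitz_decay:
 fixes f :: "'a::euclidean_space => complex"
 assumes f: "f \<in> schwartz"
 obtains L where "0 \<le> L" "\<And>x v. norm v \<le> 1 ==> (1 + norm x) ^ N * norm (f (x + v) - f x) \<le> L * norm v"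
proof -
 obtain C where C: "0 \<le> C" "\<And>v x. (1 + norm x) ^ N * norm (pderiv_dir v f x) \<le> C * norm v"
  using schwartz_pderiv_bound[OF f] by blast
 have "(1 + norm x) ^ N * norm (f (x + v) - f x) \<le> (2 ^ N * C) * norm v" if v: "norm v \<le> 1" for x v
 proof -
  have p: "0 < (1 + norm x) ^ N" by (simp add: add_pos_nonneg)
  have "norm (f (x + v) - f x) \<le> 2 ^ N * C * norm v / (1 + norm x) ^ N"
  proof (rule pderiv_mvt)
   fix s :: real assume s: "0 \<le> s" "s \<le> 1"
   show "f differentiable at (x + s *\<^sub>R v)" using f by (intro smooth_differentiable schwartz_smooth)
   have sv: "norm (s *\<^sub>R v) \<le> 1" using s v by (simp add: mult_le_one)
   have "norm x \<le> norm (x + s *\<^sub>R v) + norm (s *\<^sub>R v)" by (metis add_diff_cancel_right' norm_triangle_ineq4)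
   from order_trans[OF this add_left_mono[OF sv]]
   have "1 + norm x \<le> 2 * (1 + norm (x + s *\<^sub>R v))" using norm_ge_zero[of "x + s *\<^sub>R v"] by argo
   then have "(1 + norm x) ^ N \<le> 2 ^ N * (1 + norm (x + s *\<^sub>R v)) ^ N"
    by (metis power_mono power_mult_distrib add_nonneg_nonneg norm_ge_zero zero_le_one)
   then have "(1 + norm x) ^ N * norm (pderiv_dir v f (x + s *\<^sub>R v)) \<le> 2 ^ N * (1 + norm (x + s *\<^sub>R v)) ^ N * norm (pderiv_dir v f (x + s *\<^sub>R v))"
    by (rule mult_right_mono) simp
   also have "... \<le> 2 ^ N * (C * norm v)" using C(2)[of "x + s *\<^sub>R v" v] by simp
   finally show "norm (pderiv_dir v f (x + s *\<^sub>R v)) \<le> 2 ^ N * C * norm v / (1 + norm x) ^ N"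
    using p by (simp add: field_simps)
  qed
  then show ?thesis using p by (simp add: field_simps)
 qed
 then show ?thesis using C(1) by (intro that[of "2 ^ N * C"]) auto
qed

lemma fourier_modulate: "fourier (\<lambda>\<xi>. iexp (\<xi> \<bullet> x) * h \<xi>) y = fourier h (y - x)"
proof -
 have "exp (- \<i> * of_real (\<xi> \<bullet> y)) * iexp (\<xi> \<bullet> x) = exp (- \<i> * of_real (\<xi> \<bullet> (y - x)))" for \<xi>
  unfolding exp_add[symmetric] by (simp add: inner_diff_right right_diff_distrib)
 then show ?thesis unfolding fourier_def mult.assoc[symmetric] by simp
qed

lemma integral_heat_kernel: "0 < \<tau> ==> (\<integral>z. heat_kernel \<tau> (z::'a::euclidean_space) \<partial>lborel) = 1"
 using fourier_heat_kernel[of \<tau> "0::'a"] by (simp add: fourier_def gauss_def)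

lemma heat_kernel_second_moment:
 assumes \<tau>: "0 < \<tau>"
 shows "(\<integral>z. of_real ((norm z)\<^sup>2) * heat_kernel \<tau> (z::'a::euclidean_space) \<partial>lborel) = of_real (2 * real DIM('a) * \<tau>)"
proof -
 have h: "heat_kernel \<tau> \<in> (schwartz :: ('a => complex) set)" using \<tau> by (rule schwartz_heat_kernel)
 have hd: "heat_kernel \<tau> differentiable (at x)" for x :: 'a
  using h by (intro smooth_differentiable schwartz_smooth)
 have dh: "pderiv_dir b (heat_kernel \<tau>) x = - (of_real (x \<bullet> b) / (2 * of_real \<tau>)) * heat_kernel \<tau> x" for b x :: 'a
 proof -
  have "pderiv_dir b (\<lambda>x. of_real ((4 * pi * \<tau>) powr (- real DIM('a) / 2)) * gauss (1 / (4 * \<tau>)) x) x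
   = of_real ((4 * pi * \<tau>) powr (- real DIM('a) / 2)) * pderiv_dir b (gauss (1 / (4 * \<tau>))) x"
   by (rule pderiv_dir_linear_image[OF bounded_linear_mult_right gauss_differentiable])
  then show ?thesis unfolding heat_kernel_gauss pderiv_dir_gauss using \<tau> by simp
 qed
 have one: "(\<integral>z. of_real (z \<bullet> b) * (of_real (z \<bullet> b) * heat_kernel \<tau> z) \<partial>lborel) = of_real (2 * \<tau>)" if b: "b \<in> Basis" for b :: 'a
 proof -
  have zh: "(\<lambda>z. of_real (z \<bullet> b) * heat_kernel \<tau> z) \<in> schwartz" using h by (rule schwartz_coord)
  have "pderiv_dir b (\<lambda>z. of_real (z \<bullet> b) * heat_kernel \<tau> z)
   = (\<lambda>z. heat_kernel \<tau> z - of_real (1 / (2 * \<tau>)) * (of_real (z \<bullet> b) * (of_real (z \<bullet> b) * heat_kernel \<tau> z)))"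
   by (rule ext, subst pderiv_dir_mult[OF coord_differentiable hd])
    (use b in \<open>simp add: pderiv_dir_coord dh algebra_simps\<close>)
  then have "0 = (\<integral>z. heat_kernel \<tau> z - of_real (1 / (2 * \<tau>)) * (of_real (z \<bullet> b) * (of_real (z \<bullet> b) * heat_kernel \<tau> z)) \<partial>lborel)"
   using integral_pderiv_zero[OF zh, of b] by simp
  also have "... = 1 - of_real (1 / (2 * \<tau>)) * (\<integral>z. of_real (z \<bullet> b) * (of_real (z \<bullet> b) * heat_kernel \<tau> z) \<partial>lborel)"
  proof -
   have i1: "integrable lborel (heat_kernel \<tau> :: 'a => complex)" using h by (rule schwartz_integrable)
   have i2: "integrable lborel (\<lambda>z. of_real (1 / (2 * \<tau>)) * (of_real (z \<bullet> b) * (of_real (z \<bullet> b) * heat_kernel \<tau> z)))"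
    by (intro schwartz_integrable schwartz_cmult schwartz_coord h)
   show ?thesis
    unfolding Bochner_Integration.integral_diff[OF i1 i2] integral_heat_kernel[OF \<tau>] by simp
  qed
  finally show ?thesis using \<tau> by (simp add: field_simps)
 qed
 have e: "of_real ((norm z)\<^sup>2) * heat_kernel \<tau> z = (\<Sum>b\<in>Basis. of_real (z \<bullet> b) * (of_real (z \<bullet> b) * heat_kernel \<tau> z))" for z :: 'a
  unfolding power2_norm_eq_inner by (subst euclidean_inner) (simp add: sum_distrib_right mult.assoc)
 have "(\<integral>z. of_real ((norm z)\<^sup>2) * heat_kernel \<tau> (z::'a) \<partial>lborel) = (\<Sum>b\<in>(Basis::'a set). of_real (2 * \<tau>))"
  unfolding e by (subst Bochner_Integration.integral_sum)
   (auto intro!: schwartz_integrable schwartz_coord h simp: one)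
 then show ?thesis by simp
qed

text \<open>Multiply the integrand by \<open>e\<close> to the power \<open>-\<epsilon> |\<xi>|\<^sup>2\<close>. By the multiplication formula the result is
\<open>f\<close> averaged against a heat kernel centred at \<open>x\<close>. The average converges to \<open>f x\<close> as \<open>\<epsilon>\<close> tends to \<open>0\<close>, because
\<open>f\<close> is Lipschitz and the second moment of the kernel tends to \<open>0\<close>.\<close>

lemma fourier_inversion_integral:
 fixes f :: "'a::euclidean_space => complex"
 assumes f: "f \<in> schwartz"
 shows "(\<integral>\<xi>. iexp (x \<bullet> \<xi>) * fourier f \<xi> \<partial>lborel) = (2 * pi) ^ DIM('a) * f x"
proof -
 obtain L where L: "0 \<le> L" "\<And>x v. norm (f (x + v) - f x) \<le> L * norm v" using schwartz_lipschitz[OF f] by blast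
 define I where "I \<epsilon> = (\<integral>\<xi>. fourier f \<xi> * (iexp (\<xi> \<bullet> x) * gauss \<epsilon> \<xi>) \<partial>lborel)" for \<epsilon>
 have near: "norm (I \<epsilon> - (2 * pi) ^ DIM('a) * f x) \<le> (2 * pi) ^ DIM('a) * L * (1 + 2 * real DIM('a)) * sqrt \<epsilon>" if \<epsilon>: "0 < \<epsilon>" for \<epsilon>
 proof -
  have h: "heat_kernel \<epsilon> \<in> (schwartz :: ('a => complex) set)" using \<epsilon> by (rule schwartz_heat_kernel)
  have hx: "(\<lambda>y. heat_kernel \<epsilon> (y - x)) \<in> schwartz" using schwartz_shift_reflect[OF h, of 1 "-x"] by simp
  have m: "heat_kernel \<epsilon> \<in> borel_measurable (borel :: 'a measure)" using h by (rule schwartz_measurable)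
  have "I \<epsilon> = (\<integral>y. f y * fourier (\<lambda>\<xi>. iexp (\<xi> \<bullet> x) * gauss \<epsilon> \<xi>) y \<partial>lborel)"
   unfolding I_def by (intro fourier_mult_formula f schwartz_wave schwartz_gauss \<epsilon>)
  also have "... = (\<integral>y. (2 * pi) ^ DIM('a) * (f y * heat_kernel \<epsilon> (y - x)) \<partial>lborel)"
   unfolding fourier_modulate fourier_gauss_heat[OF \<epsilon>] by (simp add: mult.left_commute)
  also have "... = (2 * pi) ^ DIM('a) * (\<integral>y. f y * heat_kernel \<epsilon> (y - x) \<partial>lborel)" by simp
  also have "(\<integral>y. f y * heat_kernel \<epsilon> (y - x) \<partial>lborel) = (\<integral>v. f (x + v) * heat_kernel \<epsilon> v \<partial>lborel)"
   using integral_lborel_shift(1)[of "\<lambda>y. f y * heat_kernel \<epsilon> (y - x)" x] schwartz_measurable[OF f] m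
   by (simp add: add.commute)
  finally have I: "I \<epsilon> = (2 * pi) ^ DIM('a) * (\<integral>v. f (x + v) * heat_kernel \<epsilon> v \<partial>lborel)" .
  have fx: "(\<lambda>v. f (x + v)) \<in> schwartz" using schwartz_shift_reflect[OF f, of 1 x] by (simp add: add.commute)
  have i1: "integrable lborel (\<lambda>v. f (x + v) * heat_kernel \<epsilon> v)"
   by (rule schwartz_integrable[OF schwartz_mult[OF schwartz_subset_moderate[OF fx] h]])
  have i2: "integrable lborel (\<lambda>v::'a. f x * heat_kernel \<epsilon> v)" by (intro schwartz_integrable schwartz_cmult h)
  have "(\<integral>v. f (x + v) * heat_kernel \<epsilon> v \<partial>lborel) - f x = (\<integral>v. f (x + v) * heat_kernel \<epsilon> v \<partial>lborel) - (\<integral>(v::'a). f x * heat_kernel \<epsilon> v \<partial>lborel)"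
   using integral_heat_kernel[OF \<epsilon>, where 'a='a] by simp
  also have "... = (\<integral>v. (f (x + v) - f x) * heat_kernel \<epsilon> v \<partial>lborel)"
   by (subst Bochner_Integration.integral_diff[OF i1 i2, symmetric]) (simp add: algebra_simps)
  also have "norm ... \<le> L * (1 + 2 * real DIM('a)) * sqrt \<epsilon>"
  proof -
   define hr where "hr v = (4 * pi * \<epsilon>) powr (- real DIM('a) / 2) * exp (- (norm v)\<^sup>2 / (4 * \<epsilon>))" for v :: 'a
   have hr: "heat_kernel \<epsilon> v = of_real (hr v)" "0 \<le> hr v" for v
    unfolding hr_def heat_kernel_def by auto
   have ih: "integrable lborel hr"
   proof -
    have "integrable lborel (\<lambda>v::'a. complex_of_real (hr v))" using schwartz_integrable[OF h] hr(1) by (metis (mono_tags, lifting) Bochner_Integration.integrable_cong)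
    then show ?thesis by (simp add: complex_of_real_integrable_eq)
   qed
   have sq: "(\<lambda>v. of_real ((norm v)\<^sup>2) * heat_kernel \<epsilon> v) \<in> (schwartz :: ('a => complex) set)"
   proof -
    have "of_real ((norm z)\<^sup>2) * heat_kernel \<epsilon> z = (\<Sum>b\<in>Basis. of_real (z \<bullet> b) * (of_real (z \<bullet> b) * heat_kernel \<epsilon> z))" for z :: 'a
     unfolding power2_norm_eq_inner by (subst euclidean_inner) (simp add: sum_distrib_right mult.assoc)
    then show ?thesis by (auto intro!: schwartz_sum schwartz_coord h)
   qed
   have ih2: "integrable lborel (\<lambda>v. (norm v)\<^sup>2 * hr v)"
   proof -
    have "integrable lborel (\<lambda>v::'a. complex_of_real ((norm v)\<^sup>2 * hr v))" using schwartz_integrable[OF sq] by (simp add: hr)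
    then show ?thesis unfolding complex_of_real_integrable_eq .
   qed
   have v1: "(\<integral>v. hr v \<partial>lborel) = 1"
    using integral_heat_kernel[OF \<epsilon>, where 'a='a] unfolding hr integral_complex_of_real by simp
   have v2: "(\<integral>v. (norm v)\<^sup>2 * hr v \<partial>lborel) = 2 * real DIM('a) * \<epsilon>"
   proof -
    have "complex_of_real (\<integral>v. (norm v)\<^sup>2 * hr v \<partial>lborel) = of_real (2 * real DIM('a) * \<epsilon>)"
     using heat_kernel_second_moment[OF \<epsilon>, where 'a='a] unfolding hr of_real_mult[symmetric] integral_complex_of_real .
    then show ?thesis using of_real_eq_iff by blast
   qed
   have se: "0 < sqrt \<epsilon>" "sqrt \<epsilon> * sqrt \<epsilon> = \<epsilon>" using \<epsilon> by auto
   have "norm (\<integral>v. (f (x + v) - f x) * heat_kernel \<epsilon> v \<partial>lborel) \<le> (\<integral>v. L * (sqrt \<epsilon> * hr v + inverse (sqrt \<epsilon>) * ((norm v)\<^sup>2 * hr v)) \<partial>lborel)"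
   proof (rule order_trans[OF integral_norm_bound integral_mono])
    have "(\<lambda>v. f (x + v) * heat_kernel \<epsilon> v - f x * heat_kernel \<epsilon> v) = (\<lambda>v. (f (x + v) - f x) * heat_kernel \<epsilon> v)"
     by (simp add: algebra_simps)
    then show "integrable lborel (\<lambda>v. norm ((f (x + v) - f x) * heat_kernel \<epsilon> v))"
     using Bochner_Integration.integrable_diff[OF i1 i2] by simp
    show "integrable lborel (\<lambda>v. L * (sqrt \<epsilon> * hr v + inverse (sqrt \<epsilon>) * ((norm v)\<^sup>2 * hr v)))"
     by (intro integrable_mult_right Bochner_Integration.integrable_add ih ih2)
    fix v :: 'a
    have "norm v \<le> sqrt \<epsilon> + inverse (sqrt \<epsilon>) * (norm v)\<^sup>2"
    proof (cases "norm v \<le> sqrt \<epsilon>")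
     case True
     then show ?thesis using se by (simp add: add_increasing2)
    next
     case False
     then have "sqrt \<epsilon> * norm v \<le> norm v * norm v" by (intro mult_right_mono) auto
     then have "norm v \<le> inverse (sqrt \<epsilon>) * (norm v)\<^sup>2" using se by (simp add: field_simps power2_eq_square)
     then show ?thesis using se by linarith
    qed
    then have "L * norm v * hr v \<le> L * (sqrt \<epsilon> + inverse (sqrt \<epsilon>) * (norm v)\<^sup>2) * hr v"
     by (intro mult_right_mono mult_left_mono L hr)
    moreover have "norm ((f (x + v) - f x) * heat_kernel \<epsilon> v) \<le> L * norm v * hr v"
     unfolding norm_mult hr using hr(2)[of v] L(2)[of x v] by (auto intro: mult_right_mono)
    ultimately show "norm ((f (x + v) - f x) * heat_kernel \<epsilon> v) \<le> L * (sqrt \<epsilon> * hr v + inverse (sqrt \<epsilon>) * ((norm v)\<^sup>2 * hr v))"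
     by (simp add: algebra_simps)
   qed
   also have "... = L * (sqrt \<epsilon> * 1 + inverse (sqrt \<epsilon>) * (2 * real DIM('a) * \<epsilon>))"
    using ih ih2 by (simp add: v1 v2)
   also have "inverse (sqrt \<epsilon>) * (2 * real DIM('a) * \<epsilon>) = 2 * real DIM('a) * sqrt \<epsilon>"
    using se by (metis (no_types, lifting) left_inverse less_irrefl mult.assoc mult.commute mult.left_neutral)
   finally show ?thesis by (simp add: algebra_simps)
  qed
  finally have "norm ((\<integral>v. f (x + v) * heat_kernel \<epsilon> v \<partial>lborel) - f x) \<le> L * (1 + 2 * real DIM('a)) * sqrt \<epsilon>" .
  then have "(2 * pi) ^ DIM('a) * norm ((\<integral>v. f (x + v) * heat_kernel \<epsilon> v \<partial>lborel) - f x) \<le> (2 * pi) ^ DIM('a) * (L * (1 + 2 * real DIM('a)) * sqrt \<epsilon>)"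
   by (intro mult_left_mono) auto
  moreover have "I \<epsilon> - (2 * pi) ^ DIM('a) * f x = of_real ((2 * pi) ^ DIM('a)) * ((\<integral>v. f (x + v) * heat_kernel \<epsilon> v \<partial>lborel) - f x)"
   unfolding I by (simp add: algebra_simps)
  ultimately show ?thesis by (simp add: norm_mult norm_power mult.assoc)
 qed
 define \<epsilon> where "\<epsilon> k = inverse (real (Suc k))" for k
 have e0: "\<epsilon> \<longlonglongrightarrow> 0" unfolding \<epsilon>_def by (rule LIMSEQ_inverse_real_of_nat)
 have ep: "0 < \<epsilon> k" for k by (simp add: \<epsilon>_def)
 have ff: "fourier f \<in> schwartz" using f by (rule schwartz_fourier)
 have "(\<lambda>k. I (\<epsilon> k)) \<longlonglongrightarrow> (2 * pi) ^ DIM('a) * f x"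
 proof (rule LIM_zero_cancel, rule Lim_null_comparison)
  show "\<forall>\<^sub>F k in sequentially. norm (I (\<epsilon> k) - (2 * pi) ^ DIM('a) * f x) \<le> (2 * pi) ^ DIM('a) * L * (1 + 2 * real DIM('a)) * sqrt (\<epsilon> k)"
   using near[OF ep] by simp
  show "(\<lambda>k. (2 * pi) ^ DIM('a) * L * (1 + 2 * real DIM('a)) * sqrt (\<epsilon> k)) \<longlonglongrightarrow> 0"
   using tendsto_mult_right_zero[OF tendsto_real_sqrt[OF e0, simplified]] .
 qed
 moreover have "(\<lambda>k. I (\<epsilon> k)) \<longlonglongrightarrow> (\<integral>\<xi>. fourier f \<xi> * (iexp (\<xi> \<bullet> x) * 1) \<partial>lborel)"
  unfolding I_def
 proof (rule integral_dominated_convergence[where w="\<lambda>\<xi>. norm (fourier f \<xi>)"])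
  have s: "(\<lambda>\<xi>. fourier f \<xi> * (iexp (\<xi> \<bullet> x) * gauss (\<epsilon> k) \<xi>)) \<in> schwartz" for k
   using schwartz_mult[OF schwartz_subset_moderate[OF ff] schwartz_wave[OF schwartz_gauss[OF ep]]] .
  show "(\<lambda>\<xi>. fourier f \<xi> * (iexp (\<xi> \<bullet> x) * gauss (\<epsilon> k) \<xi>)) \<in> borel_measurable lborel" for k
   using schwartz_measurable[OF s] by simp
  have "(\<lambda>\<xi>. fourier f \<xi> * (iexp (\<xi> \<bullet> x) * 1)) \<in> schwartz"
   using schwartz_wave[OF ff, of x] by (simp add: mult.commute)
  then show "(\<lambda>\<xi>. fourier f \<xi> * (iexp (\<xi> \<bullet> x) * 1)) \<in> borel_measurable lborel"
   using schwartz_measurable by auto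
  show "integrable lborel (\<lambda>\<xi>. norm (fourier f \<xi>))" using schwartz_integrable[OF ff] by simp
  have "(\<lambda>k. gauss (\<epsilon> k) \<xi>) \<longlonglongrightarrow> 1" for \<xi>
  proof -
   have "(\<lambda>k. complex_of_real (exp (- \<epsilon> k * (norm \<xi>)\<^sup>2))) \<longlonglongrightarrow> of_real (exp (- 0 * (norm \<xi>)\<^sup>2))"
    by (intro tendsto_intros e0)
   then show ?thesis by (simp add: gauss_def)
  qed
  then show "AE \<xi> in lborel. (\<lambda>k. fourier f \<xi> * (iexp (\<xi> \<bullet> x) * gauss (\<epsilon> k) \<xi>)) \<longlonglongrightarrow> fourier f \<xi> * (iexp (\<xi> \<bullet> x) * 1)"
   by (intro AE_I2 tendsto_intros)
  have "norm (gauss (\<epsilon> k) \<xi>) \<le> 1" for k and \<xi> :: 'a using ep[of k] by (simp add: gauss_def)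
  then show "AE \<xi> in lborel. norm (fourier f \<xi> * (iexp (\<xi> \<bullet> x) * gauss (\<epsilon> k) \<xi>)) \<le> norm (fourier f \<xi>)" for k
   by (intro AE_I2) (simp add: norm_mult mult_left_le)
 qed
 ultimately have "(\<integral>\<xi>. fourier f \<xi> * (iexp (\<xi> \<bullet> x) * 1) \<partial>lborel) = (2 * pi) ^ DIM('a) * f x"
  using LIMSEQ_unique by blast
 then show ?thesis by (simp add: mult.commute inner_commute)
qed

lemma inv_fourier_fourier: "f \<in> schwartz ==> inv_fourier (fourier f) = f"
 unfolding inv_fourier_def by (simp add: fourier_inversion_integral)

lemma inv_fourier_eq: "inv_fourier f (x::'a::euclidean_space) = fourier f (- x) / (2 * pi) ^ DIM('a)"
 unfolding inv_fourier_def fourier_def by (simp add: inner_commute)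

lemma schwartz_inv_fourier: "f \<in> schwartz ==> inv_fourier f \<in> schwartz"
proof -
 assume "f \<in> schwartz"
 then have "(\<lambda>x. fourier f ((-1) *\<^sub>R x + 0)) \<in> schwartz" by (intro schwartz_shift_reflect schwartz_fourier) auto
 then have "(\<lambda>x. inverse ((2 * pi) ^ DIM('a)) * fourier f ((-1) *\<^sub>R x + 0)) \<in> schwartz" by (rule schwartz_cmult)
 moreover have "(\<lambda>x. inverse ((2 * pi) ^ DIM('a)) * fourier f ((-1) *\<^sub>R x + 0)) = inv_fourier f"
  by (rule ext) (simp add: inv_fourier_eq divide_inverse mult.commute)
 ultimately show ?thesis by simp
qed

lemma fourier_inv_fourier:
 assumes f: "f \<in> schwartz" shows "fourier (inv_fourier f) = f"
proof
 fix \<xi> :: 'a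
 have "fourier (inv_fourier f) \<xi> = (\<integral>x. exp (- \<i> * of_real (x \<bullet> \<xi>)) * fourier f (- x) \<partial>lborel) / (2 * pi) ^ DIM('a)"
  unfolding fourier_def[of "inv_fourier f"] inv_fourier_eq by simp
 also have "(\<integral>x. exp (- \<i> * of_real (x \<bullet> \<xi>)) * fourier f (- x) \<partial>lborel) = (\<integral>x. iexp (\<xi> \<bullet> x) * fourier f x \<partial>lborel)"
  using integral_lborel_reflect[OF schwartz_measurable[OF schwartz_wave[OF schwartz_fourier[OF f], of \<xi>]]]
  by (simp add: inner_commute)
 finally show "fourier (inv_fourier f) \<xi> = f \<xi>"
  by (simp add: fourier_inversion_integral[OF f])
qed

lemma integral_inv_fourier_fourier:
 assumes "F \<in> schwartz" "G \<in> schwartz"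
 shows "(\<integral>x. inv_fourier F x * fourier G x \<partial>lborel) = (\<integral>\<xi>. F \<xi> * G \<xi> \<partial>lborel)"
 using fourier_mult_formula[OF schwartz_inv_fourier[OF assms(1)] assms(2)]
 by (simp add: fourier_inv_fourier assms)

lemma fmult_distr_of:
 assumes m: "m \<in> moderate" and F: "F \<in> schwartz"
 shows "fmult m (distr_of (inv_fourier F)) = distr_of (inv_fourier (\<lambda>\<xi>. m \<xi> * F \<xi>))"
proof
 fix g :: "'a => complex"
 show "fmult m (distr_of (inv_fourier F)) g = distr_of (inv_fourier (\<lambda>\<xi>. m \<xi> * F \<xi>)) g"
 proof (cases "g \<in> schwartz")
  case True
  have G: "(\<lambda>\<xi>. m \<xi> * inv_fourier g \<xi>) \<in> schwartz" using m True by (intro schwartz_mult schwartz_inv_fourier)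
  have mF: "(\<lambda>\<xi>. m \<xi> * F \<xi>) \<in> schwartz" using m F by (rule schwartz_mult)
  have "fmult m (distr_of (inv_fourier F)) g = (\<integral>x. inv_fourier F x * fourier (\<lambda>\<xi>. m \<xi> * inv_fourier g \<xi>) x \<partial>lborel)"
   unfolding fmult_def distr_of_def using True schwartz_fourier[OF G] by simp
  also have "... = (\<integral>\<xi>. (m \<xi> * F \<xi>) * inv_fourier g \<xi> \<partial>lborel)"
   by (subst integral_inv_fourier_fourier[OF F G]) (simp add: mult_ac)
  also have "... = (\<integral>x. inv_fourier (\<lambda>\<xi>. m \<xi> * F \<xi>) x * fourier (inv_fourier g) x \<partial>lborel)"
   by (rule integral_inv_fourier_fourier[OF mF schwartz_inv_fourier[OF True], symmetric])
  also have "... = distr_of (inv_fourier (\<lambda>\<xi>. m \<xi> * F \<xi>)) g"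
   unfolding distr_of_def using True by (simp add: fourier_inv_fourier)
  finally show ?thesis .
 qed (simp add: fmult_def distr_of_def)
qed

section \<open>Tempered distributions and convolution\<close>

lemma schwartz_seminorm_le:
 assumes "\<And>x vs. set vs \<subseteq> Basis ==> length vs \<le> N ==> (1 + norm x) ^ N * norm (pderivs vs f x) \<le> e"
 shows "schwartz_seminorm N f \<le> e"
 unfolding schwartz_seminorm_def
proof (rule cSUP_least)
 have "(0, []) \<in> UNIV \<times> {vs. set vs \<subseteq> Basis \<and> length vs \<le> N}" by simp
 then show "UNIV \<times> {vs. set vs \<subseteq> (Basis :: 'a set) \<and> length vs \<le> N} \<noteq> ({} :: ('a \<times> _) set)" by blast
qed (use assms in auto)

lemma schwartz_seminorm_nonneg:
 fixes f :: "'a::euclidean_space => complex"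
 assumes f: "f \<in> schwartz" shows "0 \<le> schwartz_seminorm N f"
proof -
 have "\<exists>C. \<forall>x. (1 + norm x) ^ N * norm (pderivs vs f x) \<le> C" for vs
  using schwartz_bound[OF schwartz_pderivs[OF f]] by metis
 then obtain C where C: "\<And>vs x. (1 + norm x) ^ N * norm (pderivs vs f x) \<le> C vs" by metis
 have C0: "0 \<le> C vs" for vs by (rule order_trans[OF _ C[of 0]]) simp
 define A where "A = {vs. set vs \<subseteq> (Basis :: 'a set) \<and> length vs \<le> N}"
 have A: "finite A" unfolding A_def by (rule finite_lists_length_le) simp
 have "bdd_above ((\<lambda>(x, vs). (1 + norm x) ^ N * norm (pderivs vs f x)) ` (UNIV \<times> A))"
 proof (rule bdd_aboveI)
  fix t assume "t \<in> (\<lambda>(x, vs). (1 + norm x) ^ N * norm (pderivs vs f x)) ` (UNIV \<times> A)"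
  then obtain x vs where t: "t = (1 + norm x) ^ N * norm (pderivs vs f x)" "vs \<in> A" by auto
  have "t \<le> C vs" unfolding t by (rule C)
  also have "C vs \<le> sum C A" using A C0 t(2) by (intro member_le_sum) auto
  finally show "t \<le> sum C A" .
 qed
 then have "(\<lambda>(x, vs). (1 + norm x) ^ N * norm (pderivs vs f x)) (0, []) \<le> schwartz_seminorm N f"
  unfolding schwartz_seminorm_def A_def by (intro cSUP_upper) auto
 then show ?thesis by (simp add: order_trans[OF norm_ge_zero])
qed

lemma tempered_bound:
 assumes "u \<in> tempered"
 obtains C N where "0 \<le> C" "\<And>f. f \<in> schwartz ==> norm (u f) \<le> C * schwartz_seminorm N f"
proof -
 obtain C N where C: "\<And>f. f \<in> schwartz ==> norm (u f) \<le> C * schwartz_seminorm N f"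
  using assms unfolding tempered_def by blast
 have "norm (u f) \<le> max C 0 * schwartz_seminorm N f" if f: "f \<in> schwartz" for f
  by (rule order_trans[OF C[OF f] mult_right_mono[OF _ schwartz_seminorm_nonneg[OF f]]]) simp
 then show ?thesis using that by (meson max.cobounded2)
qed

lemma tempered_linear:
 assumes "u \<in> tempered" "f \<in> schwartz" "g \<in> schwartz"
 shows "u (\<lambda>x. c * f x + d * g x) = c * u f + d * u g"
 using assms unfolding tempered_def by blast

lemma tempered_cmult: "u \<in> tempered ==> f \<in> schwartz ==> u (\<lambda>x. c * f x) = c * u f"
 using tempered_linear[of u f f c 0] by simp

lemma tempered_add: "u \<in> tempered ==> f \<in> schwartz ==> g \<in> schwartz ==> u (\<lambda>x. f x + g x) = u f + u g"
 using tempered_linear[of u f g 1 1] by simp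

lemma tempered_diff: "u \<in> tempered ==> f \<in> schwartz ==> g \<in> schwartz ==> u (\<lambda>x. f x - g x) = u f - u g"
 using tempered_linear[of u f g 1 "-1"] by simp

lemma tempered_sum:
 assumes "u \<in> tempered" "finite A" "\<And>i. i \<in> A ==> f i \<in> schwartz"
 shows "u (\<lambda>x. \<Sum>i\<in>A. f i x) = (\<Sum>i\<in>A. u (f i))"
 using assms(2,3)
proof (induction A rule: finite_induct)
 case empty
 then show ?case using tempered_cmult[OF assms(1) schwartz_zero, of 0] by simp
next
 case (insert i A)
 then show ?case by (simp add: tempered_add[OF assms(1)] schwartz_sum)
qed

definition lipschitz_decay :: "real => ('a::euclidean_space => complex) => bool"
 where "lipschitz_decay C h \<longleftrightarrow> 0 \<le> C \<and> h \<in> borel_measurable borel \<and>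
  (\<forall>x. norm (h x) \<le> C * (1 / (1 + norm x) ^ (2 * DIM('a) + 1))) \<and>
  (\<forall>x d. norm d \<le> 1 --> norm (h (x + d) - h x) \<le> C * norm d * (1 / (1 + norm x) ^ (2 * DIM('a) + 1)))"

text \<open>The nodes and weights depend on the accuracy only, not on the function. One Riemann sum can
therefore be used for a whole family of integrands at once.\<close>

lemma quadrature:
 fixes \<epsilon> :: real
 assumes \<epsilon>: "0 < \<epsilon>"
 obtains S :: "'a::euclidean_space set" and v :: "'a => real" where "finite S"
  "\<And>(h :: 'a => complex) C. lipschitz_decay C h ==> norm ((\<Sum>c\<in>S. of_real (v c) * h c) - (\<integral>x. h x \<partial>lborel)) \<le> C * \<epsilon>"
proof -
 define w where "w x = 1 / (1 + norm x) ^ (2 * DIM('a))" for x :: 'a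
 define W where "W = (\<integral>x. w x \<partial>lborel)"
 have wi: "integrable lborel w" unfolding w_def by (rule integrable_decay)
 have w0: "0 \<le> w x" for x by (simp add: w_def)
 have W0: "0 \<le> W" unfolding W_def by (rule Bochner_Integration.integral_nonneg) (simp add: w0)
 define n where "n = real DIM('a)"
 have n1: "1 \<le> n" unfolding n_def using DIM_positive[where 'a='a] by linarith
 define r where "r = 2 * W / \<epsilon>"
 have r: "0 \<le> r" "W / (1 + r) \<le> \<epsilon> / 2"
 proof -
  show "0 \<le> r" using W0 \<epsilon> by (simp add: r_def)
  have "W = \<epsilon> / 2 * r" using \<epsilon> by (simp add: r_def)
  also have "... \<le> \<epsilon> / 2 * (1 + r)" using \<epsilon> by simp
  finally show "W / (1 + r) \<le> \<epsilon> / 2" using \<open>0 \<le> r\<close> by (simp add: divide_le_eq)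
 qed
 define \<delta> where "\<delta> = min (1 / n) (\<epsilon> / (2 * n * (1 + W)))"
 have \<delta>: "0 < \<delta>" "n * \<delta> \<le> 1" "n * \<delta> * W \<le> \<epsilon> / 2"
 proof -
  show "0 < \<delta>" unfolding \<delta>_def using \<epsilon> W0 n1 by auto
  have "n * \<delta> \<le> n * (1 / n)" unfolding \<delta>_def using n1 by (intro mult_left_mono) auto
  then show "n * \<delta> \<le> 1" using n1 by simp
  have "n * \<delta> * W \<le> n * (\<epsilon> / (2 * n * (1 + W))) * (1 + W)"
   unfolding \<delta>_def using n1 W0 \<epsilon> by (intro mult_mono mult_left_mono) auto
  also have "... = \<epsilon> / 2"
  proof -
   have "n * (\<epsilon> / (2 * n * q)) * q = \<epsilon> / 2" if "n \<noteq> 0" "q \<noteq> 0" for q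
    using that by simp
   from this[of "1 + W"] show ?thesis using n1 W0 by auto
  qed
  finally show "n * \<delta> * W \<le> \<epsilon> / 2" .
 qed
 have nd: "0 \<le> n * \<delta>" using \<delta>(1) n1 by simp
 define s where "s x = (\<Sum>b\<in>Basis. (\<delta> * of_int \<lfloor>(x \<bullet> b) / \<delta>\<rfloor>) *\<^sub>R b)" for x :: 'a
 have sm: "s \<in> borel_measurable borel" unfolding s_def by measurable
 have sx: "norm (s x - x) \<le> n * \<delta>" for x
 proof -
  have "norm (s x - x) \<le> (\<Sum>b\<in>Basis. \<bar>(s x - x) \<bullet> b\<bar>)" by (rule norm_le_l1)
  also have "... \<le> (\<Sum>b\<in>(Basis::'a set). \<delta>)"
  proof (rule sum_mono)
   fix b :: 'a assume b: "b \<in> Basis"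
   have "\<delta> * of_int \<lfloor>(x \<bullet> b) / \<delta>\<rfloor> \<le> \<delta> * ((x \<bullet> b) / \<delta>)"
    "\<delta> * ((x \<bullet> b) / \<delta>) \<le> \<delta> * (of_int \<lfloor>(x \<bullet> b) / \<delta>\<rfloor> + 1)"
    using \<delta>(1) by (intro mult_left_mono; linarith)+
   then have "\<delta> * of_int \<lfloor>(x \<bullet> b) / \<delta>\<rfloor> \<le> x \<bullet> b" "x \<bullet> b \<le> \<delta> * of_int \<lfloor>(x \<bullet> b) / \<delta>\<rfloor> + \<delta>"
    using \<delta>(1) by (simp_all add: distrib_left)
   then show "\<bar>(s x - x) \<bullet> b\<bar> \<le> \<delta>" using b by (simp add: s_def inner_diff_left)
  qed
  finally show ?thesis by (simp add: n_def)
 qed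
 define S where "S = s ` cball 0 r"
 define A where "A c = {x \<in> cball 0 r. s x = c}" for c
 define v where "v c = measure lborel (A c)" for c
 have finS: "finite S"
 proof -
  define M where "M = \<lceil>r / \<delta>\<rceil> + 1"
  have "S \<subseteq> (\<lambda>g. \<Sum>b\<in>Basis. (\<delta> * of_int (g b)) *\<^sub>R b) ` (Basis \<rightarrow>\<^sub>E {- M .. M})"
  proof
   fix y assume "y \<in> S"
   then obtain x where x: "norm x \<le> r" "y = s x" unfolding S_def by auto
   define g where "g = restrict (\<lambda>b. \<lfloor>(x \<bullet> b) / \<delta>\<rfloor>) Basis"
   have "g \<in> Basis \<rightarrow>\<^sub>E {- M .. M}"
   proof (rule PiE_I)
    fix b :: 'a assume b: "b \<in> Basis"
    have "\<bar>(x \<bullet> b) / \<delta>\<bar> \<le> r / \<delta>" using Basis_le_norm[OF b, of x] x \<delta>(1) by (simp add: divide_right_mono)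
    then have t: "- (r / \<delta>) \<le> (x \<bullet> b) / \<delta>" "(x \<bullet> b) / \<delta> \<le> r / \<delta>" by (simp_all only: abs_le_iff) auto
    have "- M \<le> \<lfloor>(x \<bullet> b) / \<delta>\<rfloor>" "\<lfloor>(x \<bullet> b) / \<delta>\<rfloor> \<le> M"
     using t le_of_int_ceiling[of "r / \<delta>"] unfolding le_floor_iff floor_le_iff M_def by simp_all linarith+
    then show "g b \<in> {- M .. M}" using b unfolding g_def by simp
   qed (auto simp: g_def)
   moreover have "y = (\<Sum>b\<in>Basis. (\<delta> * of_int (g b)) *\<^sub>R b)" unfolding x s_def g_def by (rule sum.cong) auto
   ultimately show "y \<in> (\<lambda>g. \<Sum>b\<in>Basis. (\<delta> * of_int (g b)) *\<^sub>R b) ` (Basis \<rightarrow>\<^sub>E {- M .. M})" by blast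
  qed
  then show ?thesis by (rule finite_subset) (intro finite_imageI finite_PiE; simp)
 qed
 have Am: "A c \<in> sets borel" for c
 proof -
  have "A c = cball 0 r \<inter> (s -` {c} \<inter> space borel)" unfolding A_def by auto
  then show ?thesis using measurable_sets[OF sm, of "{c}"] by simp
 qed
 have Afin: "emeasure lborel (A c) < \<infinity>" for c
 proof (rule le_less_trans)
  have "A c \<subseteq> cball 0 r" by (auto simp: A_def)
  then show "emeasure lborel (A c) \<le> emeasure lborel (cball (0::'a) r)" by (intro emeasure_mono) auto
  show "emeasure lborel (cball (0::'a) r) < \<infinity>" by (rule emeasure_bounded_finite) simp
 qed
 show ?thesis
 proof (rule that[OF finS])
  fix h :: "'a => complex" and C
  assume "lipschitz_decay C h"
  then have C: "0 \<le> C" and hm: "h \<in> borel_measurable borel"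
   and h1: "\<And>x. norm (h x) \<le> C * (1 / (1 + norm x) ^ (2 * DIM('a) + 1))"
   and h2: "\<And>x d. norm d \<le> 1 ==> norm (h (x + d) - h x) \<le> C * norm d * (1 / (1 + norm x) ^ (2 * DIM('a) + 1))"
   unfolding lipschitz_decay_def by blast+
  have w1: "1 / (1 + norm x) ^ (2 * DIM('a) + 1) = w x / (1 + norm x)" for x :: 'a
   unfolding w_def by simp
  have w2: "w x / (1 + norm x) \<le> w x" for x
  proof -
   have "w x / (1 + norm x) \<le> w x / 1" using w0[of x] by (intro divide_left_mono) (auto intro: add_pos_nonneg)
   then show ?thesis by simp
  qed
  have hi: "integrable lborel h"
  proof (rule integrable_decayI[OF hm, of C])
   show "norm (h x) \<le> C * (1 / (1 + norm x) ^ (2 * DIM('a)))" for x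
    using h1[of x] mult_left_mono[OF w2[of x] C] unfolding w1 by (simp add: w_def)
  qed
  have ind: "(\<Sum>c\<in>S. indicat_real (A c) x *\<^sub>R h c) = indicat_real (cball 0 r) x *\<^sub>R h (s x)" for x
  proof (cases "x \<in> cball 0 r")
   case True
   have "(\<Sum>c\<in>S. indicat_real (A c) x *\<^sub>R h c) = (\<Sum>c\<in>S. if c = s x then h c else 0)"
    using True by (intro sum.cong) (auto simp: A_def)
   also have "... = h (s x)" using finS True by (subst sum.delta) (auto simp: S_def)
   finally show ?thesis using True by simp
  next
   case False
   then have "indicat_real (A c) x = 0" for c unfolding A_def by auto
   then show ?thesis using False by simp
  qed
  have ii: "integrable lborel (\<lambda>x. indicat_real (A c) x *\<^sub>R h c)" for c
   using Am Afin by (intro integrable_scaleR_left integrable_real_indicator) auto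
  have "(\<Sum>c\<in>S. of_real (v c) * h c) = (\<Sum>c\<in>S. (\<integral>x. indicat_real (A c) x *\<^sub>R h c \<partial>lborel))"
   using Am by (simp add: v_def scaleR_conv_of_real)
  also have "... = (\<integral>x. (\<Sum>c\<in>S. indicat_real (A c) x *\<^sub>R h c) \<partial>lborel)"
   by (rule Bochner_Integration.integral_sum[symmetric]) (rule ii)
  also have "... - (\<integral>x. h x \<partial>lborel) = (\<integral>x. (\<Sum>c\<in>S. indicat_real (A c) x *\<^sub>R h c) - h x \<partial>lborel)"
   by (intro Bochner_Integration.integral_diff[symmetric] Bochner_Integration.integrable_sum ii hi)
  also have "norm ... \<le> (\<integral>x. C * (n * \<delta> + 1 / (1 + r)) * w x \<partial>lborel)"
  proof (rule order_trans[OF integral_norm_bound integral_mono])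
   show "integrable lborel (\<lambda>x. norm ((\<Sum>c\<in>S. indicat_real (A c) x *\<^sub>R h c) - h x))"
    by (intro integrable_norm Bochner_Integration.integrable_diff Bochner_Integration.integrable_sum ii hi)
   show "integrable lborel (\<lambda>x. C * (n * \<delta> + 1 / (1 + r)) * w x)" using wi by (rule integrable_mult_right)
   fix x :: 'a
   show "norm ((\<Sum>c\<in>S. indicat_real (A c) x *\<^sub>R h c) - h x) \<le> C * (n * \<delta> + 1 / (1 + r)) * w x"
   proof (cases "x \<in> cball 0 r")
    case True
    have "norm (h (x + (s x - x)) - h x) \<le> C * norm (s x - x) * (w x / (1 + norm x))"
     using h2[of "s x - x" x] sx[of x] \<delta>(2) unfolding w1 by linarith
    also have "... \<le> C * (n * \<delta>) * w x"
     using C sx[of x] w2[of x] w0[of x] nd by (intro mult_mono) auto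
    also have "... \<le> C * (n * \<delta> + 1 / (1 + r)) * w x"
     using C w0[of x] r(1) by (intro mult_right_mono mult_left_mono) auto
    finally show ?thesis using True unfolding ind by simp
   next
    case False
    have "norm (h x) \<le> C * (w x / (1 + norm x))" using h1[of x] unfolding w1 .
    also have "... \<le> C * (w x / (1 + r))"
     using False C w0[of x] r(1) by (intro mult_left_mono divide_left_mono mult_pos_pos) (auto intro: add_pos_nonneg)
    also have "... = C * (1 / (1 + r)) * w x" by simp
    also have "... \<le> C * (n * \<delta> + 1 / (1 + r)) * w x"
     using C w0[of x] nd by (intro mult_right_mono mult_left_mono) auto
    finally show ?thesis using False unfolding ind by simp
   qed
  qed
  also have "... = C * (n * \<delta> + 1 / (1 + r)) * W" by (simp add: W_def)
  also have "... = C * (n * \<delta> * W + W / (1 + r))" by (simp add: algebra_simps)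
  also have "... \<le> C * (\<epsilon> / 2 + \<epsilon> / 2)" by (intro mult_left_mono add_mono \<delta> r C)
  finally show "norm ((\<Sum>c\<in>S. of_real (v c) * h c) - (\<integral>x. h x \<partial>lborel)) \<le> C * \<epsilon>" by simp
 qed
qed

lemma shifted_product_bounds:
 fixes \<kappa> \<psi> :: "'a::euclidean_space => complex"
 assumes \<kappa>: "\<kappa> \<in> schwartz" and \<psi>: "\<psi> \<in> schwartz"
 obtains C where "0 \<le> C"
  "\<And>x y. (1 + norm y) ^ N * norm (\<psi> x * \<kappa> (y - x)) \<le> C * (1 / (1 + norm x) ^ M)"
  "\<And>x y d. norm d \<le> 1 ==> (1 + norm y) ^ N * norm (\<psi> (x + d) * \<kappa> (y - (x + d)) - \<psi> x * \<kappa> (y - x))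
    \<le> C * norm d * (1 / (1 + norm x) ^ M)"
proof -
 obtain C1 where C1: "0 \<le> C1" "\<And>x. (1 + norm x) ^ N * norm (\<kappa> x) \<le> C1" using schwartz_bound[OF \<kappa>] by blast
 obtain C2 where C2: "0 \<le> C2" "\<And>x. (1 + norm x) ^ (N + M) * norm (\<psi> x) \<le> C2" using schwartz_bound[OF \<psi>] by blast
 obtain L1 where L1: "0 \<le> L1" "\<And>x v. norm v \<le> 1 ==> (1 + norm x) ^ N * norm (\<kappa> (x + v) - \<kappa> x) \<le> L1 * norm v"
  using schwartz_lipschitz_decay[OF \<kappa>] by blast
 obtain L2 where L2: "0 \<le> L2" "\<And>x v. norm v \<le> 1 ==> (1 + norm x) ^ (N + M) * norm (\<psi> (x + v) - \<psi> x) \<le> L2 * norm v"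
  using schwartz_lipschitz_decay[OF \<psi>] by blast
 have key: "(1 + norm y) ^ N * (a * b) \<le> (A * B) * (1 / (1 + norm x) ^ M)"
  if "0 \<le> a" "0 \<le> b" "(1 + norm x) ^ (N + M) * a \<le> A" "(1 + norm (y - x)) ^ N * b \<le> B" for x y :: 'a and a b A B :: real
 proof -
  have p: "0 < (1 + norm x) ^ M" by (simp add: add_pos_nonneg)
  have "norm y \<le> norm x + norm (y - x)" by (metis add.commute diff_add_cancel norm_triangle_ineq)
  then have "1 + norm y \<le> (1 + norm x) * (1 + norm (y - x))" by (rule one_plus_le_mult) auto
  then have "(1 + norm y) ^ N \<le> (1 + norm x) ^ N * (1 + norm (y - x)) ^ N"
   by (metis power_mono power_mult_distrib add_nonneg_nonneg norm_ge_zero zero_le_one)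
  then have "(1 + norm y) ^ N * (a * b) \<le> (1 + norm x) ^ N * (1 + norm (y - x)) ^ N * (a * b)"
   using that by (intro mult_right_mono) auto
  also have "... = ((1 + norm x) ^ (N + M) * a) * ((1 + norm (y - x)) ^ N * b) * (1 / (1 + norm x) ^ M)"
  proof -
   have "Q * R * (a * b) = (Q * P * a) * (R * b) * (1 / P)" if "P \<noteq> 0" for P Q R :: real
    using that by simp
   from this[of "(1 + norm x) ^ M"] show ?thesis unfolding power_add using p by (metis less_irrefl)
  qed
  also have "... \<le> (A * B) * (1 / (1 + norm x) ^ M)"
  proof (intro mult_right_mono mult_mono that)
   show "0 \<le> A" by (rule order_trans[OF _ that(3)]) (use that in simp)
  qed (use that p in auto)
  finally show ?thesis .
 qed
 show ?thesis
 proof (rule that[of "C2 * C1 + (L2 * C1 + (C2 + L2) * L1)"])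
  show "0 \<le> C2 * C1 + (L2 * C1 + (C2 + L2) * L1)" using C1 C2 L1 L2 by simp
  fix x y :: 'a
  have p: "0 \<le> 1 / (1 + norm x) ^ M" by simp
  have "(1 + norm y) ^ N * (norm (\<psi> x) * norm (\<kappa> (y - x))) \<le> (C2 * C1) * (1 / (1 + norm x) ^ M)"
   by (rule key) (auto intro: C1 C2)
  also have "... \<le> (C2 * C1 + (L2 * C1 + (C2 + L2) * L1)) * (1 / (1 + norm x) ^ M)"
   using C1 C2 L1 L2 by (intro mult_right_mono p) auto
  finally show "(1 + norm y) ^ N * norm (\<psi> x * \<kappa> (y - x)) \<le> (C2 * C1 + (L2 * C1 + (C2 + L2) * L1)) * (1 / (1 + norm x) ^ M)"
   by (simp add: norm_mult)
  fix d :: 'a assume d: "norm d \<le> 1"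
  have "\<psi> (x + d) * \<kappa> (y - (x + d)) - \<psi> x * \<kappa> (y - x)
   = (\<psi> (x + d) - \<psi> x) * \<kappa> (y - x) + \<psi> (x + d) * (\<kappa> ((y - x) + (- d)) - \<kappa> (y - x))"
   by (simp add: algebra_simps)
  then have "(1 + norm y) ^ N * norm (\<psi> (x + d) * \<kappa> (y - (x + d)) - \<psi> x * \<kappa> (y - x))
   \<le> (1 + norm y) ^ N * (norm (\<psi> (x + d) - \<psi> x) * norm (\<kappa> (y - x)) + norm (\<psi> (x + d)) * norm (\<kappa> ((y - x) + (- d)) - \<kappa> (y - x)))"
   by (intro mult_left_mono) (auto simp: norm_mult[symmetric] intro: norm_triangle_ineq)
  also have "... \<le> ((L2 * norm d) * C1) * (1 / (1 + norm x) ^ M) + ((C2 + L2) * (L1 * norm d)) * (1 / (1 + norm x) ^ M)"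
   unfolding distrib_left
  proof (intro add_mono key)
   show "(1 + norm (y - x)) ^ N * norm (\<kappa> ((y - x) + (- d)) - \<kappa> (y - x)) \<le> L1 * norm d"
    using L1(2)[of "- d" "y - x"] d by simp
   have "(1 + norm x) ^ (N + M) * norm (\<psi> (x + d)) \<le> (1 + norm x) ^ (N + M) * (norm (\<psi> x) + norm (\<psi> (x + d) - \<psi> x))"
    by (intro mult_left_mono) (auto simp: norm_triangle_sub)
   also have "... \<le> C2 + L2 * norm d" unfolding distrib_left by (intro add_mono C2 L2 d)
   also have "... \<le> C2 + L2" using L2(1) d by (simp add: mult_left_le)
   finally show "(1 + norm x) ^ (N + M) * norm (\<psi> (x + d)) \<le> C2 + L2" .
  qed (auto intro: C1 L2 d)
  also have "... = (L2 * C1 + (C2 + L2) * L1) * norm d * (1 / (1 + norm x) ^ M)" by (simp add: algebra_simps)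
  also have "... \<le> (C2 * C1 + (L2 * C1 + (C2 + L2) * L1)) * norm d * (1 / (1 + norm x) ^ M)"
   using C1 C2 by (intro mult_right_mono p) auto
  finally show "(1 + norm y) ^ N * norm (\<psi> (x + d) * \<kappa> (y - (x + d)) - \<psi> x * \<kappa> (y - x))
    \<le> (C2 * C1 + (L2 * C1 + (C2 + L2) * L1)) * norm d * (1 / (1 + norm x) ^ M)" .
 qed
qed

lemma schwartz_translate: "f \<in> schwartz ==> (\<lambda>y. f (y - x)) \<in> schwartz"
 using schwartz_shift_reflect[of f 1 "- x"] by simp

lemma pderivs_translate:
 assumes "smooth f" shows "pderivs vs (\<lambda>y. c * f (y - x)) = (\<lambda>y. c * pderivs vs f (y - x) :: complex)"
proof -
 have s: "smooth (\<lambda>y. c * f y)" using assms by (intro smooth_mult) auto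
 have "pderivs vs (\<lambda>y. c * f (y - x)) = (\<lambda>y. pderivs (map (\<lambda>v. v) vs) (\<lambda>y. c * f y) (y + (- x)))"
  using pderivs_affine[OF linear_id[unfolded id_def] s, of vs "- x"] by simp
 also have "... = (\<lambda>y. c * pderivs vs f (y - x))"
  using pderivs_linear_image[OF bounded_linear_mult_right assms, of vs c] by simp
 finally show ?thesis .
qed

lemma pderivs_fourier_mult:
 assumes "K \<in> schwartz"
 shows "\<exists>K'\<in>schwartz. \<forall>\<Theta>\<in>moderate. pderivs vs (fourier (\<lambda>\<eta>. K \<eta> * \<Theta> \<eta>)) = fourier (\<lambda>\<eta>. K' \<eta> * \<Theta> \<eta>)"
proof (induction vs)
 case (Cons v vs)
 then obtain K' where K': "K' \<in> schwartz"
  "\<And>\<Theta>. \<Theta> \<in> moderate ==> pderivs vs (fourier (\<lambda>\<eta>. K \<eta> * \<Theta> \<eta>)) = fourier (\<lambda>\<eta>. K' \<eta> * \<Theta> \<eta>)" by blast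
 have "(\<lambda>\<eta>. - \<i> * (of_real (\<eta> \<bullet> v) * K' \<eta>)) \<in> schwartz" by (intro schwartz_cmult schwartz_coord K')
 moreover have "pderivs (v # vs) (fourier (\<lambda>\<eta>. K \<eta> * \<Theta> \<eta>)) = fourier (\<lambda>\<eta>. - \<i> * (of_real (\<eta> \<bullet> v) * K' \<eta>) * \<Theta> \<eta>)"
  if T: "\<Theta> \<in> moderate" for \<Theta>
 proof -
  have "(\<lambda>\<eta>. \<Theta> \<eta> * K' \<eta>) \<in> schwartz" using T K'(1) by (rule schwartz_mult)
  then have "(\<lambda>\<eta>. K' \<eta> * \<Theta> \<eta>) \<in> schwartz" by (simp add: mult.commute)
  from pderiv_dir_fourier[OF this] show ?thesis
   by (simp add: pderivs_Cons K'(2)[OF T] mult.assoc)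
 qed
 ultimately show ?case
  by (intro bexI[of _ "\<lambda>\<eta>. - \<i> * (of_real (\<eta> \<bullet> v) * K' \<eta>)"] ballI)
qed (use assms in auto)

context
 fixes u :: "'a::euclidean_space distribution" and K :: "'a => complex"
 assumes u: "u \<in> tempered" and K: "K \<in> schwartz"
begin

lemma tempered_shift_bounds:
 assumes \<psi>: "\<psi> \<in> schwartz"
 obtains C where "0 \<le> C"
  "\<And>x. norm (\<psi> x * u (\<lambda>y. fourier K (y - x))) \<le> C * (1 / (1 + norm x) ^ M)"
  "\<And>x d. norm d \<le> 1 ==> norm (\<psi> (x + d) * u (\<lambda>y. fourier K (y - (x + d))) - \<psi> x * u (\<lambda>y. fourier K (y - x)))
    \<le> C * norm d * (1 / (1 + norm x) ^ M)"
proof -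
 let ?\<kappa> = "fourier K"
 have \<kappa>: "?\<kappa> \<in> schwartz" using K by (rule schwartz_fourier)
 have \<kappa>x: "(\<lambda>y. ?\<kappa> (y - x)) \<in> schwartz" for x using \<kappa> by (rule schwartz_translate)
 obtain C0 N where C0: "0 \<le> C0" "\<And>f. f \<in> schwartz ==> norm (u f) \<le> C0 * schwartz_seminorm N f"
  using tempered_bound[OF u] by blast
 define P where "P vs C \<longleftrightarrow> 0 \<le> C \<and>
   (\<forall>x y. (1 + norm y) ^ N * norm (\<psi> x * pderivs vs ?\<kappa> (y - x)) \<le> C * (1 / (1 + norm x) ^ M)) \<and>
   (\<forall>x y d. norm d \<le> 1 --> (1 + norm y) ^ N * norm (\<psi> (x + d) * pderivs vs ?\<kappa> (y - (x + d)) - \<psi> x * pderivs vs ?\<kappa> (y - x))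
    \<le> C * norm d * (1 / (1 + norm x) ^ M))" for vs C
 have "\<exists>C. P vs C" for vs
  using shifted_product_bounds[OF schwartz_pderivs[OF \<kappa>, of vs] \<psi>, of N M] unfolding P_def by metis
 then obtain B where B: "\<And>vs. P vs (B vs)" by metis
 define A where "A = {vs. set vs \<subseteq> (Basis :: 'a set) \<and> length vs \<le> N}"
 have A: "finite A" unfolding A_def by (rule finite_lists_length_le) simp
 define C where "C = sum B A"
 have BC: "B vs \<le> C" if "vs \<in> A" for vs
  unfolding C_def using B that by (intro member_le_sum A) (auto simp: P_def)
 have C: "0 \<le> C" unfolding C_def using B by (intro sum_nonneg) (auto simp: P_def)
 have ps: "pderivs vs (\<lambda>y. c * ?\<kappa> (y - x)) = (\<lambda>y. c * pderivs vs ?\<kappa> (y - x))" for vs c x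
  using \<kappa> by (intro pderivs_translate schwartz_smooth)
 have 1: "norm (\<psi> x * u (\<lambda>y. ?\<kappa> (y - x))) \<le> (C0 * C) * (1 / (1 + norm x) ^ M)" for x
 proof -
  have eF: "\<psi> x * u (\<lambda>y. ?\<kappa> (y - x)) = u (\<lambda>y. \<psi> x * ?\<kappa> (y - x))"
   using tempered_cmult[OF u \<kappa>x] by simp
  have "norm (u (\<lambda>y. \<psi> x * ?\<kappa> (y - x))) \<le> C0 * schwartz_seminorm N (\<lambda>y. \<psi> x * ?\<kappa> (y - x))"
   by (intro C0 schwartz_cmult \<kappa>x)
  also have "... \<le> C0 * (C * (1 / (1 + norm x) ^ M))"
  proof (intro mult_left_mono C0 schwartz_seminorm_le)
   fix y :: 'a and vs :: "'a list" assume vs: "set vs \<subseteq> Basis" "length vs \<le> N"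
   have "(1 + norm y) ^ N * norm (\<psi> x * pderivs vs ?\<kappa> (y - x)) \<le> B vs * (1 / (1 + norm x) ^ M)"
    using B[of vs] unfolding P_def by blast
   also have "... \<le> C * (1 / (1 + norm x) ^ M)" using vs by (intro mult_right_mono BC) (auto simp: A_def)
   finally show "(1 + norm y) ^ N * norm (pderivs vs (\<lambda>y. \<psi> x * ?\<kappa> (y - x)) y) \<le> C * (1 / (1 + norm x) ^ M)"
    unfolding ps .
  qed
  finally show ?thesis unfolding eF by (simp add: mult.assoc)
 qed
 have 2: "norm (\<psi> (x + d) * u (\<lambda>y. ?\<kappa> (y - (x + d))) - \<psi> x * u (\<lambda>y. ?\<kappa> (y - x)))
    \<le> (C0 * C) * norm d * (1 / (1 + norm x) ^ M)" if d: "norm d \<le> 1" for x d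
 proof -
  define c where "c = - \<psi> x"
  let ?F = "\<lambda>y. \<psi> (x + d) * ?\<kappa> (y - (x + d)) + c * ?\<kappa> (y - x)"
  have eF: "\<psi> (x + d) * u (\<lambda>y. ?\<kappa> (y - (x + d))) - \<psi> x * u (\<lambda>y. ?\<kappa> (y - x)) = u ?F"
   using tempered_linear[OF u \<kappa>x \<kappa>x, of "\<psi> (x + d)" "x + d" c x] by (simp add: c_def)
  have "norm (u ?F) \<le> C0 * schwartz_seminorm N ?F"
   by (intro C0 schwartz_add schwartz_cmult \<kappa>x)
  also have "... \<le> C0 * (C * norm d * (1 / (1 + norm x) ^ M))"
  proof (intro mult_left_mono C0 schwartz_seminorm_le)
   fix y :: 'a and vs :: "'a list" assume vs: "set vs \<subseteq> Basis" "length vs \<le> N"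
   have e: "pderivs vs ?F y = \<psi> (x + d) * pderivs vs ?\<kappa> (y - (x + d)) - \<psi> x * pderivs vs ?\<kappa> (y - x)"
   proof -
    have "smooth (\<lambda>y. \<psi> (x + d) * ?\<kappa> (y - (x + d)))" "smooth (\<lambda>y. c * ?\<kappa> (y - x))"
     by (intro schwartz_smooth schwartz_cmult \<kappa>x)+
    from pderivs_add[OF this, of vs] show ?thesis unfolding ps by (simp add: c_def)
   qed
   have "(1 + norm y) ^ N * norm (\<psi> (x + d) * pderivs vs ?\<kappa> (y - (x + d)) - \<psi> x * pderivs vs ?\<kappa> (y - x)) \<le> B vs * norm d * (1 / (1 + norm x) ^ M)"
    using B[of vs] d unfolding P_def by blast
   also have "... \<le> C * norm d * (1 / (1 + norm x) ^ M)" using vs by (intro mult_right_mono BC) (auto simp: A_def)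
   finally show "(1 + norm y) ^ N * norm (pderivs vs ?F y) \<le> C * norm d * (1 / (1 + norm x) ^ M)"
    unfolding e .
  qed
  finally show ?thesis unfolding eF by (simp add: mult.assoc)
 qed
 show ?thesis by (rule that[of "C0 * C"]) (use C0 C 1 2 in auto)
qed

lemma tempered_shift_product_continuous:
 assumes \<psi>: "\<psi> \<in> schwartz"
 shows "continuous_on UNIV (\<lambda>x. \<psi> x * u (\<lambda>y. fourier K (y - x)))"
proof -
 let ?h = "\<lambda>x. \<psi> x * u (\<lambda>y. fourier K (y - x))"
 obtain C where C: "0 \<le> C" "\<And>x d. norm d \<le> 1 ==> norm (?h (x + d) - ?h x) \<le> C * norm d * (1 / (1 + norm x) ^ 0)"
  using tempered_shift_bounds[OF \<psi>, of 0] by metis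
 have "isCont ?h x" for x
  unfolding isCont_iff
 proof (rule LIM_zero_cancel, rule Lim_null_comparison)
  show "\<forall>\<^sub>F d in at 0. norm (?h (x + d) - ?h x) \<le> C * norm d"
   using C(2)[of _ x] unfolding eventually_at by (intro exI[of _ 1]) auto
  show "((\<lambda>d. C * norm d) \<longlongrightarrow> 0) (at 0)" by (auto intro!: tendsto_eq_intros)
 qed
 then show ?thesis by (simp add: continuous_at_imp_continuous_on)
qed

lemma tempered_shift_measurable: "(\<lambda>x. u (\<lambda>y. fourier K (y - x))) \<in> borel_measurable borel"
proof -
 have g: "gauss 1 \<in> (schwartz :: ('a => complex) set)" by (rule schwartz_gauss) simp
 have "gauss 1 x \<noteq> 0" for x :: 'a by (simp add: gauss_def)
 then have "continuous_on UNIV (\<lambda>x. gauss 1 x * u (\<lambda>y. fourier K (y - x)) / gauss 1 x)"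
  by (intro continuous_on_divide tempered_shift_product_continuous g smooth_continuous schwartz_smooth) auto
 then have "continuous_on UNIV (\<lambda>x. u (\<lambda>y. fourier K (y - x)))" by (simp add: gauss_def)
 then show ?thesis by (rule borel_measurable_continuous_onI)
qed

lemma fourier_convolution:
 fixes \<psi> :: "'a => complex"
 assumes K: "K' \<in> schwartz" and \<psi>: "\<psi> \<in> schwartz"
 shows "fourier (\<lambda>\<eta>. K' \<eta> * ((2 * pi) ^ DIM('a) * inv_fourier \<psi> \<eta>)) y = (\<integral>x. \<psi> x * fourier K' (y - x) \<partial>lborel)"
proof -
 have c: "continuous_on UNIV (\<lambda>p::'a \<times> 'a. iexp (fst p \<bullet> snd p))" by (intro continuous_intros)
 have Ky: "(\<lambda>\<eta>. exp (- \<i> * of_real (\<eta> \<bullet> y)) * K' \<eta>) \<in> schwartz" using K by (rule schwartz_fourier_integrand)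
 have "(\<integral>\<eta>. (\<integral>x. iexp (x \<bullet> \<eta>) * \<psi> x \<partial>lborel) * (exp (- \<i> * of_real (\<eta> \<bullet> y)) * K' \<eta>) \<partial>lborel)
  = (\<integral>x. \<psi> x * (\<integral>\<eta>. iexp (x \<bullet> \<eta>) * (exp (- \<i> * of_real (\<eta> \<bullet> y)) * K' \<eta>) \<partial>lborel) \<partial>lborel)"
  by (rule fubini_kernel[OF \<psi> Ky c, of 1, simplified fst_conv snd_conv]) simp
 also have "... = (\<integral>x. \<psi> x * fourier K' (y - x) \<partial>lborel)"
 proof -
  have "(\<integral>\<eta>. iexp (x \<bullet> \<eta>) * (exp (- \<i> * of_real (\<eta> \<bullet> y)) * K' \<eta>) \<partial>lborel) = fourier K' (y - x)" for x
   using fourier_modulate[of x K' y] by (simp add: fourier_def inner_commute mult.left_commute)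
  then show ?thesis by presburger
 qed
 finally show ?thesis
  unfolding fourier_def[of _ y] inv_fourier_def by (simp add: inner_commute mult_ac)
qed

text \<open>A tempered distribution may be interchanged with the integral that defines a convolution. The
test function on the left is the integral of \<open>\<psi> x\<close> times the translate of \<open>fourier K\<close> by \<open>x\<close>. A quadrature rule replaces
the integrals on both sides by the same finite sum: for the right-hand side it is applied to the scalar
integrand, for the left-hand side to the integrals that represent the derivatives of the test function,
uniformly in \<open>y\<close> even after multiplication by powers of \<open>1 + |y|\<close>. The sums thus converge in the seminorm
that bounds \<open>u\<close>.\<close>

lemma tempered_convolution:
 assumes \<psi>: "\<psi> \<in> schwartz"
 shows "u (fourier (\<lambda>\<eta>. K \<eta> * ((2 * pi) ^ DIM('a) * inv_fourier \<psi> \<eta>))) = (\<integral>x. \<psi> x * u (\<lambda>y. fourier K (y - x)) \<partial>lborel)"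
  (is "u ?J = ?R")
proof -
 let ?\<kappa> = "fourier K" and ?\<Psi> = "\<lambda>\<eta>. (2 * pi) ^ DIM('a) * inv_fourier \<psi> \<eta>"
 have \<kappa>: "?\<kappa> \<in> schwartz" using K by (rule schwartz_fourier)
 have \<kappa>x: "(\<lambda>y. ?\<kappa> (y - x)) \<in> schwartz" for x using \<kappa> by (rule schwartz_translate)
 have \<Psi>S: "?\<Psi> \<in> schwartz" using schwartz_cmult[OF schwartz_inv_fourier[OF \<psi>], of "(2 * pi) ^ DIM('a)"] by simp
 have J: "?J \<in> schwartz"
  using schwartz_fourier[OF schwartz_mult[OF schwartz_subset_moderate[OF K] \<Psi>S]] .
 obtain C0 N where C0: "0 \<le> C0" "\<And>f. f \<in> schwartz ==> norm (u f) \<le> C0 * schwartz_seminorm N f"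
  using tempered_bound[OF u] by blast
 define M where "M = 2 * DIM('a) + 1"
 obtain C1 where C1: "0 \<le> C1"
  "\<And>x. norm (\<psi> x * u (\<lambda>y. ?\<kappa> (y - x))) \<le> C1 * (1 / (1 + norm x) ^ M)"
  "\<And>x d. norm d \<le> 1 ==> norm (\<psi> (x + d) * u (\<lambda>y. ?\<kappa> (y - (x + d))) - \<psi> x * u (\<lambda>y. ?\<kappa> (y - x)))
    \<le> C1 * norm d * (1 / (1 + norm x) ^ M)"
  using tempered_shift_bounds[OF \<psi>, of M] by blast
 have "\<exists>K'. K' \<in> schwartz \<and> (\<forall>\<Theta>\<in>moderate. pderivs vs (fourier (\<lambda>\<eta>. K \<eta> * \<Theta> \<eta>)) = fourier (\<lambda>\<eta>. K' \<eta> * \<Theta> \<eta>))" for vs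
  using pderivs_fourier_mult[OF K] by blast
 then obtain KK where KK: "\<And>vs. KK vs \<in> schwartz"
  "\<And>vs \<Theta>. \<Theta> \<in> moderate ==> pderivs vs (fourier (\<lambda>\<eta>. K \<eta> * \<Theta> \<eta>)) = fourier (\<lambda>\<eta>. KK vs \<eta> * \<Theta> \<eta>)" by metis
 define P where "P vs C \<longleftrightarrow> 0 \<le> C \<and>
   (\<forall>x y. (1 + norm y) ^ N * norm (\<psi> x * fourier (KK vs) (y - x)) \<le> C * (1 / (1 + norm x) ^ M)) \<and>
   (\<forall>x y d. norm d \<le> 1 --> (1 + norm y) ^ N * norm (\<psi> (x + d) * fourier (KK vs) (y - (x + d)) - \<psi> x * fourier (KK vs) (y - x))
    \<le> C * norm d * (1 / (1 + norm x) ^ M))" for vs C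
 have "\<exists>C. P vs C" for vs
  using shifted_product_bounds[OF schwartz_fourier[OF KK(1)[of vs]] \<psi>, of N M] unfolding P_def by metis
 then obtain B where B: "\<And>vs. P vs (B vs)" by metis
 define A where "A = {vs. set vs \<subseteq> (Basis :: 'a set) \<and> length vs \<le> N}"
 have A: "finite A" unfolding A_def by (rule finite_lists_length_le) simp
 define C where "C = sum B A"
 have BC: "B vs \<le> C" if "vs \<in> A" for vs
  unfolding C_def using B that by (intro member_le_sum A) (auto simp: P_def)
 have C: "0 \<le> C" unfolding C_def using B by (intro sum_nonneg) (auto simp: P_def)
 have main: "norm (u ?J - ?R) \<le> (C0 * C + C1) * \<epsilon>" if \<epsilon>: "0 < \<epsilon>" for \<epsilon>
 proof -
  obtain S :: "'a set" and v :: "'a => real" where S: "finite S" and quad: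
   "\<And>(h :: 'a => complex) C. lipschitz_decay C h ==> norm ((\<Sum>c\<in>S. of_real (v c) * h c) - (\<integral>x. h x \<partial>lborel)) \<le> C * \<epsilon>"
   using quadrature[where 'a='a, OF \<epsilon>] by blast
  define \<Sigma> where "\<Sigma> y = (\<Sum>c\<in>S. of_real (v c) * \<psi> c * ?\<kappa> (y - c))" for y
  have \<Sigma>S: "\<Sigma> \<in> schwartz" unfolding \<Sigma>_def by (intro schwartz_sum schwartz_cmult \<kappa>x S)
  have u\<Sigma>: "u \<Sigma> = (\<Sum>c\<in>S. of_real (v c) * (\<psi> c * u (\<lambda>y. ?\<kappa> (y - c))))"
  proof -
   have "u \<Sigma> = (\<Sum>c\<in>S. u (\<lambda>y. of_real (v c) * \<psi> c * ?\<kappa> (y - c)))"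
    unfolding \<Sigma>_def by (intro tempered_sum u S schwartz_cmult \<kappa>x)
   then show ?thesis unfolding tempered_cmult[OF u \<kappa>x] by (simp only: mult.assoc)
  qed
  have e1: "norm (u \<Sigma> - ?R) \<le> C1 * \<epsilon>"
   unfolding u\<Sigma>
  proof (rule quad)
   have "(\<lambda>x. \<psi> x * u (\<lambda>y. ?\<kappa> (y - x))) \<in> borel_measurable borel"
    by (intro borel_measurable_times tempered_shift_measurable schwartz_measurable[OF \<psi>])
   then show "lipschitz_decay C1 (\<lambda>x. \<psi> x * u (\<lambda>y. ?\<kappa> (y - x)))"
    using C1 unfolding lipschitz_decay_def M_def by blast
  qed
  define \<Theta> where "\<Theta> \<eta> = ?\<Psi> \<eta> + (-1) * (\<Sum>c\<in>S. of_real (v c) * \<psi> c * iexp (\<eta> \<bullet> c))" for \<eta>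
  have sm: "(\<lambda>\<eta>. \<Sum>c\<in>S. of_real (v c) * \<psi> c * iexp (\<eta> \<bullet> c)) \<in> moderate"
   using S by (induction S rule: finite_induct) (auto intro!: moderate_add moderate_mult moderate_wave)
  have \<Theta>: "\<Theta> \<in> moderate" unfolding \<Theta>_def
   by (intro moderate_add moderate_mult[OF moderate_const] sm schwartz_subset_moderate \<Psi>S)
  have val: "fourier (\<lambda>\<eta>. K' \<eta> * \<Theta> \<eta>) y = (\<integral>x. \<psi> x * fourier K' (y - x) \<partial>lborel) - (\<Sum>c\<in>S. of_real (v c) * (\<psi> c * fourier K' (y - c)))"
   if K': "K' \<in> schwartz" for K' y
  proof -
   have s1: "(\<lambda>\<eta>. K' \<eta> * ?\<Psi> \<eta>) \<in> schwartz" by (intro schwartz_mult schwartz_subset_moderate K' \<Psi>S)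
   have s2: "(\<lambda>\<eta>. iexp (\<eta> \<bullet> c) * K' \<eta>) \<in> schwartz" for c using K' by (rule schwartz_wave)
   have s3: "(\<lambda>\<eta>. \<Sum>c\<in>S. (of_real (v c) * \<psi> c) * (iexp (\<eta> \<bullet> c) * K' \<eta>)) \<in> schwartz"
    by (intro schwartz_sum schwartz_cmult s2 S)
   have fs: "fourier (\<lambda>\<eta>. \<Sum>c\<in>S. (of_real (v c) * \<psi> c) * (iexp (\<eta> \<bullet> c) * K' \<eta>)) y
    = (\<Sum>c\<in>S. (of_real (v c) * \<psi> c) * fourier K' (y - c))"
    using S
   proof (induction S rule: finite_induct)
    case empty
    then show ?case by (simp add: fourier_def)
   next
    case (insert c S)
    then show ?case
     by (simp add: fourier_add schwartz_cmult schwartz_sum s2 fourier_cmult fourier_modulate)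
   qed
   have "(\<lambda>\<eta>. K' \<eta> * \<Theta> \<eta>) = (\<lambda>\<eta>. K' \<eta> * ?\<Psi> \<eta> + (-1) * (\<Sum>c\<in>S. (of_real (v c) * \<psi> c) * (iexp (\<eta> \<bullet> c) * K' \<eta>)))"
    unfolding \<Theta>_def by (rule ext) (simp add: distrib_left right_diff_distrib sum_distrib_left mult_ac)
   then show ?thesis
    using fourier_add[OF s1 schwartz_cmult[OF s3, of "-1"], of y]
    unfolding fourier_cmult fs fourier_convolution[OF K' \<psi>] by (simp add: mult.assoc)
  qed
  have J\<Sigma>: "(\<lambda>y. ?J y - \<Sigma> y) = fourier (\<lambda>\<eta>. K \<eta> * \<Theta> \<eta>)"
   unfolding val[OF K] fourier_convolution[OF K \<psi>] \<Sigma>_def by (simp only: mult.assoc)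
  have "norm (u (\<lambda>y. ?J y - \<Sigma> y)) \<le> C0 * schwartz_seminorm N (\<lambda>y. ?J y - \<Sigma> y)"
   by (intro C0 schwartz_diff J \<Sigma>S)
  also have "... \<le> C0 * (C * \<epsilon>)"
  proof (intro mult_left_mono C0 schwartz_seminorm_le)
   fix y :: 'a and vs :: "'a list" assume vs: "set vs \<subseteq> Basis" "length vs \<le> N"
   let ?h = "\<lambda>x. of_real ((1 + norm y) ^ N) * (\<psi> x * fourier (KK vs) (y - x))"
   have nh: "norm (of_real ((1 + norm y) ^ N) * z) = (1 + norm y) ^ N * norm z" for z :: complex
    by (simp only: norm_mult norm_of_real) (simp add: abs_of_nonneg)
   have hm: "?h \<in> borel_measurable borel"
    using schwartz_measurable[OF \<psi>] schwartz_measurable[OF schwartz_fourier[OF KK(1)[of vs]]] by simp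
   have e: "pderivs vs (\<lambda>y. ?J y - \<Sigma> y) y = (\<integral>x. \<psi> x * fourier (KK vs) (y - x) \<partial>lborel) - (\<Sum>c\<in>S. of_real (v c) * (\<psi> c * fourier (KK vs) (y - c)))"
    unfolding J\<Sigma> KK(2)[OF \<Theta>] by (rule val[OF KK(1)])
   have "(1 + norm y) ^ N * norm (pderivs vs (\<lambda>y. ?J y - \<Sigma> y) y) = norm ((\<Sum>c\<in>S. of_real (v c) * ?h c) - (\<integral>x. ?h x \<partial>lborel))"
   proof -
    have "(\<Sum>c\<in>S. of_real (v c) * ?h c) - (\<integral>x. ?h x \<partial>lborel)
     = of_real ((1 + norm y) ^ N) * ((\<Sum>c\<in>S. of_real (v c) * (\<psi> c * fourier (KK vs) (y - c))) - (\<integral>x. \<psi> x * fourier (KK vs) (y - x) \<partial>lborel))"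
     unfolding right_diff_distrib integral_mult_right_zero by (simp add: sum_distrib_left mult_ac)
    then show ?thesis unfolding e nh[symmetric] by (simp add: norm_mult norm_minus_commute)
   qed
   also have "... \<le> B vs * \<epsilon>"
   proof (rule quad)
    have "norm (?h x) \<le> B vs * (1 / (1 + norm x) ^ M)" for x
     using B[of vs] unfolding nh P_def by blast
    moreover have "norm (?h (x + d) - ?h x) \<le> B vs * norm d * (1 / (1 + norm x) ^ M)" if "norm d \<le> 1" for x d
     using B[of vs] that unfolding right_diff_distrib[symmetric] nh P_def by blast
    moreover have "0 \<le> B vs" using B[of vs] unfolding P_def by blast
    ultimately show "lipschitz_decay (B vs) ?h" using hm unfolding lipschitz_decay_def M_def by blast
   qed
   also have "... \<le> C * \<epsilon>" using \<epsilon> vs by (intro mult_right_mono BC) (auto simp: A_def)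
   finally show "(1 + norm y) ^ N * norm (pderivs vs (\<lambda>y. ?J y - \<Sigma> y) y) \<le> C * \<epsilon>" .
  qed
  also have "u (\<lambda>y. ?J y - \<Sigma> y) = u ?J - u \<Sigma>" by (rule tempered_diff[OF u J \<Sigma>S])
  finally have e2: "norm (u ?J - u \<Sigma>) \<le> C0 * (C * \<epsilon>)" .
  have "norm (u ?J - ?R) \<le> norm (u ?J - u \<Sigma>) + norm (u \<Sigma> - ?R)"
   using dist_triangle[of "u ?J" ?R "u \<Sigma>"] unfolding dist_norm .
  also have "... \<le> C0 * (C * \<epsilon>) + C1 * \<epsilon>" using e1 e2 by linarith
  finally show ?thesis by (simp only: distrib_right mult.assoc)
 qed
 have "norm (u ?J - ?R) \<le> 0"
 proof (rule field_le_epsilon)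
  fix e :: real assume e: "0 < e"
  have p: "0 < C0 * C + C1 + 1" using C0 C C1 by (simp add: add_nonneg_pos)
  have "norm (u ?J - ?R) \<le> (C0 * C + C1) * (e / (C0 * C + C1 + 1))" by (rule main) (use e p in simp)
  also have "... \<le> e" using e p by (simp add: field_simps)
  finally show "norm (u ?J - ?R) \<le> 0 + e" by simp
 qed
 then show ?thesis by simp
qed

end

section \<open>Anisotropic dilations and spherical caps\<close>

lemma nn_integral_lborel_shift:
 fixes f :: "'a::euclidean_space => ennreal"
 assumes "f \<in> borel_measurable borel"
 shows "(\<integral>\<^sup>+x. f (x + c) \<partial>lborel) = (\<integral>\<^sup>+x. f x \<partial>lborel)"
proof -
 have "(\<lambda>x. x + c) = (+) c" by (auto simp: add.commute)
 then have d: "distr lborel borel (\<lambda>x. x + c) = (lborel :: 'a measure)"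
  using lborel_distr_plus[of c] by metis
 show ?thesis using nn_integral_distr[of "\<lambda>x. x + c" lborel borel f] assms by (simp add: d)
qed

lemma nn_integral_orthogonal:
 fixes Q :: "'a::euclidean_space => 'a" and f :: "'a => ennreal"
 assumes Q: "orthogonal_transformation Q" and f[measurable]: "f \<in> borel_measurable borel"
 shows "(\<integral>\<^sup>+x. f (Q x) \<partial>lborel) = (\<integral>\<^sup>+x. f x \<partial>lborel)"
proof -
 have lin: "linear Q" using Q orthogonal_transformation_linear by blast
 have Qm[measurable]: "Q \<in> borel_measurable borel"
  by (intro borel_measurable_continuous_onI linear_continuous_on linear_conv_bounded_linear[THEN iffD1] lin)
 have surj: "surj Q" using Q orthogonal_transformation_surj by blast
 have normQ: "norm (Q x) = norm x" for x using Q orthogonal_transformation_norm by blast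
 define g :: "'a => ennreal" where "g = indicator (ball 0 1)"
 have gm[measurable]: "g \<in> borel_measurable borel" unfolding g_def by (intro borel_measurable_indicator) simp
 have g: "g (- Q x) = g x" for x unfolding g_def by (simp add: normQ indicator_def)
 define V where "V = (\<integral>\<^sup>+x. g x \<partial>lborel)"
 have V: "V = emeasure lborel (ball (0::'a) 1)" unfolding V_def g_def by simp
 have "V \<noteq> 0" unfolding V
 proof -
  have "unit_ball_vol (real DIM('a)) \<noteq> 0" using unit_ball_vol_pos[of "real DIM('a)"] by (metis less_irrefl of_nat_0_le_iff)
  then show "emeasure lborel (ball (0::'a) 1) \<noteq> 0" by (simp add: emeasure_ball)
 qed
 have "V < \<infinity>" unfolding V by (rule emeasure_bounded_finite) simp
 have "(\<integral>\<^sup>+x. f (Q x) \<partial>lborel) * V = (\<integral>\<^sup>+x. f (Q x) * (\<integral>\<^sup>+y. g (y - Q x) \<partial>lborel) \<partial>lborel)"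
  unfolding V_def using nn_integral_lborel_shift[OF gm, of "- Q _"] by (simp add: nn_integral_multc)
 also have "... = (\<integral>\<^sup>+x. (\<integral>\<^sup>+y. f (Q x) * g (y - Q x) \<partial>lborel) \<partial>lborel)"
  by (simp add: nn_integral_cmult)
 also have "... = (\<integral>\<^sup>+y. (\<integral>\<^sup>+x. f (Q x) * g (y - Q x) \<partial>lborel) \<partial>lborel)"
  by (rule lborel_pair.Fubini'[symmetric]) measurable
 also have "... = (\<integral>\<^sup>+y. (\<integral>\<^sup>+x. f (Q x + y) * g x \<partial>lborel) \<partial>lborel)"
 proof (rule nn_integral_cong)
  fix y
  obtain z where z: "Q z = y" using surj by (metis surjD)
  have "(\<integral>\<^sup>+x. f (Q x) * g (y - Q x) \<partial>lborel) = (\<integral>\<^sup>+x. f (Q (x + z)) * g (y - Q (x + z)) \<partial>lborel)"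
   by (rule nn_integral_lborel_shift[symmetric]) measurable
  then show "(\<integral>\<^sup>+x. f (Q x) * g (y - Q x) \<partial>lborel) = (\<integral>\<^sup>+x. f (Q x + y) * g x \<partial>lborel)"
   by (simp add: linear_add[OF lin] z g)
 qed
 also have "... = (\<integral>\<^sup>+x. (\<integral>\<^sup>+y. f (Q x + y) * g x \<partial>lborel) \<partial>lborel)"
  by (rule lborel_pair.Fubini') measurable
 also have "... = (\<integral>\<^sup>+x. (\<integral>\<^sup>+y. f y \<partial>lborel) * g x \<partial>lborel)"
  using nn_integral_lborel_shift[OF f] by (simp add: nn_integral_multc add.commute[of "Q _"])
 also have "... = (\<integral>\<^sup>+y. f y \<partial>lborel) * V" unfolding V_def by (simp add: nn_integral_cmult)
 finally have "V * (\<integral>\<^sup>+x. f (Q x) \<partial>lborel) = V * (\<integral>\<^sup>+y. f y \<partial>lborel)" by (simp add: mult.commute)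
 then show ?thesis using \<open>V \<noteq> 0\<close> \<open>V < \<infinity>\<close> by (auto simp: ennreal_mult_cancel_left)
qed

text \<open>Dilation by \<open>r1\<close> along the unit vector \<open>\<omega>\<close> and by \<open>r2\<close> across it.\<close>

definition aniso :: "'a::euclidean_space => real => real => 'a => 'a"
 where "aniso \<omega> r1 r2 u = r2 *\<^sub>R u + ((r1 - r2) * (u \<bullet> \<omega>)) *\<^sub>R \<omega>"

lemma linear_aniso: "linear (aniso \<omega> r1 r2)"
 by (rule linearI) (simp_all add: aniso_def algebra_simps inner_add_left)

lemma aniso_diff: "aniso \<omega> r1 r2 (u - v) = aniso \<omega> r1 r2 u - aniso \<omega> r1 r2 v"
 by (rule linear_diff[OF linear_aniso])

lemma aniso_measurable [measurable]: "aniso \<omega> r1 r2 \<in> borel_measurable borel"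
 by (intro borel_measurable_continuous_onI linear_continuous_on linear_conv_bounded_linear[THEN iffD1] linear_aniso)

lemma aniso_split: "aniso \<omega> r1 r2 u = (r1 * (u \<bullet> \<omega>)) *\<^sub>R \<omega> + r2 *\<^sub>R (u - (u \<bullet> \<omega>) *\<^sub>R \<omega>)"
 by (simp add: aniso_def algebra_simps)

lemma norm_perp_le:
 assumes "norm \<omega> = 1" shows "norm (u - (u \<bullet> \<omega>) *\<^sub>R \<omega>) \<le> norm u" "norm (u - (u \<bullet> \<omega>) *\<^sub>R \<omega>) \<le> norm (u - c *\<^sub>R \<omega>)"
proof -
 have w: "\<omega> \<bullet> \<omega> = 1" using assms by (simp add: dot_square_norm)
 have "(norm (u - (u \<bullet> \<omega>) *\<^sub>R \<omega>))\<^sup>2 \<le> (norm (u - c *\<^sub>R \<omega>))\<^sup>2" for c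
 proof -
  have "(norm (u - c *\<^sub>R \<omega>))\<^sup>2 - (norm (u - (u \<bullet> \<omega>) *\<^sub>R \<omega>))\<^sup>2 = (c - u \<bullet> \<omega>)\<^sup>2"
   unfolding power2_norm_eq_inner by (simp add: inner_diff_left inner_diff_right w inner_commute[of \<omega> u] algebra_simps power2_eq_square)
  then show ?thesis by (metis diff_ge_0_iff_ge zero_le_power2)
 qed
 then have *: "norm (u - (u \<bullet> \<omega>) *\<^sub>R \<omega>) \<le> norm (u - c *\<^sub>R \<omega>)" for c
  by (meson norm_ge_zero power2_le_imp_le)
 show "norm (u - (u \<bullet> \<omega>) *\<^sub>R \<omega>) \<le> norm (u - c *\<^sub>R \<omega>)" by (rule *)
 show "norm (u - (u \<bullet> \<omega>) *\<^sub>R \<omega>) \<le> norm u" using *[of 0] by simp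
qed

lemma norm_aniso_le:
 assumes "norm \<omega> = 1" "0 \<le> r1" "0 \<le> r2"
 shows "norm (aniso \<omega> r1 r2 u) \<le> r1 * \<bar>u \<bullet> \<omega>\<bar> + r2 * norm (u - (u \<bullet> \<omega>) *\<^sub>R \<omega>)"
 unfolding aniso_split using assms by (intro order_trans[OF norm_triangle_ineq]) (simp add: abs_mult)

lemma aniso_components:
 assumes "norm \<omega> = 1"
 shows "aniso \<omega> r1 r2 u \<bullet> \<omega> = r1 * (u \<bullet> \<omega>)"
  and "aniso \<omega> r1 r2 u - (aniso \<omega> r1 r2 u \<bullet> \<omega>) *\<^sub>R \<omega> = r2 *\<^sub>R (u - (u \<bullet> \<omega>) *\<^sub>R \<omega>)"
proof -
 have w: "\<omega> \<bullet> \<omega> = 1" using assms by (simp add: dot_square_norm)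
 show e: "aniso \<omega> r1 r2 u \<bullet> \<omega> = r1 * (u \<bullet> \<omega>)" by (simp add: aniso_def inner_add_left w algebra_simps)
 show "aniso \<omega> r1 r2 u - (aniso \<omega> r1 r2 u \<bullet> \<omega>) *\<^sub>R \<omega> = r2 *\<^sub>R (u - (u \<bullet> \<omega>) *\<^sub>R \<omega>)"
  unfolding e by (simp add: aniso_def algebra_simps)
qed

lemma aniso_lower:
 assumes "norm \<omega> = 1" "0 \<le> r1" "0 \<le> r2"
 shows "r1 * \<bar>u \<bullet> \<omega>\<bar> \<le> norm (aniso \<omega> r1 r2 u)" "r2 * norm (u - (u \<bullet> \<omega>) *\<^sub>R \<omega>) \<le> norm (aniso \<omega> r1 r2 u)"
proof -
 have "\<bar>aniso \<omega> r1 r2 u \<bullet> \<omega>\<bar> \<le> norm (aniso \<omega> r1 r2 u)"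
  using Cauchy_Schwarz_ineq2[of "aniso \<omega> r1 r2 u" \<omega>] assms(1) by simp
 then show "r1 * \<bar>u \<bullet> \<omega>\<bar> \<le> norm (aniso \<omega> r1 r2 u)" using assms by (simp add: aniso_components abs_mult)
 have "norm (r2 *\<^sub>R (u - (u \<bullet> \<omega>) *\<^sub>R \<omega>)) \<le> norm (aniso \<omega> r1 r2 u)"
  unfolding aniso_components(2)[OF assms(1), of r1 r2 u, symmetric] by (rule norm_perp_le(1)[OF assms(1)])
 then show "r2 * norm (u - (u \<bullet> \<omega>) *\<^sub>R \<omega>) \<le> norm (aniso \<omega> r1 r2 u)" using assms by simp
qed

lemma ennreal_cancel_left: "0 < k ==> ennreal (1 / k) * (ennreal k * X) = X"
 by (simp add: mult.assoc[symmetric] ennreal_mult[symmetric])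

lemma nn_integral_aniso:
 fixes \<omega> :: "real^'n" and f :: "real^'n => ennreal"
 assumes \<omega>: "norm \<omega> = 1" and r: "0 < r1" "0 < r2" and f[measurable]: "f \<in> borel_measurable borel"
 shows "(\<integral>\<^sup>+x. f x \<partial>lborel) = ennreal (r1 * r2 ^ (CARD('n) - 1)) * (\<integral>\<^sup>+x. f (aniso \<omega> r1 r2 x) \<partial>lborel)"
proof -
 define k :: 'n where "k = undefined"
 define e :: "real^'n" where "e = axis k 1"
 have e: "e \<in> Basis" "norm e = 1" by (auto simp: e_def axis_in_Basis_iff)
 obtain Q where Q: "orthogonal_transformation Q" "Q \<omega> = e"
  using orthogonal_transformation_exists[of \<omega> e] \<omega> e by auto
 have lin: "linear Q" using Q orthogonal_transformation_linear by blast
 define P where "P = inv Q"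
 have P: "orthogonal_transformation P" unfolding P_def using Q(1) orthogonal_transformation_inv by blast
 have PQ: "P (Q x) = x" for x
  unfolding P_def using orthogonal_transformation_inj[OF Q(1)] by simp
 have [measurable]: "P \<in> borel_measurable borel"
  by (intro borel_measurable_continuous_onI linear_continuous_on linear_conv_bounded_linear[THEN iffD1] orthogonal_transformation_linear P)
 have [measurable]: "Q \<in> borel_measurable borel"
  by (intro borel_measurable_continuous_onI linear_continuous_on linear_conv_bounded_linear[THEN iffD1] lin)
 have Qa: "Q (aniso \<omega> r1 r2 x) = aniso e r1 r2 (Q x)" for x
  using Q unfolding aniso_def orthogonal_transformation_def
  by (metis (no_types, lifting) linear_add linear_scale)
 define c where "c j = (if j = e then r1 else r2)" for j
 define T where "T x = 0 + (\<Sum>j\<in>Basis. (c j * (x \<bullet> j)) *\<^sub>R j)" for x :: "real^'n"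
 have T: "T x = aniso e r1 r2 x" for x
 proof -
  have "T x = (\<Sum>j\<in>Basis. r2 *\<^sub>R ((x \<bullet> j) *\<^sub>R j) + (if j = e then ((r1 - r2) * (x \<bullet> j)) *\<^sub>R j else 0))"
   unfolding T_def c_def by (simp, rule sum.cong) (auto simp: algebra_simps)
  also have "... = r2 *\<^sub>R (\<Sum>j\<in>Basis. (x \<bullet> j) *\<^sub>R j) + ((r1 - r2) * (x \<bullet> e)) *\<^sub>R e"
   using e(1) by (simp add: sum.distrib scaleR_sum_right)
  finally show ?thesis by (simp add: euclidean_representation aniso_def)
 qed
 have prod: "(\<Prod>j\<in>Basis. \<bar>c j\<bar>) = r1 * r2 ^ (CARD('n) - 1)"
 proof -
  have "(\<Prod>j\<in>Basis. \<bar>c j\<bar>) = \<bar>c e\<bar> * (\<Prod>j\<in>Basis - {e}. \<bar>c j\<bar>)"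
   using e(1) by (simp add: prod.remove)
  also have "(\<Prod>j\<in>Basis - {e}. \<bar>c j\<bar>) = (\<Prod>j\<in>Basis - {e}. r2)"
   using r by (intro prod.cong) (auto simp: c_def)
  finally show ?thesis using r e(1) by (simp add: c_def card_Diff_singleton)
 qed
 have L: "lborel = density (distr lborel borel T) (\<lambda>_. (\<Prod>j\<in>Basis. \<bar>c j\<bar>))"
  unfolding T_def by (rule lborel_affine_euclidean) (use r in \<open>auto simp: c_def\<close>)
 have Tm[measurable]: "T \<in> borel_measurable borel" unfolding T by measurable
 have "(\<integral>\<^sup>+x. f x \<partial>lborel) = (\<integral>\<^sup>+x. f (P x) \<partial>lborel)"
  by (rule nn_integral_orthogonal[OF P f, symmetric])
 also have "... = (\<integral>\<^sup>+x. ennreal (r1 * r2 ^ (CARD('n) - 1)) * f (P (T x)) \<partial>lborel)"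
  by (subst L) (simp add: nn_integral_density nn_integral_distr prod)
 also have "... = ennreal (r1 * r2 ^ (CARD('n) - 1)) * (\<integral>\<^sup>+x. f (P (T x)) \<partial>lborel)"
  by (simp add: nn_integral_cmult)
 also have "(\<integral>\<^sup>+x. f (P (T x)) \<partial>lborel) = (\<integral>\<^sup>+x. f (P (T (Q x))) \<partial>lborel)"
  by (rule nn_integral_orthogonal[OF Q(1), symmetric]) measurable
 also have "... = (\<integral>\<^sup>+x. f (aniso \<omega> r1 r2 x) \<partial>lborel)"
  unfolding T Qa[symmetric] PQ ..
 finally show ?thesis .
qed

lemma emeasure_aniso_ball:
 fixes \<omega> c :: "real^'n"
 assumes \<omega>: "norm \<omega> = 1" and r: "0 < r1" "0 < r2"
 shows "emeasure lborel {x. norm (aniso \<omega> r1 r2 (x - c)) \<le> b} =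
  ennreal (1 / (r1 * r2 ^ (CARD('n) - 1))) * emeasure lborel (cball (0 :: real^'n) b)"
proof -
 have [measurable]: "{x. norm (aniso \<omega> r1 r2 (x - c)) \<le> b} \<in> sets borel"
  by measurable
 have "emeasure lborel (cball (0 :: real^'n) b) = (\<integral>\<^sup>+x. indicator (cball 0 b) (x::real^'n) \<partial>lborel)" by simp
 also have "... = ennreal (r1 * r2 ^ (CARD('n) - 1)) * (\<integral>\<^sup>+x. indicator (cball 0 b) (aniso \<omega> r1 r2 x) \<partial>lborel)"
  by (rule nn_integral_aniso[OF \<omega> r], intro borel_measurable_indicator) simp
 also have "(\<integral>\<^sup>+x. indicator (cball 0 b) (aniso \<omega> r1 r2 x) \<partial>lborel) = (\<integral>\<^sup>+x. indicator (cball 0 b) (aniso \<omega> r1 r2 (x - c)) \<partial>lborel)"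
 proof -
  have "(\<lambda>x. indicator (cball 0 b) (aniso \<omega> r1 r2 x) :: ennreal) \<in> borel_measurable borel"
   by (rule measurable_compose[OF aniso_measurable], intro borel_measurable_indicator) simp
  from nn_integral_lborel_shift[OF this, of "- c"] show ?thesis by simp
 qed
 also have "... = (\<integral>\<^sup>+x. indicator {x. norm (aniso \<omega> r1 r2 (x - c)) \<le> b} x \<partial>lborel)"
  by (rule nn_integral_cong) (simp add: indicator_def)
 also have "... = emeasure lborel {x. norm (aniso \<omega> r1 r2 (x - c)) \<le> b}" by simp
 finally have "emeasure lborel (cball (0 :: real^'n) b) = ennreal (r1 * r2 ^ (CARD('n) - 1)) * emeasure lborel {x. norm (aniso \<omega> r1 r2 (x - c)) \<le> b}" .
 then show ?thesis using r by (simp only: ennreal_cancel_left mult_pos_pos zero_less_power)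
qed

text \<open>The surface measure is the measure of a cone, and the cone over a cap of radius \<open>\<rho>\<close> lies in an anisotropic
ball of length about 1 and width about \<open>\<rho>\<close>.\<close>

lemma emeasure_sphere_cap:
 fixes \<omega> :: "real^'n"
 assumes \<omega>: "norm \<omega> = 1" and \<rho>: "0 < \<rho>"
 shows "emeasure sphere_measure {\<theta> \<in> sphere 0 1. norm (\<theta> - \<omega>) \<le> \<rho>}
  \<le> ennreal (real CARD('n) * \<rho> ^ (CARD('n) - 1)) * emeasure lborel (cball (0 :: real^'n) 2)"
proof -
 have sgnm: "sgn \<in> restrict_space lborel (ball (0::real^'n) 1 - {0}) \<rightarrow>\<^sub>M restrict_space borel (sphere 0 1)"
 proof (rule measurable_restrict_space2)
  show "sgn \<in> space (restrict_space lborel (ball (0::real^'n) 1 - {0})) \<rightarrow> sphere 0 1"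
   by (auto simp: space_restrict_space norm_sgn)
  show "sgn \<in> restrict_space lborel (ball (0::real^'n) 1 - {0}) \<rightarrow>\<^sub>M borel"
   by (rule measurable_restrict_space1) (simp add: sgn_div_norm)
 qed
 let ?A = "{\<theta> \<in> sphere 0 1. norm (\<theta> - \<omega>) \<le> \<rho>}"
 have A: "?A \<in> sets (restrict_space borel (sphere 0 1))"
 proof -
  have "?A = sphere 0 1 \<inter> cball \<omega> \<rho>" by (auto simp: dist_norm norm_minus_commute)
  then show ?thesis unfolding sets_restrict_space by auto
 qed
 have "emeasure sphere_measure ?A = ennreal (real CARD('n)) * emeasure (restrict_space lborel (ball (0::real^'n) 1 - {0}))
   (sgn -` ?A \<inter> space (restrict_space lborel (ball 0 1 - {0})))"
  unfolding sphere_measure_def emeasure_scale_measure DIM_cart emeasure_distr[OF sgnm A] by simp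
 also have "emeasure (restrict_space lborel (ball (0::real^'n) 1 - {0})) (sgn -` ?A \<inter> space (restrict_space lborel (ball 0 1 - {0})))
  = emeasure lborel (sgn -` ?A \<inter> (ball (0::real^'n) 1 - {0}))"
  by (subst emeasure_restrict_space) (auto simp: space_restrict_space)
 also have "... \<le> emeasure lborel {x. norm (aniso \<omega> 1 (1 / \<rho>) (x - 0)) \<le> 2}"
 proof (rule emeasure_mono)
  show "sgn -` ?A \<inter> (ball (0::real^'n) 1 - {0}) \<subseteq> {x. norm (aniso \<omega> 1 (1 / \<rho>) (x - 0)) \<le> 2}"
  proof safe
   fix x :: "real^'n" assume x: "x \<in> ball 0 1" "x \<noteq> 0" "norm (sgn x - \<omega>) \<le> \<rho>"
   have x1: "norm x \<le> 1" using x by simp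
   have xs: "x = norm x *\<^sub>R sgn x" by (simp add: sgn_div_norm x)
   have "\<bar>x \<bullet> \<omega>\<bar> \<le> norm x * norm \<omega>" by (rule Cauchy_Schwarz_ineq2)
   then have 1: "\<bar>x \<bullet> \<omega>\<bar> \<le> 1" using x1 \<omega> by simp
   have "norm (x - (x \<bullet> \<omega>) *\<^sub>R \<omega>) \<le> norm (x - norm x *\<^sub>R \<omega>)" by (rule norm_perp_le(2)[OF \<omega>])
   also have "x - norm x *\<^sub>R \<omega> = norm x *\<^sub>R (sgn x - \<omega>)" by (subst (1) xs) (simp add: algebra_simps)
   also have "norm ... \<le> 1 * \<rho>" using x x1 by (simp only: norm_scaleR) (intro mult_mono, auto)
   finally have 2: "norm (x - (x \<bullet> \<omega>) *\<^sub>R \<omega>) \<le> \<rho>" by simp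
   have "norm (aniso \<omega> 1 (1 / \<rho>) x) \<le> 1 * \<bar>x \<bullet> \<omega>\<bar> + (1 / \<rho>) * norm (x - (x \<bullet> \<omega>) *\<^sub>R \<omega>)"
    using \<rho> by (intro norm_aniso_le \<omega>) auto
   also have "... \<le> 1 + (1 / \<rho>) * \<rho>" using 1 2 \<rho> by (intro add_mono mult_left_mono) auto
   finally show "norm (aniso \<omega> 1 (1 / \<rho>) (x - 0)) \<le> 2" using \<rho> by simp
  qed
 qed measurable
 also have "... = ennreal (1 / (1 * (1 / \<rho>) ^ (CARD('n) - 1))) * emeasure lborel (cball (0 :: real^'n) 2)"
  using \<rho> by (intro emeasure_aniso_ball \<omega>) auto
 also have "1 / (1 * (1 / \<rho>) ^ (CARD('n) - 1)) = \<rho> ^ (CARD('n) - 1)"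
  by (simp add: power_divide)
 finally show ?thesis using \<rho> by (simp add: ennreal_mult mult.assoc mult_left_mono)
qed

lemma nn_integral_aniso_decay:
 fixes \<omega> :: "real^'n"
 assumes \<omega>: "norm \<omega> = 1" and r: "0 < r1" "0 < r2"
 shows "(\<integral>\<^sup>+x. ennreal (1 / (1 + norm (aniso \<omega> r1 r2 (x - c))) ^ (2 * CARD('n))) \<partial>lborel) =
  ennreal (1 / (r1 * r2 ^ (CARD('n) - 1)) * (\<integral>(x::real^'n). 1 / (1 + norm x) ^ (2 * CARD('n)) \<partial>lborel))"
proof -
 let ?w = "\<lambda>x::real^'n. ennreal (1 / (1 + norm x) ^ (2 * CARD('n)))"
 have i: "(\<integral>\<^sup>+x. ?w x \<partial>lborel) = ennreal (\<integral>(x::real^'n). 1 / (1 + norm x) ^ (2 * CARD('n)) \<partial>lborel)"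
  using integrable_decay[where 'a="real^'n"] by (intro nn_integral_eq_integral) auto
 have "(\<integral>\<^sup>+x. ?w x \<partial>lborel) = ennreal (r1 * r2 ^ (CARD('n) - 1)) * (\<integral>\<^sup>+x. ?w (aniso \<omega> r1 r2 x) \<partial>lborel)"
  by (rule nn_integral_aniso[OF \<omega> r]) measurable
 also have "(\<integral>\<^sup>+x. ?w (aniso \<omega> r1 r2 x) \<partial>lborel) = (\<integral>\<^sup>+x. ?w (aniso \<omega> r1 r2 (x - c)) \<partial>lborel)"
  using nn_integral_lborel_shift[of "\<lambda>x. ?w (aniso \<omega> r1 r2 x)" "- c"] by simp
 finally have "ennreal (\<integral>(x::real^'n). 1 / (1 + norm x) ^ (2 * CARD('n)) \<partial>lborel) = ennreal (r1 * r2 ^ (CARD('n) - 1)) * (\<integral>\<^sup>+x. ?w (aniso \<omega> r1 r2 (x - c)) \<partial>lborel)"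
  unfolding i .
 note e = this
 show ?thesis
  by (subst ennreal_mult) (use r in \<open>auto simp: e ennreal_cancel_left intro!: Bochner_Integration.integral_nonneg\<close>)
qed

section \<open>Symbols with a heat parameter\<close>

lemma japanese_ge_1: "1 \<le> japanese x"
 by (simp add: japanese_def)

lemma norm_le_japanese: "norm x \<le> japanese x"
 unfolding japanese_def by (rule real_le_rsqrt) simp

lemma japanese_le: "japanese x \<le> 1 + norm x"
 unfolding japanese_def by (rule real_le_lsqrt) (simp_all add: power2_sum)

lemma japanese_pos: "0 < japanese x"
 using japanese_ge_1[of x] by linarith

lemma japanese_sq: "japanese x = (1 + x \<bullet> x) powr (1/2)"
 unfolding japanese_def by (simp add: powr_half_sqrt power2_norm_eq_inner)

lemma japanese_powr: "japanese x powr r = (1 + x \<bullet> x) powr (r / 2)"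
 unfolding japanese_sq by (simp add: powr_powr)

lemma japanese_has_derivative:
 "((\<lambda>x. complex_of_real (japanese x powr r)) has_derivative
   (\<lambda>v. of_real r * of_real (x \<bullet> v) * of_real (japanese x powr (r - 2)))) (at x)"
proof -
 have p: "0 < 1 + x \<bullet> x" by (simp add: add_pos_nonneg)
 have 1: "((\<lambda>x. 1 + x \<bullet> x) has_derivative (\<lambda>v. 2 * (x \<bullet> v))) (at x)"
  by (auto intro!: derivative_eq_intros simp: inner_commute)
 have 2: "((\<lambda>y. y powr (r / 2)) has_derivative (\<lambda>h. (r / 2 * (1 + x \<bullet> x) powr (r / 2 - 1)) * h)) (at (1 + x \<bullet> x))"
  using has_field_derivative_imp_has_derivative[OF has_real_derivative_powr[OF p, of "r / 2"]] .
 have "((\<lambda>x. complex_of_real ((1 + x \<bullet> x) powr (r / 2))) has_derivative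
   (\<lambda>v. of_real ((r / 2 * (1 + x \<bullet> x) powr (r / 2 - 1)) * (2 * (x \<bullet> v))))) (at x)"
  by (rule bounded_linear.has_derivative[OF bounded_linear_of_real has_derivative_compose[OF 1 2]])
 then show ?thesis
  unfolding japanese_powr by (simp add: diff_divide_distrib mult_ac)
qed

lemma powr_comparable:
 fixes R c y a :: real
 assumes "0 < R" "1 \<le> c" "R / c \<le> y" "y \<le> c * R"
 shows "y powr a \<le> c powr \<bar>a\<bar> * R powr a"
proof -
 have "0 < R / c" using assms(1,2) by (intro divide_pos_pos) linarith+
 then have y: "0 < y" using assms by linarith
 show ?thesis
 proof (cases "0 \<le> a")
  case True
  then have "y powr a \<le> (c * R) powr a" using y assms by (intro powr_mono2) auto
  then show ?thesis using True assms by (simp add: powr_mult)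
 next
  case False
  then have "y powr a \<le> (R / c) powr a" using assms by (intro powr_mono2') auto
  also have "... = c powr \<bar>a\<bar> * R powr a" using False assms
   by (simp add: powr_divide powr_minus_divide)
  finally show ?thesis .
 qed
qed

text \<open>Symbols of order \<open>r\<close> that depend on a heat parameter and obey bounds uniform in it. Each
generator is stable under differentiation up to the listed operations, which makes the class closed under
derivatives by construction. The heat factor belongs to it because the maximal function in the norm of
\<open>H\<^sup>1\<close> requires estimates for all heat parameters simultaneously.\<close>

inductive symb :: "real => (real => 'a::euclidean_space => complex) => bool" where
 zero: "symb r (\<lambda>_ _. 0)"
| const: "symb 0 (\<lambda>_ _. c)"
| coord: "symb 1 (\<lambda>_ x. of_real (x \<bullet> y))"
| jap: "symb r (\<lambda>_ x. of_real (japanese x powr r))"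
| heat: "symb (- 2 * real k) (\<lambda>\<tau> x. of_real (\<tau> ^ k) * gauss \<tau> x)"
| add: "symb r f ==> symb r g ==> symb r (\<lambda>\<tau> x. f \<tau> x + g \<tau> x)"
| mult: "symb r f ==> symb s g ==> symb (r + s) (\<lambda>\<tau> x. f \<tau> x * g \<tau> x)"

lemma symb_differentiable: "symb r f ==> f \<tau> differentiable (at x)"
proof (induction rule: symb.induct)
 case (coord y)
 show ?case by (rule coord_differentiable)
next
 case (jap r)
 show ?case using japanese_has_derivative differentiable_def by blast
next
 case (heat k)
 show ?case by (intro differentiable_mult gauss_differentiable) auto
qed (auto intro: differentiable_add differentiable_mult)

lemma symb_pderiv: "symb r f ==> \<exists>g. symb (r - 1) g \<and> (\<forall>\<tau>. pderiv_dir v (f \<tau>) = g \<tau>)"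
proof (induction rule: symb.induct)
 case (zero r)
 show ?case by (rule exI[of _ "\<lambda>_ _. 0"]) (auto intro: symb.zero)
next
 case (const c)
 show ?case by (rule exI[of _ "\<lambda>_ _. 0"]) (auto intro: symb.zero)
next
 case (coord y)
 show ?case
  by (rule exI[of _ "\<lambda>_ _. of_real (v \<bullet> y)"]) (auto simp: pderiv_dir_coord intro: symb.const)
next
 case (jap r)
 have "symb (0 + (1 + (r - 2))) (\<lambda>_ x. of_real r * (of_real (x \<bullet> v) * of_real (japanese x powr (r - 2))))"
  by (intro symb.intros)
 moreover have "pderiv_dir v (\<lambda>x. complex_of_real (japanese x powr r)) = (\<lambda>x. of_real r * (of_real (x \<bullet> v) * of_real (japanese x powr (r - 2))))"
  by (rule ext) (simp add: pderiv_dir_eqI[OF japanese_has_derivative] mult.assoc)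
 ultimately show ?case by (intro exI[of _ "\<lambda>_ x. of_real r * (of_real (x \<bullet> v) * of_real (japanese x powr (r - 2)))"]) simp
next
 case (heat k)
 have e: "- 2 * real k - 1 = 0 + (1 + (- 2 * real (Suc k)))" by simp
 have "symb (- 2 * real k - 1) (\<lambda>\<tau> x. -2 * (of_real (x \<bullet> v) * (of_real (\<tau> ^ Suc k) * gauss \<tau> x)))"
  unfolding e by (intro symb.intros)
 moreover have "pderiv_dir v (\<lambda>x. of_real (\<tau> ^ k) * gauss \<tau> x) = (\<lambda>x. -2 * (of_real (x \<bullet> v) * (of_real (\<tau> ^ Suc k) * gauss \<tau> x)))" for \<tau>
  by (rule ext, subst pderiv_dir_linear_image[OF bounded_linear_mult_right gauss_differentiable])
    (simp add: pderiv_dir_gauss)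
 ultimately show ?case
  by (intro exI[of _ "\<lambda>\<tau> x. -2 * (of_real (x \<bullet> v) * (of_real (\<tau> ^ Suc k) * gauss \<tau> x))"]) blast
next
 case (add r f g)
 then obtain f' g' where d: "symb (r - 1) f'" "\<And>\<tau>. pderiv_dir v (f \<tau>) = f' \<tau>" "symb (r - 1) g'" "\<And>\<tau>. pderiv_dir v (g \<tau>) = g' \<tau>" by blast
 have "pderiv_dir v (\<lambda>x. f \<tau> x + g \<tau> x) = (\<lambda>x. f' \<tau> x + g' \<tau> x)" for \<tau>
  by (rule ext, subst pderiv_dir_add) (auto simp: d intro: symb_differentiable add.hyps)
 then show ?case using symb.add[OF d(1,3)] by (intro exI[of _ "\<lambda>\<tau> x. f' \<tau> x + g' \<tau> x"]) simp
next
 case (mult r f s g)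
 then obtain f' g' where d: "symb (r - 1) f'" "\<And>\<tau>. pderiv_dir v (f \<tau>) = f' \<tau>" "symb (s - 1) g'" "\<And>\<tau>. pderiv_dir v (g \<tau>) = g' \<tau>" by blast
 have "pderiv_dir v (\<lambda>x. f \<tau> x * g \<tau> x) = (\<lambda>x. f \<tau> x * g' \<tau> x + f' \<tau> x * g \<tau> x)" for \<tau>
  by (rule ext, subst pderiv_dir_mult) (auto simp: d intro: symb_differentiable mult.hyps)
 moreover have "symb (r + s - 1) (\<lambda>\<tau> x. f \<tau> x * g' \<tau> x + f' \<tau> x * g \<tau> x)"
  using symb.mult[OF mult.hyps(1) d(3)] symb.mult[OF d(1) mult.hyps(2)]
  by (intro symb.add) (simp_all add: algebra_simps)
 ultimately show ?case by (intro exI[of _ "\<lambda>\<tau> x. f \<tau> x * g' \<tau> x + f' \<tau> x * g \<tau> x"]) simp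
qed

text \<open>For the Gaussian with heat parameter \<open>\<tau>\<close> the bound rests on the boundedness of \<open>s ^ k * exp (- s)\<close> at
\<open>s = \<tau> |x|\<^sup>2\<close>, which is uniform in \<open>\<tau>\<close>.\<close>

lemma symb_bound: "symb r f ==> \<exists>C. 0 \<le> C \<and> (\<forall>\<tau> x. 0 < \<tau> --> 1 \<le> norm x --> norm (f \<tau> x) \<le> C * japanese x powr r)"
proof (induction rule: symb.induct)
 case (const c)
 have "japanese x \<noteq> 0" for x :: 'a using japanese_pos[of x] by simp
 then show ?case by (intro exI[of _ "norm c"]) auto
next
 case (coord y)
 show ?case
 proof (intro exI[of _ "norm y"] conjI allI impI)
  fix x :: 'a
  have "norm (complex_of_real (x \<bullet> y)) \<le> norm x * norm y" using Cauchy_Schwarz_ineq2[of x y] by simp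
  also have "... \<le> japanese x * norm y" by (intro mult_right_mono norm_le_japanese) auto
  finally show "norm (complex_of_real (x \<bullet> y)) \<le> norm y * japanese x powr 1"
   using japanese_pos[of x] by (simp add: mult.commute)
 qed auto
next
 case (heat k)
 show ?case
 proof (intro exI[of _ "fact k * 2 ^ k"] conjI allI impI)
  fix \<tau> :: real and x :: 'a assume \<tau>: "0 < \<tau>" and x: "1 \<le> norm x"
  have j2: "(japanese x)\<^sup>2 \<le> 2 * (norm x)\<^sup>2"
   using x by (simp add: japanese_def)
  have "(\<tau> * (norm x)\<^sup>2) ^ k * exp (- \<tau> * (norm x)\<^sup>2) \<le> (fact k * exp (\<tau> * (norm x)\<^sup>2)) * exp (- \<tau> * (norm x)\<^sup>2)"
   using \<tau> by (intro mult_right_mono power_le_fact_exp) auto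
  also have "... = fact k" by (simp add: exp_minus_inverse mult.assoc exp_add[symmetric])
  finally have 1: "\<tau> ^ k * exp (- \<tau> * (norm x)\<^sup>2) * ((norm x)\<^sup>2) ^ k \<le> fact k" by (simp add: power_mult_distrib mult_ac)
  have "\<tau> ^ k * exp (- \<tau> * (norm x)\<^sup>2) * ((japanese x)\<^sup>2) ^ k \<le> \<tau> ^ k * exp (- \<tau> * (norm x)\<^sup>2) * (2 * (norm x)\<^sup>2) ^ k"
   using \<tau> j2 by (intro mult_left_mono power_mono) auto
  also have "... = 2 ^ k * (\<tau> ^ k * exp (- \<tau> * (norm x)\<^sup>2) * ((norm x)\<^sup>2) ^ k)" by (simp add: power_mult_distrib)
  also have "... \<le> 2 ^ k * fact k" using 1 by simp
  finally have 2: "\<tau> ^ k * exp (- \<tau> * (norm x)\<^sup>2) * ((japanese x)\<^sup>2) ^ k \<le> 2 ^ k * fact k" .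
  have "japanese x powr (- 2 * real k) = inverse (((japanese x)\<^sup>2) ^ k)"
  proof -
   have "- 2 * real k = - real (2 * k)" by simp
   then have "japanese x powr (- 2 * real k) = inverse (japanese x powr real (2 * k))" by (simp only: powr_minus)
   also have "japanese x powr real (2 * k) = ((japanese x)\<^sup>2) ^ k"
    using powr_realpow[OF japanese_pos[of x], of "2 * k"] by (simp only: power_mult)
   finally show ?thesis .
  qed
  moreover have "0 < ((japanese x)\<^sup>2) ^ k" using japanese_pos[of x] by simp
  then have "\<tau> ^ k * exp (- \<tau> * (norm x)\<^sup>2) \<le> 2 ^ k * fact k / ((japanese x)\<^sup>2) ^ k"
   using 2 by (subst pos_le_divide_eq)
  moreover have "norm (of_real (\<tau> ^ k) * gauss \<tau> x) = \<tau> ^ k * exp (- \<tau> * (norm x)\<^sup>2)"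
   unfolding gauss_def norm_mult norm_of_real using \<tau> by simp
  ultimately show "norm (of_real (\<tau> ^ k) * gauss \<tau> x) \<le> fact k * 2 ^ k * japanese x powr (- 2 * real k)"
   by (simp only: divide_inverse mult.commute)
 qed simp
next
 case (add r f g)
 then obtain C D where C: "0 \<le> C" "\<And>\<tau> x. 0 < \<tau> ==> 1 \<le> norm x ==> norm (f \<tau> x) \<le> C * japanese x powr r"
  and D: "0 \<le> D" "\<And>\<tau> x. 0 < \<tau> ==> 1 \<le> norm x ==> norm (g \<tau> x) \<le> D * japanese x powr r" by blast
 show ?case
 proof (intro exI[of _ "C + D"] conjI allI impI)
  fix \<tau> :: real and x :: 'a assume \<tau>: "0 < \<tau>" and x: "1 \<le> norm x"
  show "norm (f \<tau> x + g \<tau> x) \<le> (C + D) * japanese x powr r"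
   using norm_triangle_ineq[of "f \<tau> x" "g \<tau> x"] C(2)[OF \<tau> x] D(2)[OF \<tau> x] unfolding distrib_right by linarith
 qed (use C D in auto)
next
 case (mult r f s g)
 then obtain C D where C: "0 \<le> C" "\<And>\<tau> x. 0 < \<tau> ==> 1 \<le> norm x ==> norm (f \<tau> x) \<le> C * japanese x powr r"
  and D: "0 \<le> D" "\<And>\<tau> x. 0 < \<tau> ==> 1 \<le> norm x ==> norm (g \<tau> x) \<le> D * japanese x powr s" by blast
 show ?case
 proof (intro exI[of _ "C * D"] conjI allI impI)
  fix \<tau> :: real and x :: 'a assume \<tau>: "0 < \<tau>" and x: "1 \<le> norm x"
  have "norm (f \<tau> x) * norm (g \<tau> x) \<le> (C * japanese x powr r) * (D * japanese x powr s)"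
   using C D \<tau> x by (intro mult_mono) auto
  then show "norm (f \<tau> x * g \<tau> x) \<le> C * D * japanese x powr (r + s)"
   by (simp add: norm_mult powr_add mult_ac)
 qed (use C D in auto)
next
 case (jap r)
 show ?case by (rule exI[of _ 1]) simp
next
 case (zero r)
 show ?case by (rule exI[of _ 0]) simp
qed

lemma symb_pderivs: "symb r f ==> \<exists>g. symb (r - real (length vs)) g \<and> (\<forall>\<tau>. pderivs vs (f \<tau>) = g \<tau>)"
proof (induction vs)
 case (Cons v vs)
 then obtain g where g: "symb (r - real (length vs)) g" "\<And>\<tau>. pderivs vs (f \<tau>) = g \<tau>" by blast
 obtain h where "symb (r - real (length vs) - 1) h" "\<And>\<tau>. pderiv_dir v (g \<tau>) = h \<tau>" using symb_pderiv[OF g(1)] by blast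
 then show ?case using g(2) by (intro exI[of _ h]) (simp add: pderivs_Cons algebra_simps)
qed auto

lemma symb_smooth: assumes "symb r f" shows "smooth (f \<tau>)"
proof (rule smooth_coinduct[of _ "{f \<tau> | f r. symb r f}"])
 fix h b assume "h \<in> {f \<tau> | f r. symb r f}"
 then obtain f r where f: "h = f \<tau>" "symb r f" by blast
 then obtain g where "symb (r - 1) g" "\<forall>\<tau>. pderiv_dir b (f \<tau>) = g \<tau>" using symb_pderiv by blast
 then show "pderiv_dir b h \<in> {f \<tau> | f r. symb r f}" using f by auto
qed (use assms symb_differentiable in auto)

lemma moderate_outside:
 fixes m :: "'a::euclidean_space => complex"
 assumes m: "smooth m"
  and b: "\<And>vs. set vs \<subseteq> Basis ==> \<exists>C r. \<forall>x. 1 \<le> norm x --> norm (pderivs vs m x) \<le> C * (1 + norm x) powr r"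
 shows "m \<in> moderate"
 unfolding moderate_def
proof (intro CollectI conjI allI impI m)
 fix vs :: "'a list" assume "set vs \<subseteq> Basis"
 then obtain C r where C: "\<And>x. 1 \<le> norm x ==> norm (pderivs vs m x) \<le> C * (1 + norm x) powr r" using b by blast
 have "compact (pderivs vs m ` cball 0 1)"
  by (intro compact_continuous_image smooth_continuous smooth_pderivs m compact_cball)
 then obtain D where D: "\<And>x. norm x \<le> 1 ==> norm (pderivs vs m x) \<le> D"
  by (meson compact_imp_bounded bounded_iff image_eqI mem_cball_0)
 define N where "N = nat \<lceil>\<bar>r\<bar>\<rceil>"
 have N: "(1 + norm x) powr r \<le> (1 + norm x) ^ N" for x :: 'a
 proof -
  have "(1 + norm x) powr r \<le> (1 + norm x) powr (real N)"
   unfolding N_def by (intro powr_mono) (linarith, simp)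
  then show ?thesis by (simp add: powr_realpow add_pos_nonneg)
 qed
 have "norm (pderivs vs m x) \<le> (\<bar>C\<bar> + \<bar>D\<bar>) * (1 + norm x) ^ N" for x
 proof (cases "1 \<le> norm x")
  case True
  have "norm (pderivs vs m x) \<le> \<bar>C\<bar> * (1 + norm x) powr r"
   by (rule order_trans[OF C[OF True]]) (auto intro: mult_right_mono)
  also have "... \<le> \<bar>C\<bar> * (1 + norm x) ^ N" by (intro mult_left_mono N) auto
  also have "... \<le> (\<bar>C\<bar> + \<bar>D\<bar>) * (1 + norm x) ^ N" by (intro mult_right_mono) auto
  finally show ?thesis .
 next
  case False
  have "norm (pderivs vs m x) \<le> \<bar>D\<bar> * 1" using D[of x] False by simp
  also have "... \<le> (\<bar>C\<bar> + \<bar>D\<bar>) * (1 + norm x) ^ N" by (intro mult_mono) auto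
  finally show ?thesis .
 qed
 then show "\<exists>C N. \<forall>x. norm (pderivs vs m x) \<le> C * (1 + norm x) ^ N" by blast
qed

lemma symb_moderate:
 assumes "symb r f" "0 < \<tau>" shows "f \<tau> \<in> moderate"
proof (rule moderate_outside[OF symb_smooth[OF assms(1)]])
 fix vs :: "'a list"
 obtain g where g: "symb (r - real (length vs)) g" "\<And>\<tau>. pderivs vs (f \<tau>) = g \<tau>" using symb_pderivs[OF assms(1)] by blast
 define e where "e = r - real (length vs)"
 obtain C where C: "0 \<le> C" "\<And>x. 1 \<le> norm x ==> norm (g \<tau> x) \<le> C * japanese x powr e"
  using symb_bound[OF g(1)] assms(2) unfolding e_def by blast
 have "norm (pderivs vs (f \<tau>) x) \<le> (C * 2 powr \<bar>e\<bar>) * (1 + norm x) powr e" if x: "1 \<le> norm x" for x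
 proof -
  have "japanese x powr e \<le> 2 powr \<bar>e\<bar> * (1 + norm x) powr e"
   using x japanese_le[of x] norm_le_japanese[of x] by (intro powr_comparable) auto
  then show ?thesis unfolding g(2) using C x mult_left_mono[of "japanese x powr e" _ C] by (fastforce simp: mult.assoc)
 qed
 then show "\<exists>C r. \<forall>x. 1 \<le> norm x --> norm (pderivs vs (f \<tau>) x) \<le> C * (1 + norm x) powr r" by blast
qed

lemma sum_abs_inner_le: "(\<Sum>b\<in>Basis. \<bar>v \<bullet> b\<bar>) \<le> real DIM('a) * norm (v::'a::euclidean_space)"
 using sum_bounded_above[of Basis "\<lambda>b. \<bar>v \<bullet> b\<bar>" "norm v"] Basis_le_norm by fastforce

lemma symb_directional:
 fixes f :: "real => 'a::euclidean_space => complex"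
 assumes f: "symb r f"
 obtains C where "0 \<le> C" "\<And>\<tau> R x u j. 0 < \<tau> ==> 2 \<le> R ==> R / 2 \<le> norm x ==> norm x \<le> 2 * R ==> norm u \<le> R ==> j \<le> N ==>
   norm (pderivs (replicate j u) (f \<tau>) x) \<le> C * R powr r"
proof -
 have "\<exists>C. 0 \<le> C \<and> (\<forall>\<tau> x. 0 < \<tau> --> 1 \<le> norm x --> norm (pderivs vs (f \<tau>) x) \<le> C * japanese x powr (r - real (length vs)))" for vs
  using symb_pderivs[OF f, of vs] symb_bound by metis
 then obtain C where C0: "\<And>vs. 0 \<le> C vs" and
  C: "\<And>vs \<tau> x. 0 < \<tau> ==> 1 \<le> norm x ==> norm (pderivs vs (f \<tau>) x) \<le> C vs * japanese x powr (r - real (length vs))" by metis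
 define A where "A = {vs. set vs \<subseteq> (Basis :: 'a set) \<and> length vs \<le> N}"
 have A: "finite A" unfolding A_def by (rule finite_lists_length_le) simp
 define D where "D = sum C A"
 have D: "0 \<le> D" unfolding D_def by (intro sum_nonneg C0)
 define n where "n = real DIM('a)"
 have n: "1 \<le> n" unfolding n_def using DIM_positive[where 'a='a] by linarith
 define K where "K = n ^ N * D * 3 powr (\<bar>r\<bar> + real N)"
 have "norm (pderivs (replicate j u) (f \<tau>) x) \<le> K * R powr r"
  if h: "0 < \<tau>" "2 \<le> R" "R / 2 \<le> norm x" "norm x \<le> 2 * R" "norm u \<le> R" "j \<le> N" for \<tau> R x u j
 proof -
  have "norm (pderivs (replicate j u) (f \<tau>) x) \<le> (n * R) ^ j * (D * japanese x powr (r - real j))"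
  proof (rule norm_pderivs_le[OF symb_smooth[OF f]])
   fix bs :: "'a list" assume bs: "set bs \<subseteq> Basis" "length bs = j"
   have "norm (pderivs bs (f \<tau>) x) \<le> C bs * japanese x powr (r - real j)"
    using C[of \<tau> x bs] h bs by simp
   also have "C bs \<le> D" unfolding D_def using bs h by (intro member_le_sum C0 A) (auto simp: A_def)
   finally show "norm (pderivs bs (f \<tau>) x) \<le> D * japanese x powr (r - real j)"
    by (simp add: mult_right_mono)
  next
   fix v assume "v \<in> set (replicate j u)"
   then have "v = u" by (simp split: if_splits)
   then show "(\<Sum>b\<in>Basis. \<bar>v \<bullet> b\<bar>) \<le> n * R"
    using order_trans[OF sum_abs_inner_le[of u] mult_left_mono[OF h(5)]] by (simp add: n_def)
  qed (use h n in auto)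
  also have "japanese x powr (r - real j) \<le> 3 powr \<bar>r - real j\<bar> * R powr (r - real j)"
   using h japanese_le[of x] norm_le_japanese[of x] by (intro powr_comparable) auto
  also have "3 powr \<bar>r - real j\<bar> \<le> 3 powr (\<bar>r\<bar> + real N)" using h by (intro powr_mono) auto
  also have "(n * R) ^ j * (D * (3 powr (\<bar>r\<bar> + real N) * R powr (r - real j))) = n ^ j * D * 3 powr (\<bar>r\<bar> + real N) * (R ^ j * R powr (r - real j))"
   by (simp add: power_mult_distrib)
  also have "R ^ j * R powr (r - real j) = R powr r" using h by (simp add: powr_realpow[symmetric] powr_add[symmetric])
  also have "n ^ j * D * 3 powr (\<bar>r\<bar> + real N) * R powr r \<le> K * R powr r"
   unfolding K_def using n h D by (intro mult_right_mono power_increasing) auto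
  finally show ?thesis using h D n by (simp add: mult_left_mono mult_right_mono)
 qed
 then show ?thesis using that[of K] D n unfolding K_def by auto
qed

text \<open>The squared modulus of the cutoff is a nonnegative bump, so the given \<open>q\<close> also supplies the profile of the
wave packet.\<close>

lemma low_freq_cutoff_bump:
 fixes q :: "'a::euclidean_space => complex"
 assumes q: "low_freq_cutoff q"
 obtains \<zeta> :: "'a => real" and b where "1 \<le> b" "smooth (\<lambda>x. complex_of_real (\<zeta> x))" "\<And>x. 0 \<le> \<zeta> x"
  "\<And>x. norm x \<le> 1 ==> \<zeta> x = 1" "\<And>x. b < norm x ==> \<zeta> x = 0" "\<And>x. b < norm x ==> q x = 0"
proof -
 have sm: "smooth q" and "compact (supp q)" and q1: "\<And>x. norm x \<le> 2 ==> q x = 1"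
  using q unfolding low_freq_cutoff_def by auto
 then obtain b where b: "\<And>x. x \<in> supp q ==> norm x \<le> b" using compact_imp_bounded bounded_iff by metis
 have q0: "q x = 0" if "max b 1 < norm x" for x
  using b[of x] that closure_subset[of "{x. q x \<noteq> 0}"] unfolding supp_def by auto
 have "smooth (\<lambda>x. q x * cnj (q x))"
  by (intro smooth_mult sm smooth_linear_image[OF bounded_linear_cnj])
 then have "smooth (\<lambda>x. complex_of_real ((norm (q x))\<^sup>2))"
  unfolding complex_norm_square .
 then show ?thesis
  using that[of "max b 1" "\<lambda>x. (norm (q x))\<^sup>2"] q0 q1 by auto
qed

lemma pderivs_zero_on_open:
 assumes "open S" "\<And>x. x \<in> S ==> f x = 0" "x \<in> S"
 shows "pderivs vs f x = 0"
 using assms(3)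
proof (induction vs arbitrary: x)
 case (Cons v vs)
 have "(pderivs vs f has_derivative (\<lambda>_. 0)) (at x)"
  using has_derivative_transform_within_open[of "\<lambda>_. 0" "\<lambda>_. 0" x UNIV S "pderivs vs f"] assms(1) Cons by simp
 then show ?case unfolding pderivs_Cons by (rule pderiv_dir_eqI)
qed (use assms in simp)

section \<open>Planks and wave packets\<close>

lemma one_plus_sum_power_le:
 fixes a :: real and f :: "'b => real"
 assumes A: "finite A" and a: "0 \<le> a" and f: "\<And>i. i \<in> A ==> 0 \<le> f i"
 shows "(1 + a + (\<Sum>i\<in>A. f i)) ^ N \<le> (2 + real (card A)) ^ N * (1 + a ^ N + (\<Sum>i\<in>A. f i ^ N))"
proof -
 define M where "M = Max (insert 1 (insert a (f ` A)))"
 have fin: "finite (insert 1 (insert a (f ` A)))" using A by simp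
 have M: "1 \<le> M" "a \<le> M" "\<And>i. i \<in> A ==> f i \<le> M" unfolding M_def by (rule Max_ge[OF fin]; simp)+
 have "(\<Sum>i\<in>A. f i) \<le> real (card A) * M" using sum_bounded_above[of A f M] M(3) by simp
 then have "1 + a + (\<Sum>i\<in>A. f i) \<le> (2 + real (card A)) * M" using M by (simp add: algebra_simps)
 then have "(1 + a + (\<Sum>i\<in>A. f i)) ^ N \<le> ((2 + real (card A)) * M) ^ N"
  using a f by (intro power_mono add_nonneg_nonneg sum_nonneg) auto
 also have "... = (2 + real (card A)) ^ N * M ^ N" by (rule power_mult_distrib)
 also have "M ^ N \<le> 1 + a ^ N + (\<Sum>i\<in>A. f i ^ N)"
 proof -
  have nn: "0 \<le> (\<Sum>i\<in>A. f i ^ N)" "0 \<le> a ^ N" using f a by (auto intro!: sum_nonneg)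
  have "M \<in> insert 1 (insert a (f ` A))" unfolding M_def using fin by (intro Max_in) auto
  then consider "M = 1" | "M = a" | i where "i \<in> A" "M = f i" by blast
  then show ?thesis
  proof cases
   case 3
   have "f i ^ N \<le> (\<Sum>i\<in>A. f i ^ N)"
    using 3(1) A f by (intro member_le_sum[of i A "\<lambda>i. f i ^ N"]) auto
   then show ?thesis using 3 nn by simp
  qed (use nn in auto)
 qed
 finally show ?thesis by (simp add: mult_left_mono)
qed

text \<open>Integration by parts: differentiating \<open>2 n\<close> times along \<open>R \<omega>\<close> or along the basis vectors stretched by
\<open>sqrt R\<close> multiplies the inverse transform by the corresponding power of a coordinate of the dilated
variable, and these coordinates control its norm.\<close>

lemma inv_fourier_decay:
 fixes G :: "'a::euclidean_space => complex"
 assumes G: "G \<in> schwartz" and \<omega>: "norm \<omega> = 1" and R: "0 < R"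
  and B0: "(\<integral>\<eta>. norm (G \<eta>) \<partial>lborel) \<le> B"
  and B1: "(\<integral>\<eta>. norm (pderivs (replicate (2 * DIM('a)) (R *\<^sub>R \<omega>)) G \<eta>) \<partial>lborel) \<le> B"
  and B2: "\<And>b. b \<in> Basis ==> (\<integral>\<eta>. norm (pderivs (replicate (2 * DIM('a)) (sqrt R *\<^sub>R b)) G \<eta>) \<partial>lborel) \<le> B"
 shows "norm (inv_fourier G z) \<le> (2 + real DIM('a)) ^ (2 * DIM('a) + 1) * B * (1 / (1 + norm (aniso \<omega> R (sqrt R) z)) ^ (2 * DIM('a)))"
proof -
 define n where "n = DIM('a)"
 let ?f = "norm (fourier G (- z))"
 have d: "\<bar>v \<bullet> z\<bar> ^ (2 * n) * ?f \<le> (\<integral>\<eta>. norm (pderivs (replicate (2 * n) v) G \<eta>) \<partial>lborel)" for v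
  using norm_fourier_le[of "pderivs (replicate (2 * n) v) G" "- z"]
  by (simp add: fourier_pderivs_replicate[OF G] norm_mult norm_power)
 have "norm (aniso \<omega> R (sqrt R) z) \<le> R * \<bar>z \<bullet> \<omega>\<bar> + sqrt R * norm (z - (z \<bullet> \<omega>) *\<^sub>R \<omega>)"
  using R by (intro norm_aniso_le \<omega>) auto
 also have "... \<le> R * \<bar>z \<bullet> \<omega>\<bar> + sqrt R * (\<Sum>b\<in>Basis. \<bar>z \<bullet> b\<bar>)"
  using R by (intro add_left_mono mult_left_mono order_trans[OF norm_perp_le(1)[OF \<omega>] norm_le_l1]) auto
 also have "... = \<bar>(R *\<^sub>R \<omega>) \<bullet> z\<bar> + (\<Sum>b\<in>Basis. \<bar>(sqrt R *\<^sub>R b) \<bullet> z\<bar>)"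
  using R by (simp add: abs_mult inner_commute sum_distrib_left)
 finally have "(1 + norm (aniso \<omega> R (sqrt R) z)) ^ (2 * n) \<le> (1 + \<bar>(R *\<^sub>R \<omega>) \<bullet> z\<bar> + (\<Sum>b\<in>Basis. \<bar>(sqrt R *\<^sub>R b) \<bullet> z\<bar>)) ^ (2 * n)"
  by (intro power_mono) auto
 also have "... \<le> (2 + real (card (Basis :: 'a set))) ^ (2 * n) * (1 + \<bar>(R *\<^sub>R \<omega>) \<bullet> z\<bar> ^ (2 * n) + (\<Sum>b\<in>Basis. \<bar>(sqrt R *\<^sub>R b) \<bullet> z\<bar> ^ (2 * n)))"
  by (rule one_plus_sum_power_le) auto
 finally have w: "(1 + norm (aniso \<omega> R (sqrt R) z)) ^ (2 * n) \<le> (2 + real n) ^ (2 * n) * (1 + \<bar>(R *\<^sub>R \<omega>) \<bullet> z\<bar> ^ (2 * n) + (\<Sum>b\<in>Basis. \<bar>(sqrt R *\<^sub>R b) \<bullet> z\<bar> ^ (2 * n)))"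
  by (simp add: n_def)
 have "(1 + norm (aniso \<omega> R (sqrt R) z)) ^ (2 * n) * ?f \<le> (2 + real n) ^ (2 * n) * (1 + \<bar>(R *\<^sub>R \<omega>) \<bullet> z\<bar> ^ (2 * n) + (\<Sum>b\<in>Basis. \<bar>(sqrt R *\<^sub>R b) \<bullet> z\<bar> ^ (2 * n))) * ?f"
  by (rule mult_right_mono[OF w]) simp
 also have "... = (2 + real n) ^ (2 * n) * (?f + \<bar>(R *\<^sub>R \<omega>) \<bullet> z\<bar> ^ (2 * n) * ?f + (\<Sum>b\<in>Basis. \<bar>(sqrt R *\<^sub>R b) \<bullet> z\<bar> ^ (2 * n) * ?f))"
  by (simp only: distrib_right sum_distrib_right mult.assoc mult_1_left)
 also have "... \<le> (2 + real n) ^ (2 * n) * (B + B + (\<Sum>b\<in>(Basis :: 'a set). B))"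
 proof (intro mult_left_mono add_mono sum_mono)
  show "?f \<le> B" using norm_fourier_le[of G "- z"] B0 by linarith
  show "\<bar>(R *\<^sub>R \<omega>) \<bullet> z\<bar> ^ (2 * n) * ?f \<le> B" by (rule order_trans[OF d B1[folded n_def]])
  show "\<bar>(sqrt R *\<^sub>R b) \<bullet> z\<bar> ^ (2 * n) * ?f \<le> B" if "b \<in> Basis" for b
   by (rule order_trans[OF d B2[OF that, folded n_def]])
 qed simp
 also have "... = (2 + real n) ^ (2 * n + 1) * B" by (simp add: n_def algebra_simps)
 finally have main: "(1 + norm (aniso \<omega> R (sqrt R) z)) ^ (2 * n) * ?f \<le> (2 + real n) ^ (2 * n + 1) * B" .
 have p: "0 < (1 + norm (aniso \<omega> R (sqrt R) z)) ^ (2 * n)" by (simp add: add_pos_nonneg)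
 have "norm (inv_fourier G z) = ?f / (2 * pi) ^ n" by (simp add: inv_fourier_eq norm_divide norm_power n_def norm_mult)
 also have "... \<le> ?f / 1"
  using pi_ge_two by (intro divide_left_mono one_le_power) auto
 also have "?f \<le> (2 + real n) ^ (2 * n + 1) * B / (1 + norm (aniso \<omega> R (sqrt R) z)) ^ (2 * n)"
  using main p by (simp only: pos_le_divide_eq mult.commute)
 finally show ?thesis by (simp add: n_def)
qed

text \<open>The profile of the wave packet on the frequency side: a bump around \<open>R \<omega>\<close> of length about \<open>R\<close> along
\<open>\<omega>\<close> and width about \<open>sqrt R\<close> across it.\<close>

definition packet :: "('a::euclidean_space => real) => 'a => real => real => 'a => complex"
 where "packet \<zeta> \<omega> \<delta> R \<eta> = of_real (\<zeta> (aniso \<omega> (1 / (\<delta> * R)) (1 / (\<delta> * sqrt R)) (\<eta> - R *\<^sub>R \<omega>)))"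

definition plank :: "'a::euclidean_space => real => real => 'a set"
 where "plank \<omega> \<sigma> R = {\<eta>. \<bar>\<eta> \<bullet> \<omega> - R\<bar> \<le> \<sigma> * R \<and> norm (\<eta> - (\<eta> \<bullet> \<omega>) *\<^sub>R \<omega>) \<le> \<sigma> * sqrt R}"

text \<open>The directions that occur in the plank deviate from \<open>\<omega>\<close> by at most the angle \<open>1 / sqrt R\<close> to which the
symbols \<open>\<phi> \<omega>\<close> are localised.\<close>

lemma plank_bounds:
 assumes \<omega>: "norm \<omega> = 1" and \<sigma>: "\<sigma> \<le> 1/8" and R: "4 \<le> R" and \<eta>: "\<eta> \<in> plank \<omega> \<sigma> R"
 shows "R / 2 \<le> norm \<eta>" "norm \<eta> \<le> 2 * R" "norm (\<eta> - R *\<^sub>R \<omega>) \<le> 2 * \<sigma> * R" "norm (sgn \<eta> - \<omega>) \<le> 1 / sqrt R"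
proof -
 define h where "h = \<eta> \<bullet> \<omega>"
 define \<nu> where "\<nu> = \<eta> - h *\<^sub>R \<omega>"
 have h: "\<bar>h - R\<bar> \<le> \<sigma> * R" and \<nu>: "norm \<nu> \<le> \<sigma> * sqrt R" using \<eta> by (auto simp: plank_def h_def \<nu>_def)
 have "0 \<le> \<sigma> * R" using h by linarith
 then have \<sigma>0: "0 \<le> \<sigma>" using R by (simp add: zero_le_mult_iff)
 have s2: "2 \<le> sqrt R" using R by (intro real_le_rsqrt) simp
 have ss: "sqrt R * sqrt R = R" using R by simp
 have "sqrt R * 1 \<le> sqrt R * sqrt R" by (rule mult_left_mono) (use s2 in linarith)+
 then have sR: "2 \<le> sqrt R" "sqrt R \<le> R" "sqrt R * sqrt R = R" "0 < sqrt R" using s2 unfolding ss by auto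
 have "\<sigma> * R \<le> 1 / 8 * R" using \<sigma> R by (intro mult_right_mono) auto
 then have \<sigma>R: "\<sigma> * R \<le> R / 8" "\<sigma> * sqrt R \<le> \<sigma> * R" using \<sigma>0 sR by (auto intro: mult_left_mono)
 have hp: "7 / 8 * R \<le> h" "h \<le> 9 / 8 * R" using h \<sigma>R by linarith+
 have hn: "h \<le> norm \<eta>" using Cauchy_Schwarz_ineq2[of \<eta> \<omega>] \<omega> by (simp add: h_def)
 have "\<eta> = h *\<^sub>R \<omega> + \<nu>" by (simp add: \<nu>_def)
 then have nh: "norm \<eta> \<le> h + norm \<nu>" using norm_triangle_ineq[of "h *\<^sub>R \<omega>" \<nu>] \<omega> hp R by simp
 show "R / 2 \<le> norm \<eta>" using hp hn R by linarith
 show "norm \<eta> \<le> 2 * R" using nh hp \<nu> \<sigma>R R by linarith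
 have "norm (\<eta> - R *\<^sub>R \<omega>) = norm ((h - R) *\<^sub>R \<omega> + \<nu>)" by (simp add: \<nu>_def algebra_simps)
 also have "... \<le> \<bar>h - R\<bar> + norm \<nu>" using norm_triangle_ineq[of "(h - R) *\<^sub>R \<omega>" \<nu>] \<omega> by simp
 finally show "norm (\<eta> - R *\<^sub>R \<omega>) \<le> 2 * \<sigma> * R" using h \<nu> \<sigma>R by linarith
 have np: "0 < norm \<eta>" using hp hn R by linarith
 have "norm (\<eta> - norm \<eta> *\<^sub>R \<omega>) = norm (\<nu> - (norm \<eta> - h) *\<^sub>R \<omega>)" by (simp add: \<nu>_def algebra_simps)
 also have "... \<le> norm \<nu> + \<bar>norm \<eta> - h\<bar>" using norm_triangle_ineq4[of \<nu> "(norm \<eta> - h) *\<^sub>R \<omega>"] \<omega> by simp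
 also have "... \<le> 2 * (\<sigma> * sqrt R)" using nh hn \<nu> by linarith
 finally have 1: "norm (\<eta> - norm \<eta> *\<^sub>R \<omega>) \<le> 2 * (\<sigma> * sqrt R)" .
 have "sgn \<eta> - \<omega> = (1 / norm \<eta>) *\<^sub>R (\<eta> - norm \<eta> *\<^sub>R \<omega>)"
  using np by (simp add: sgn_div_norm scaleR_diff_right divide_inverse_commute)
 then have "norm (sgn \<eta> - \<omega>) = norm (\<eta> - norm \<eta> *\<^sub>R \<omega>) / norm \<eta>" using np by (simp add: divide_inverse_commute)
 also have "... \<le> (2 * (\<sigma> * sqrt R)) / (R / 2)"
  using 1 hp hn R np \<sigma>0 sR by (intro frac_le) auto
 also have "... \<le> (2 * (1 / 8 * sqrt R)) / (R / 2)"
  using \<sigma> R sR by (intro divide_right_mono mult_left_mono mult_right_mono) auto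
 also have "... = 1 / 2 * (sqrt R / R)" by simp
 also have "sqrt R / R = 1 / sqrt R" using sR R by (simp add: field_simps)
 finally show "norm (sgn \<eta> - \<omega>) \<le> 1 / sqrt R" using sR by (simp add: field_simps)
qed

lemma packet_nonzero_iff_dist:
 "packet \<zeta> \<omega> \<delta> R \<eta> \<noteq> 0 ==> (\<And>x. b < norm x ==> \<zeta> x = 0) ==> norm (aniso \<omega> (1 / (\<delta> * R)) (1 / (\<delta> * sqrt R)) (\<eta> - R *\<^sub>R \<omega>)) \<le> b"
 by (rule ccontr) (simp add: packet_def not_le)

lemma aniso_ball_plank:
 assumes \<omega>: "norm \<omega> = 1" and \<delta>: "0 < \<delta>" and R: "0 < R"
  and h: "norm (aniso \<omega> (1 / (\<delta> * R)) (1 / (\<delta> * sqrt R)) (\<eta> - R *\<^sub>R \<omega>)) \<le> b"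
 shows "\<eta> \<in> plank \<omega> (\<delta> * b) R"
proof -
 have w: "\<omega> \<bullet> \<omega> = 1" using \<omega> by (simp add: dot_square_norm)
 have i: "(\<eta> - R *\<^sub>R \<omega>) \<bullet> \<omega> = \<eta> \<bullet> \<omega> - R" by (simp add: inner_diff_left w)
 have e: "\<eta> - R *\<^sub>R \<omega> - (\<eta> \<bullet> \<omega> - R) *\<^sub>R \<omega> = \<eta> - (\<eta> \<bullet> \<omega>) *\<^sub>R \<omega>" by (simp add: algebra_simps)
 have p: "0 < \<delta> * R" "0 < \<delta> * sqrt R" using \<delta> R by auto
 have "1 / (\<delta> * R) * \<bar>\<eta> \<bullet> \<omega> - R\<bar> \<le> b" "1 / (\<delta> * sqrt R) * norm (\<eta> - (\<eta> \<bullet> \<omega>) *\<^sub>R \<omega>) \<le> b"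
  using aniso_lower[OF \<omega>, of "1 / (\<delta> * R)" "1 / (\<delta> * sqrt R)" "\<eta> - R *\<^sub>R \<omega>"] h p unfolding i e by auto
 then show ?thesis using p unfolding plank_def by (simp add: divide_le_eq mult_ac)
qed

lemma wave_packets_smooth: "wave_packets \<phi> ==> norm \<omega> = 1 ==> smooth (\<phi> \<omega>)"
 unfolding wave_packets_def by auto

lemma wave_packets_support:
 "wave_packets \<phi> ==> norm \<omega> = 1 ==> \<xi> \<noteq> 0 ==> norm \<xi> powr (-1/2) < norm (sgn \<xi> - \<omega>) ==> \<phi> \<omega> \<xi> = 0"
 unfolding wave_packets_def by (metis dist_0_norm mem_sphere)

lemma wave_packets_bound:
 fixes \<phi> :: "'a::euclidean_space => 'a => complex"
 assumes "wave_packets \<phi>" "set vs \<subseteq> Basis"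
 obtains C where "0 \<le> C" "\<And>\<omega> \<xi>. norm \<omega> = 1 ==> \<xi> \<noteq> 0 ==> norm (pderivs (replicate k \<omega> @ vs) (\<phi> \<omega>) \<xi>)
     \<le> C * norm \<xi> powr ((real DIM('a) - 1) / 4 - real (length vs) / 2 - real k)"
proof -
 have "\<forall>vs k. set vs \<subseteq> (Basis :: 'a set) -->
   (\<exists>C\<ge>0. \<forall>\<omega>\<in>sphere 0 1. \<forall>\<xi>. \<xi> \<noteq> 0 -->
    norm (pderivs (replicate k \<omega> @ vs) (\<phi> \<omega>) \<xi>)
     \<le> C * norm \<xi> powr ((real DIM('a) - 1) / 4 - real (length vs) / 2 - real k))"
  using assms(1) unfolding wave_packets_def by (elim conjE)
 then show ?thesis using assms(2) that by (metis dist_0_norm mem_sphere)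
qed

lemma wave_packets_moderate:
 fixes \<phi> :: "'a::euclidean_space => 'a => complex"
 assumes \<phi>: "wave_packets \<phi>" and \<omega>: "norm \<omega> = 1" shows "\<phi> \<omega> \<in> moderate"
proof (rule moderate_outside[OF wave_packets_smooth[OF \<phi> \<omega>]])
 fix vs :: "'a list" assume vs: "set vs \<subseteq> Basis"
 define r where "r = (real DIM('a) - 1) / 4 - real (length vs) / 2"
 obtain C where C: "0 \<le> C" "\<And>\<omega> \<xi>. norm \<omega> = 1 ==> \<xi> \<noteq> 0 ==> norm (pderivs (replicate 0 \<omega> @ vs) (\<phi> \<omega>) \<xi>)
     \<le> C * norm \<xi> powr ((real DIM('a) - 1) / 4 - real (length vs) / 2 - real 0)"
  using wave_packets_bound[OF \<phi> vs] by metis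
 have "norm (pderivs vs (\<phi> \<omega>) x) \<le> (C * 2 powr \<bar>r\<bar>) * (1 + norm x) powr r" if x: "1 \<le> norm x" for x
 proof -
  have "x \<noteq> 0" using x by auto
  then have "norm (pderivs vs (\<phi> \<omega>) x) \<le> C * norm x powr r" using C(2)[OF \<omega>, of x] by (simp add: r_def)
  also have "norm x powr r \<le> 2 powr \<bar>r\<bar> * (1 + norm x) powr r"
   using x by (intro powr_comparable) auto
  finally show ?thesis using C(1) by (simp add: mult_left_mono mult.assoc)
 qed
 then show "\<exists>C r. \<forall>x. 1 \<le> norm x --> norm (pderivs vs (\<phi> \<omega>) x) \<le> C * (1 + norm x) powr r" by blast
qed

text \<open>At frequencies of size \<open>R\<close> a derivative along \<open>\<omega>\<close> gains \<open>1 / R\<close> and any other derivative gains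
\<open>1 / sqrt R\<close>. Derivatives along these rescaled directions therefore cost nothing.\<close>

lemma wave_packets_directional:
 fixes \<phi> :: "'a::euclidean_space => 'a => complex"
 assumes \<phi>: "wave_packets \<phi>"
 obtains C where "0 \<le> C" "\<And>\<omega> R x u j. norm \<omega> = 1 ==> 4 \<le> R ==> R / 2 \<le> norm x ==> norm x \<le> 2 * R ==>
   u \<in> insert (R *\<^sub>R \<omega>) ((\<lambda>b. sqrt R *\<^sub>R b) ` Basis) ==> j \<le> N ==>
   norm (pderivs (replicate j u) (\<phi> \<omega>) x) \<le> C * R powr ((real DIM('a) - 1) / 4)"
proof -
 define e where "e = (real DIM('a) - 1) / 4"
 have 1: "\<exists>C. 0 \<le> C \<and> (\<forall>\<omega> \<xi>. norm \<omega> = 1 --> \<xi> \<noteq> 0 --> norm (pderivs (replicate j \<omega>) (\<phi> \<omega>) \<xi>) \<le> C * norm \<xi> powr (e - real j))" for j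
  by (rule wave_packets_bound[OF \<phi>, of "[]" j]) (auto simp: e_def)
 have 2: "\<exists>C. 0 \<le> C \<and> (\<forall>\<omega> \<xi>. norm \<omega> = 1 --> \<xi> \<noteq> 0 --> norm (pderivs (replicate j b) (\<phi> \<omega>) \<xi>) \<le> C * norm \<xi> powr (e - real j / 2))" if "b \<in> Basis" for j b
  by (rule wave_packets_bound[OF \<phi>, of "replicate j b" 0]) (use that in \<open>auto simp: e_def split: if_splits\<close>)
 obtain C where C0: "\<And>j. 0 \<le> C j" and C: "\<And>j \<omega> \<xi>. norm \<omega> = 1 ==> \<xi> \<noteq> 0 ==> norm (pderivs (replicate j \<omega>) (\<phi> \<omega>) \<xi>) \<le> C j * norm \<xi> powr (e - real j)"
  using 1 by metis
 have "\<forall>j b. \<exists>C. 0 \<le> C \<and> (b \<in> Basis --> (\<forall>\<omega> \<xi>. norm \<omega> = 1 --> \<xi> \<noteq> 0 --> norm (pderivs (replicate j b) (\<phi> \<omega>) \<xi>) \<le> C * norm \<xi> powr (e - real j / 2)))"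
  using 2 by (metis order_refl)
 then obtain D where D0: "\<And>j b. 0 \<le> D j b" and D: "\<And>j b \<omega> \<xi>. b \<in> Basis ==> norm \<omega> = 1 ==> \<xi> \<noteq> 0 ==> norm (pderivs (replicate j b) (\<phi> \<omega>) \<xi>) \<le> D j b * norm \<xi> powr (e - real j / 2)"
  by metis
 define K where "K = (\<Sum>j\<le>N. (C j + (\<Sum>b\<in>Basis. D j b))) * 2 powr (\<bar>e\<bar> + real N)"
 have K0: "0 \<le> K" unfolding K_def using C0 D0 by (auto intro!: sum_nonneg add_nonneg_nonneg mult_nonneg_nonneg)
 have Kj: "A * 2 powr (\<bar>e\<bar> + real N) \<le> K" if "A \<le> C j + (\<Sum>b\<in>Basis. D j b)" "j \<le> N" for A j
 proof -
  have "C j + (\<Sum>b\<in>Basis. D j b) \<le> (\<Sum>j\<le>N. (C j + (\<Sum>b\<in>Basis. D j b)))"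
   using that(2) C0 D0 by (intro member_le_sum[of j "{..N}" "\<lambda>j. C j + (\<Sum>b\<in>Basis. D j b)"]) (auto intro!: sum_nonneg add_nonneg_nonneg)
  then show ?thesis unfolding K_def using that(1) by (intro mult_right_mono) auto
 qed
 have "norm (pderivs (replicate j u) (\<phi> \<omega>) x) \<le> K * R powr e"
  if h: "norm \<omega> = 1" "4 \<le> R" "R / 2 \<le> norm x" "norm x \<le> 2 * R" "u \<in> insert (R *\<^sub>R \<omega>) ((\<lambda>b. sqrt R *\<^sub>R b) ` Basis)" "j \<le> N" for \<omega> R x u j
 proof -
  have x0: "x \<noteq> 0" using h by auto
  have sm: "smooth (\<phi> \<omega>)" using wave_packets_smooth[OF \<phi> h(1)] .
  have px: "norm x powr a \<le> 2 powr (\<bar>e\<bar> + real N) * R powr a" if "\<bar>a\<bar> \<le> \<bar>e\<bar> + real N" for a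
  proof -
   have "norm x powr a \<le> 2 powr \<bar>a\<bar> * R powr a" using h by (intro powr_comparable) auto
   also have "... \<le> 2 powr (\<bar>e\<bar> + real N) * R powr a" using that by (intro mult_right_mono powr_mono) auto
   finally show ?thesis .
  qed
  from h(5) consider "u = R *\<^sub>R \<omega>" | b where "b \<in> Basis" "u = sqrt R *\<^sub>R b" by blast
  then show ?thesis
  proof cases
   case 1
   have "norm (pderivs (replicate j u) (\<phi> \<omega>) x) = R ^ j * norm (pderivs (replicate j \<omega>) (\<phi> \<omega>) x)"
    using h unfolding 1 by (simp add: pderivs_replicate_scale[OF sm])
   also have "... \<le> R ^ j * (C j * (2 powr (\<bar>e\<bar> + real N) * R powr (e - real j)))"
    using h C0 by (intro mult_left_mono order_trans[OF C[OF h(1) x0] mult_left_mono[OF px]]) auto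
   also have "... = (C j * 2 powr (\<bar>e\<bar> + real N)) * (R powr real j * R powr (e - real j))"
    using h by (simp add: powr_realpow)
   also have "R powr real j * R powr (e - real j) = R powr e" by (simp add: powr_add[symmetric])
   also have "(C j * 2 powr (\<bar>e\<bar> + real N)) * R powr e \<le> K * R powr e"
    using h D0 by (intro mult_right_mono Kj[of _ j]) (auto intro: sum_nonneg)
   finally show ?thesis .
  next
   case 2
   have "norm (pderivs (replicate j u) (\<phi> \<omega>) x) = sqrt R ^ j * norm (pderivs (replicate j b) (\<phi> \<omega>) x)"
    using h unfolding 2(2) by (simp add: pderivs_replicate_scale[OF sm])
   also have "... \<le> sqrt R ^ j * (D j b * (2 powr (\<bar>e\<bar> + real N) * R powr (e - real j / 2)))"
    using h D0 by (intro mult_left_mono order_trans[OF D[OF 2(1) h(1) x0] mult_left_mono[OF px]]) auto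
   also have "... = (D j b * 2 powr (\<bar>e\<bar> + real N)) * (sqrt R ^ j * R powr (e - real j / 2))" by simp
   also have "sqrt R ^ j = R powr (real j / 2)"
    using h by (simp add: powr_half_sqrt[symmetric] powr_realpow[symmetric] powr_powr)
   also have "R powr (real j / 2) * R powr (e - real j / 2) = R powr e" by (simp add: powr_add[symmetric])
   also have "(D j b * 2 powr (\<bar>e\<bar> + real N)) * R powr e \<le> K * R powr e"
   proof (intro mult_right_mono Kj[of _ j] h)
    have "D j b \<le> (\<Sum>b\<in>Basis. D j b)" using 2(1) D0 by (intro member_le_sum) auto
    then show "D j b \<le> C j + (\<Sum>b\<in>Basis. D j b)" using C0[of j] by linarith
   qed simp
   finally show ?thesis .
  qed
 qed
 then show ?thesis using that[OF K0] unfolding e_def by blast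
qed

section \<open>Wave packets in the spaces with finite exponent\<close>

lemma sqrt_le_self: "1 \<le> R ==> sqrt R \<le> R"
 by (intro real_le_lsqrt) (auto simp: self_le_power)

lemma epowr_ennreal: "0 \<le> a ==> epowr (ennreal a) r = ennreal (a powr r)"
 by (simp add: epowr_def)

lemma epowr_mono: "x \<le> y ==> 0 \<le> r ==> epowr x r \<le> epowr y r"
 unfolding epowr_def by (auto simp: top_unique intro!: ennreal_leI powr_mono2 enn2real_mono simp: less_top[symmetric])

lemma inv_fourier_zero [simp]: "inv_fourier (\<lambda>_. 0) = (\<lambda>_. 0)"
 by (rule ext) (simp add: inv_fourier_def)

lemma inv_fourier_modulate:
 "inv_fourier (\<lambda>\<eta>. H \<eta> * exp (- \<i> * of_real (\<eta> \<bullet> y))) x = inv_fourier H (x - y)"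
proof -
 have "iexp (x \<bullet> \<eta>) * (H \<eta> * exp (- \<i> * of_real (\<eta> \<bullet> y))) = iexp ((x - y) \<bullet> \<eta>) * H \<eta>" for \<eta>
 proof -
  have "iexp (x \<bullet> \<eta>) * exp (- \<i> * of_real (\<eta> \<bullet> y)) = iexp ((x - y) \<bullet> \<eta>)"
   unfolding exp_add[symmetric] by (simp add: inner_diff_left inner_commute[of \<eta> y] right_diff_distrib)
  then show ?thesis by (metis (no_types) mult.assoc mult.commute)
 qed
 then show ?thesis unfolding inv_fourier_def by presburger
qed

lemma Lp_norm_fun_decay:
 fixes g :: "'a::euclidean_space => complex"
 assumes p: "1 \<le> p" "p \<noteq> \<infinity>" and K: "0 \<le> K" and I: "0 \<le> I"
  and g: "\<And>x. norm (g x) \<le> K * w x" and w: "\<And>x. 0 \<le> w x" "\<And>x. w x \<le> 1"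
  and wm: "w \<in> borel_measurable borel" and wI: "(\<integral>\<^sup>+x. ennreal (w x) \<partial>lborel) \<le> ennreal I"
 shows "Lp_norm_fun p (\<lambda>x. ennreal (norm (g x))) \<le> ennreal (K * I powr (1 / enn2real p))"
proof -
 define P where "P = enn2real p"
 have P: "1 \<le> P" unfolding P_def using enn2real_mono[of 1 p] p by (simp add: less_top[symmetric])
 have "(\<integral>\<^sup>+x. epowr (ennreal (norm (g x))) P \<partial>lborel) \<le> (\<integral>\<^sup>+x. ennreal (K powr P) * ennreal (w x) \<partial>lborel)"
 proof (rule nn_integral_mono)
  fix x
  have "norm (g x) powr P \<le> (K * w x) powr P" using g P by (intro powr_mono2) auto
  also have "... = K powr P * w x powr P" using K w by (simp add: powr_mult)
  also have "w x powr P \<le> w x powr 1"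
  proof (cases "w x = 0")
   case False
   then show ?thesis using w[of x] P by (intro powr_mono') auto
  qed simp
  finally have "norm (g x) powr P \<le> K powr P * w x" using w[of x] by (simp add: mult_left_mono)
  then show "epowr (ennreal (norm (g x))) P \<le> ennreal (K powr P) * ennreal (w x)"
   using w by (simp add: epowr_ennreal ennreal_mult[symmetric] ennreal_leI)
 qed
 also have "... = ennreal (K powr P) * (\<integral>\<^sup>+x. ennreal (w x) \<partial>lborel)"
  using wm by (intro nn_integral_cmult) simp
 also have "... \<le> ennreal (K powr P) * ennreal I" by (intro mult_left_mono wI) simp
 also have "... = ennreal (K powr P * I)" using I by (simp add: ennreal_mult)
 finally have "epowr (\<integral>\<^sup>+x. epowr (ennreal (norm (g x))) P \<partial>lborel) (1 / P) \<le> epowr (ennreal (K powr P * I)) (1 / P)"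
  using P by (intro epowr_mono) auto
 also have "... = ennreal ((K powr P * I) powr (1 / P))" using I by (simp add: epowr_ennreal)
 also have "(K powr P * I) powr (1 / P) = K * I powr (1 / P)"
  using P K I by (simp add: powr_mult powr_powr)
 finally show ?thesis using p unfolding Lp_norm_fun_def P_def by simp
qed

lemma Lp_norm_distr_of_decay:
 fixes g :: "'a::euclidean_space => complex"
 assumes gm: "g \<in> borel_measurable borel" and p: "1 \<le> p" "p \<noteq> \<infinity>" and K: "0 \<le> K" and I: "0 \<le> I"
  and g: "\<And>x. norm (g x) \<le> K * w x" and w: "\<And>x. 0 \<le> w x" "\<And>x. w x \<le> 1"
  and wm: "w \<in> borel_measurable borel" and wI: "(\<integral>\<^sup>+x. ennreal (w x) \<partial>lborel) \<le> ennreal I"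
 shows "Lp_norm p (distr_of g) \<le> ennreal (K * I powr (1 / enn2real p))"
proof -
 have *: "Lp_norm_fun p (\<lambda>x. ennreal (norm (g x))) \<le> ennreal (K * I powr (1 / enn2real p))"
  by (rule Lp_norm_fun_decay[OF p K I g w wm wI])
 have "Lp_norm p (distr_of g) \<le> Lp_norm_fun p (\<lambda>x. ennreal (norm (g x)))"
  unfolding Lp_norm_def
 proof (intro Inf_lower CollectI exI[of _ g] conjI refl gm)
  show "Lp_norm_fun p (\<lambda>x. ennreal (norm (g x))) < \<infinity>" using * by (rule le_less_trans) simp
 qed
 then show ?thesis using * by order
qed

lemma Lp_norm_zero:
 assumes p: "1 \<le> p" "p \<noteq> \<infinity>" shows "Lp_norm p (distr_of (\<lambda>_::'a::euclidean_space. 0)) = 0"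
proof -
 have "Lp_norm p (distr_of (\<lambda>_::'a. 0)) \<le> ennreal (0 * 0 powr (1 / enn2real p))"
  by (rule Lp_norm_distr_of_decay[OF _ p, where w="\<lambda>_. 0"]) auto
 then show ?thesis by simp
qed

lemma heat_kernel_fourier:
 assumes \<tau>: "0 < \<tau>"
 shows "(\<lambda>y. heat_kernel \<tau> (x - y)) = fourier (\<lambda>\<eta>. iexp (\<eta> \<bullet> x) * (inverse (of_real ((2 * pi) ^ DIM('a))) * gauss \<tau> (\<eta>::'a::euclidean_space)))"
proof
 fix y :: 'a
 have "inverse (of_real ((2 * pi) ^ DIM('a))) * (complex_of_real ((2 * pi) ^ DIM('a)) * t) = t" for t :: complex
  by (simp add: power_mult_distrib field_simps)
 then show "heat_kernel \<tau> (x - y) = fourier (\<lambda>\<eta>. iexp (\<eta> \<bullet> x) * (inverse (of_real ((2 * pi) ^ DIM('a))) * gauss \<tau> \<eta>)) y"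
  unfolding fourier_modulate fourier_cmult fourier_gauss_heat[OF \<tau>]
  by (simp only: heat_kernel_def norm_minus_commute)
qed

lemma H1_norm_distr_of:
 fixes G :: "'a::euclidean_space => complex"
 assumes G: "G \<in> schwartz"
 shows "H1_norm (distr_of (inv_fourier G)) =
  (\<integral>\<^sup>+x. (SUP \<tau>\<in>{0<..}. ennreal (norm (inv_fourier (\<lambda>\<eta>. G \<eta> * gauss \<tau> \<eta>) x))) \<partial>lborel)"
proof -
 have "distr_of (inv_fourier G) (\<lambda>y. heat_kernel \<tau> (x - y)) = inv_fourier (\<lambda>\<eta>. G \<eta> * gauss \<tau> \<eta>) x" if \<tau>: "0 < \<tau>" for \<tau> and x :: 'a
 proof -
  let ?c = "complex_of_real ((2 * pi) ^ DIM('a))"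
  let ?H = "\<lambda>\<eta>. iexp (\<eta> \<bullet> x) * (inverse ?c * gauss \<tau> \<eta>)"
  have H: "?H \<in> schwartz" by (intro schwartz_wave schwartz_cmult schwartz_gauss \<tau>)
  have e: "(\<lambda>y. heat_kernel \<tau> (x - y)) = fourier ?H" using \<tau> by (rule heat_kernel_fourier)
  then have "(\<lambda>y. heat_kernel \<tau> (x - y)) \<in> schwartz" using schwartz_fourier[OF H] by simp
  then have "distr_of (inv_fourier G) (\<lambda>y. heat_kernel \<tau> (x - y)) = (\<integral>y. inv_fourier G y * fourier ?H y \<partial>lborel)"
   unfolding distr_of_def e by simp
  also have "... = (\<integral>\<eta>. G \<eta> * ?H \<eta> \<partial>lborel)" by (rule integral_inv_fourier_fourier[OF G H])
  also have "... = (\<integral>\<eta>. inverse ?c * (iexp (x \<bullet> \<eta>) * (G \<eta> * gauss \<tau> \<eta>)) \<partial>lborel)"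
   by (simp add: inner_commute mult_ac)
  also have "... = inv_fourier (\<lambda>\<eta>. G \<eta> * gauss \<tau> \<eta>) x"
   unfolding inv_fourier_def by (simp add: divide_inverse mult.commute)
  finally show ?thesis .
 qed
 then show ?thesis unfolding H1_norm_def by (intro nn_integral_cong SUP_cong) auto
qed

lemma integral_norm_le_measure:
 fixes g :: "'a::euclidean_space => complex"
 assumes g: "g \<in> schwartz" and K: "K \<in> sets borel" "emeasure lborel K = ennreal V" and V: "0 \<le> V"
  and 0: "\<And>x. x \<notin> K ==> g x = 0" and M: "\<And>x. x \<in> K ==> norm (g x) \<le> M"
 shows "(\<integral>x. norm (g x) \<partial>lborel) \<le> M * V"
proof -
 have "(\<integral>x. norm (g x) \<partial>lborel) \<le> (\<integral>x. M * indicat_real K x \<partial>lborel)"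
 proof (rule integral_mono)
  show "integrable lborel (\<lambda>x. norm (g x))" using schwartz_integrable[OF g] by simp
  show "integrable lborel (\<lambda>x. M * indicat_real K x)" using K by (intro integrable_mult_right integrable_real_indicator) auto
  show "norm (g x) \<le> M * indicat_real K x" for x using 0[of x] M[of x] by (cases "x \<in> K") auto
 qed
 also have "... = M * V" using K V by (simp add: measure_def)
 finally show ?thesis .
qed

lemma aniso_ball_measure:
 fixes \<omega>0 c :: "real^'n"
 assumes \<omega>0: "norm \<omega>0 = 1" and \<delta>: "0 < \<delta>" and R: "0 < R"
 shows "emeasure lborel {\<eta>. norm (aniso \<omega>0 (1 / (\<delta> * R)) (1 / (\<delta> * sqrt R)) (\<eta> - c)) \<le> b}
  = ennreal (\<delta> ^ CARD('n) * measure lborel (cball (0::real^'n) b) * R powr ((real CARD('n) + 1) / 2))"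
proof -
 define k where "k = CARD('n) - 1"
 have k: "CARD('n) = Suc k" unfolding k_def by simp
 have "1 / (1 / (\<delta> * R) * (1 / (\<delta> * sqrt R)) ^ k) = \<delta> ^ Suc k * (R * sqrt R ^ k)"
  by (simp add: power_divide power_mult_distrib)
 also have "R * sqrt R ^ k = R powr 1 * R powr (real k / 2)"
  using R by (simp add: powr_half_sqrt[symmetric] powr_realpow[symmetric] powr_powr)
 also have "... = R powr ((real CARD('n) + 1) / 2)" unfolding powr_add[symmetric] k by (simp add: field_simps)
 finally have e: "1 / (1 / (\<delta> * R) * (1 / (\<delta> * sqrt R)) ^ (CARD('n) - 1)) = \<delta> ^ CARD('n) * R powr ((real CARD('n) + 1) / 2)"
  by (simp add: k)
 have "emeasure lborel (cball (0::real^'n) b) = ennreal (measure lborel (cball (0::real^'n) b))"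
  by (rule emeasure_eq_ennreal_measure) (use emeasure_bounded_finite[of "cball (0::real^'n) b"] in simp)
 moreover have p: "0 < 1 / (\<delta> * R)" "0 < 1 / (\<delta> * sqrt R)" using R \<delta> by auto
 ultimately show ?thesis
  unfolding emeasure_aniso_ball[OF \<omega>0 p] e using \<delta> by (simp add: ennreal_mult[symmetric] mult_ac)
qed

context
 fixes \<zeta> :: "real^'n => real" and b \<delta> :: real and \<omega>0 :: "real^'n"
  and \<phi> :: "real^'n => real^'n => complex"
 assumes b: "1 \<le> b" and \<zeta>: "smooth (\<lambda>x. complex_of_real (\<zeta> x))" and \<zeta>0: "\<And>x. b < norm x ==> \<zeta> x = 0"
  and \<delta>: "0 < \<delta>" "\<delta> * b \<le> 1/8" and \<omega>0: "norm \<omega>0 = 1" and \<phi>: "wave_packets \<phi>"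
begin

lemma packet_plank:
 assumes "4 \<le> R" "packet \<zeta> \<omega>0 \<delta> R \<eta> \<noteq> 0" shows "\<eta> \<in> plank \<omega>0 (\<delta> * b) R"
 by (rule aniso_ball_plank[OF \<omega>0 \<delta>(1) _ packet_nonzero_iff_dist[OF assms(2) \<zeta>0]]) (use assms in auto)

lemma packet_smooth: "smooth (packet \<zeta> \<omega>0 \<delta> R)"
proof -
 have "smooth (\<lambda>\<eta>. complex_of_real (\<zeta> (aniso \<omega>0 (1 / (\<delta> * R)) (1 / (\<delta> * sqrt R)) \<eta> + (- aniso \<omega>0 (1 / (\<delta> * R)) (1 / (\<delta> * sqrt R)) (R *\<^sub>R \<omega>0)))))"
  by (rule smooth_affine[OF linear_aniso \<zeta>])
 then show ?thesis unfolding packet_def[abs_def] aniso_diff by simp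
qed

lemma packet_schwartz:
 assumes R: "4 \<le> R" shows "packet \<zeta> \<omega>0 \<delta> R \<in> schwartz"
proof (rule schwartz_compact_support[OF packet_smooth])
 fix \<eta> :: "real^'n" assume "2 * R < norm \<eta>"
 then show "packet \<zeta> \<omega>0 \<delta> R \<eta> = 0"
  using plank_bounds(2)[OF \<omega>0 \<delta>(2) R packet_plank[OF R]] by fastforce
qed

text \<open>The rescaled directions are adapted to \<open>\<omega>\<close>, the packet to \<open>\<omega>0\<close>. They are compatible when the two differ by \<open>O(1 / sqrt R)\<close>:
then \<open>R \<omega>\<close> has components of size \<open>R\<close> along \<open>\<omega>0\<close> and of size \<open>sqrt R\<close> across it.\<close>

lemma packet_directional:
 obtains C where "0 \<le> C" "\<And>\<omega> R u j \<eta>. norm \<omega> = 1 ==> 4 \<le> R ==> norm (\<omega> - \<omega>0) \<le> 3 / sqrt R ==>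
   u \<in> insert (R *\<^sub>R \<omega>) ((\<lambda>b. sqrt R *\<^sub>R b) ` Basis) ==> j \<le> N ==>
   norm (pderivs (replicate j u) (packet \<zeta> \<omega>0 \<delta> R) \<eta>) \<le> C"
proof -
 let ?Z = "\<lambda>x. complex_of_real (\<zeta> x)"
 have "\<exists>C. 0 \<le> C \<and> (\<forall>x. norm (pderivs vs ?Z x) \<le> C)" for vs
 proof -
  have "?Z \<in> schwartz" by (rule schwartz_compact_support[OF \<zeta>, of b]) (simp add: \<zeta>0)
  then obtain C where "0 \<le> C" "\<And>x. (1 + norm x) ^ 0 * norm (pderivs vs ?Z x) \<le> C"
   using schwartz_bound[OF schwartz_pderivs] by blast
  then show ?thesis by auto
 qed
 then obtain C where C0: "\<And>vs. 0 \<le> C vs" and C: "\<And>vs x. norm (pderivs vs ?Z x) \<le> C vs" by metis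
 define A where "A = {vs. set vs \<subseteq> (Basis :: (real^'n) set) \<and> length vs \<le> N}"
 have A: "finite A" unfolding A_def by (rule finite_lists_length_le) simp
 define D where "D = sum C A"
 have D: "0 \<le> D" unfolding D_def by (intro sum_nonneg C0)
 define m where "m = real CARD('n) * (4 / \<delta>)"
 have m: "0 \<le> m" unfolding m_def using \<delta> by simp
 define K where "K = (\<Sum>j\<le>N. m ^ j) * D"
 have "norm (pderivs (replicate j u) (packet \<zeta> \<omega>0 \<delta> R) \<eta>) \<le> K"
  if h: "norm \<omega> = 1" "4 \<le> R" "norm (\<omega> - \<omega>0) \<le> 3 / sqrt R" "u \<in> insert (R *\<^sub>R \<omega>) ((\<lambda>b. sqrt R *\<^sub>R b) ` Basis)" "j \<le> N"
  for \<omega> R u j and \<eta> :: "real^'n"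
 proof -
  define L where "L = aniso \<omega>0 (1 / (\<delta> * R)) (1 / (\<delta> * sqrt R))"
  have s2: "2 \<le> sqrt R" using h(2) by (intro real_le_rsqrt) simp
  have ss: "sqrt R * sqrt R = R" using h(2) by simp
  have sR: "0 < sqrt R" "sqrt R \<le> R" using s2 sqrt_le_self[of R] h(2) by auto
  have Lu: "norm (L u) \<le> 4 / \<delta>"
  proof -
   have "norm (L u) \<le> 1 / (\<delta> * R) * \<bar>u \<bullet> \<omega>0\<bar> + 1 / (\<delta> * sqrt R) * norm (u - (u \<bullet> \<omega>0) *\<^sub>R \<omega>0)"
    unfolding L_def using \<delta> h sR by (intro norm_aniso_le \<omega>0) auto
   also have "... \<le> 1 / (\<delta> * R) * R + 1 / (\<delta> * sqrt R) * (3 * sqrt R)"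
   proof (intro add_mono mult_left_mono)
    from h(4) consider "u = R *\<^sub>R \<omega>" | c where "c \<in> Basis" "u = sqrt R *\<^sub>R c" by blast
    then have "\<bar>u \<bullet> \<omega>0\<bar> \<le> R \<and> norm (u - (u \<bullet> \<omega>0) *\<^sub>R \<omega>0) \<le> 3 * sqrt R"
    proof cases
     case 1
     have "norm (u - (u \<bullet> \<omega>0) *\<^sub>R \<omega>0) \<le> norm (u - R *\<^sub>R \<omega>0)" by (rule norm_perp_le(2)[OF \<omega>0])
     also have "u - R *\<^sub>R \<omega>0 = R *\<^sub>R (\<omega> - \<omega>0)" by (simp add: 1 algebra_simps)
     also have "norm ... \<le> R * (3 / sqrt R)" using mult_left_mono[OF h(3), of R] h(2) by simp
     also have "... = 3 * sqrt R" using sR ss by (simp add: field_simps)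
     finally show ?thesis using Cauchy_Schwarz_ineq2[of u \<omega>0] h \<omega>0 by (simp add: 1)
    next
     case 2
     have nu: "norm u = sqrt R" using 2 sR by simp
     have "norm (u - (u \<bullet> \<omega>0) *\<^sub>R \<omega>0) \<le> sqrt R" using norm_perp_le(1)[OF \<omega>0, of u] nu by simp
     moreover have "\<bar>u \<bullet> \<omega>0\<bar> \<le> sqrt R" using Cauchy_Schwarz_ineq2[of u \<omega>0] nu \<omega>0 by simp
     ultimately show ?thesis using sR by linarith
    qed
    then show "\<bar>u \<bullet> \<omega>0\<bar> \<le> R" "norm (u - (u \<bullet> \<omega>0) *\<^sub>R \<omega>0) \<le> 3 * sqrt R" by auto
   qed (use \<delta> h sR in auto)
   also have "... = 4 / \<delta>" using \<delta> h sR by (simp add: field_simps)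
   finally show ?thesis .
  qed
  have eq: "packet \<zeta> \<omega>0 \<delta> R = (\<lambda>\<eta>. ?Z (L \<eta> + (- L (R *\<^sub>R \<omega>0))))"
   unfolding packet_def[abs_def] aniso_diff L_def by simp
  have "pderivs (replicate j u) (packet \<zeta> \<omega>0 \<delta> R) \<eta> = pderivs (replicate j (L u)) ?Z (L \<eta> + (- L (R *\<^sub>R \<omega>0)))"
   unfolding eq pderivs_affine[OF linear_aniso[of \<omega>0 "1 / (\<delta> * R)" "1 / (\<delta> * sqrt R)", folded L_def] \<zeta>] by simp
  also have "norm ... \<le> m ^ j * D"
  proof (rule norm_pderivs_le[OF \<zeta>])
   fix bs :: "(real^'n) list" assume bs: "set bs \<subseteq> Basis" "length bs = j"
   have "C bs \<le> D" unfolding D_def using bs h by (intro member_le_sum C0 A) (auto simp: A_def)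
   then show "norm (pderivs bs ?Z (L \<eta> + (- L (R *\<^sub>R \<omega>0)))) \<le> D" by (rule order_trans[OF C])
  next
   fix v assume "v \<in> set (replicate j (L u))"
   then have "v = L u" by (simp split: if_splits)
   then show "(\<Sum>b\<in>Basis. \<bar>v \<bullet> b\<bar>) \<le> m"
    using order_trans[OF sum_abs_inner_le[of "L u"] mult_left_mono[OF Lu]] by (simp add: m_def)
  qed (use m in auto)
  also have "m ^ j * D \<le> K"
   unfolding K_def using h m D by (intro mult_right_mono member_le_sum[of j "{..N}" "\<lambda>j. m ^ j"]) auto
  finally show ?thesis .
 qed
 moreover have "0 \<le> K" unfolding K_def using m D by (intro mult_nonneg_nonneg sum_nonneg) auto
 ultimately show ?thesis using that by blast
qed

text \<open>For \<open>\<omega>\<close> outside the cap around \<open>\<omega>0\<close> the supports of the two localisations are disjoint. Inside it, all rescaled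
derivatives of the product are bounded by its size, so \<open>inv_fourier_decay\<close> applies, and the measure of the
plank contributes the power \<open>(n + 1) / 2\<close>.\<close>

lemma packet_multiplier_decay:
 assumes f: "symb r f"
 obtains C where "0 \<le> C" "\<And>\<omega> R \<tau> z. norm \<omega> = 1 ==> 4 \<le> R ==> 0 < \<tau> ==>
   norm (inv_fourier (\<lambda>\<eta>. \<phi> \<omega> \<eta> * (f \<tau> \<eta> * packet \<zeta> \<omega>0 \<delta> R \<eta>)) z) \<le>
    (if norm (\<omega> - \<omega>0) \<le> 3 / sqrt R then C * R powr ((real CARD('n) - 1) / 4 + r + (real CARD('n) + 1) / 2)
     * (1 / (1 + norm (aniso \<omega> R (sqrt R) z)) ^ (2 * CARD('n))) else 0)"
proof -
 define N where "N = 2 * CARD('n)"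
 define e where "e = (real CARD('n) - 1) / 4"
 obtain C1 where C1: "0 \<le> C1" "\<And>\<omega> R x u j. norm \<omega> = 1 ==> 4 \<le> R ==> R / 2 \<le> norm x ==> norm x \<le> 2 * R ==>
   u \<in> insert (R *\<^sub>R \<omega>) ((\<lambda>b. sqrt R *\<^sub>R b) ` Basis) ==> j \<le> N ==>
   norm (pderivs (replicate j u) (\<phi> \<omega>) x) \<le> C1 * R powr e"
  using wave_packets_directional[OF \<phi>, of N] unfolding e_def by (simp, metis)
 obtain C2 where C2: "0 \<le> C2" "\<And>\<tau> R x u j. 0 < \<tau> ==> 2 \<le> R ==> R / 2 \<le> norm x ==> norm x \<le> 2 * R ==> norm u \<le> R ==> j \<le> N ==>
   norm (pderivs (replicate j u) (f \<tau>) x) \<le> C2 * R powr r"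
  using symb_directional[OF f, of N] by metis
 obtain C3 where C3: "0 \<le> C3" "\<And>\<omega> R u j \<eta>. norm \<omega> = 1 ==> 4 \<le> R ==> norm (\<omega> - \<omega>0) \<le> 3 / sqrt R ==>
   u \<in> insert (R *\<^sub>R \<omega>) ((\<lambda>b. sqrt R *\<^sub>R b) ` Basis) ==> j \<le> N ==>
   norm (pderivs (replicate j u) (packet \<zeta> \<omega>0 \<delta> R) \<eta>) \<le> C3"
  using packet_directional[of N] by metis
 define V where "V = \<delta> ^ CARD('n) * measure lborel (cball (0::real^'n) b)"
 have V: "0 \<le> V" unfolding V_def using \<delta> by simp
 define M where "M = 4 ^ N * (C1 * (C2 * C3))"
 define C where "C = (2 + real CARD('n)) ^ (N + 1) * (M * V)"
 have M: "0 \<le> M" unfolding M_def using C1 C2 C3 by simp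
 have "norm (inv_fourier (\<lambda>\<eta>. \<phi> \<omega> \<eta> * (f \<tau> \<eta> * packet \<zeta> \<omega>0 \<delta> R \<eta>)) z) \<le>
    (if norm (\<omega> - \<omega>0) \<le> 3 / sqrt R then C * R powr (e + r + (real CARD('n) + 1) / 2)
     * (1 / (1 + norm (aniso \<omega> R (sqrt R) z)) ^ N) else 0)" (is "norm (inv_fourier ?G z) \<le> _")
  if \<omega>: "norm \<omega> = 1" and R: "4 \<le> R" and \<tau>: "0 < \<tau>" for \<omega> R \<tau> and z :: "real^'n"
 proof (cases "norm (\<omega> - \<omega>0) \<le> 3 / sqrt R")
  case False
  have "?G \<eta> = 0" for \<eta>
  proof (rule ccontr)
   assume "?G \<eta> \<noteq> 0"
   then have ne: "\<phi> \<omega> \<eta> \<noteq> 0" "packet \<zeta> \<omega>0 \<delta> R \<eta> \<noteq> 0" by auto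
   note pl = plank_bounds[OF \<omega>0 \<delta>(2) R packet_plank[OF R ne(2)]]
   have "\<eta> \<noteq> 0" using pl(1) R by auto
   then have "norm (sgn \<eta> - \<omega>) \<le> norm \<eta> powr (-1/2)"
    using wave_packets_support[OF \<phi> \<omega>, of \<eta>] ne(1) by (meson not_le)
   also have "... \<le> (R / 4) powr (-1/2)" using pl(1) R by (intro powr_mono2') auto
   also have "... = 2 / sqrt R" using R by (simp add: powr_minus_divide powr_half_sqrt real_sqrt_divide)
   finally have "norm (sgn \<eta> - \<omega>) \<le> 2 / sqrt R" .
   moreover have "norm (\<omega> - \<omega>0) \<le> norm (sgn \<eta> - \<omega>0) + norm (sgn \<eta> - \<omega>)"
    using norm_triangle_ineq4[of "sgn \<eta> - \<omega>0" "sgn \<eta> - \<omega>"] by simp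
   ultimately have "norm (\<omega> - \<omega>0) \<le> 3 / sqrt R" using pl(4) by (simp add: field_simps)
   then show False using False by simp
  qed
  then have "?G = (\<lambda>_. 0)" by auto
  then show ?thesis using False by simp
 next
  case True
  define K where "K = {\<eta>. norm (aniso \<omega>0 (1 / (\<delta> * R)) (1 / (\<delta> * sqrt R)) (\<eta> - R *\<^sub>R \<omega>0)) \<le> b}"
  have Kc: "closed K"
  proof -
   have "continuous_on UNIV (\<lambda>\<eta>. norm (aniso \<omega>0 (1 / (\<delta> * R)) (1 / (\<delta> * sqrt R)) (\<eta> - R *\<^sub>R \<omega>0)))"
    unfolding aniso_def by (intro continuous_intros)
   then show ?thesis unfolding K_def using closed_Collect_le[of _ "\<lambda>_. b"] by simp
  qed
  have Kb: "K \<in> sets borel" using Kc by simp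
  have KV: "emeasure lborel K = ennreal (V * R powr ((real CARD('n) + 1) / 2))"
   unfolding K_def V_def using aniso_ball_measure[OF \<omega>0 \<delta>(1)] R by simp
  have KP: "\<eta> \<in> plank \<omega>0 (\<delta> * b) R" if "\<eta> \<in> K" for \<eta>
   using that aniso_ball_plank[OF \<omega>0 \<delta>(1), of R \<eta> b] R unfolding K_def by simp
  have pz: "packet \<zeta> \<omega>0 \<delta> R \<eta> = 0" if "\<eta> \<notin> K" for \<eta>
   using that packet_nonzero_iff_dist[of \<zeta> \<omega>0 \<delta> R \<eta> b] \<zeta>0 unfolding K_def by blast
  have sm\<phi>: "smooth (\<phi> \<omega>)" and smf: "smooth (f \<tau>)" and smp: "smooth (packet \<zeta> \<omega>0 \<delta> R)"
   using wave_packets_smooth[OF \<phi> \<omega>] symb_smooth[OF f] packet_smooth by auto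
  have G: "?G \<in> schwartz"
   by (intro schwartz_mult wave_packets_moderate \<phi> \<omega> symb_moderate[OF f \<tau>] packet_schwartz R)
  have s2: "2 \<le> sqrt R" using R by (intro real_le_rsqrt) simp
  have sR: "sqrt R \<le> R" using sqrt_le_self[of R] R by auto
  have int: "(\<integral>\<eta>. norm (pderivs (replicate j u) ?G \<eta>) \<partial>lborel) \<le> (M * R powr (e + r)) * (V * R powr ((real CARD('n) + 1) / 2))"
   if u: "u \<in> insert (R *\<^sub>R \<omega>) ((\<lambda>b. sqrt R *\<^sub>R b) ` Basis)" and j: "j \<le> N" for u j
  proof (rule integral_norm_le_measure[OF schwartz_pderivs[OF G] Kb KV])
   show "0 \<le> V * R powr ((real CARD('n) + 1) / 2)" using V by simp
   show "pderivs (replicate j u) ?G \<eta> = 0" if "\<eta> \<notin> K" for \<eta>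
    by (rule pderivs_zero_on_open[of "- K"]) (use Kc pz that in auto)
   fix \<eta> assume \<eta>: "\<eta> \<in> K"
   note pl = plank_bounds[OF \<omega>0 \<delta>(2) R KP[OF \<eta>]]
   have uR: "norm u \<le> R" using u \<omega> R s2 sR by auto
   have "norm (pderivs (replicate j u) ?G \<eta>) \<le> 2 ^ j * ((C1 * R powr e) * (2 ^ j * ((C2 * R powr r) * C3)))"
   proof (rule pderivs_replicate_mult_le[OF sm\<phi> smooth_mult[OF smf smp]])
    fix i assume i: "i \<le> j"
    show "norm (pderivs (replicate i u) (\<phi> \<omega>) \<eta>) \<le> C1 * R powr e"
     by (rule C1(2)) (use \<omega> R pl u i j in auto)
    have "norm (pderivs (replicate i u) (\<lambda>\<eta>. f \<tau> \<eta> * packet \<zeta> \<omega>0 \<delta> R \<eta>) \<eta>) \<le> 2 ^ i * ((C2 * R powr r) * C3)"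
    proof (rule pderivs_replicate_mult_le[OF smf smp])
     fix l assume "l \<le> i"
     then have l: "l \<le> N" using i j by linarith
     show "norm (pderivs (replicate l u) (f \<tau>) \<eta>) \<le> C2 * R powr r"
      by (rule C2(2)) (use \<tau> R pl uR l in auto)
     show "norm (pderivs (replicate l u) (packet \<zeta> \<omega>0 \<delta> R) \<eta>) \<le> C3"
      by (rule C3(2)[OF \<omega> R True u l])
    qed
    also have "... \<le> 2 ^ j * ((C2 * R powr r) * C3)"
     using i C2 C3 by (intro mult_right_mono power_increasing) auto
    finally show "norm (pderivs (replicate i u) (\<lambda>\<eta>. f \<tau> \<eta> * packet \<zeta> \<omega>0 \<delta> R \<eta>) \<eta>) \<le> 2 ^ j * ((C2 * R powr r) * C3)" .
   qed
   also have "... = 4 ^ j * (C1 * (C2 * C3)) * R powr (e + r)"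
    by (simp add: powr_add power_mult_distrib[symmetric] mult_ac)
   also have "... \<le> M * R powr (e + r)"
    unfolding M_def using j C1 C2 C3 by (intro mult_right_mono power_increasing) auto
   finally show "norm (pderivs (replicate j u) ?G \<eta>) \<le> M * R powr (e + r)" .
  qed
  have "norm (inv_fourier ?G z) \<le> (2 + real DIM(real^'n)) ^ (2 * DIM(real^'n) + 1) * ((M * R powr (e + r)) * (V * R powr ((real CARD('n) + 1) / 2)))
    * (1 / (1 + norm (aniso \<omega> R (sqrt R) z)) ^ (2 * DIM(real^'n)))"
  proof (rule inv_fourier_decay[OF G \<omega>])
   show "(\<integral>\<eta>. norm (?G \<eta>) \<partial>lborel) \<le> (M * R powr (e + r)) * (V * R powr ((real CARD('n) + 1) / 2))"
    using int[of "R *\<^sub>R \<omega>" 0] by simp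
   show "(\<integral>\<eta>. norm (pderivs (replicate (2 * DIM(real^'n)) (R *\<^sub>R \<omega>)) ?G \<eta>) \<partial>lborel) \<le> (M * R powr (e + r)) * (V * R powr ((real CARD('n) + 1) / 2))"
    by (rule int) (auto simp: N_def)
   show "(\<integral>\<eta>. norm (pderivs (replicate (2 * DIM(real^'n)) (sqrt R *\<^sub>R c)) ?G \<eta>) \<partial>lborel) \<le> (M * R powr (e + r)) * (V * R powr ((real CARD('n) + 1) / 2))"
    if "c \<in> Basis" for c by (rule int) (use that in \<open>auto simp: N_def\<close>)
  qed (use R in simp)
  also have "... = C * R powr (e + r + (real CARD('n) + 1) / 2) * (1 / (1 + norm (aniso \<omega> R (sqrt R) z)) ^ N)"
   by (simp add: C_def N_def powr_add mult_ac)
  finally show ?thesis using True by simp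
 qed
 moreover have "0 \<le> C" unfolding C_def using M V by simp
 ultimately show ?thesis using that unfolding e_def N_def by blast
qed

end

lemma sphere_measure_space [simp]: "space sphere_measure = sphere 0 1"
 by (simp add: sphere_measure_def space_scale_measure space_restrict_space)

lemma sphere_measure_sets: "sets sphere_measure = sets (restrict_space borel (sphere 0 1))"
 by (simp add: sphere_measure_def)

lemma sphere_cap_sets: "{\<theta> \<in> sphere 0 1. norm (\<theta> - \<omega>) \<le> \<rho>} \<in> sets sphere_measure"
proof -
 have "{\<theta> \<in> sphere 0 1. norm (\<theta> - \<omega>) \<le> \<rho>} = sphere 0 1 \<inter> cball \<omega> \<rho>" by (auto simp: dist_norm norm_minus_commute)
 then show ?thesis unfolding sphere_measure_sets sets_restrict_space by auto
qed

lemma emeasure_sphere_cap_sqrt: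
 obtains C where "0 < C" "\<And>(\<omega>::real^'n) R c. norm \<omega> = 1 ==> 0 < R ==> 0 < c ==>
  emeasure sphere_measure {\<theta> \<in> sphere 0 1. norm (\<theta> - \<omega>) \<le> c / sqrt R} \<le> ennreal (C * c ^ (CARD('n) - 1) * R powr (- (real CARD('n) - 1) / 2))"
proof -
 define k where "k = CARD('n) - 1"
 have k: "real k = real CARD('n) - 1" unfolding k_def by (simp add: of_nat_diff)
 define m where "m = measure lborel (cball (0 :: real^'n) 2)"
 have m: "emeasure lborel (cball (0 :: real^'n) 2) = ennreal m"
  unfolding m_def by (rule emeasure_eq_ennreal_measure) (use emeasure_bounded_finite[of "cball (0::real^'n) 2"] in simp)
 have m0: "0 \<le> m" unfolding m_def by simp
 define C where "C = real CARD('n) * (m + 1)"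
 have C: "0 < C" unfolding C_def using m0 by simp
 have "emeasure sphere_measure {\<theta> \<in> sphere 0 1. norm (\<theta> - \<omega>) \<le> c / sqrt R} \<le> ennreal (C * c ^ (CARD('n) - 1) * R powr (- (real CARD('n) - 1) / 2))"
  if \<omega>: "norm \<omega> = 1" and R: "0 < R" and c: "0 < c" for \<omega> :: "real^'n" and R c
 proof -
  have "emeasure sphere_measure {\<theta> \<in> sphere 0 1. norm (\<theta> - \<omega>) \<le> c / sqrt R}
   \<le> ennreal (real CARD('n) * (c / sqrt R) ^ k) * ennreal m"
   unfolding k_def m[symmetric] using R c by (intro emeasure_sphere_cap \<omega>) auto
  also have "... = ennreal (real CARD('n) * (c / sqrt R) ^ k * m)" using R c m0 by (simp add: ennreal_mult)
  also have "... \<le> ennreal (C * c ^ k * R powr (- real k / 2))"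
  proof (rule ennreal_leI)
   have "R powr (- real k / 2) = 1 / sqrt R ^ k"
    using R by (simp add: powr_minus_divide powr_half_sqrt[symmetric] powr_realpow[symmetric] powr_powr)
   then have "real CARD('n) * (c / sqrt R) ^ k * m = real CARD('n) * m * c ^ k * R powr (- real k / 2)"
    by (simp add: power_divide)
   also have "... \<le> C * c ^ k * R powr (- real k / 2)"
    unfolding C_def using c m0 by (intro mult_right_mono mult_left_mono) auto
   finally show "real CARD('n) * (c / sqrt R) ^ k * m \<le> C * c ^ k * R powr (- real k / 2)" .
  qed
  finally show ?thesis unfolding k_def[symmetric] k .
 qed
 then show ?thesis using that C by blast
qed

lemma nn_integral_aniso_decay_sqrt:
 fixes \<omega> y :: "real^'n"
 assumes \<omega>: "norm \<omega> = 1" and R: "0 < R"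
 shows "(\<integral>\<^sup>+x. ennreal (1 / (1 + norm (aniso \<omega> R (sqrt R) (x - y))) ^ (2 * CARD('n))) \<partial>lborel) =
  ennreal ((\<integral>(x::real^'n). 1 / (1 + norm x) ^ (2 * CARD('n)) \<partial>lborel) * R powr (- (real CARD('n) + 1) / 2))"
proof -
 define k where "k = CARD('n) - 1"
 have k: "real k = real CARD('n) - 1" unfolding k_def by (simp add: of_nat_diff)
 have "R * sqrt R ^ k = R powr 1 * R powr (real k / 2)"
  using R by (simp add: powr_half_sqrt[symmetric] powr_realpow[symmetric] powr_powr)
 also have "... = R powr ((real CARD('n) + 1) / 2)" unfolding powr_add[symmetric] k by (simp add: field_simps)
 finally have "1 / (R * sqrt R ^ k) = R powr (- ((real CARD('n) + 1) / 2))"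
  by (simp add: powr_minus_divide)
 then have e: "1 / (R * sqrt R ^ (CARD('n) - 1)) = R powr (- (real CARD('n) + 1) / 2)"
  by (simp only: k_def minus_divide_left)
 show ?thesis
  using nn_integral_aniso_decay[OF \<omega>, of R "sqrt R" y] R unfolding e by (simp add: mult.commute)
qed

lemma inverse_power_le_one: "1 / (1 + norm x) ^ k \<le> (1::real)"
proof -
 have "1 \<le> (1 + norm x) ^ k" by (rule one_le_power) simp
 then show ?thesis by (meson divide_le_eq_1_pos less_le_trans zero_less_one)
qed

lemma epowr_one [simp]: "epowr x 1 = x"
 by (simp add: epowr_def less_top[symmetric])

context
 fixes \<zeta> :: "real^'n => real" and b \<delta> :: real and \<omega>0 :: "real^'n"
  and \<phi> :: "real^'n => real^'n => complex" and q :: "real^'n => complex"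
 assumes b: "1 \<le> b" and \<zeta>: "smooth (\<lambda>x. complex_of_real (\<zeta> x))" and \<zeta>0: "\<And>x. b < norm x ==> \<zeta> x = 0"
  and \<delta>: "0 < \<delta>" "\<delta> * b \<le> 1/8" and \<omega>0: "norm \<omega>0 = 1" and \<phi>: "wave_packets \<phi>"
  and q: "q \<in> schwartz" "\<And>x. b < norm x ==> q x = 0"
begin

lemma packet_cutoff:
 assumes R: "4 \<le> R" "2 * b < R" shows "q \<eta> * (c * packet \<zeta> \<omega>0 \<delta> R \<eta>) = 0"
proof (cases "packet \<zeta> \<omega>0 \<delta> R \<eta> = 0")
 case False
 have "R / 2 \<le> norm \<eta>"
  by (rule plank_bounds(1)[OF \<omega>0 \<delta>(2) R(1) packet_plank[OF b \<zeta> \<zeta>0 \<delta> \<omega>0 \<phi> R(1) False]])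
 then show ?thesis using q(2)[of \<eta>] R by simp
qed simp

lemma modulated_packet_schwartz:
 assumes R: "4 \<le> R" shows "(\<lambda>\<eta>. packet \<zeta> \<omega>0 \<delta> R \<eta> * exp (- \<i> * of_real (\<eta> \<bullet> y))) \<in> schwartz"
 using schwartz_fourier_integrand[OF packet_schwartz[OF b \<zeta> \<zeta>0 \<delta> \<omega>0 \<phi> R], of y] by (simp add: mult.commute)

text \<open>A wave packet only meets the directions in a cap of measure \<open>R powr (- (n - 1) / 2)\<close>, and for each of them the localised
piece is concentrated on a set of measure \<open>R powr (- (n + 1) / 2)\<close>. Together they give the power \<open>-n / p\<close>. The low-frequency term
vanishes, and for \<open>p = 1\<close> the heat maximal function obeys the same pointwise bound as the piece itself.\<close>

lemma HFIO_fin_upper: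
 assumes p: "1 \<le> p" "p \<noteq> \<infinity>"
 obtains C R0 where "0 \<le> C" "4 \<le> R0" "\<And>R y. R0 \<le> R ==>
  HFIO_norm q \<phi> s p (distr_of (inv_fourier (\<lambda>\<eta>. packet \<zeta> \<omega>0 \<delta> R \<eta> * exp (- \<i> * of_real (\<eta> \<bullet> y)))))
   \<le> ennreal (C * R powr ((real CARD('n) - 1) / 4 + s + (real CARD('n) + 1) / 2 - real CARD('n) * enn2real (1 / p)))"
proof -
 define P where "P = enn2real p"
 have P: "1 \<le> P" unfolding P_def using enn2real_mono[of 1 p] p by (simp add: less_top[symmetric])
 have P1: "enn2real (1 / p) = 1 / P"
 proof -
  have "p = ennreal P" unfolding P_def using p by (simp add: less_top[symmetric])
  then have "1 / p = ennreal (1 / P)" using P by (simp add: divide_ennreal[symmetric])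
  then show ?thesis using P by simp
 qed
 define n where "n = real CARD('n)"
 define fs where "fs = (\<lambda>(_::real) (x::real^'n). complex_of_real (japanese x powr s))"
 define fh where "fh = (\<lambda>\<tau> (x::real^'n). complex_of_real (japanese x powr s) * (of_real (\<tau> ^ 0) * gauss \<tau> x))"
 have fs: "symb s fs" unfolding fs_def by (rule symb.jap)
 have fh: "symb s fh"
  using symb.mult[OF symb.jap[of s] symb.heat[of 0]] unfolding fh_def by simp
 define E where "E = (n - 1) / 4 + s + (n + 1) / 2"
 obtain C1 where C1: "0 \<le> C1" "\<And>\<omega> R \<tau> z. norm \<omega> = 1 ==> 4 \<le> R ==> 0 < \<tau> ==>
   norm (inv_fourier (\<lambda>\<eta>. \<phi> \<omega> \<eta> * (fs \<tau> \<eta> * packet \<zeta> \<omega>0 \<delta> R \<eta>)) z) \<le>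
    (if norm (\<omega> - \<omega>0) \<le> 3 / sqrt R then C1 * R powr E * (1 / (1 + norm (aniso \<omega> R (sqrt R) z)) ^ (2 * CARD('n))) else 0)"
  using packet_multiplier_decay[OF b \<zeta> \<zeta>0 \<delta> \<omega>0 \<phi> fs] unfolding E_def n_def by blast
 obtain C2 where C2: "0 \<le> C2" "\<And>\<omega> R \<tau> z. norm \<omega> = 1 ==> 4 \<le> R ==> 0 < \<tau> ==>
   norm (inv_fourier (\<lambda>\<eta>. \<phi> \<omega> \<eta> * (fh \<tau> \<eta> * packet \<zeta> \<omega>0 \<delta> R \<eta>)) z) \<le>
    (if norm (\<omega> - \<omega>0) \<le> 3 / sqrt R then C2 * R powr E * (1 / (1 + norm (aniso \<omega> R (sqrt R) z)) ^ (2 * CARD('n))) else 0)"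
  using packet_multiplier_decay[OF b \<zeta> \<zeta>0 \<delta> \<omega>0 \<phi> fh] unfolding E_def n_def by blast
 define W where "W = (\<integral>(x::real^'n). 1 / (1 + norm x) ^ (2 * CARD('n)) \<partial>lborel)"
 have W: "0 \<le> W" unfolding W_def by (rule Bochner_Integration.integral_nonneg) simp
 obtain Cs where Cs: "0 < Cs" "\<And>(\<omega>::real^'n) R c. norm \<omega> = 1 ==> 0 < R ==> 0 < c ==>
  emeasure sphere_measure {\<theta> \<in> sphere 0 1. norm (\<theta> - \<omega>) \<le> c / sqrt R} \<le> ennreal (Cs * c ^ (CARD('n) - 1) * R powr (- (n - 1) / 2))"
  using emeasure_sphere_cap_sqrt[where 'n='n] unfolding n_def by blast
 define D where "D = Cs * 3 ^ (CARD('n) - 1)"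
 have D: "0 \<le> D" using Cs(1) by (simp add: D_def)
 define R0 where "R0 = max 4 (2 * b + 1)"
 define C where "C = (C1 + C2) * W powr (1 / P) * D powr (1 / P)"
 have main: "HFIO_norm q \<phi> s p (distr_of (inv_fourier (\<lambda>\<eta>. packet \<zeta> \<omega>0 \<delta> R \<eta> * exp (- \<i> * of_real (\<eta> \<bullet> y)))))
   \<le> ennreal (C * R powr (E - n * (1 / P)))" if R0: "R0 \<le> R" for R y
 proof -
  have R: "4 \<le> R" "2 * b < R" using R0 unfolding R0_def by auto
  define F where "F = (\<lambda>\<eta>. packet \<zeta> \<omega>0 \<delta> R \<eta> * exp (- \<i> * of_real (\<eta> \<bullet> y)))"
  have F: "F \<in> schwartz" unfolding F_def by (rule modulated_packet_schwartz[OF R(1)])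
  define H where "H = (\<lambda>\<eta>. fs 1 \<eta> * F \<eta>)"
  have fsm: "fs 1 \<in> moderate" by (rule symb_moderate[OF fs]) simp
  have H: "H \<in> schwartz" unfolding H_def using fsm F by (rule schwartz_mult)
  define v where "v = distr_of (inv_fourier H)"
  have v: "fmult (\<lambda>\<xi>. of_real (japanese \<xi> powr s)) (distr_of (inv_fourier F)) = v"
   using fmult_distr_of[OF fsm F] unfolding v_def H_def fs_def .
  have qm: "q \<in> moderate" using q(1) by (rule schwartz_subset_moderate)
  have q1m: "(\<lambda>\<xi>. 1 - q \<xi>) \<in> moderate"
   using moderate_add[OF moderate_const[of 1] moderate_mult[OF moderate_const[of "-1"] qm]] by simp
  have qF: "q \<eta> * (c * F \<eta>) = 0" for \<eta> c
   unfolding F_def using packet_cutoff[OF R, of \<eta> c] by (metis mult.assoc mult_zero_left)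
  have low: "Lp_norm p (fmult q v) = 0"
  proof -
   have "fmult q v = distr_of (inv_fourier (\<lambda>\<eta>. q \<eta> * H \<eta>))" unfolding v_def by (rule fmult_distr_of[OF qm H])
   also have "(\<lambda>\<eta>. q \<eta> * H \<eta>) = (\<lambda>_. 0)" unfolding H_def qF ..
   finally show ?thesis by (simp add: Lp_norm_zero[OF p])
  qed
  define w where "w \<omega> x = 1 / (1 + norm (aniso \<omega> R (sqrt R) (x - y))) ^ (2 * CARD('n))" for \<omega> x :: "real^'n"
  have w: "0 \<le> w \<omega> x" "w \<omega> x \<le> 1" for \<omega> x unfolding w_def using inverse_power_le_one by auto
  have wm: "w \<omega> \<in> borel_measurable borel" for \<omega> unfolding w_def by measurable
  define I where "I = W * R powr (- (n + 1) / 2)"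
  have I: "0 \<le> I" unfolding I_def using W by simp
  have wI: "(\<integral>\<^sup>+x. ennreal (w \<omega> x) \<partial>lborel) \<le> ennreal I" if "norm \<omega> = 1" for \<omega>
   unfolding w_def I_def W_def n_def using nn_integral_aniso_decay_sqrt[OF that, of R y] R by simp
  define cap where "cap = {\<theta> \<in> sphere 0 1. norm (\<theta> - \<omega>0) \<le> 3 / sqrt R}"
  define M where "M = (C1 + C2) * R powr E * I powr (1 / P)"
  have M: "0 \<le> M" unfolding M_def using C1 C2 by simp
  have hardy: "hardy_norm q p (fmult (\<phi> \<omega>) v) \<le> ennreal (M * indicat_real cap \<omega>)" if \<omega>: "norm \<omega> = 1" for \<omega>
  proof -
   define K where "K = (if norm (\<omega> - \<omega>0) \<le> 3 / sqrt R then (C1 + C2) * R powr E else 0)"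
   have K: "0 \<le> K" unfolding K_def using C1 C2 by simp
   define G where "G = (\<lambda>\<eta>. \<phi> \<omega> \<eta> * H \<eta>)"
   have \<phi>m: "\<phi> \<omega> \<in> moderate" by (rule wave_packets_moderate[OF \<phi> \<omega>])
   have G: "G \<in> schwartz" unfolding G_def using \<phi>m H by (rule schwartz_mult)
   have vG: "fmult (\<phi> \<omega>) v = distr_of (inv_fourier G)" unfolding v_def G_def by (rule fmult_distr_of[OF \<phi>m H])
   have up: "(if norm (\<omega> - \<omega>0) \<le> 3 / sqrt R then C' * R powr E * (1 / (1 + norm (aniso \<omega> R (sqrt R) (x - y))) ^ (2 * CARD('n))) else 0) \<le> K * w \<omega> x"
    if "C' \<le> C1 + C2" for C' x
    unfolding K_def w_def using that by (auto intro!: divide_right_mono mult_right_mono)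
   have g: "norm (inv_fourier G x) \<le> K * w \<omega> x" for x
   proof -
    have "inv_fourier G x = inv_fourier (\<lambda>\<eta>. \<phi> \<omega> \<eta> * (fs 1 \<eta> * packet \<zeta> \<omega>0 \<delta> R \<eta>)) (x - y)"
     unfolding inv_fourier_modulate[symmetric] G_def H_def F_def by (simp add: mult.assoc)
    then show ?thesis using C1(2)[OF \<omega> R(1) zero_less_one, of "x - y"] up[of C1 x] C2(1) by simp
   qed
   have gh: "norm (inv_fourier (\<lambda>\<eta>. G \<eta> * gauss \<tau> \<eta>) x) \<le> K * w \<omega> x" if \<tau>: "0 < \<tau>" for x \<tau>
   proof -
    have "inv_fourier (\<lambda>\<eta>. G \<eta> * gauss \<tau> \<eta>) x = inv_fourier (\<lambda>\<eta>. \<phi> \<omega> \<eta> * (fh \<tau> \<eta> * packet \<zeta> \<omega>0 \<delta> R \<eta>)) (x - y)"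
     unfolding inv_fourier_modulate[symmetric] G_def H_def F_def fh_def fs_def by (simp add: mult_ac)
    then show ?thesis using C2(2)[OF \<omega> R(1) \<tau>, of "x - y"] up[of C2 x] C1(1) by simp
   qed
   have "hardy_norm q p (distr_of (inv_fourier G)) \<le> ennreal (K * I powr (1 / P))"
   proof (cases "p = 1")
    case False
    then show ?thesis unfolding hardy_norm_def P_def
     using Lp_norm_distr_of_decay[OF schwartz_measurable[OF schwartz_inv_fourier[OF G]] p K I g w wm wI[OF \<omega>]] by simp
   next
    case True
    have P': "P = 1" unfolding P_def True by simp
    have qG: "q \<eta> * G \<eta> = 0" for \<eta>
     using qF[of \<eta> "\<phi> \<omega> \<eta> * fs 1 \<eta>"] unfolding G_def H_def by (simp add: mult.assoc)
    have "fmult q (distr_of (inv_fourier G)) = distr_of (\<lambda>_. 0)"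
     unfolding fmult_distr_of[OF qm G] qG by simp
    then have l0: "Lp_norm 1 (fmult q (distr_of (inv_fourier G))) = 0" by (simp add: Lp_norm_zero)
    have "(\<lambda>\<eta>. (1 - q \<eta>) * G \<eta>) = G" using qG by (auto simp: algebra_simps)
    then have "fmult (\<lambda>\<xi>. 1 - q \<xi>) (distr_of (inv_fourier G)) = distr_of (inv_fourier G)"
     unfolding fmult_distr_of[OF q1m G] by simp
    then have "H1_norm (fmult (\<lambda>\<xi>. 1 - q \<xi>) (distr_of (inv_fourier G))) = H1_norm (distr_of (inv_fourier G))" by simp
    also have "... \<le> (\<integral>\<^sup>+x. ennreal K * ennreal (w \<omega> x) \<partial>lborel)"
     unfolding H1_norm_distr_of[OF G]
     by (intro nn_integral_mono SUP_least) (use gh K w in \<open>auto simp: ennreal_mult[symmetric] intro!: ennreal_leI\<close>)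
    also have "... = ennreal K * (\<integral>\<^sup>+x. ennreal (w \<omega> x) \<partial>lborel)" using wm by (intro nn_integral_cmult) simp
    also have "... \<le> ennreal K * ennreal I" by (intro mult_left_mono wI \<omega>) simp
    also have "... = ennreal (K * I powr (1 / P))" using K I by (simp add: P' ennreal_mult)
    finally show ?thesis unfolding hardy_norm_def using True l0 by simp
   qed
   also have "K * I powr (1 / P) = M * indicat_real cap \<omega>"
    unfolding K_def M_def cap_def using \<omega> by (simp add: indicator_def)
   finally show ?thesis unfolding vG .
  qed
  have capm: "cap \<in> sets sphere_measure" unfolding cap_def by (rule sphere_cap_sets)
  have "(\<integral>\<^sup>+\<omega>. epowr (hardy_norm q p (fmult (\<phi> \<omega>) v)) P \<partial>sphere_measure) \<le> (\<integral>\<^sup>+\<omega>. ennreal (M powr P) * indicator cap \<omega> \<partial>sphere_measure)"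
  proof (rule nn_integral_mono)
   fix \<omega> :: "real^'n" assume "\<omega> \<in> space sphere_measure"
   then have \<omega>: "norm \<omega> = 1" by simp
   have "epowr (hardy_norm q p (fmult (\<phi> \<omega>) v)) P \<le> epowr (ennreal (M * indicat_real cap \<omega>)) P"
    using P by (intro epowr_mono hardy \<omega>) auto
   also have "... = ennreal (M powr P) * indicator cap \<omega>"
    using M P by (simp add: epowr_ennreal indicator_def)
   finally show "epowr (hardy_norm q p (fmult (\<phi> \<omega>) v)) P \<le> ennreal (M powr P) * indicator cap \<omega>" .
  qed
  also have "... = ennreal (M powr P) * emeasure sphere_measure cap" using capm by (rule nn_integral_cmult_indicator)
  also have "... \<le> ennreal (M powr P) * ennreal (D * R powr (- (n - 1) / 2))"
   unfolding cap_def D_def using Cs(2)[OF \<omega>0, of R 3] R by (intro mult_left_mono) auto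
  also have "... = ennreal (M powr P * (D * R powr (- (n - 1) / 2)))" using D by (simp add: ennreal_mult)
  finally have "epowr (\<integral>\<^sup>+\<omega>. epowr (hardy_norm q p (fmult (\<phi> \<omega>) v)) P \<partial>sphere_measure) (1 / P)
    \<le> epowr (ennreal (M powr P * (D * R powr (- (n - 1) / 2)))) (1 / P)"
   using P by (intro epowr_mono) auto
  also have "... = ennreal ((M powr P * (D * R powr (- (n - 1) / 2))) powr (1 / P))"
   using D by (simp add: epowr_ennreal)
  also have "(M powr P * (D * R powr (- (n - 1) / 2))) powr (1 / P) = M * (D powr (1 / P) * R powr (- (n - 1) / 2 * (1 / P)))"
   using P M D by (simp add: powr_mult powr_powr)
  also have "... = C * R powr (E - n * (1 / P))"
  proof -
   have e1: "I powr (1 / P) = W powr (1 / P) * R powr (- (n + 1) / 2 * (1 / P))"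
    unfolding I_def using W by (simp add: powr_mult powr_powr)
   have e2: "R powr E * R powr (- (n + 1) / 2 * (1 / P)) * R powr (- (n - 1) / 2 * (1 / P)) = R powr (E - n * (1 / P))"
   proof -
    have "E + - (n + 1) / 2 * t + - (n - 1) / 2 * t = E - n * t" for t by (simp add: field_simps)
    from this[of "1 / P"] show ?thesis unfolding powr_add[symmetric] by (rule arg_cong)
   qed
   show ?thesis unfolding M_def C_def e1 e2[symmetric] by (simp only: mult_ac)
  qed
  finally show ?thesis
   unfolding F_def[symmetric] HFIO_norm_def Let_def v HFIO_fin_norm_def P_def[symmetric] using p low by simp
 qed
 show ?thesis
 proof (rule that[of C R0])
  show "0 \<le> C" unfolding C_def using C1 C2 by simp
  show "4 \<le> R0" unfolding R0_def by simp
 qed (use main in \<open>simp add: E_def n_def P1\<close>)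
qed

end

section \<open>Wave packets in the dual space\<close>

lemma smooth_divide_supported:
 fixes F D :: "'a::euclidean_space => complex"
 assumes F: "smooth F" and D: "smooth D" and S: "closed S"
  and 0: "\<And>x. x \<notin> S ==> F x = 0" and ne: "\<And>x. x \<in> S ==> D x \<noteq> 0"
 shows "smooth (\<lambda>x. F x / D x)"
proof (rule smooth_coinduct[of _ "{\<lambda>x. F x / D x ^ k | F k. smooth F \<and> (\<forall>x. x \<notin> S --> F x = 0)}"])
 show "(\<lambda>x. F x / D x) \<in> {\<lambda>x. F x / D x ^ k | F k. smooth F \<and> (\<forall>x. x \<notin> S --> F x = 0)}"
  using F 0 by (intro CollectI exI[of _ F] exI[of _ 1]) simp
 fix h :: "'a => complex" assume "h \<in> {\<lambda>x. F x / D x ^ k | F k. smooth F \<and> (\<forall>x. x \<notin> S --> F x = 0)}"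
 then obtain F k where h: "h = (\<lambda>x. F x / D x ^ k)" and F: "smooth F" and F0: "\<And>x. x \<notin> S ==> F x = 0" by blast
 define F' where "F' b x = pderiv_dir b F x * D x + F x * (- of_nat k * pderiv_dir b D x)" for b x
 have F'0: "F' b x = 0" if "x \<notin> S" for b x
  using pderivs_zero_on_open[of "- S" F x "[b]"] open_Compl[OF S] F0 that unfolding F'_def by (simp add: pderivs_Cons)
 have der: "(h has_derivative (\<lambda>b. F' b x / D x ^ Suc k)) (at x)" for x
 proof (cases "x \<in> S")
  case False
  have "(h has_derivative (\<lambda>_. 0)) (at x)"
   using has_derivative_transform_within_open[of "\<lambda>_. 0" "\<lambda>_. 0" x UNIV "- S" h] S False F0 unfolding h by auto
  then show ?thesis using F'0[OF False] by simp
 next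
  case True
  have Dx: "D x \<noteq> 0" using ne True by blast
  have dF: "(F has_derivative (\<lambda>b. pderiv_dir b F x)) (at x)" and dD: "(D has_derivative (\<lambda>b. pderiv_dir b D x)) (at x)"
   by (rule has_derivative_pderiv[OF smooth_differentiable]; fact F D)+
  have dp: "((\<lambda>z. inverse z ^ k) has_field_derivative (of_nat k * inverse (D x) ^ (k - 1) * (- inverse (D x ^ 2)))) (at (D x))"
   using Dx by (auto intro!: derivative_eq_intros simp: power2_eq_square)
  have "((\<lambda>y. F y * inverse (D y) ^ k) has_derivative (\<lambda>b. F x * ((of_nat k * inverse (D x) ^ (k - 1) * (- inverse (D x ^ 2))) * pderiv_dir b D x) + pderiv_dir b F x * inverse (D x) ^ k)) (at x)"
   by (rule has_derivative_mult[OF dF has_derivative_compose[OF dD has_field_derivative_imp_has_derivative[OF dp]]])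
  moreover have "F x * ((of_nat k * inverse (D x) ^ (k - 1) * (- inverse (D x ^ 2))) * d) + e * inverse (D x) ^ k = (e * D x + F x * (- of_nat k * d)) / D x ^ Suc k" for d e
   using Dx by (cases k) (simp_all add: field_simps power2_eq_square)
  moreover have "(\<lambda>y. F y * inverse (D y) ^ k) = h" unfolding h by (simp add: divide_inverse power_inverse)
  ultimately show ?thesis unfolding F'_def by simp
 qed
 show "h differentiable at x" for x using der differentiable_def by blast
 show "pderiv_dir b h \<in> {\<lambda>x. F x / D x ^ k | F k. smooth F \<and> (\<forall>x. x \<notin> S --> F x = 0)}" for b
 proof -
  have "pderiv_dir b h = (\<lambda>x. F' b x / D x ^ Suc k)" by (rule ext, rule pderiv_dir_eqI[OF der])
  moreover have "smooth (F' b)" unfolding F'_def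
   by (intro smooth_add smooth_mult smooth_pderiv F D smooth_const)
  ultimately show ?thesis using F'0 by blast
 qed
qed

lemma plank_reflect: "\<eta> \<in> plank \<omega> \<sigma> R ==> - \<eta> \<in> plank (- \<omega>) \<sigma> R"
 unfolding plank_def by (simp add: norm_minus_commute)

lemma plank_segment:
 assumes \<omega>: "norm \<omega> = 1" and \<sigma>: "0 \<le> \<sigma>" and R: "0 \<le> R" and \<eta>: "\<eta> \<in> plank \<omega> \<sigma> R" and s: "0 \<le> s" "s \<le> 1"
 shows "R *\<^sub>R \<omega> + s *\<^sub>R (\<eta> - R *\<^sub>R \<omega>) \<in> plank \<omega> \<sigma> R"
proof -
 have w: "\<omega> \<bullet> \<omega> = 1" using \<omega> by (simp add: dot_square_norm)
 define x where "x = R *\<^sub>R \<omega> + s *\<^sub>R (\<eta> - R *\<^sub>R \<omega>)"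
 have i: "x \<bullet> \<omega> = R + s * (\<eta> \<bullet> \<omega> - R)" by (simp add: x_def inner_add_left inner_diff_left w)
 have p: "x - (x \<bullet> \<omega>) *\<^sub>R \<omega> = s *\<^sub>R (\<eta> - (\<eta> \<bullet> \<omega>) *\<^sub>R \<omega>)" unfolding i by (simp add: x_def algebra_simps)
 have h: "\<bar>\<eta> \<bullet> \<omega> - R\<bar> \<le> \<sigma> * R" "norm (\<eta> - (\<eta> \<bullet> \<omega>) *\<^sub>R \<omega>) \<le> \<sigma> * sqrt R" using \<eta> unfolding plank_def by auto
 have "\<bar>x \<bullet> \<omega> - R\<bar> = s * \<bar>\<eta> \<bullet> \<omega> - R\<bar>" unfolding i using s by (simp add: abs_mult)
 also have "... \<le> 1 * (\<sigma> * R)" using h s \<sigma> R by (intro mult_mono) auto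
 finally have "\<bar>x \<bullet> \<omega> - R\<bar> \<le> \<sigma> * R" by simp
 moreover have "norm (x - (x \<bullet> \<omega>) *\<^sub>R \<omega>) = s * norm (\<eta> - (\<eta> \<bullet> \<omega>) *\<^sub>R \<omega>)" unfolding p using s by simp
 then have "norm (x - (x \<bullet> \<omega>) *\<^sub>R \<omega>) \<le> 1 * (\<sigma> * sqrt R)" using mult_mono[OF s(2) h(2)] by simp
 ultimately show ?thesis unfolding x_def[symmetric] plank_def by simp
qed

text \<open>The integral of the square of \<open>\<phi> \<omega> (R \<theta>)\<close> over \<open>\<omega>\<close> is 1, and it is carried by a cap of measure about \<open>R powr (- (n - 1) / 2)\<close>.
The directions in the cap where the modulus is below a small multiple of \<open>R powr ((n - 1) / 4)\<close> contribute at most one half.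
On the remaining ones the modulus is comparable to \<open>R powr ((n - 1) / 4)\<close>, because it is at most a
multiple of that; so they fill a fixed proportion of the cap. The bound at \<open>R \<theta>\<close> spreads to a narrow plank
around it by the derivative estimates.\<close>

lemma wave_packets_lower:
 fixes \<phi> :: "real^'n => real^'n => complex"
 assumes \<phi>: "wave_packets \<phi>"
 obtains \<sigma> c \<kappa> where "0 < \<sigma>" "\<sigma> \<le> 1/8" "0 < c" "0 < \<kappa>"
  "\<And>\<theta> R. norm \<theta> = 1 ==> 4 \<le> R ==> \<exists>\<Omega>. \<Omega> \<in> sets sphere_measure \<and>
   ennreal (\<kappa> * R powr (- (real CARD('n) - 1) / 2)) \<le> emeasure sphere_measure \<Omega> \<and>
   (\<forall>\<omega>\<in>\<Omega>. \<forall>\<xi>\<in>plank \<theta> \<sigma> R. c * R powr ((real CARD('n) - 1) / 4) \<le> norm (\<phi> \<omega> \<xi>))"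
proof -
 define n where "n = real CARD('n)"
 define e where "e = (n - 1) / 4"
 obtain C0 where C0: "0 \<le> C0" "\<And>\<omega> R x u j. norm \<omega> = 1 ==> 4 \<le> R ==> R / 2 \<le> norm x ==> norm x \<le> 2 * R ==>
   u \<in> insert (R *\<^sub>R \<omega>) ((\<lambda>b. sqrt R *\<^sub>R b) ` Basis) ==> j \<le> 1 ==>
   norm (pderivs (replicate j u) (\<phi> \<omega>) x) \<le> C0 * R powr e"
  using wave_packets_directional[OF \<phi>, of 1] unfolding e_def n_def by (simp, metis)
 define C where "C = C0 + 1"
 have C: "0 < C" "C0 \<le> C" using C0(1) by (auto simp: C_def)
 obtain Cs where Cs: "0 < Cs" "\<And>(\<omega>::real^'n) R c. norm \<omega> = 1 ==> 0 < R ==> 0 < c ==>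
  emeasure sphere_measure {\<theta> \<in> sphere 0 1. norm (\<theta> - \<omega>) \<le> c / sqrt R} \<le> ennreal (Cs * c ^ (CARD('n) - 1) * R powr (- (n - 1) / 2))"
  using emeasure_sphere_cap_sqrt[where 'n='n] unfolding n_def by blast
 define c1 where "c1 = sqrt (1 / (2 * Cs))"
 have c1: "0 < c1" "c1\<^sup>2 * Cs = 1 / 2" using Cs(1) by (auto simp: c1_def)
 define \<sigma> where "\<sigma> = min (1 / 8) (c1 / (2 * C * (1 + 2 * n)))"
 have n: "1 \<le> n" unfolding n_def by (simp add: Suc_leI)
 have \<sigma>: "0 < \<sigma>" "\<sigma> \<le> 1/8"
  unfolding \<sigma>_def by (use c1 C n in simp, rule min.cobounded1)
 have \<sigma>2: "\<sigma> * (1 + 2 * n) * C \<le> c1 / 2"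
 proof -
  have "\<sigma> * (1 + 2 * n) * C \<le> c1 / (2 * C * (1 + 2 * n)) * (1 + 2 * n) * C"
   unfolding \<sigma>_def using C n by (intro mult_right_mono) auto
  also have "... = c1 / 2"
  proof -
   have "c1 / (2 * C * q) * q * C = c1 / 2" if "q \<noteq> 0" for q using that C(1) by simp
   from this[of "1 + 2 * n"] show ?thesis using n by simp
  qed
  finally show ?thesis .
 qed
 define \<kappa> where "\<kappa> = 1 / (2 * C\<^sup>2)"
 have "\<exists>\<Omega>. \<Omega> \<in> sets sphere_measure \<and> ennreal (\<kappa> * R powr (- (n - 1) / 2)) \<le> emeasure sphere_measure \<Omega> \<and>
   (\<forall>\<omega>\<in>\<Omega>. \<forall>\<xi>\<in>plank \<theta> \<sigma> R. c1 / 2 * R powr e \<le> norm (\<phi> \<omega> \<xi>))" if \<theta>: "norm \<theta> = 1" and R: "4 \<le> R" for \<theta> :: "real^'n" and R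
 proof -
  define \<xi>0 where "\<xi>0 = R *\<^sub>R \<theta>"
  have \<xi>0: "norm \<xi>0 = R" "\<xi>0 \<noteq> 0" "sgn \<xi>0 = \<theta>" using \<theta> R by (auto simp: \<xi>0_def sgn_div_norm)
  define cap where "cap = {\<omega> \<in> sphere 0 1. norm (\<omega> - \<theta>) \<le> 1 / sqrt R}"
  have capm: "cap \<in> sets sphere_measure" unfolding cap_def by (rule sphere_cap_sets)
  have capC: "emeasure sphere_measure cap \<le> ennreal (Cs * R powr (- (n - 1) / 2))"
   unfolding cap_def using Cs(2)[OF \<theta>, of R 1] R by simp
  have m: "(\<lambda>\<omega>. \<phi> \<omega> \<xi>0) \<in> borel_measurable sphere_measure"
  proof -
   have "(\<lambda>(\<xi>, \<omega>). \<phi> \<omega> \<xi>) \<in> borel_measurable (borel \<Otimes>\<^sub>M sphere_measure)"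
    using \<phi> unfolding wave_packets_def by (elim conjE)
   from measurable_compose_Pair1[OF _ this, of \<xi>0] show ?thesis by simp
  qed
  have one: "(\<integral>\<omega>. (\<phi> \<omega> \<xi>0)\<^sup>2 \<partial>sphere_measure) = 1"
   using \<phi> \<xi>0(1) R unfolding wave_packets_def by simp
  have sup: "\<phi> \<omega> \<xi>0 = 0" if "norm \<omega> = 1" "\<omega> \<notin> cap" for \<omega>
  proof (rule wave_packets_support[OF \<phi> that(1) \<xi>0(2)])
   have "norm \<xi>0 powr (-1/2) = 1 / sqrt R" using R \<xi>0(1) by (simp add: powr_minus_divide powr_half_sqrt)
   then show "norm \<xi>0 powr (-1/2) < norm (sgn \<xi>0 - \<omega>)" using that unfolding cap_def \<xi>0(3) by (simp add: norm_minus_commute)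
  qed
  have up: "norm (\<phi> \<omega> \<xi>0) \<le> C * R powr e" if "norm \<omega> = 1" for \<omega>
  proof -
   have "norm (pderivs (replicate 0 (R *\<^sub>R \<omega>)) (\<phi> \<omega>) \<xi>0) \<le> C0 * R powr e"
    by (rule C0(2)) (use that R \<xi>0 in auto)
   also have "... \<le> C * R powr e" by (intro mult_right_mono C) auto
   finally show ?thesis by simp
  qed
  define \<Omega> where "\<Omega> = {\<omega> \<in> space sphere_measure. \<omega> \<in> cap \<and> c1 * R powr e \<le> norm (\<phi> \<omega> \<xi>0)}"
  have \<Omega>m: "\<Omega> \<in> sets sphere_measure"
   unfolding \<Omega>_def using m capm by measurable
  have mass: "ennreal (\<kappa> * R powr (- (n - 1) / 2)) \<le> emeasure sphere_measure \<Omega>"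
  proof -
   define a where "a = R powr (2 * e)"
   have "2 * e + - (n - 1) / 2 = 0" unfolding e_def by (simp add: field_simps)
   then have "a * R powr (- (n - 1) / 2) = R powr 0" unfolding a_def powr_add[symmetric] by (rule arg_cong)
   then have a3: "a * R powr (- (n - 1) / 2) = 1" using R by simp
   have "(R powr e)\<^sup>2 = a" unfolding a_def mult_2 powr_add by (rule power2_eq_square)
   moreover have "0 < a" unfolding a_def using R by simp
   ultimately have a: "0 < a" "(R powr e)\<^sup>2 = a" "a * R powr (- (n - 1) / 2) = 1"
    using a3 by auto
   have "ennreal 1 = ennreal (norm (\<integral>\<omega>. (\<phi> \<omega> \<xi>0)\<^sup>2 \<partial>sphere_measure))" unfolding one by simp
   also have "... \<le> (\<integral>\<^sup>+\<omega>. ennreal (norm ((\<phi> \<omega> \<xi>0)\<^sup>2)) \<partial>sphere_measure)"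
   proof (cases "integrable sphere_measure (\<lambda>\<omega>. (\<phi> \<omega> \<xi>0)\<^sup>2)")
    case True
    then show ?thesis by (rule integral_norm_bound_ennreal)
   next
    case False
    then show ?thesis using one by (simp add: not_integrable_integral_eq)
   qed
   also have "... \<le> (\<integral>\<^sup>+\<omega>. ennreal (C\<^sup>2 * a) * indicator \<Omega> \<omega> + ennreal (c1\<^sup>2 * a) * indicator cap \<omega> \<partial>sphere_measure)"
   proof (rule nn_integral_mono)
    fix \<omega> :: "real^'n" assume sp: "\<omega> \<in> space sphere_measure"
    then have \<omega>: "norm \<omega> = 1" by simp
    show "ennreal (norm ((\<phi> \<omega> \<xi>0)\<^sup>2)) \<le> ennreal (C\<^sup>2 * a) * indicator \<Omega> \<omega> + ennreal (c1\<^sup>2 * a) * indicator cap \<omega>"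
    proof (cases "\<omega> \<in> cap")
     case False
     then show ?thesis using sup[OF \<omega>] by simp
    next
     case cap: True
     show ?thesis
     proof (cases "\<omega> \<in> \<Omega>")
      case True
      have "norm ((\<phi> \<omega> \<xi>0)\<^sup>2) \<le> (C * R powr e)\<^sup>2"
       unfolding norm_power by (intro power_mono up \<omega>) auto
      also have "... = C\<^sup>2 * a" by (simp add: power_mult_distrib a)
      finally have "ennreal (norm ((\<phi> \<omega> \<xi>0)\<^sup>2)) \<le> ennreal (C\<^sup>2 * a)" by (rule ennreal_leI)
      then show ?thesis using True by (simp add: add_increasing2)
     next
      case False
      then have "norm (\<phi> \<omega> \<xi>0) \<le> c1 * R powr e" using cap sp unfolding \<Omega>_def by auto
      then have "norm ((\<phi> \<omega> \<xi>0)\<^sup>2) \<le> (c1 * R powr e)\<^sup>2"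
       unfolding norm_power by (intro power_mono) auto
      also have "... = c1\<^sup>2 * a" by (simp add: power_mult_distrib a)
      finally have "ennreal (norm ((\<phi> \<omega> \<xi>0)\<^sup>2)) \<le> ennreal (c1\<^sup>2 * a)" by (rule ennreal_leI)
      then show ?thesis using cap False by simp
     qed
    qed
   qed
   also have "... = ennreal (C\<^sup>2 * a) * emeasure sphere_measure \<Omega> + ennreal (c1\<^sup>2 * a) * emeasure sphere_measure cap"
    using \<Omega>m capm by (simp add: nn_integral_add nn_integral_cmult_indicator)
   also have "... \<le> ennreal (C\<^sup>2 * a) * emeasure sphere_measure \<Omega> + ennreal (c1\<^sup>2 * a) * ennreal (Cs * R powr (- (n - 1) / 2))"
    by (intro add_left_mono mult_left_mono capC) simp
   also have "ennreal (c1\<^sup>2 * a) * ennreal (Cs * R powr (- (n - 1) / 2)) = ennreal (1 / 2)"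
   proof -
    have "c1\<^sup>2 * a * (Cs * R powr (- (n - 1) / 2)) = (c1\<^sup>2 * Cs) * (a * R powr (- (n - 1) / 2))" by simp
    then have "c1\<^sup>2 * a * (Cs * R powr (- (n - 1) / 2)) = 1 / 2" unfolding c1 a(3) by simp
    moreover have "ennreal (c1\<^sup>2 * a) * ennreal (Cs * R powr (- (n - 1) / 2)) = ennreal (c1\<^sup>2 * a * (Cs * R powr (- (n - 1) / 2)))"
     using a(1) Cs(1) by (intro ennreal_mult[symmetric]) auto
    ultimately show ?thesis by (simp only:)
   qed
   finally have le: "ennreal 1 \<le> ennreal (C\<^sup>2 * a) * emeasure sphere_measure \<Omega> + ennreal (1 / 2)" .
   show ?thesis
   proof (cases "emeasure sphere_measure \<Omega> = \<infinity>")
    case False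
    then obtain t where t: "0 \<le> t" "emeasure sphere_measure \<Omega> = ennreal t" by (cases "emeasure sphere_measure \<Omega>") auto
    have "1 \<le> C\<^sup>2 * a * t + 1 / 2"
    proof -
     have "ennreal (C\<^sup>2 * a) * ennreal t + ennreal (1 / 2) = ennreal (C\<^sup>2 * a * t) + ennreal (1 / 2)"
      using t a(1) by (simp only: ennreal_mult[symmetric] zero_le_power2 mult_nonneg_nonneg less_imp_le)
     also have "... = ennreal (C\<^sup>2 * a * t + 1 / 2)"
      using t a(1) by (intro ennreal_plus[symmetric]) auto
     finally have eq: "ennreal (C\<^sup>2 * a) * ennreal t + ennreal (1 / 2) = ennreal (C\<^sup>2 * a * t + 1 / 2)" .
     have "ennreal 1 \<le> ennreal (C\<^sup>2 * a * t + 1 / 2)" using le unfolding t eq .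
     then show ?thesis using t a(1) by (subst (asm) ennreal_le_iff) auto
    qed
    then have "\<kappa> * (a * R powr (- (n - 1) / 2)) * 1 \<le> (a * t)"
     unfolding a(3) \<kappa>_def using C by (simp add: field_simps)
    then have "\<kappa> * R powr (- (n - 1) / 2) \<le> t" using a(1) by (simp add: mult.left_commute)
    then show ?thesis unfolding t by (rule ennreal_leI)
   qed simp
  qed
  have low: "c1 / 2 * R powr e \<le> norm (\<phi> \<omega> \<xi>)" if \<omega>\<Omega>: "\<omega> \<in> \<Omega>" and \<xi>: "\<xi> \<in> plank \<theta> \<sigma> R" for \<omega> \<xi>
  proof -
   have \<omega>: "norm \<omega> = 1" "norm (\<omega> - \<theta>) \<le> 1 / sqrt R" "c1 * R powr e \<le> norm (\<phi> \<omega> \<xi>0)" using \<omega>\<Omega> unfolding \<Omega>_def cap_def by auto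
   have sR: "0 < sqrt R" "sqrt R * sqrt R = R" using R by auto
   define v where "v = \<xi> - R *\<^sub>R \<theta>"
   have sm: "smooth (\<phi> \<omega>)" by (rule wave_packets_smooth[OF \<phi> \<omega>(1)])
   define \<alpha> where "\<alpha> = \<xi> \<bullet> \<theta> - R"
   define z where "z = \<alpha> *\<^sub>R (\<theta> - \<omega>) + (\<xi> - (\<xi> \<bullet> \<theta>) *\<^sub>R \<theta>)"
   have vz: "v = (\<alpha> / R) *\<^sub>R (R *\<^sub>R \<omega>) + z"
   proof -
    have "(\<alpha> / R) *\<^sub>R (R *\<^sub>R \<omega>) = \<alpha> *\<^sub>R \<omega>" using R by simp
    then show ?thesis unfolding v_def z_def by (simp add: \<alpha>_def algebra_simps)
   qed
   have \<alpha>: "\<bar>\<alpha>\<bar> \<le> \<sigma> * R" and pp: "norm (\<xi> - (\<xi> \<bullet> \<theta>) *\<^sub>R \<theta>) \<le> \<sigma> * sqrt R" using \<xi> unfolding plank_def \<alpha>_def by auto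
   have "norm z \<le> \<bar>\<alpha>\<bar> * norm (\<theta> - \<omega>) + norm (\<xi> - (\<xi> \<bullet> \<theta>) *\<^sub>R \<theta>)"
    unfolding z_def by (rule order_trans[OF norm_triangle_ineq]) simp
   also have "... \<le> (\<sigma> * R) * (1 / sqrt R) + \<sigma> * sqrt R"
    using \<alpha> pp \<omega>(2) \<sigma> R by (intro add_mono mult_mono) (auto simp: norm_minus_commute)
   also have "(\<sigma> * R) * (1 / sqrt R) = \<sigma> * sqrt R" using sR by (simp add: field_simps)
   finally have z: "norm z \<le> 2 * \<sigma> * sqrt R" by simp
   have "norm (\<phi> \<omega> (\<xi>0 + v) - \<phi> \<omega> \<xi>0) \<le> c1 / 2 * R powr e"
   proof (rule pderiv_mvt)
    fix s :: real assume s: "0 \<le> s" "s \<le> 1"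
    let ?x = "\<xi>0 + s *\<^sub>R v"
    show d: "\<phi> \<omega> differentiable at ?x" using sm by (rule smooth_differentiable)
    have "?x \<in> plank \<theta> \<sigma> R" unfolding \<xi>0_def v_def using plank_segment[OF \<theta> _ _ \<xi> s] \<sigma> R by simp
    note pl = plank_bounds[OF \<theta> \<sigma>(2) R this]
    have dR: "norm (pderiv_dir (R *\<^sub>R \<omega>) (\<phi> \<omega>) ?x) \<le> C0 * R powr e"
     using C0(2)[OF \<omega>(1) R pl(1,2), of "R *\<^sub>R \<omega>" 1] by (simp add: pderivs_Cons)
    have db: "norm (pderiv_dir c (\<phi> \<omega>) ?x) \<le> C0 * R powr e / sqrt R" if c: "c \<in> Basis" for c
    proof -
     have "norm (pderiv_dir (sqrt R *\<^sub>R c) (\<phi> \<omega>) ?x) \<le> C0 * R powr e"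
     proof -
      have "sqrt R *\<^sub>R c \<in> insert (R *\<^sub>R \<omega>) ((\<lambda>b. sqrt R *\<^sub>R b) ` Basis)" using c by blast
      from C0(2)[OF \<omega>(1) R pl(1,2) this, of 1] show ?thesis by (simp add: pderivs_Cons)
     qed
     then show ?thesis using sR by (simp add: pderiv_dir_scale[OF d] field_simps)
    qed
    have lin: "linear (\<lambda>w. pderiv_dir w (\<phi> \<omega>) ?x)"
     using has_derivative_linear[OF has_derivative_pderiv[OF d]] .
    have "pderiv_dir v (\<phi> \<omega>) ?x = pderiv_dir ((\<alpha> / R) *\<^sub>R (R *\<^sub>R \<omega>) + z) (\<phi> \<omega>) ?x"
     by (rule arg_cong[OF vz])
    also have "... = (\<alpha> / R) *\<^sub>R pderiv_dir (R *\<^sub>R \<omega>) (\<phi> \<omega>) ?x + pderiv_dir z (\<phi> \<omega>) ?x"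
     by (simp only: linear_add[OF lin] linear_scale[OF lin])
    finally have "pderiv_dir v (\<phi> \<omega>) ?x = (\<alpha> / R) *\<^sub>R pderiv_dir (R *\<^sub>R \<omega>) (\<phi> \<omega>) ?x + pderiv_dir z (\<phi> \<omega>) ?x" .
    also have "norm ... \<le> \<bar>\<alpha> / R\<bar> * norm (pderiv_dir (R *\<^sub>R \<omega>) (\<phi> \<omega>) ?x) + norm (pderiv_dir z (\<phi> \<omega>) ?x)"
     by (rule order_trans[OF norm_triangle_ineq]) simp
    also have "... \<le> \<sigma> * (C0 * R powr e) + (2 * n * \<sigma>) * (C0 * R powr e)"
    proof (intro add_mono mult_mono dR)
     show "\<bar>\<alpha> / R\<bar> \<le> \<sigma>" using \<alpha> R by (simp add: abs_divide divide_le_eq)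
     have "norm (pderiv_dir z (\<phi> \<omega>) ?x) \<le> (\<Sum>c\<in>Basis. \<bar>z \<bullet> c\<bar> * norm (pderiv_dir c (\<phi> \<omega>) ?x))"
      by (rule norm_pderiv_dir_le[OF d])
     also have "... \<le> (\<Sum>c\<in>(Basis :: (real^'n) set). (2 * \<sigma> * sqrt R) * (C0 * R powr e / sqrt R))"
      using z by (intro sum_mono mult_mono db order_trans[OF Basis_le_norm z]) (use \<sigma> R in auto)
     also have "... = (2 * n * \<sigma>) * (C0 * R powr e)" using sR by (simp add: n_def)
     finally show "norm (pderiv_dir z (\<phi> \<omega>) ?x) \<le> (2 * n * \<sigma>) * (C0 * R powr e)" .
    qed (use \<sigma> in auto)
    also have "... = \<sigma> * (1 + 2 * n) * C0 * R powr e" by (simp add: algebra_simps)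
    also have "... \<le> \<sigma> * (1 + 2 * n) * C * R powr e" using \<sigma> n C by (intro mult_right_mono mult_left_mono) auto
    also have "... \<le> c1 / 2 * R powr e" by (intro mult_right_mono \<sigma>2) auto
    finally show "norm (pderiv_dir v (\<phi> \<omega>) ?x) \<le> c1 / 2 * R powr e" .
   qed
   moreover have "\<xi>0 + v = \<xi>" by (simp add: \<xi>0_def v_def)
   ultimately have "norm (\<phi> \<omega> \<xi>0) - norm (\<phi> \<omega> \<xi>) \<le> c1 / 2 * R powr e"
    using norm_triangle_ineq2[of "\<phi> \<omega> \<xi>0" "\<phi> \<omega> \<xi>"] by (simp add: norm_minus_commute)
   then show ?thesis using \<omega>(3) by linarith
  qed
  show ?thesis using \<Omega>m mass low by blast
 qed
 then show ?thesis
  using that[of \<sigma> "c1 / 2" \<kappa>] \<sigma> c1 C unfolding \<kappa>_def n_def e_def by auto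
qed

lemma fmult_moderate:
 assumes "f \<in> schwartz" shows "fmult m u f = u (fourier (\<lambda>\<xi>. m \<xi> * inv_fourier f \<xi>))"
 using assms by (simp add: fmult_def)

text \<open>By \<open>tempered_convolution\<close> the pairing on the left is the integral of the Fourier transform of \<open>\<Psi>\<close> times
the convolution of \<open>(1 - q)(D) m(D) u\<close> with the heat kernel at the single time \<open>\<tau>\<close>. The first factor is
bounded by the integral of \<open>|\<Psi>|\<close>, the second by the heat maximal function.\<close>

lemma hardy_norm_one_lower:
 fixes u :: "'a::euclidean_space distribution"
 assumes u: "u \<in> tempered" and m: "m \<in> moderate" and q: "q \<in> moderate" and \<Psi>: "\<Psi> \<in> schwartz" and \<tau>: "0 < \<tau>"
 shows "ennreal (norm (u (fourier (\<lambda>\<eta>. m \<eta> * ((1 - q \<eta>) * (gauss \<tau> \<eta> * \<Psi> \<eta>))))))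
  \<le> ennreal (\<integral>\<eta>. norm (\<Psi> \<eta>) \<partial>lborel) * hardy_norm q 1 (fmult m u)"
proof -
 define c where "c = inverse (complex_of_real ((2 * pi) ^ DIM('a)))"
 have c: "c * (2 * pi) ^ DIM('a) = 1" unfolding c_def by (simp add: power_mult_distrib field_simps)
 define w where "w = fmult (\<lambda>\<xi>. 1 - q \<xi>) (fmult m u)"
 define K where "K \<eta> = m \<eta> * ((1 - q \<eta>) * (c * gauss \<tau> \<eta>))" for \<eta>
 have q1: "(\<lambda>\<xi>. 1 - q \<xi>) \<in> moderate"
  using moderate_add[OF moderate_const[of 1] moderate_mult[OF moderate_const[of "-1"] q]] by simp
 have g: "gauss \<tau> \<in> (schwartz :: ('a => complex) set)" using \<tau> by (rule schwartz_gauss)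
 have K: "K \<in> schwartz" unfolding K_def[abs_def] by (intro schwartz_mult m q1 schwartz_cmult g)
 have wx: "w (\<lambda>y. heat_kernel \<tau> (x - y)) = u (\<lambda>y. fourier K (y - x))" for x
 proof -
  let ?H = "\<lambda>\<eta>. iexp (\<eta> \<bullet> x) * (c * gauss \<tau> \<eta>)"
  have H: "?H \<in> schwartz" by (intro schwartz_wave schwartz_cmult g)
  have 1: "(\<lambda>\<xi>. (1 - q \<xi>) * ?H \<xi>) \<in> schwartz" by (rule schwartz_mult[OF q1 H])
  have "w (\<lambda>y. heat_kernel \<tau> (x - y)) = w (fourier ?H)"
   unfolding heat_kernel_fourier[OF \<tau>] c_def ..
  also have "... = fmult m u (fourier (\<lambda>\<xi>. (1 - q \<xi>) * ?H \<xi>))"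
   unfolding w_def by (simp add: fmult_moderate schwartz_fourier[OF H] inv_fourier_fourier[OF H])
  also have "... = u (fourier (\<lambda>\<xi>. m \<xi> * ((1 - q \<xi>) * ?H \<xi>)))"
   by (simp add: fmult_moderate schwartz_fourier[OF 1] inv_fourier_fourier[OF 1])
  also have "(\<lambda>\<xi>. m \<xi> * ((1 - q \<xi>) * ?H \<xi>)) = (\<lambda>\<eta>. iexp (\<eta> \<bullet> x) * K \<eta>)"
   by (rule ext) (simp add: K_def)
  also have "fourier ... = (\<lambda>y. fourier K (y - x))" by (rule ext) (rule fourier_modulate)
  finally show ?thesis .
 qed
 define \<psi> where "\<psi> = fourier \<Psi>"
 have \<psi>: "\<psi> \<in> schwartz" unfolding \<psi>_def using \<Psi> by (rule schwartz_fourier)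
 have "(\<lambda>\<eta>. m \<eta> * ((1 - q \<eta>) * (gauss \<tau> \<eta> * \<Psi> \<eta>))) = (\<lambda>\<eta>. K \<eta> * ((2 * pi) ^ DIM('a) * inv_fourier \<psi> \<eta>))"
 proof
  fix \<eta>
  have "K \<eta> * ((2 * pi) ^ DIM('a) * inv_fourier \<psi> \<eta>) = (c * (2 * pi) ^ DIM('a)) * (m \<eta> * ((1 - q \<eta>) * (gauss \<tau> \<eta> * \<Psi> \<eta>)))"
   unfolding K_def \<psi>_def inv_fourier_fourier[OF \<Psi>] by (simp only: mult_ac)
  then show "m \<eta> * ((1 - q \<eta>) * (gauss \<tau> \<eta> * \<Psi> \<eta>)) = K \<eta> * ((2 * pi) ^ DIM('a) * inv_fourier \<psi> \<eta>)" unfolding c by simp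
 qed
 then have "u (fourier (\<lambda>\<eta>. m \<eta> * ((1 - q \<eta>) * (gauss \<tau> \<eta> * \<Psi> \<eta>)))) = (\<integral>x. \<psi> x * u (\<lambda>y. fourier K (y - x)) \<partial>lborel)"
  using tempered_convolution[OF u K \<psi>] by simp
 also have "ennreal (norm ...) \<le> (\<integral>\<^sup>+x. ennreal (\<integral>\<eta>. norm (\<Psi> \<eta>) \<partial>lborel) * ennreal (norm (u (\<lambda>y. fourier K (y - x)))) \<partial>lborel)"
 proof (cases "integrable lborel (\<lambda>x. \<psi> x * u (\<lambda>y. fourier K (y - x)))")
  case True
  have "ennreal (norm (\<integral>x. \<psi> x * u (\<lambda>y. fourier K (y - x)) \<partial>lborel)) \<le> (\<integral>\<^sup>+x. ennreal (norm (\<psi> x * u (\<lambda>y. fourier K (y - x)))) \<partial>lborel)"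
   by (rule integral_norm_bound_ennreal[OF True])
  also have "... \<le> (\<integral>\<^sup>+x. ennreal (\<integral>\<eta>. norm (\<Psi> \<eta>) \<partial>lborel) * ennreal (norm (u (\<lambda>y. fourier K (y - x)))) \<partial>lborel)"
   unfolding norm_mult \<psi>_def
   by (intro nn_integral_mono) (auto simp: ennreal_mult[symmetric] intro!: ennreal_leI mult_right_mono norm_fourier_le)
  finally show ?thesis .
 qed (simp add: not_integrable_integral_eq)
 also have "... = ennreal (\<integral>\<eta>. norm (\<Psi> \<eta>) \<partial>lborel) * (\<integral>\<^sup>+x. ennreal (norm (u (\<lambda>y. fourier K (y - x)))) \<partial>lborel)"
  using tempered_shift_measurable[OF u K] by (intro nn_integral_cmult) simp
 also have "... \<le> ennreal (\<integral>\<eta>. norm (\<Psi> \<eta>) \<partial>lborel) * hardy_norm q 1 (fmult m u)"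
 proof (rule mult_left_mono)
  have "(\<integral>\<^sup>+x. ennreal (norm (u (\<lambda>y. fourier K (y - x)))) \<partial>lborel) \<le> H1_norm w"
   unfolding H1_norm_def wx[symmetric] by (intro nn_integral_mono SUP_upper) (use \<tau> in auto)
  also have "... \<le> hardy_norm q 1 (fmult m u)" unfolding hardy_norm_def w_def by (simp add: add_increasing)
  finally show "(\<integral>\<^sup>+x. ennreal (norm (u (\<lambda>y. fourier K (y - x)))) \<partial>lborel) \<le> hardy_norm q 1 (fmult m u)" .
 qed simp
 finally show ?thesis .
qed

context
 fixes \<zeta> :: "real^'n => real" and b \<delta> :: real and \<omega>0 :: "real^'n"
  and \<phi> :: "real^'n => real^'n => complex" and q :: "real^'n => complex"
 assumes b: "1 \<le> b" and \<zeta>: "smooth (\<lambda>x. complex_of_real (\<zeta> x))" and \<zeta>0: "\<And>x. b < norm x ==> \<zeta> x = 0"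
  and \<delta>: "0 < \<delta>" "\<delta> * b \<le> 1/8" and \<omega>0: "norm \<omega>0 = 1" and \<phi>: "wave_packets \<phi>"
  and q: "q \<in> schwartz" "\<And>x. b < norm x ==> q x = 0"
begin

text \<open>By duality the packet has to be paired with \<open>u\<close> in the unit ball for \<open>p = 1\<close>. For each direction in the
set provided by \<open>wave_packets_lower\<close> the packet can be divided by the symbol \<open>\<phi> \<omega>\<close>, so the pairing is bounded by
the Hardy norm of \<open>\<phi> \<omega> (D) u\<close>. Averaging over these directions gains the reciprocal of their measure.\<close>

lemma HFIO_inf_upper:
 assumes \<sigma>: "\<delta> * b \<le> \<sigma>" and c: "0 < c" and \<kappa>: "0 < \<kappa>"
  and lower: "\<And>\<theta> R. norm \<theta> = 1 ==> 4 \<le> R ==> \<exists>\<Omega>. \<Omega> \<in> sets sphere_measure \<and>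
   ennreal (\<kappa> * R powr (- (real CARD('n) - 1) / 2)) \<le> emeasure sphere_measure \<Omega> \<and>
   (\<forall>\<omega>\<in>\<Omega>. \<forall>\<xi>\<in>plank \<theta> \<sigma> R. c * R powr ((real CARD('n) - 1) / 4) \<le> norm (\<phi> \<omega> \<xi>))"
 obtains C R0 where "0 \<le> C" "4 \<le> R0" "\<And>R y. R0 \<le> R ==>
  HFIO_norm q \<phi> s \<infinity> (distr_of (inv_fourier (\<lambda>\<eta>. packet \<zeta> \<omega>0 \<delta> R \<eta> * exp (- \<i> * of_real (\<eta> \<bullet> y)))))
   \<le> ennreal (C * R powr ((real CARD('n) - 1) / 4 + s + (real CARD('n) + 1) / 2))"
proof -
 define n where "n = real CARD('n)"
 define e where "e = (n - 1) / 4"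
 obtain Z where Z: "0 \<le> Z" "\<And>x. \<bar>\<zeta> x\<bar> \<le> Z"
 proof -
  have "(\<lambda>x. complex_of_real (\<zeta> x)) \<in> schwartz" by (rule schwartz_compact_support[OF \<zeta>, of b]) (simp add: \<zeta>0)
  then obtain C where "0 \<le> C" "\<And>x. (1 + norm x) ^ 0 * norm (complex_of_real (\<zeta> x)) \<le> C" using schwartz_bound by blast
  then show ?thesis using that by auto
 qed
 define V where "V = \<delta> ^ CARD('n) * measure lborel (cball (0::real^'n) b)"
 have V: "0 \<le> V" unfolding V_def using \<delta> by simp
 define A where "A = 3 powr \<bar>s\<bar> * Z * exp 4 / c"
 have A: "0 \<le> A" unfolding A_def using Z c by simp
 define R0 where "R0 = max 4 (2 * b + 1)"
 define C where "C = A * V / \<kappa>"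
 have main: "HFIO_norm q \<phi> s \<infinity> (distr_of (inv_fourier (\<lambda>\<eta>. packet \<zeta> \<omega>0 \<delta> R \<eta> * exp (- \<i> * of_real (\<eta> \<bullet> y)))))
   \<le> ennreal (C * R powr (e + s + (n + 1) / 2))" if R0: "R0 \<le> R" for R y
 proof -
  have R: "4 \<le> R" "2 * b < R" using R0 unfolding R0_def by auto
  define F where "F = (\<lambda>\<eta>. packet \<zeta> \<omega>0 \<delta> R \<eta> * exp (- \<i> * of_real (\<eta> \<bullet> y)))"
  have F: "F \<in> schwartz" unfolding F_def by (rule modulated_packet_schwartz[OF b \<zeta> \<zeta>0 \<delta> \<omega>0 \<phi> q R(1)])
  have jm: "(\<lambda>\<xi>. of_real (japanese \<xi> powr s)) \<in> (moderate :: (real^'n => complex) set)"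
   using symb_moderate[OF symb.jap[of s], of 1] by simp
  define H where "H = (\<lambda>\<eta>. of_real (japanese \<eta> powr s) * F \<eta>)"
  have H: "H \<in> schwartz" unfolding H_def using jm F by (rule schwartz_mult)
  define h where "h = inv_fourier H"
  have h: "h \<in> schwartz" unfolding h_def using H by (rule schwartz_inv_fourier)
  define h' where "h' = inv_fourier h"
  have h': "h' \<in> schwartz" unfolding h'_def using h by (rule schwartz_inv_fourier)
  have h'_eq: "h' \<eta> = H (- \<eta>) / (2 * pi) ^ CARD('n)" for \<eta>
   unfolding h'_def inv_fourier_eq[of h] unfolding h_def fourier_inv_fourier[OF H] by simp
  define S where "S = {\<eta>. norm (aniso \<omega>0 (1 / (\<delta> * R)) (1 / (\<delta> * sqrt R)) (\<eta> - (- (R *\<^sub>R \<omega>0)))) \<le> b}"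
  have Sc: "closed S"
  proof -
   have "continuous_on UNIV (\<lambda>\<eta>. norm (aniso \<omega>0 (1 / (\<delta> * R)) (1 / (\<delta> * sqrt R)) (\<eta> - (- (R *\<^sub>R \<omega>0)))))"
    unfolding aniso_def by (intro continuous_intros)
   then show ?thesis unfolding S_def using closed_Collect_le[of _ "\<lambda>_. b"] by simp
  qed
  have Sb: "S \<in> sets borel" using Sc by simp
  have SV: "emeasure lborel S = ennreal (V * R powr ((n + 1) / 2))"
   unfolding S_def V_def n_def by (rule aniso_ball_measure[OF \<omega>0 \<delta>(1)]) (use R in simp)
  have Srefl: "norm (aniso \<omega>0 (1 / (\<delta> * R)) (1 / (\<delta> * sqrt R)) (- \<eta> - R *\<^sub>R \<omega>0)) \<le> b \<longleftrightarrow> \<eta> \<in> S" for \<eta>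
  proof -
   have "- \<eta> - R *\<^sub>R \<omega>0 = - (\<eta> - (- (R *\<^sub>R \<omega>0)))" by simp
   then show ?thesis unfolding S_def by (simp only: linear_neg[OF linear_aniso] norm_minus_cancel mem_Collect_eq)
  qed
  have h'0: "h' \<eta> = 0" if "\<eta> \<notin> S" for \<eta>
  proof -
   have "packet \<zeta> \<omega>0 \<delta> R (- \<eta>) = 0"
    using packet_nonzero_iff_dist[of \<zeta> \<omega>0 \<delta> R "- \<eta>" b] \<zeta>0 that Srefl by blast
   then show ?thesis unfolding h'_eq H_def F_def by simp
  qed
  have Spl: "- \<eta> \<in> plank \<omega>0 (\<delta> * b) R" if "\<eta> \<in> S" for \<eta>
   using that aniso_ball_plank[OF \<omega>0 \<delta>(1), of R "- \<eta>" b] R Srefl by simp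
  have Spl': "\<eta> \<in> plank (- \<omega>0) \<sigma> R" if "\<eta> \<in> S" for \<eta>
  proof -
   have "\<eta> \<in> plank (- \<omega>0) (\<delta> * b) R" using plank_reflect[OF Spl[OF that]] by simp
   moreover have "\<delta> * b * R \<le> \<sigma> * R" "\<delta> * b * sqrt R \<le> \<sigma> * sqrt R" using \<sigma> R by (auto intro: mult_right_mono)
   ultimately show ?thesis unfolding plank_def by auto
  qed
  have Sn: "R / 2 \<le> norm \<eta>" "norm \<eta> \<le> 2 * R" if "\<eta> \<in> S" for \<eta>
   using plank_bounds(1,2)[OF \<omega>0 \<delta>(2) R(1) Spl[OF that]] by auto
  have h'b: "norm (h' \<eta>) \<le> 3 powr \<bar>s\<bar> * Z * R powr s" if \<eta>: "\<eta> \<in> S" for \<eta>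
  proof -
   have j: "japanese (- \<eta>) powr s \<le> 3 powr \<bar>s\<bar> * R powr s"
    using R Sn[OF \<eta>] japanese_le[of "- \<eta>"] norm_le_japanese[of "- \<eta>"] by (intro powr_comparable) auto
   have "norm (h' \<eta>) = japanese (- \<eta>) powr s * \<bar>\<zeta> (aniso \<omega>0 (1 / (\<delta> * R)) (1 / (\<delta> * sqrt R)) (- \<eta> - R *\<^sub>R \<omega>0))\<bar> / (2 * pi) ^ CARD('n)"
    unfolding h'_eq H_def F_def packet_def by (simp add: norm_divide norm_mult norm_power)
   also have "... \<le> (3 powr \<bar>s\<bar> * R powr s) * Z / (2 * pi) ^ CARD('n)"
    by (intro divide_right_mono mult_mono j Z) auto
   also have "... \<le> (3 powr \<bar>s\<bar> * R powr s) * Z / 1"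
    using Z pi_ge_two by (intro divide_left_mono one_le_power mult_nonneg_nonneg) auto
   finally show ?thesis by (simp add: mult_ac)
  qed
  \<comment> \<open>At this scale the heat factor is bounded below on the packet, so dividing by it is harmless.\<close>
  define \<tau> where "\<tau> = 1 / R\<^sup>2"
  have \<tau>: "0 < \<tau>" unfolding \<tau>_def using R by simp
  \<comment> \<open>The pairing is bilinear, so it tests the frequencies opposite to those of the packet.\<close>
  obtain \<Omega> where \<Omega>: "\<Omega> \<in> sets sphere_measure" "ennreal (\<kappa> * R powr (- (n - 1) / 2)) \<le> emeasure sphere_measure \<Omega>"
   "\<And>\<omega> \<xi>. \<omega> \<in> \<Omega> ==> \<xi> \<in> plank (- \<omega>0) \<sigma> R ==> c * R powr e \<le> norm (\<phi> \<omega> \<xi>)"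
   using lower[of "- \<omega>0" R] \<omega>0 R unfolding n_def e_def by auto
  define X where "X = A * R powr (s - e) * (V * R powr ((n + 1) / 2))"
  have X: "0 \<le> X" unfolding X_def using A V by simp
  have key: "ennreal (norm (u h)) \<le> ennreal X * hardy_norm q 1 (fmult (\<phi> \<omega>) u)"
   if u: "u \<in> tempered" and \<omega>\<Omega>: "\<omega> \<in> \<Omega>" for u \<omega>
  proof -
   have "\<Omega> \<subseteq> sphere 0 1" using sets.sets_into_space[OF \<Omega>(1)] by simp
   then have \<omega>: "norm \<omega> = 1" using \<omega>\<Omega> by auto
   have \<phi>m: "\<phi> \<omega> \<in> moderate" by (rule wave_packets_moderate[OF \<phi> \<omega>])
   have gm: "smooth (gauss \<tau> :: real^'n => complex)" using schwartz_smooth[OF schwartz_gauss[OF \<tau>]] .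
   have pos: "0 < c * R powr e" using c R by simp
   have ne: "\<phi> \<omega> \<eta> * gauss \<tau> \<eta> \<noteq> 0" if "\<eta> \<in> S" for \<eta>
    using \<Omega>(3)[OF \<omega>\<Omega> Spl'[OF that]] pos by (auto simp: gauss_def)
   define \<Psi> where "\<Psi> \<eta> = h' \<eta> / (\<phi> \<omega> \<eta> * gauss \<tau> \<eta>)" for \<eta>
   have "smooth \<Psi>" unfolding \<Psi>_def[abs_def]
    by (rule smooth_divide_supported[OF schwartz_smooth[OF h'] smooth_mult[OF wave_packets_smooth[OF \<phi> \<omega>] gm] Sc h'0 ne])
   moreover have "\<Psi> \<eta> = 0" if "2 * R < norm \<eta>" for \<eta>
    using h'0[of \<eta>] Sn(2)[of \<eta>] that unfolding \<Psi>_def by fastforce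
   ultimately have \<Psi>: "\<Psi> \<in> schwartz" by (rule schwartz_compact_support)
   have "(\<lambda>\<eta>. \<phi> \<omega> \<eta> * ((1 - q \<eta>) * (gauss \<tau> \<eta> * \<Psi> \<eta>))) = h'"
   proof
    fix \<eta>
    show "\<phi> \<omega> \<eta> * ((1 - q \<eta>) * (gauss \<tau> \<eta> * \<Psi> \<eta>)) = h' \<eta>"
    proof (cases "\<eta> \<in> S")
     case True
     have "q \<eta> = 0" using q(2)[of \<eta>] Sn(1)[OF True] R by simp
     then show ?thesis using ne[OF True] unfolding \<Psi>_def by simp
    qed (simp add: \<Psi>_def h'0)
   qed
   then have "u (fourier (\<lambda>\<eta>. \<phi> \<omega> \<eta> * ((1 - q \<eta>) * (gauss \<tau> \<eta> * \<Psi> \<eta>)))) = u h"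
    unfolding h'_def using fourier_inv_fourier[OF h] by simp
   then have "ennreal (norm (u h)) \<le> ennreal (\<integral>\<eta>. norm (\<Psi> \<eta>) \<partial>lborel) * hardy_norm q 1 (fmult (\<phi> \<omega>) u)"
    using hardy_norm_one_lower[OF u \<phi>m schwartz_subset_moderate[OF q(1)] \<Psi> \<tau>] by simp
   also have "... \<le> ennreal X * hardy_norm q 1 (fmult (\<phi> \<omega>) u)"
   proof (intro mult_right_mono ennreal_leI)
    show "(\<integral>\<eta>. norm (\<Psi> \<eta>) \<partial>lborel) \<le> X"
     unfolding X_def
    proof (rule integral_norm_le_measure[OF \<Psi> Sb SV])
     show "0 \<le> V * R powr ((n + 1) / 2)" using V by simp
     show "\<Psi> \<eta> = 0" if "\<eta> \<notin> S" for \<eta> using h'0[OF that] by (simp add: \<Psi>_def)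
     fix \<eta> assume \<eta>: "\<eta> \<in> S"
     have ge: "exp (- 4) \<le> norm (gauss \<tau> \<eta>)"
     proof -
      have "(norm \<eta>)\<^sup>2 \<le> (2 * R)\<^sup>2" using Sn(2)[OF \<eta>] by (intro power_mono) auto
      then have "\<tau> * (norm \<eta>)\<^sup>2 \<le> 4" unfolding \<tau>_def using R by (simp add: divide_le_eq power_mult_distrib)
      then show ?thesis by (simp add: gauss_def)
     qed
     have "norm (\<Psi> \<eta>) = norm (h' \<eta>) / (norm (\<phi> \<omega> \<eta>) * norm (gauss \<tau> \<eta>))"
      unfolding \<Psi>_def by (simp add: norm_divide norm_mult)
     also have "... \<le> (3 powr \<bar>s\<bar> * Z * R powr s) / ((c * R powr e) * exp (- 4))"
      using pos ge c by (intro frac_le h'b[OF \<eta>] mult_mono \<Omega>(3)[OF \<omega>\<Omega> Spl'[OF \<eta>]] mult_pos_pos mult_nonneg_nonneg Z) auto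
     also have "... = A * R powr (s - e)"
      unfolding A_def using R by (simp add: powr_diff exp_minus field_simps)
     finally show "norm (\<Psi> \<eta>) \<le> A * R powr (s - e)" .
    qed
   qed simp
   finally show ?thesis .
  qed
  have X2: "X / (\<kappa> * R powr (- (n - 1) / 2)) = C * R powr (e + s + (n + 1) / 2)"
  proof -
   have "R powr (s - e) * R powr ((n + 1) / 2) / R powr (- (n - 1) / 2) = R powr (s - e + (n + 1) / 2 - (- (n - 1) / 2))"
    by (simp only: powr_add powr_diff)
   also have "s - e + (n + 1) / 2 - (- (n - 1) / 2) = e + s + (n + 1) / 2" unfolding e_def by (simp add: field_simps)
   finally have "R powr (e + s + (n + 1) / 2) = R powr (s - e) * R powr ((n + 1) / 2) / R powr (- (n - 1) / 2)" ..
   then show ?thesis unfolding X_def C_def by simp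
  qed
  define L where "L = (\<lambda>u :: (real^'n) distribution. u h)"
  have dn: "HFIO1_dual_norm q \<phi> L \<le> ennreal (C * R powr (e + s + (n + 1) / 2))"
   unfolding HFIO1_dual_norm_def
  proof (rule SUP_least)
   fix u assume "u \<in> {v \<in> HFIO_fin q \<phi> 1. HFIO_fin_norm q \<phi> 1 v \<le> 1}"
   then have u: "u \<in> tempered" and u1: "HFIO_fin_norm q \<phi> 1 u \<le> 1" unfolding HFIO_fin_def by auto
   define t where "t = norm (u h)"
   have "ennreal t * emeasure sphere_measure \<Omega> = (\<integral>\<^sup>+\<omega>. ennreal t * indicator \<Omega> \<omega> \<partial>sphere_measure)"
    using \<Omega>(1) by (simp add: nn_integral_cmult_indicator)
   show "ennreal (norm (L u)) \<le> ennreal (C * R powr (e + s + (n + 1) / 2))"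
   proof (cases "X = 0")
    case True
    have "0 < \<kappa> * R powr (- (n - 1) / 2)" using \<kappa> R by (intro mult_pos_pos) auto
    then have "emeasure sphere_measure \<Omega> \<noteq> 0"
     using \<Omega>(2) by (metis ennreal_eq_0_iff le_zero_eq not_le)
    then obtain \<omega> where \<omega>: "\<omega> \<in> \<Omega>" by (metis emeasure_empty ex_in_conv)
    then show ?thesis using key[OF u \<omega>] unfolding L_def True by simp
   next
    case False
    then have Xp: "0 < X" using X by simp
    have "ennreal (t / X) * emeasure sphere_measure \<Omega> = (\<integral>\<^sup>+\<omega>. ennreal (t / X) * indicator \<Omega> \<omega> \<partial>sphere_measure)"
     using \<Omega>(1) by (simp add: nn_integral_cmult_indicator)
    also have "... \<le> (\<integral>\<^sup>+\<omega>. hardy_norm q 1 (fmult (\<phi> \<omega>) u) \<partial>sphere_measure)"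
    proof (rule nn_integral_mono)
     fix \<omega>
     show "ennreal (t / X) * indicator \<Omega> \<omega> \<le> hardy_norm q 1 (fmult (\<phi> \<omega>) u)"
     proof (cases "\<omega> \<in> \<Omega>")
      case True
      have "ennreal (1 / X) * ennreal t \<le> ennreal (1 / X) * (ennreal X * hardy_norm q 1 (fmult (\<phi> \<omega>) u))"
       unfolding t_def by (intro mult_left_mono key u True) simp
      also have "... = hardy_norm q 1 (fmult (\<phi> \<omega>) u)" by (rule ennreal_cancel_left[OF Xp])
      finally show ?thesis using True Xp by (simp add: ennreal_mult'[symmetric] t_def)
     qed simp
    qed
    also have "... \<le> HFIO_fin_norm q \<phi> 1 u" unfolding HFIO_fin_norm_def by (simp add: add_increasing)
    also have "... \<le> 1" by (rule u1)
    finally have 1: "ennreal (t / X) * emeasure sphere_measure \<Omega> \<le> 1" .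
    have "ennreal (t / X * (\<kappa> * R powr (- (n - 1) / 2))) = ennreal (t / X) * ennreal (\<kappa> * R powr (- (n - 1) / 2))"
     using \<kappa> Xp by (intro ennreal_mult) (simp_all add: t_def)
    also have "... \<le> ennreal (t / X) * emeasure sphere_measure \<Omega>" by (intro mult_left_mono \<Omega>(2)) simp
    also have "... \<le> ennreal 1" using 1 by simp
    finally have "t / X * (\<kappa> * R powr (- (n - 1) / 2)) \<le> 1" by (simp add: ennreal_le_iff)
    then have "t \<le> X / (\<kappa> * R powr (- (n - 1) / 2))" using Xp \<kappa> R by (simp add: field_simps)
    then show ?thesis unfolding X2 L_def t_def by (rule ennreal_leI)
   qed
  qed
  have "L \<in> HFIO1_dual q \<phi>"
   unfolding HFIO1_dual_def using le_less_trans[OF dn ennreal_less_top] by (simp add: L_def)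
  moreover have "distr_of h g = L (distr_of g)" if "g \<in> schwartz" for g
   unfolding L_def distr_of_def using h that by (simp add: mult.commute)
  ultimately have "HFIO_inf_norm q \<phi> (distr_of h) \<le> HFIO1_dual_norm q \<phi> L"
   unfolding HFIO_inf_norm_def by (intro INF_lower) auto
  also have "... \<le> ennreal (C * R powr (e + s + (n + 1) / 2))" by (rule dn)
  finally have "HFIO_inf_norm q \<phi> (distr_of h) \<le> ..." .
  moreover have "fmult (\<lambda>\<xi>. of_real (japanese \<xi> powr s)) (distr_of (inv_fourier F)) = distr_of h"
   unfolding h_def H_def by (rule fmult_distr_of[OF jm F])
  ultimately show ?thesis unfolding HFIO_norm_def Let_def F_def[symmetric] by simp
 qed
 show ?thesis
 proof (rule that[of C R0])
  show "0 \<le> C" unfolding C_def using A V \<kappa> by simp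
  show "4 \<le> R0" unfolding R0_def by simp
 qed (use main in \<open>simp add: e_def n_def\<close>)
qed

end

section \<open>Local behaviour of amplitude and phase\<close>

lemma smooth_on_open_pderivs:
 assumes "smooth_on V f" "open V" "set vs \<subseteq> Basis" "x \<in> V"
 shows "pderivs vs f differentiable (at x)"
 using assms unfolding smooth_on_def differentiable_on_def by (metis at_within_open)

lemma smooth_on_continuous_pderivs:
 assumes "smooth_on V f" "set vs \<subseteq> Basis"
 shows "continuous_on V (pderivs vs f)"
 using assms unfolding smooth_on_def by (simp add: differentiable_imp_continuous_on)

lemma symbol_class_directional:
 fixes a :: "'z::euclidean_space \<times> 'a::euclidean_space => complex"
 assumes a: "a \<in> symbol_class m"
 obtains C where "0 \<le> C" "\<And>z \<eta>. norm (a (z, \<eta>)) \<le> C * japanese \<eta> powr m"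
  "\<And>z \<eta> h k. norm (pderiv_dir (h, k) a (z, \<eta>)) \<le> C * (norm h * japanese \<eta> powr m + norm k * japanese \<eta> powr (m - 1))"
proof -
 have sm: "smooth a" using a unfolding symbol_class_def by blast
 note jp = japanese_pos
 have bd: "\<exists>C. 0 \<le> C \<and> (\<forall>z \<eta>. norm (pderivs (map (\<lambda>v. (v, 0)) vs @ map (\<lambda>w. (0, w)) ws) a (z, \<eta>)) \<le> C * japanese \<eta> powr (m - real (length ws)))"
  if "set vs \<subseteq> Basis" "set ws \<subseteq> Basis" for vs :: "'z list" and ws :: "'a list"
 proof -
  have "bounded (range (\<lambda>(z, \<eta>). japanese \<eta> powr (real (length ws) - m) * norm (pderivs (map (\<lambda>v. (v, 0)) vs @ map (\<lambda>w. (0, w)) ws) a (z, \<eta>))))"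
   using a that unfolding symbol_class_def by blast
  then obtain C where C: "\<And>z \<eta>. \<bar>japanese \<eta> powr (real (length ws) - m) * norm (pderivs (map (\<lambda>v. (v, 0)) vs @ map (\<lambda>w. (0, w)) ws) a (z, \<eta>))\<bar> \<le> C"
   unfolding bounded_iff by (auto simp: split_beta)
  have "norm (pderivs (map (\<lambda>v. (v, 0)) vs @ map (\<lambda>w. (0, w)) ws) a (z, \<eta>)) \<le> \<bar>C\<bar> * japanese \<eta> powr (m - real (length ws))" (is "?N \<le> _") for z \<eta>
  proof -
   have "japanese \<eta> powr (m - real (length ws)) * (japanese \<eta> powr (real (length ws) - m) * ?N) = ?N"
    using jp[of \<eta>] by (simp add: powr_add[symmetric] mult.assoc[symmetric])
   moreover have "japanese \<eta> powr (real (length ws) - m) * ?N \<le> \<bar>C\<bar>" using C[of \<eta> z] by linarith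
   ultimately show ?thesis by (metis mult.commute mult_left_mono powr_ge_zero)
  qed
  then show ?thesis by (intro exI[of _ "\<bar>C\<bar>"]) auto
 qed
 obtain C0 where C0: "0 \<le> C0" "\<And>z \<eta>. norm (a (z, \<eta>)) \<le> C0 * japanese \<eta> powr m"
  using bd[of "[]" "[]"] by auto
 have "\<exists>C. 0 \<le> C \<and> (\<forall>z \<eta> h k. \<bar>(h, k) \<bullet> b\<bar> * norm (pderiv_dir b a (z, \<eta>)) \<le> C * (norm h * japanese \<eta> powr m + norm k * japanese \<eta> powr (m - 1)))"
  if b: "b \<in> Basis" for b
 proof -
  from b consider v where "v \<in> Basis" "b = (v, 0)" | w where "w \<in> Basis" "b = (0, w)"
   unfolding Basis_prod_def by blast
  then show ?thesis
  proof cases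
   case 1
   obtain C where C: "0 \<le> C" "\<And>z \<eta>. norm (pderiv_dir b a (z, \<eta>)) \<le> C * japanese \<eta> powr m"
    using bd[of "[v]" "[]"] 1 by (auto simp: pderivs_Cons)
   have "\<bar>(h, k) \<bullet> b\<bar> * norm (pderiv_dir b a (z, \<eta>)) \<le> C * (norm h * japanese \<eta> powr m + norm k * japanese \<eta> powr (m - 1))" for z \<eta> h k
   proof -
    have "\<bar>(h, k) \<bullet> b\<bar> * norm (pderiv_dir b a (z, \<eta>)) \<le> norm h * (C * japanese \<eta> powr m)"
     using 1 by (intro mult_mono C) (auto simp: Basis_le_norm)
    also have "... \<le> C * (norm h * japanese \<eta> powr m + norm k * japanese \<eta> powr (m - 1))"
     using C(1) by (simp add: algebra_simps)
    finally show ?thesis .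
   qed
   then show ?thesis using C(1) by blast
  next
   case 2
   obtain C where C: "0 \<le> C" "\<And>z \<eta>. norm (pderiv_dir b a (z, \<eta>)) \<le> C * japanese \<eta> powr (m - 1)"
    using bd[of "[]" "[w]"] 2 by (auto simp: pderivs_Cons)
   have "\<bar>(h, k) \<bullet> b\<bar> * norm (pderiv_dir b a (z, \<eta>)) \<le> C * (norm h * japanese \<eta> powr m + norm k * japanese \<eta> powr (m - 1))" for z \<eta> h k
   proof -
    have "\<bar>(h, k) \<bullet> b\<bar> * norm (pderiv_dir b a (z, \<eta>)) \<le> norm k * (C * japanese \<eta> powr (m - 1))"
     using 2 by (intro mult_mono C) (auto simp: Basis_le_norm)
    also have "... \<le> C * (norm h * japanese \<eta> powr m + norm k * japanese \<eta> powr (m - 1))"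
     using C(1) by (simp add: algebra_simps)
    finally show ?thesis .
   qed
   then show ?thesis using C(1) by blast
  qed
 qed
 then have "\<forall>b. \<exists>C. 0 \<le> C \<and> (b \<in> Basis --> (\<forall>z \<eta> h k. \<bar>(h, k) \<bullet> b\<bar> * norm (pderiv_dir b a (z, \<eta>)) \<le> C * (norm h * japanese \<eta> powr m + norm k * japanese \<eta> powr (m - 1))))"
  by (metis order_refl)
 then obtain C where C: "\<And>b. 0 \<le> C b" "\<And>b z \<eta> h k. b \<in> Basis ==> \<bar>(h, k) \<bullet> b\<bar> * norm (pderiv_dir b a (z, \<eta>)) \<le> C b * (norm h * japanese \<eta> powr m + norm k * japanese \<eta> powr (m - 1))"
  by metis
 have S0: "0 \<le> (\<Sum>b\<in>Basis. C b)" by (intro sum_nonneg C)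
 have "norm (pderiv_dir (h, k) a (z, \<eta>)) \<le> (C0 + (\<Sum>b\<in>Basis. C b)) * (norm h * japanese \<eta> powr m + norm k * japanese \<eta> powr (m - 1))" for z \<eta> h k
 proof -
  have "norm (pderiv_dir (h, k) a (z, \<eta>)) \<le> (\<Sum>b\<in>Basis. \<bar>(h, k) \<bullet> b\<bar> * norm (pderiv_dir b a (z, \<eta>)))"
   by (rule norm_pderiv_dir_le[OF smooth_differentiable[OF sm]])
  also have "... \<le> (\<Sum>b\<in>Basis. C b * (norm h * japanese \<eta> powr m + norm k * japanese \<eta> powr (m - 1)))"
   by (intro sum_mono C)
  also have "... = (\<Sum>b\<in>Basis. C b) * (norm h * japanese \<eta> powr m + norm k * japanese \<eta> powr (m - 1))"
   by (simp only: sum_distrib_right)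
  also have "... \<le> (C0 + (\<Sum>b\<in>Basis. C b)) * (norm h * japanese \<eta> powr m + norm k * japanese \<eta> powr (m - 1))"
   using C0(1) by (intro mult_right_mono) auto
  finally show ?thesis .
 qed
 moreover have "norm (a (z, \<eta>)) \<le> (C0 + (\<Sum>b\<in>Basis. C b)) * japanese \<eta> powr m" for z \<eta>
  by (rule order_trans[OF C0(2)]) (use S0 in \<open>auto intro: mult_right_mono\<close>)
 ultimately show ?thesis using that[of "C0 + (\<Sum>b\<in>Basis. C b)"] C0(1) S0 by auto
qed

lemma amplitude_near:
 fixes a :: "'z::euclidean_space \<times> 'a::euclidean_space => complex"
 assumes a: "a \<in> symbol_class m" and \<omega>: "norm \<omega> = 1" and \<epsilon>: "0 < \<epsilon>"
 obtains \<rho> \<sigma>0 where "0 < \<rho>" "0 < \<sigma>0" "\<sigma>0 \<le> 1/8"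
  "\<And>z R \<sigma> \<eta>. norm (z - z0) \<le> \<rho> ==> 4 \<le> R ==> \<sigma> \<le> \<sigma>0 ==> \<eta> \<in> plank \<omega> \<sigma> R ==> norm (a (z, \<eta>) - a (z0, R *\<^sub>R \<omega>)) \<le> \<epsilon> * R powr m"
proof -
 have sm: "smooth a" using a unfolding symbol_class_def by blast
 obtain C1 where C1: "0 \<le> C1" "\<And>z \<eta> h k. norm (pderiv_dir (h, k) a (z, \<eta>)) \<le> C1 * (norm h * japanese \<eta> powr m + norm k * japanese \<eta> powr (m - 1))"
  using symbol_class_directional[OF a] by metis
 define C where "C = C1 + 1"
 have C: "0 < C" "\<And>z \<eta> h k. norm (pderiv_dir (h, k) a (z, \<eta>)) \<le> C * (norm h * japanese \<eta> powr m + norm k * japanese \<eta> powr (m - 1))"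
 proof -
  show "0 < C" using C1(1) by (simp add: C_def)
  show "norm (pderiv_dir (h, k) a (z, \<eta>)) \<le> C * (norm h * japanese \<eta> powr m + norm k * japanese \<eta> powr (m - 1))" for z \<eta> h k
   by (rule order_trans[OF C1(2)]) (auto simp: C_def intro!: mult_right_mono)
 qed
 define B where "B = 3 powr \<bar>m\<bar> + 3 powr \<bar>m - 1\<bar>"
 have B: "0 < B" "3 powr \<bar>m\<bar> \<le> B" "3 powr \<bar>m - 1\<bar> \<le> B" unfolding B_def by (auto intro: add_pos_pos)
 \<comment> \<open>Moving \<open>z\<close> and moving \<open>\<eta>\<close> are each allowed half of \<open>\<epsilon>\<close>.\<close>
 define \<rho> where "\<rho> = \<epsilon> / (2 * C * B)"
 define \<sigma>0 where "\<sigma>0 = min (1 / 8) (\<epsilon> / (4 * C * B))"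
 have \<rho>: "0 < \<rho>" "C * (\<rho> * B) = \<epsilon> / 2" unfolding \<rho>_def using \<epsilon> C B by auto
 have \<sigma>0: "0 < \<sigma>0" "\<sigma>0 \<le> 1 / 8" "\<sigma>0 \<le> \<epsilon> / (4 * C * B)" unfolding \<sigma>0_def using \<epsilon> C B by auto
 have "norm (a (z, \<eta>) - a (z0, R *\<^sub>R \<omega>)) \<le> \<epsilon> * R powr m"
  if z: "norm (z - z0) \<le> \<rho>" and R: "4 \<le> R" and \<sigma>: "\<sigma> \<le> \<sigma>0" and \<eta>: "\<eta> \<in> plank \<omega> \<sigma> R" for z R \<sigma> \<eta>
 proof -
  have \<sigma>8: "\<sigma> \<le> 1 / 8" using \<sigma> \<sigma>0 by linarith
  note pl = plank_bounds[OF \<omega> \<sigma>8 R \<eta>]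
  have comp: "japanese x powr e \<le> 3 powr \<bar>e\<bar> * R powr e" if x: "R / 2 \<le> norm x" "norm x \<le> 2 * R" for x :: 'a and e
   using norm_le_japanese[of x] japanese_le[of x] x R by (intro powr_comparable) auto
  have 1: "norm (a ((z0, \<eta>) + (z - z0, 0)) - a (z0, \<eta>)) \<le> \<epsilon> / 2 * R powr m"
  proof (rule pderiv_mvt)
   fix s :: real assume s: "0 \<le> s" "s \<le> 1"
   show "a differentiable at ((z0, \<eta>) + s *\<^sub>R (z - z0, 0))" using sm by (rule smooth_differentiable)
   have "norm (pderiv_dir (z - z0, 0) a (z0 + s *\<^sub>R (z - z0), \<eta>)) \<le> C * (norm (z - z0) * japanese \<eta> powr m + norm (0::'a) * japanese \<eta> powr (m - 1))"
    by (rule C(2))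
   also have "... \<le> C * (\<rho> * (B * R powr m))"
   proof -
    have "japanese \<eta> powr m \<le> B * R powr m"
     by (rule order_trans[OF comp[OF pl(1,2)] mult_right_mono[OF B(2)]]) simp
    then have "norm (z - z0) * japanese \<eta> powr m \<le> \<rho> * (B * R powr m)" using z \<rho> by (intro mult_mono) auto
    then show ?thesis using C(1) by simp
   qed
   also have "... = \<epsilon> / 2 * R powr m" unfolding \<rho>(2)[symmetric] by simp
   finally show "norm (pderiv_dir (z - z0, 0) a ((z0, \<eta>) + s *\<^sub>R (z - z0, 0))) \<le> \<epsilon> / 2 * R powr m" by simp
  qed
  have 2: "norm (a ((z0, R *\<^sub>R \<omega>) + (0, \<eta> - R *\<^sub>R \<omega>)) - a (z0, R *\<^sub>R \<omega>)) \<le> \<epsilon> / 2 * R powr m"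
  proof (rule pderiv_mvt)
   fix s :: real assume s: "0 \<le> s" "s \<le> 1"
   show "a differentiable at ((z0, R *\<^sub>R \<omega>) + s *\<^sub>R (0, \<eta> - R *\<^sub>R \<omega>))" using sm by (rule smooth_differentiable)
   let ?x = "R *\<^sub>R \<omega> + s *\<^sub>R (\<eta> - R *\<^sub>R \<omega>)"
   have d: "norm (\<eta> - R *\<^sub>R \<omega>) \<le> 2 * \<sigma> * R" by (rule pl(3))
   have d2: "norm (s *\<^sub>R (\<eta> - R *\<^sub>R \<omega>)) \<le> R / 4"
   proof -
    have "norm (s *\<^sub>R (\<eta> - R *\<^sub>R \<omega>)) \<le> 1 * norm (\<eta> - R *\<^sub>R \<omega>)" using s by (simp only: norm_scaleR) (intro mult_right_mono, auto)
    also have "... \<le> 2 * (1/8) * R" using d mult_right_mono[OF \<sigma>8, of R] R by linarith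
    finally show ?thesis by simp
   qed
   have nR: "norm (R *\<^sub>R \<omega>) = R" using \<omega> R by simp
   have x: "R / 2 \<le> norm ?x" "norm ?x \<le> 2 * R"
    using norm_triangle_ineq[of "R *\<^sub>R \<omega>" "s *\<^sub>R (\<eta> - R *\<^sub>R \<omega>)"] norm_diff_ineq[of "R *\<^sub>R \<omega>" "s *\<^sub>R (\<eta> - R *\<^sub>R \<omega>)"] d2 nR R by linarith+
   have "norm (pderiv_dir (0, \<eta> - R *\<^sub>R \<omega>) a (z0, ?x)) \<le> C * (norm (0::'z) * japanese ?x powr m + norm (\<eta> - R *\<^sub>R \<omega>) * japanese ?x powr (m - 1))"
    by (rule C(2))
   also have "... \<le> C * ((2 * \<sigma>0 * R) * (B * R powr (m - 1)))"
   proof -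
    have "japanese ?x powr (m - 1) \<le> B * R powr (m - 1)"
     by (rule order_trans[OF comp[OF x] mult_right_mono[OF B(3)]]) simp
    moreover have "norm (\<eta> - R *\<^sub>R \<omega>) \<le> 2 * \<sigma>0 * R" using d mult_right_mono[OF \<sigma>, of R] R by linarith
    ultimately have "norm (\<eta> - R *\<^sub>R \<omega>) * japanese ?x powr (m - 1) \<le> (2 * \<sigma>0 * R) * (B * R powr (m - 1))"
     using \<sigma>0 R by (intro mult_mono) auto
    then show ?thesis using C(1) by simp
   qed
   also have "... = 2 * C * B * \<sigma>0 * (R * R powr (m - 1))" by simp
   also have "R * R powr (m - 1) = R powr m" using R by (simp add: powr_diff)
   also have "2 * C * B * \<sigma>0 * R powr m \<le> 2 * C * B * (\<epsilon> / (4 * C * B)) * R powr m"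
    using C B \<sigma>0 by (intro mult_right_mono mult_left_mono) auto
   also have "... = \<epsilon> / 2 * R powr m" using C B by simp
   finally show "norm (pderiv_dir (0, \<eta> - R *\<^sub>R \<omega>) a ((z0, R *\<^sub>R \<omega>) + s *\<^sub>R (0, \<eta> - R *\<^sub>R \<omega>))) \<le> \<epsilon> / 2 * R powr m" by simp
  qed
  have "norm (a (z, \<eta>) - a (z0, R *\<^sub>R \<omega>)) \<le> norm (a (z, \<eta>) - a (z0, \<eta>)) + norm (a (z0, \<eta>) - a (z0, R *\<^sub>R \<omega>))"
   using norm_triangle_ineq[of "a (z, \<eta>) - a (z0, \<eta>)" "a (z0, \<eta>) - a (z0, R *\<^sub>R \<omega>)"] by simp
  then show ?thesis using 1 2 by simp
 qed
 then show ?thesis using that[OF \<rho>(1) \<sigma>0(1,2)] by blast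
qed

text \<open>Here \<open>G z\<close> is the gradient of the phase in the fiber variable at \<open>\<omega>\<close>, and the estimate is the second-order Taylor
formula in that variable.\<close>

lemma phase_near:
 fixes \<Phi> :: "'z::euclidean_space \<times> 'a::euclidean_space => real"
 assumes V: "open V" "(z0, \<omega>) \<in> V" and \<Phi>: "smooth_on V \<Phi>"
 obtains \<rho> K G where "0 < \<rho>" "0 \<le> K" "cball z0 \<rho> \<times> cball \<omega> \<rho> \<subseteq> V" "continuous_on (cball z0 \<rho>) G"
  "\<And>z \<theta> y. z \<in> cball z0 \<rho> ==> norm \<theta> \<le> \<rho> ==> \<Phi> (z, \<omega>) = y \<bullet> \<omega> ==>
   \<bar>\<Phi> (z, \<omega> + \<theta>) - y \<bullet> (\<omega> + \<theta>)\<bar> \<le> \<bar>(G z - y) \<bullet> \<theta>\<bar> + K * (norm \<theta>)\<^sup>2"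
proof -
 obtain A B where AB: "open A" "open B" "(z0, \<omega>) \<in> A \<times> B" "A \<times> B \<subseteq> V" using open_prod_elim[OF V] by blast
 obtain r1 where r1: "0 < r1" "cball z0 r1 \<subseteq> A" using AB open_contains_cball_eq by blast
 obtain r2 where r2: "0 < r2" "cball \<omega> r2 \<subseteq> B" using AB open_contains_cball_eq by blast
 define \<rho> where "\<rho> = min r1 r2"
 have \<rho>: "0 < \<rho>" unfolding \<rho>_def using r1 r2 by simp
 have "cball z0 \<rho> \<subseteq> A" "cball \<omega> \<rho> \<subseteq> B"
  using r1(2) r2(2) subset_cball[of \<rho> r1 z0] subset_cball[of \<rho> r2 \<omega>] unfolding \<rho>_def by auto
 then have sub: "cball z0 \<rho> \<times> cball \<omega> \<rho> \<subseteq> V" using AB(4) by blast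
 define g where "g b = pderiv_dir (0, b) \<Phi>" for b :: 'a
 have B0: "(0, b) \<in> (Basis :: ('z \<times> 'a) set)" if "b \<in> Basis" for b using that unfolding Basis_prod_def by auto
 have \<Phi>d: "\<Phi> differentiable (at p)" if "p \<in> V" for p
  using smooth_on_open_pderivs[OF \<Phi> V(1), of "[]" p] that by simp
 have gd: "g b differentiable (at p)" if "p \<in> V" "b \<in> Basis" for p b
  using smooth_on_open_pderivs[OF \<Phi> V(1), of "[(0, b)]" p] that B0 by (simp add: g_def pderivs_Cons)
 have "\<exists>K. 0 \<le> K \<and> (\<forall>p\<in>cball z0 \<rho> \<times> cball \<omega> \<rho>. norm (pderiv_dir (0, c) (g b) p) \<le> K)" if "b \<in> Basis" "c \<in> Basis" for b c
 proof -
  have "continuous_on V (pderivs [(0, c), (0, b)] \<Phi>)"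
   by (rule smooth_on_continuous_pderivs[OF \<Phi>]) (use that B0 in auto)
  then have "continuous_on (cball z0 \<rho> \<times> cball \<omega> \<rho>) (pderiv_dir (0, c) (g b))"
   unfolding g_def using sub continuous_on_subset by (auto simp: pderivs_Cons)
  then have "bounded (pderiv_dir (0, c) (g b) ` (cball z0 \<rho> \<times> cball \<omega> \<rho>))"
   by (intro compact_imp_bounded compact_continuous_image compact_Times compact_cball)
  then obtain K where "\<forall>y\<in>pderiv_dir (0, c) (g b) ` (cball z0 \<rho> \<times> cball \<omega> \<rho>). norm y \<le> K"
   unfolding bounded_iff by blast
  then have "\<forall>p\<in>cball z0 \<rho> \<times> cball \<omega> \<rho>. norm (pderiv_dir (0, c) (g b) p) \<le> max K 0" by (intro ballI max.coboundedI1) blast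
  then show ?thesis by (intro exI[of _ "max K 0"]) simp
 qed
 then have "\<forall>b c. \<exists>K. 0 \<le> K \<and> (b \<in> Basis --> c \<in> Basis --> (\<forall>p\<in>cball z0 \<rho> \<times> cball \<omega> \<rho>. norm (pderiv_dir (0, c) (g b) p) \<le> K))"
  by (metis order_refl)
 then obtain K where K: "\<And>b c. 0 \<le> K b c" "\<And>b c p. b \<in> Basis ==> c \<in> Basis ==> p \<in> cball z0 \<rho> \<times> cball \<omega> \<rho> ==> norm (pderiv_dir (0, c) (g b) p) \<le> K b c"
  by metis
 define G where "G z = (\<Sum>b\<in>Basis. g b (z, \<omega>) *\<^sub>R b)" for z
 have Gc: "continuous_on (cball z0 \<rho>) G"
  unfolding G_def
 proof (intro continuous_on_sum continuous_on_scaleR continuous_on_const)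
  fix b :: 'a assume b: "b \<in> Basis"
  have "continuous_on V (g b)"
   using smooth_on_continuous_pderivs[OF \<Phi>, of "[(0, b)]"] b B0 by (simp add: g_def pderivs_Cons)
  then show "continuous_on (cball z0 \<rho>) (\<lambda>z. g b (z, \<omega>))"
   by (rule continuous_on_compose2) (use sub \<rho> in \<open>auto intro!: continuous_intros\<close>)
 qed
 define KK where "KK = (\<Sum>b\<in>Basis. \<Sum>c\<in>Basis. K b c)"
 have gb: "\<bar>g b (z, \<omega> + \<eta>) - g b (z, \<omega>)\<bar> \<le> (\<Sum>c\<in>Basis. K b c) * norm \<eta>"
  if z: "z \<in> cball z0 \<rho>" and \<eta>: "norm \<eta> \<le> \<rho>" and b: "b \<in> Basis" for z \<eta> b
 proof -
  have "norm (g b ((z, \<omega>) + (0, \<eta>)) - g b (z, \<omega>)) \<le> (\<Sum>c\<in>Basis. K b c) * norm \<eta>"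
  proof (rule pderiv_mvt)
   fix s :: real assume s: "0 \<le> s" "s \<le> 1"
   have "s * norm \<eta> \<le> 1 * \<rho>" using s \<eta> by (intro mult_mono) auto
   then have p: "(z, \<omega>) + s *\<^sub>R (0, \<eta>) \<in> cball z0 \<rho> \<times> cball \<omega> \<rho>" using z s by (simp add: dist_norm)
   have pV: "(z, \<omega>) + s *\<^sub>R (0, \<eta>) \<in> V" by (rule subsetD[OF sub p])
   show d: "g b differentiable at ((z, \<omega>) + s *\<^sub>R (0, \<eta>))" using gd[OF pV b] .
   have lin: "linear (\<lambda>v. pderiv_dir v (g b) ((z, \<omega>) + s *\<^sub>R (0, \<eta>)))"
    using has_derivative_linear[OF has_derivative_pderiv[OF d]] .
   have rep: "(0, \<eta>) = (\<Sum>c\<in>Basis. (\<eta> \<bullet> c) *\<^sub>R (0::'z, c))"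
    by (rule prod_eqI) (simp_all add: fst_sum snd_sum euclidean_representation)
   have "pderiv_dir (0, \<eta>) (g b) ((z, \<omega>) + s *\<^sub>R (0, \<eta>)) = pderiv_dir (\<Sum>c\<in>Basis. (\<eta> \<bullet> c) *\<^sub>R (0::'z, c)) (g b) ((z, \<omega>) + s *\<^sub>R (0, \<eta>))"
    by (rule arg_cong[OF rep])
   also have "... = (\<Sum>c\<in>Basis. (\<eta> \<bullet> c) *\<^sub>R pderiv_dir (0, c) (g b) ((z, \<omega>) + s *\<^sub>R (0, \<eta>)))"
    by (simp only: linear_sum[OF lin] linear_scale[OF lin])
   finally have "pderiv_dir (0, \<eta>) (g b) ((z, \<omega>) + s *\<^sub>R (0, \<eta>)) = (\<Sum>c\<in>Basis. (\<eta> \<bullet> c) *\<^sub>R pderiv_dir (0, c) (g b) ((z, \<omega>) + s *\<^sub>R (0, \<eta>)))" .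
   also have "norm ... \<le> (\<Sum>c\<in>Basis. norm \<eta> * K b c)"
    by (rule order_trans[OF norm_sum], rule sum_mono, unfold norm_scaleR) (intro mult_mono K(2)[OF b _ p], simp_all add: Basis_le_norm)
   also have "... = (\<Sum>c\<in>Basis. K b c) * norm \<eta>" by (simp add: sum_distrib_left[symmetric] mult.commute)
   finally show "norm (pderiv_dir (0, \<eta>) (g b) ((z, \<omega>) + s *\<^sub>R (0, \<eta>))) \<le> (\<Sum>c\<in>Basis. K b c) * norm \<eta>" .
  qed
  then show ?thesis by simp
 qed
 have main: "\<bar>\<Phi> (z, \<omega> + \<theta>) - y \<bullet> (\<omega> + \<theta>)\<bar> \<le> \<bar>(G z - y) \<bullet> \<theta>\<bar> + KK * (norm \<theta>)\<^sup>2"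
  if z: "z \<in> cball z0 \<rho>" and \<theta>: "norm \<theta> \<le> \<rho>" and y: "\<Phi> (z, \<omega>) = y \<bullet> \<omega>" for z \<theta> y
 proof -
  define Q where "Q p = \<Phi> p - y \<bullet> snd p" for p
  have "norm (Q ((z, \<omega>) + (0, \<theta>)) - Q (z, \<omega>)) \<le> \<bar>(G z - y) \<bullet> \<theta>\<bar> + KK * (norm \<theta>)\<^sup>2"
  proof (rule pderiv_mvt)
   fix s :: real assume s: "0 \<le> s" "s \<le> 1"
   have s1: "norm (s *\<^sub>R \<theta>) \<le> norm \<theta>" using s by (simp add: mult_left_le_one_le)
   then have p: "(z, \<omega>) + s *\<^sub>R (0, \<theta>) \<in> cball z0 \<rho> \<times> cball \<omega> \<rho>" using z \<theta> by (simp add: dist_norm)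
   have pV: "(z, \<omega>) + s *\<^sub>R (0, \<theta>) \<in> V" by (rule subsetD[OF sub p])
   have dQ: "(Q has_derivative (\<lambda>v. pderiv_dir v \<Phi> ((z, \<omega>) + s *\<^sub>R (0, \<theta>)) - y \<bullet> snd v)) (at ((z, \<omega>) + s *\<^sub>R (0, \<theta>)))"
    unfolding Q_def by (intro has_derivative_diff has_derivative_pderiv \<Phi>d pV) (auto intro!: derivative_eq_intros)
   then show "Q differentiable at ((z, \<omega>) + s *\<^sub>R (0, \<theta>))" using differentiable_def by blast
   have lin: "linear (\<lambda>v. pderiv_dir v \<Phi> ((z, \<omega>) + s *\<^sub>R (0, \<theta>)))"
    using has_derivative_linear[OF has_derivative_pderiv[OF \<Phi>d[OF pV]]] .
   have rep: "(0, \<theta>) = (\<Sum>c\<in>Basis. (\<theta> \<bullet> c) *\<^sub>R (0::'z, c))"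
    by (rule prod_eqI) (simp_all add: fst_sum snd_sum euclidean_representation)
   have "pderiv_dir (0, \<theta>) \<Phi> ((z, \<omega>) + s *\<^sub>R (0, \<theta>)) = pderiv_dir (\<Sum>c\<in>Basis. (\<theta> \<bullet> c) *\<^sub>R (0::'z, c)) \<Phi> ((z, \<omega>) + s *\<^sub>R (0, \<theta>))"
    by (rule arg_cong[OF rep])
   also have "... = (\<Sum>c\<in>Basis. (\<theta> \<bullet> c) *\<^sub>R pderiv_dir (0, c) \<Phi> ((z, \<omega>) + s *\<^sub>R (0, \<theta>)))"
    by (simp only: linear_sum[OF lin] linear_scale[OF lin])
   also have "... = (\<Sum>c\<in>Basis. (\<theta> \<bullet> c) * g c (z, \<omega> + s *\<^sub>R \<theta>))" by (simp add: g_def)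
   finally have e1: "pderiv_dir (0, \<theta>) \<Phi> ((z, \<omega>) + s *\<^sub>R (0, \<theta>)) = (\<Sum>c\<in>Basis. (\<theta> \<bullet> c) * g c (z, \<omega> + s *\<^sub>R \<theta>))" .
   have e2: "(G z - y) \<bullet> \<theta> = (\<Sum>c\<in>Basis. (\<theta> \<bullet> c) * g c (z, \<omega>)) - y \<bullet> \<theta>"
    unfolding G_def by (simp only: inner_diff_left inner_sum_left inner_scaleR_left) (simp add: inner_commute mult.commute)
   have "norm (pderiv_dir (0, \<theta>) Q ((z, \<omega>) + s *\<^sub>R (0, \<theta>))) = \<bar>(\<Sum>c\<in>Basis. (\<theta> \<bullet> c) * g c (z, \<omega> + s *\<^sub>R \<theta>)) - y \<bullet> \<theta>\<bar>"
    using pderiv_dir_eqI[OF dQ] e1 by simp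
   also have "... = \<bar>(G z - y) \<bullet> \<theta> + (\<Sum>c\<in>Basis. (\<theta> \<bullet> c) * (g c (z, \<omega> + s *\<^sub>R \<theta>) - g c (z, \<omega>)))\<bar>"
    unfolding e2 by (simp add: right_diff_distrib sum_subtractf)
   also have "... \<le> \<bar>(G z - y) \<bullet> \<theta>\<bar> + (\<Sum>c\<in>Basis. \<bar>\<theta> \<bullet> c\<bar> * \<bar>g c (z, \<omega> + s *\<^sub>R \<theta>) - g c (z, \<omega>)\<bar>)"
    by (rule order_trans[OF abs_triangle_ineq add_left_mono[OF order_trans[OF sum_abs]]]) (simp add: abs_mult)
   also have "... \<le> \<bar>(G z - y) \<bullet> \<theta>\<bar> + (\<Sum>b\<in>Basis. norm \<theta> * ((\<Sum>c\<in>Basis. K b c) * norm \<theta>))"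
   proof (intro add_left_mono sum_mono mult_mono)
    fix c :: 'a assume c: "c \<in> Basis"
    have S0: "0 \<le> (\<Sum>d\<in>Basis. K c d)" using K(1) by (simp add: sum_nonneg)
    have "\<bar>g c (z, \<omega> + s *\<^sub>R \<theta>) - g c (z, \<omega>)\<bar> \<le> (\<Sum>d\<in>Basis. K c d) * norm (s *\<^sub>R \<theta>)"
     using s1 \<theta> by (intro gb z c) linarith
    also have "... \<le> (\<Sum>d\<in>Basis. K c d) * norm \<theta>" by (intro mult_left_mono s1 S0)
    finally show "\<bar>g c (z, \<omega> + s *\<^sub>R \<theta>) - g c (z, \<omega>)\<bar> \<le> (\<Sum>d\<in>Basis. K c d) * norm \<theta>" .
   qed (auto simp: Basis_le_norm)
   also have "(\<Sum>b\<in>Basis. norm \<theta> * ((\<Sum>c\<in>Basis. K b c) * norm \<theta>)) = KK * (norm \<theta>)\<^sup>2"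
    unfolding KK_def power2_eq_square by (simp add: sum_distrib_right sum_distrib_left mult_ac)
   finally show "norm (pderiv_dir (0, \<theta>) Q ((z, \<omega>) + s *\<^sub>R (0, \<theta>))) \<le> \<bar>(G z - y) \<bullet> \<theta>\<bar> + KK * (norm \<theta>)\<^sup>2" .
  qed
  then show ?thesis using y by (simp add: Q_def)
 qed
 have "0 \<le> KK" unfolding KK_def using K(1) by (intro sum_nonneg)
 from that[OF \<rho> this sub Gc main] show ?thesis by blast
qed

section \<open>Points where the phase is nearly stationary\<close>

lemma level_crossing_nearby:
 fixes f :: "real => real"
 assumes d: "(f has_real_derivative d) (at t0)" "d \<noteq> 0" and \<rho>: "0 < \<rho>"
 obtains t1 t2 where "\<bar>t1 - t0\<bar> \<le> \<rho>" "\<bar>t2 - t0\<bar> \<le> \<rho>" "f t1 < f t0" "f t0 < f t2"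
proof -
 consider "0 < d" | "d < 0" using d(2) by linarith
 then show ?thesis
 proof cases
  case 1
  obtain e1 where e1: "0 < e1" "\<forall>h>0. h < e1 --> f t0 < f (t0 + h)" using DERIV_pos_inc_right[OF d(1) 1] by blast
  obtain e2 where e2: "0 < e2" "\<forall>h>0. h < e2 --> f (t0 - h) < f t0" using DERIV_pos_inc_left[OF d(1) 1] by blast
  define h where "h = min \<rho> (min e1 e2) / 2"
  have "0 < h" "h < e1" "h < e2" "h \<le> \<rho>" using e1 e2 \<rho> unfolding h_def by auto
  then show ?thesis using e1 e2 by (intro that[of "t0 - h" "t0 + h"]) auto
 next
  case 2
  obtain e1 where e1: "0 < e1" "\<forall>h>0. h < e1 --> f (t0 + h) < f t0" using DERIV_neg_dec_right[OF d(1) 2] by blast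
  obtain e2 where e2: "0 < e2" "\<forall>h>0. h < e2 --> f t0 < f (t0 - h)" using DERIV_neg_dec_left[OF d(1) 2] by blast
  define h where "h = min \<rho> (min e1 e2) / 2"
  have "0 < h" "h < e1" "h < e2" "h \<le> \<rho>" using e1 e2 \<rho> unfolding h_def by auto
  then show ?thesis using e1 e2 by (intro that[of "t0 + h" "t0 - h"]) auto
 qed
qed

text \<open>Since \<open>F (x0, t)\<close> crosses its value at \<open>t0\<close> strictly, the values at two nearby times lie on either side of it, and
they still do for \<open>x\<close> near \<open>x0\<close>. The intermediate value theorem then gives a time for each such \<open>x\<close>.\<close>

lemma level_set_projects_onto_ball:
 fixes F :: "'a::euclidean_space \<times> real => real"
 assumes \<rho>: "0 < \<rho>" and F: "continuous_on (cball (x0, t0) \<rho>) F"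
  and d: "((\<lambda>t. F (x0, t)) has_real_derivative d) (at t0)" "d \<noteq> 0"
 obtains r S where "0 < r" "compact S" "S \<subseteq> cball (x0, t0) \<rho>" "\<And>p. p \<in> S ==> F p = F (x0, t0)" "cball x0 r \<subseteq> fst ` S"
proof -
 have sub: "cball x0 (\<rho> / 2) \<times> cball t0 (\<rho> / 2) \<subseteq> cball (x0, t0) \<rho>"
 proof clarify
  fix x t assume "x \<in> cball x0 (\<rho> / 2)" "t \<in> cball t0 (\<rho> / 2)"
  then have "dist x0 x + dist t0 t \<le> \<rho>" by simp
  then show "(x, t) \<in> cball (x0, t0) \<rho>"
   using sqrt_sum_squares_le_sum_abs[of "dist x0 x" "dist t0 t"] by (simp add: dist_Pair_Pair)
 qed
 have F': "continuous_on (cball x0 (\<rho> / 2) \<times> cball t0 (\<rho> / 2)) F" using F sub by (rule continuous_on_subset)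
 obtain t1 t2 where t: "\<bar>t1 - t0\<bar> \<le> \<rho> / 2" "\<bar>t2 - t0\<bar> \<le> \<rho> / 2" "F (x0, t1) < F (x0, t0)" "F (x0, t0) < F (x0, t2)"
  using level_crossing_nearby[OF d, of "\<rho> / 2"] \<rho> by auto
 have tc: "t1 \<in> cball t0 (\<rho> / 2)" "t2 \<in> cball t0 (\<rho> / 2)" using t(1,2) by (auto simp: dist_real_def abs_minus_commute)
 have near: "\<exists>e>0. \<forall>x\<in>cball x0 (\<rho> / 2). dist x x0 < e --> dist (F (x, u)) (F (x0, u)) < \<eta>" if u: "u \<in> cball t0 (\<rho> / 2)" and \<eta>: "0 < \<eta>" for u \<eta>
 proof -
  have "continuous_on (cball x0 (\<rho> / 2)) (\<lambda>x. F (x, u))"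
   by (rule continuous_on_compose2[OF F']) (use u in \<open>auto intro!: continuous_intros\<close>)
  then show ?thesis using \<eta> \<rho> unfolding continuous_on_iff by (metis centre_in_cball half_gt_zero less_imp_le)
 qed
 obtain e1 where e1: "0 < e1" "\<And>x. x \<in> cball x0 (\<rho> / 2) ==> dist x x0 < e1 ==> dist (F (x, t1)) (F (x0, t1)) < F (x0, t0) - F (x0, t1)"
  using near[OF tc(1), of "F (x0, t0) - F (x0, t1)"] t by auto
 obtain e2 where e2: "0 < e2" "\<And>x. x \<in> cball x0 (\<rho> / 2) ==> dist x x0 < e2 ==> dist (F (x, t2)) (F (x0, t2)) < F (x0, t2) - F (x0, t0)"
  using near[OF tc(2), of "F (x0, t2) - F (x0, t0)"] t by auto
 define r where "r = min (\<rho> / 2) (min e1 e2 / 2)"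
 have r: "0 < r" "r \<le> \<rho> / 2" "r < e1" "r < e2" unfolding r_def using \<rho> e1(1) e2(1) by auto
 define S where "S = {p \<in> cball x0 r \<times> cball t0 (\<rho> / 2). F p = F (x0, t0)}"
 have sub_r: "cball x0 r \<times> cball t0 (\<rho> / 2) \<subseteq> cball x0 (\<rho> / 2) \<times> cball t0 (\<rho> / 2)"
  by (intro Sigma_mono subset_cball r order_refl)
 have "closed S" unfolding S_def
  by (intro continuous_closed_preimage_constant continuous_on_subset[OF F' sub_r] closed_Times closed_cball)
 moreover have "bounded S" unfolding S_def
  by (rule bounded_subset[OF bounded_Times[OF bounded_cball bounded_cball]]) blast
 ultimately have 1: "compact S" by (simp add: compact_eq_bounded_closed)
 have 2: "S \<subseteq> cball (x0, t0) \<rho>" using sub sub_r unfolding S_def by blast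
 have 3: "cball x0 r \<subseteq> fst ` S"
 proof
  fix x assume x: "x \<in> cball x0 r"
  then have x': "x \<in> cball x0 (\<rho> / 2)" "dist x x0 < e1" "dist x x0 < e2" using r by (auto simp: dist_commute)
  have lt: "F (x, t1) < F (x0, t0)" "F (x0, t0) < F (x, t2)"
   using e1(2)[OF x'(1,2)] e2(2)[OF x'(1,3)] by (auto simp: dist_real_def abs_less_iff)
  have "continuous_on (cball t0 (\<rho> / 2)) (\<lambda>t. F (x, t))"
   by (rule continuous_on_compose2[OF F']) (use x' in \<open>auto intro!: continuous_intros\<close>)
  then have "connected ((\<lambda>t. F (x, t)) ` cball t0 (\<rho> / 2))"
   by (intro connected_continuous_image convex_connected convex_cball)
  then have "F (x0, t0) \<in> (\<lambda>t. F (x, t)) ` cball t0 (\<rho> / 2)"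
   using lt tc by (auto intro: connectedD_interval[of _ "F (x, t1)" "F (x, t2)"])
  then obtain t where "t \<in> cball t0 (\<rho> / 2)" "F (x, t) = F (x0, t0)" by auto
  then have "(x, t) \<in> S" using x unfolding S_def by simp
  then show "x \<in> fst ` S" by force
 qed
 show ?thesis by (rule that[OF r(1) 1 2 _ 3]) (simp add: S_def)
qed

lemma covering_pigeonhole:
 fixes E :: "'i => 'a::euclidean_space set"
 assumes J: "finite J" "real (card J) \<le> N" and B: "compact B" "B \<subseteq> (\<Union>j\<in>J. E j)" and E: "\<And>j. compact (E j)" and pos: "0 < measure lborel B"
 obtains j where "j \<in> J" "measure lborel B / N \<le> measure lborel (E j)"
proof -
 have Es: "E j \<in> sets borel" for j using E[of j] by (simp add: borel_closed compact_imp_closed)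
 have "measure lborel B \<le> measure lborel (\<Union>j\<in>J. E j)"
 proof (rule measure_mono_fmeasurable[OF B(2)])
  show "B \<in> sets lborel" using B(1) by (simp add: borel_closed compact_imp_closed)
  have "compact (\<Union>j\<in>J. E j)" using J(1) E by (intro compact_UN) auto
  then show "(\<Union>j\<in>J. E j) \<in> fmeasurable lborel" by (rule fmeasurable_compact)
 qed
 also have "... \<le> (\<Sum>j\<in>J. measure lborel (E j))" using J(1) Es by (intro measure_UNION_le) auto
 finally have le: "measure lborel B \<le> (\<Sum>j\<in>J. measure lborel (E j))" .
 have "J \<noteq> {}" using le pos by auto
 then have cJ: "0 < card J" using J(1) by (simp add: card_gt_0_iff)
 have "\<exists>j\<in>J. measure lborel B / N \<le> measure lborel (E j)"
 proof (rule ccontr)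
  assume "\<not> ?thesis"
  then have lt: "\<And>j. j \<in> J ==> measure lborel (E j) < measure lborel B / N" by auto
  have "(\<Sum>j\<in>J. measure lborel (E j)) < real (card J) * (measure lborel B / N)"
   by (rule sum_bounded_above_strict[OF lt cJ])
  also have "... \<le> N * (measure lborel B / N)" using J cJ pos by (intro mult_right_mono) auto
  also have "... = measure lborel B" using J cJ by simp
  finally show False using le by simp
 qed
 then show ?thesis using that by blast
qed

lemma compact_cells:
 fixes S :: "'p::metric_space set" and H :: "'p => real^'n"
 assumes S: "compact S" and H: "continuous_on S H"
 shows "compact {p \<in> S. \<forall>i. i \<noteq> k --> lo i \<le> H p $ i \<and> H p $ i \<le> hi i}"
proof -
 define A where "A = {v :: real^'n. \<forall>i. i \<noteq> k --> lo i \<le> v $ i \<and> v $ i \<le> hi i}"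
 have "closed A" unfolding A_def
  by (intro closed_Collect_all closed_Collect_imp open_Collect_const closed_Collect_conj closed_Collect_le continuous_on_const continuous_on_component continuous_on_id)
 then have "closed (S \<inter> H -` A)" by (rule continuous_closed_preimage[OF H compact_imp_closed[OF S]])
 then have "compact (S \<inter> (S \<inter> H -` A))" by (rule compact_Int_closed[OF S])
 moreover have "S \<inter> (S \<inter> H -` A) = {p \<in> S. \<forall>i. i \<noteq> k --> lo i \<le> H p $ i \<and> H p $ i \<le> hi i}"
  unfolding A_def by auto
 ultimately show ?thesis by simp
qed

lemma card_transversal_grid:
 fixes k :: "'n::finite"
 assumes K: "0 \<le> K" and r: "1 \<le> r"
 defines "J \<equiv> PiE UNIV (\<lambda>i::'n. if i = k then {0} else {- \<lceil>K * r\<rceil>..\<lceil>K * r\<rceil>})"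
 shows "finite J" "real (card J) \<le> ((2 * K + 3) * r) ^ (CARD('n) - 1)"
proof -
 show "finite J" unfolding J_def by (intro finite_PiE) auto
 define M where "M = \<lceil>K * r\<rceil>"
 have "0 \<le> K * r" using K r by simp
 then have M0: "0 \<le> M" unfolding M_def by linarith
 have "card J = (\<Prod>i\<in>UNIV. card (if i = k then {0} else {- M..M}))" unfolding J_def M_def by (simp add: card_PiE)
 also have "... = (\<Prod>i\<in>UNIV - {k}. nat (2 * M + 1))" by (subst prod.remove[of _ k]) (auto intro!: prod.cong)
 also have "... = nat (2 * M + 1) ^ (CARD('n) - 1)" by (simp add: card_Diff_singleton)
 finally have c: "real (card J) = real (nat (2 * M + 1)) ^ (CARD('n) - 1)" by simp
 have "real_of_int M \<le> K * r + 1" unfolding M_def by linarith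
 then have "real (nat (2 * M + 1)) \<le> (2 * K + 3) * r" using M0 r by (simp add: algebra_simps)
 then show "real (card J) \<le> ((2 * K + 3) * r) ^ (CARD('n) - 1)" unfolding c by (intro power_mono) auto
qed

text \<open>The graph of times supplied by \<open>level_set_projects_onto_ball\<close> is cut into cells on which the components of \<open>G\<close>
across \<open>\<omega>\<close> vary by at most \<open>1 / sqrt R\<close>. There are about \<open>R powr ((n - 1) / 2)\<close> cells and their projections cover a ball, so one
projection is large. The point \<open>y\<close> is read off from that cell.\<close>

lemma transversal_cell:
 fixes F :: "(real^'n) \<times> real => real" and G :: "(real^'n) \<times> real => real^'n"
 assumes \<rho>: "0 < \<rho>" and F: "continuous_on (cball (x0, t0) \<rho>) F" and G: "continuous_on (cball (x0, t0) \<rho>) G"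
  and d: "((\<lambda>t. F (x0, t)) has_real_derivative d) (at t0)" "d \<noteq> 0" and \<omega>: "norm \<omega> = 1"
 obtains \<kappa> where "0 < \<kappa>" "\<And>R. 1 \<le> R ==> \<exists>E y. compact E \<and> \<kappa> * R powr (- (real CARD('n) - 1) / 2) \<le> measure lborel E \<and>
  (\<forall>x\<in>E. \<exists>t. (x, t) \<in> cball (x0, t0) \<rho> \<and> F (x, t) = y \<bullet> \<omega> \<and> (\<forall>\<theta>. \<theta> \<bullet> \<omega> = 0 --> \<bar>(G (x, t) - y) \<bullet> \<theta>\<bar> \<le> real CARD('n) * norm \<theta> / sqrt R))"
proof -
 obtain r S where r: "0 < r" and S: "compact S" "S \<subseteq> cball (x0, t0) \<rho>" "\<And>p. p \<in> S ==> F p = F (x0, t0)" "cball x0 r \<subseteq> fst ` S"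
  using level_set_projects_onto_ball[OF \<rho> F d] by metis
 obtain k :: 'n where True by blast
 \<comment> \<open>After a rotation the components across \<open>\<omega>\<close> are the coordinates other than the \<open>k\<close>-th.\<close>
 obtain Q :: "real^'n => real^'n" where Q: "orthogonal_transformation Q" "Q \<omega> = axis k 1"
  using orthogonal_transformation_exists[of \<omega> "axis k 1"] \<omega> by (auto simp: norm_axis_1)
 have Ql: "linear Q" using Q(1) by (simp add: orthogonal_transformation_linear)
 have Qi: "Q v \<bullet> Q w = v \<bullet> w" for v w using Q(1) by (simp add: orthogonal_transformation_def)
 have QG: "continuous_on S (\<lambda>p. Q (G p))"
  by (rule continuous_on_compose2[OF linear_continuous_on[OF linear_conv_bounded_linear[THEN iffD1, OF Ql], of UNIV] continuous_on_subset[OF G S(2)]]) simp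
 have "bounded (G ` S)" using continuous_on_subset[OF G S(2)] S(1) by (intro compact_imp_bounded compact_continuous_image)
 then obtain K where K: "0 < K" "\<And>p. p \<in> S ==> norm (G p) \<le> K" unfolding bounded_pos by blast
 define \<kappa> where "\<kappa> = measure lborel (cball x0 r) / (2 * K + 3) ^ (CARD('n) - 1)"
 have v: "0 < measure lborel (cball x0 r)" using content_cball_pos[OF r] .
 have \<kappa>: "0 < \<kappa>" unfolding \<kappa>_def using v K by simp
 have "\<exists>E y. compact E \<and> \<kappa> * R powr (- (real CARD('n) - 1) / 2) \<le> measure lborel E \<and>
  (\<forall>x\<in>E. \<exists>t. (x, t) \<in> cball (x0, t0) \<rho> \<and> F (x, t) = y \<bullet> \<omega> \<and> (\<forall>\<theta>. \<theta> \<bullet> \<omega> = 0 --> \<bar>(G (x, t) - y) \<bullet> \<theta>\<bar> \<le> real CARD('n) * norm \<theta> / sqrt R))"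
  if R: "1 \<le> R" for R
 proof -
  define q where "q = sqrt R"
  have q: "1 \<le> q" unfolding q_def using R by simp
  define J where "J = PiE UNIV (\<lambda>i::'n. if i = k then {0} else {- \<lceil>K * q\<rceil>..\<lceil>K * q\<rceil>})"
  define T where "T j = {p \<in> S. \<forall>i. i \<noteq> k --> real_of_int (j i) / q \<le> Q (G p) $ i \<and> Q (G p) $ i \<le> (real_of_int (j i) + 1) / q}" for j :: "'n => int"
  have Tc: "compact (T j)" for j unfolding T_def by (rule compact_cells[OF S(1) QG])
  have Ec: "compact (fst ` T j)" for j by (intro compact_continuous_image Tc continuous_intros)
  have cover: "cball x0 r \<subseteq> (\<Union>j\<in>J. fst ` T j)"
  proof
   fix x assume "x \<in> cball x0 r"
   then obtain p where p: "p \<in> S" "x = fst p" using S(4) by blast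
   define j where "j i = (if i = k then 0 else \<lfloor>q * Q (G p) $ i\<rfloor>)" for i
   have "p \<in> T j"
    unfolding T_def j_def using p q by (auto simp: divide_le_eq le_divide_eq mult.commute)
   moreover have "j \<in> J"
    unfolding J_def
   proof (rule PiE_I)
    fix i
    have "norm (Q (G p)) \<le> K" using K(2)[OF p(1)] Q(1) by (simp add: orthogonal_transformation_norm)
    then have "\<bar>Q (G p) $ i\<bar> \<le> K" using component_le_norm_cart[of "Q (G p)" i] by linarith
    then have "q * \<bar>Q (G p) $ i\<bar> \<le> q * K" using q by (intro mult_left_mono) auto
    then have "\<bar>q * Q (G p) $ i\<bar> \<le> K * q" using q by (simp add: abs_mult mult.commute)
    then have "- (K * q) \<le> q * Q (G p) $ i" "q * Q (G p) $ i \<le> K * q" by linarith+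
    then have "- \<lceil>K * q\<rceil> \<le> \<lfloor>q * Q (G p) $ i\<rfloor>" "\<lfloor>q * Q (G p) $ i\<rfloor> \<le> \<lceil>K * q\<rceil>" by linarith+
    then show "j i \<in> (if i = k then {0} else {- \<lceil>K * q\<rceil>..\<lceil>K * q\<rceil>})" by (simp add: j_def)
   qed simp
   ultimately show "x \<in> (\<Union>j\<in>J. fst ` T j)" using p by blast
  qed
  have J: "finite J" "real (card J) \<le> ((2 * K + 3) * q) ^ (CARD('n) - 1)"
   unfolding J_def using card_transversal_grid[of K q k] K(1) q by simp_all
  obtain j where j: "measure lborel (cball x0 r) / ((2 * K + 3) * q) ^ (CARD('n) - 1) \<le> measure lborel (fst ` T j)"
   using covering_pigeonhole[OF J compact_cball cover Ec v] by metis
  have \<kappa>j: "\<kappa> * R powr (- (real CARD('n) - 1) / 2) \<le> measure lborel (fst ` T j)"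
  proof -
   have "q ^ (CARD('n) - 1) = R powr ((real CARD('n) - 1) / 2)"
   proof -
    have "q ^ (CARD('n) - 1) = q powr (real (CARD('n) - 1))" by (rule powr_realpow[symmetric]) (use q in simp)
    also have "... = R powr (1 / 2 * (real (CARD('n) - 1)))" unfolding q_def using R by (simp add: powr_half_sqrt[symmetric] powr_powr)
    also have "1 / 2 * (real (CARD('n) - 1)) = (real CARD('n) - 1) / 2" by (simp add: of_nat_diff)
    finally show ?thesis .
   qed
   then have "\<kappa> * R powr (- (real CARD('n) - 1) / 2) = measure lborel (cball x0 r) / ((2 * K + 3) * q) ^ (CARD('n) - 1)"
    unfolding \<kappa>_def power_mult_distrib by (simp only: minus_divide_left[symmetric] powr_minus_divide) simp
   then show ?thesis using j by simp
  qed
  \<comment> \<open>The corner of the cell, with the \<open>k\<close>-th coordinate prescribed by the level of \<open>F\<close>.\<close>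
  obtain y where y: "Q y = (vec_lambda (\<lambda>i. if i = k then F (x0, t0) else real_of_int (j i) / q))"
   using orthogonal_transformation_surj[OF Q(1)] by (metis surjD)
  have y\<omega>: "y \<bullet> \<omega> = F (x0, t0)" using Qi[of y \<omega>] unfolding y Q(2) by (simp add: inner_axis)
  have small: "\<bar>(G p - y) \<bullet> \<theta>\<bar> \<le> real CARD('n) * norm \<theta> / sqrt R" if p: "p \<in> T j" and \<theta>: "\<theta> \<bullet> \<omega> = 0" for p \<theta>
  proof -
   have \<theta>k: "Q \<theta> $ k = 0" using Qi[of \<theta> \<omega>] \<theta> unfolding Q(2) by (simp add: inner_axis)
   have "(G p - y) \<bullet> \<theta> = (\<Sum>i\<in>UNIV. (Q (G p) $ i - Q y $ i) * Q \<theta> $ i)"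
    using Qi[of "G p - y" \<theta>] by (simp add: linear_diff[OF Ql] inner_vec_def)
   also have "\<bar>...\<bar> \<le> (\<Sum>i\<in>(UNIV::'n set). 1 / q * norm \<theta>)"
   proof (rule order_trans[OF sum_abs], rule sum_mono)
    fix i
    show "\<bar>(Q (G p) $ i - Q y $ i) * Q \<theta> $ i\<bar> \<le> 1 / q * norm \<theta>"
    proof (cases "i = k")
     case True then show ?thesis using \<theta>k q by simp
    next
     case False
     then have "real_of_int (j i) / q \<le> Q (G p) $ i" "Q (G p) $ i \<le> (real_of_int (j i) + 1) / q" using p unfolding T_def by auto
     then have "\<bar>Q (G p) $ i - Q y $ i\<bar> \<le> 1 / q" using False q unfolding y by (simp add: add_divide_distrib)
     moreover have "\<bar>Q \<theta> $ i\<bar> \<le> norm \<theta>"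
      using component_le_norm_cart[of "Q \<theta>" i] Q(1) by (simp add: orthogonal_transformation_norm)
     ultimately show ?thesis unfolding abs_mult using q by (intro mult_mono) auto
    qed
   qed
   also have "... = real CARD('n) * norm \<theta> / sqrt R" by (simp add: q_def)
   finally show ?thesis .
  qed
  show ?thesis
  proof (intro exI[of _ "fst ` T j"] exI[of _ y] conjI ballI Ec \<kappa>j)
   fix x assume "x \<in> fst ` T j"
   then obtain t where t: "(x, t) \<in> T j" by force
   then have "(x, t) \<in> S" unfolding T_def by simp
   then show "\<exists>t. (x, t) \<in> cball (x0, t0) \<rho> \<and> F (x, t) = y \<bullet> \<omega> \<and> (\<forall>\<theta>. \<theta> \<bullet> \<omega> = 0 --> \<bar>(G (x, t) - y) \<bullet> \<theta>\<bar> \<le> real CARD('n) * norm \<theta> / sqrt R)"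
    using S(2,3) small[OF t] y\<omega> by (intro exI[of _ t]) auto
  qed
 qed
 then show ?thesis using that \<kappa> by blast
qed

section \<open>The maximal function of a wave packet\<close>

lemma norm_exp_i_minus_one: "norm (iexp r - 1) \<le> \<bar>r\<bar>"
proof -
 have "norm (iexp r - 1) = 2 * \<bar>sin (r / 2)\<bar>" by (rule dist_exp_i_1)
 also have "... \<le> 2 * \<bar>r / 2\<bar>" by (intro mult_left_mono abs_sin_x_le_abs_x) simp
 finally show ?thesis by simp
qed

lemma fiber_conicD: "fiber_conic V ==> (z, \<eta>) \<in> V ==> 0 < c ==> (z, c *\<^sub>R \<eta>) \<in> V"
 unfolding fiber_conic_def by fastforce

lemma smooth_on_fiber_derivative:
 fixes \<Phi> :: "('a::euclidean_space \<times> real) \<times> 'b::euclidean_space => real"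
 assumes \<Phi>: "smooth_on V \<Phi>" and V: "open V" "((x0, t0), \<omega>) \<in> V"
 shows "((\<lambda>t. \<Phi> ((x0, t), \<omega>)) has_real_derivative deriv (\<lambda>t. \<Phi> ((x0, t), \<omega>)) t0) (at t0)"
proof -
 have "\<Phi> differentiable (at ((x0, t0), \<omega>))" using smooth_on_open_pderivs[OF \<Phi> V(1) _ V(2), of "[]"] by simp
 then obtain \<Phi>' where "(\<Phi> has_derivative \<Phi>') (at ((x0, t0), \<omega>))" unfolding differentiable_def by blast
 moreover have "((\<lambda>t. ((x0, t), \<omega>)) has_derivative (\<lambda>t. ((0, t), 0))) (at t0)" by (intro derivative_eq_intros) auto
 ultimately have "((\<lambda>t. \<Phi> ((x0, t), \<omega>)) has_derivative (\<lambda>t. \<Phi>' ((0, t), 0))) (at t0)"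
  by (rule has_derivative_compose[rotated])
 then have "(\<lambda>t. \<Phi> ((x0, t), \<omega>)) differentiable (at t0)" unfolding differentiable_def by blast
 then show ?thesis by (simp add: DERIV_deriv_iff_real_differentiable)
qed

lemma plank_rescale:
 assumes \<omega>: "norm \<omega> = 1" and \<sigma>: "0 \<le> \<sigma>" "\<sigma> \<le> 1/8" and R: "4 \<le> R" and \<eta>: "\<eta> \<in> plank \<omega> \<sigma> R"
 obtains h \<theta> where "0 < h" "h \<le> 2 * R" "\<eta> = h *\<^sub>R (\<omega> + \<theta>)" "\<theta> \<bullet> \<omega> = 0" "norm \<theta> \<le> 2 * \<sigma> / sqrt R"
proof -
 define h where "h = \<eta> \<bullet> \<omega>"
 define \<theta> where "\<theta> = (1 / h) *\<^sub>R (\<eta> - h *\<^sub>R \<omega>)"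
 have h: "\<bar>h - R\<bar> \<le> \<sigma> * R" and v: "norm (\<eta> - h *\<^sub>R \<omega>) \<le> \<sigma> * sqrt R" using \<eta> unfolding plank_def h_def by auto
 have "\<sigma> * R \<le> 1/8 * R" using \<sigma> R by (intro mult_right_mono) auto
 then have hR: "R / 2 \<le> h" "h \<le> 2 * R" and h0: "0 < h" using h R by linarith+
 have 1: "\<eta> = h *\<^sub>R (\<omega> + \<theta>)" unfolding \<theta>_def using h0 by (simp add: scaleR_add_right)
 have 2: "\<theta> \<bullet> \<omega> = 0" unfolding \<theta>_def h_def using \<omega> by (simp add: inner_diff_left dot_square_norm)
 have "norm \<theta> = norm (\<eta> - h *\<^sub>R \<omega>) / h" unfolding \<theta>_def using h0 by simp
 also have "... \<le> (\<sigma> * sqrt R) / (R / 2)" using v hR R \<sigma> by (intro frac_le) auto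
 also have "... = 2 * \<sigma> / sqrt R" using R by (simp add: field_simps)
 finally show ?thesis using that[OF h0 hR(2) 1 2] by simp
qed

text \<open>The integrand of the Fourier integral operator on a packet placed at \<open>y\<close>, up to the profile of the packet, stays
within \<open>A\<close> of \<open>\<alpha>\<close> on \<open>P\<close>. Membership in \<open>V\<close> is included since nothing is known about \<open>\<Phi>\<close> elsewhere.\<close>

definition nearly_constant_on :: "('z \<times> 'a::real_inner) set => ('z \<times> 'a => real) => ('z \<times> 'a => complex) =>
  'a set => 'a => complex => real => 'z => bool"
 where "nearly_constant_on V \<Phi> a P y \<alpha> A z \<longleftrightarrow> (\<forall>\<eta>\<in>P. (z, \<eta>) \<in> V \<and>
  norm (iexp (\<Phi> (z, \<eta>)) * a (z, \<eta>) * exp (- \<i> * of_real (\<eta> \<bullet> y)) - \<alpha>) \<le> A)"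

text \<open>A frequency in the plank is \<open>h (\<omega> + \<theta>)\<close> with \<open>h = O(R)\<close> and \<open>\<theta>\<close> orthogonal to \<open>\<omega>\<close> of size \<open>O(\<sigma> / sqrt R)\<close>. By homogeneity and
\<open>phase_near\<close> the phase relative to \<open>y\<close> is at most \<open>h\<close> times \<open>|(G - y) \<bullet> \<theta>| + K |\<theta>|\<^sup>2\<close>. On the cell both terms are
\<open>O(\<sigma> / R)\<close>, so the phase is \<open>O(\<sigma>)\<close>.\<close>

lemma oscillation_controlled_on_cell:
 fixes \<Phi> :: "((real^'n) \<times> real) \<times> (real^'n) => real" and a :: "((real^'n) \<times> real) \<times> (real^'n) => complex"
 assumes V: "open V" "fiber_conic V" and \<Phi>: "smooth_on V \<Phi>"
  and hom: "\<And>z \<eta> r. (z, \<eta>) \<in> V ==> r > 0 ==> \<Phi> (z, r *\<^sub>R \<eta>) = r * \<Phi> (z, \<eta>)"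
  and a: "a \<in> symbol_class m" and \<omega>: "norm \<omega> = 1" "((x0, t0), \<omega>) \<in> V"
  and dt: "deriv (\<lambda>t. \<Phi> ((x0, t), \<omega>)) t0 \<noteq> 0" and \<epsilon>: "0 < \<epsilon>"
 obtains \<sigma> \<kappa> where "0 < \<sigma>" "\<sigma> \<le> 1/8" "0 < \<kappa>"
  "\<And>R. 4 \<le> R ==> \<exists>E y. compact E \<and> \<kappa> * R powr (- (real CARD('n) - 1) / 2) \<le> measure lborel E \<and>
   (\<forall>x\<in>E. \<exists>t. nearly_constant_on V \<Phi> a (plank \<omega> \<sigma> R) y (a ((x0, t0), R *\<^sub>R \<omega>)) (\<epsilon> * R powr m) (x, t))"
proof -
 define n where "n = real CARD('n)"
 have n0: "0 \<le> n" unfolding n_def by simp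
 obtain \<rho>a \<sigma>a where \<rho>a: "0 < \<rho>a" and \<sigma>a: "0 < \<sigma>a" "\<sigma>a \<le> 1/8"
  and near: "\<And>z R \<sigma> \<eta>. norm (z - (x0, t0)) \<le> \<rho>a ==> 4 \<le> R ==> \<sigma> \<le> \<sigma>a ==> \<eta> \<in> plank \<omega> \<sigma> R ==>
   norm (a (z, \<eta>) - a ((x0, t0), R *\<^sub>R \<omega>)) \<le> \<epsilon> / 2 * R powr m"
  using amplitude_near[OF a \<omega>(1), of "\<epsilon> / 2" "(x0, t0)"] \<epsilon> by (metis half_gt_zero)
 obtain \<rho>p K G where \<rho>p: "0 < \<rho>p" and K: "0 \<le> K" and sub: "cball (x0, t0) \<rho>p \<times> cball \<omega> \<rho>p \<subseteq> V"
  and Gc: "continuous_on (cball (x0, t0) \<rho>p) G"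
  and phase: "\<And>z \<theta> y. z \<in> cball (x0, t0) \<rho>p ==> norm \<theta> \<le> \<rho>p ==> \<Phi> (z, \<omega>) = y \<bullet> \<omega> ==>
   \<bar>\<Phi> (z, \<omega> + \<theta>) - y \<bullet> (\<omega> + \<theta>)\<bar> \<le> \<bar>(G z - y) \<bullet> \<theta>\<bar> + K * (norm \<theta>)\<^sup>2"
  using phase_near[OF V(1) \<omega>(2) \<Phi>] by blast
 obtain C0 where C0: "0 \<le> C0" "\<And>z \<eta>. norm (a (z, \<eta>)) \<le> C0 * japanese \<eta> powr m"
  using symbol_class_directional[OF a] by metis
 define C where "C = C0 * 3 powr \<bar>m\<bar>"
 have C: "0 \<le> C" unfolding C_def using C0 by simp
 have aR: "norm (a ((x0, t0), R *\<^sub>R \<omega>)) \<le> C * R powr m" if R: "4 \<le> R" for R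
 proof -
  have "norm (R *\<^sub>R \<omega>) = R" using \<omega>(1) R by simp
  then have "R / 3 \<le> japanese (R *\<^sub>R \<omega>)" "japanese (R *\<^sub>R \<omega>) \<le> 3 * R"
   using norm_le_japanese[of "R *\<^sub>R \<omega>"] japanese_le[of "R *\<^sub>R \<omega>"] R by linarith+
  then have "japanese (R *\<^sub>R \<omega>) powr m \<le> 3 powr \<bar>m\<bar> * R powr m" using R by (intro powr_comparable) auto
  then have "C0 * japanese (R *\<^sub>R \<omega>) powr m \<le> C0 * (3 powr \<bar>m\<bar> * R powr m)" using C0(1) by (rule mult_left_mono)
  then show ?thesis unfolding C_def using C0(2)[of "(x0, t0)" "R *\<^sub>R \<omega>"] by simp
 qed
 define \<rho> where "\<rho> = min \<rho>a \<rho>p"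
 have \<rho>: "0 < \<rho>" "\<rho> \<le> \<rho>a" "\<rho> \<le> \<rho>p" unfolding \<rho>_def using \<rho>a \<rho>p by auto
 have sub\<rho>: "cball (x0, t0) \<rho> \<subseteq> cball (x0, t0) \<rho>p" using \<rho>(3) by (rule subset_cball)
 have \<Phi>c: "continuous_on (cball (x0, t0) \<rho>) (\<lambda>z. \<Phi> (z, \<omega>))"
 proof (rule continuous_on_compose2[of V \<Phi> _ "\<lambda>z. (z, \<omega>)"])
  show "continuous_on V \<Phi>" using smooth_on_continuous_pderivs[OF \<Phi>, of "[]"] by simp
  show "(\<lambda>z. (z, \<omega>)) ` cball (x0, t0) \<rho> \<subseteq> V" using sub sub\<rho> \<rho>p by auto
 qed (intro continuous_intros)
 have d: "((\<lambda>t. \<Phi> ((x0, t), \<omega>)) has_real_derivative deriv (\<lambda>t. \<Phi> ((x0, t), \<omega>)) t0) (at t0)"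
  by (rule smooth_on_fiber_derivative[OF \<Phi> V(1) \<omega>(2)])
 obtain \<kappa> where \<kappa>: "0 < \<kappa>" and cell: "\<And>R. 1 \<le> R ==> \<exists>E y. compact E \<and> \<kappa> * R powr (- (real CARD('n) - 1) / 2) \<le> measure lborel E \<and>
  (\<forall>x\<in>E. \<exists>t. (x, t) \<in> cball (x0, t0) \<rho> \<and> \<Phi> ((x, t), \<omega>) = y \<bullet> \<omega> \<and> (\<forall>\<theta>. \<theta> \<bullet> \<omega> = 0 --> \<bar>(G (x, t) - y) \<bullet> \<theta>\<bar> \<le> real CARD('n) * norm \<theta> / sqrt R))"
  using transversal_cell[OF \<rho>(1) \<Phi>c continuous_on_subset[OF Gc sub\<rho>] d dt \<omega>(1)] by blast
 define B where "B = 4 * n + 8 * K + 1"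
 have B: "0 < B" unfolding B_def using n0 K by simp
 \<comment> \<open>The last term keeps the phase below \<open>\<epsilon> / 2\<close> divided by the size of the amplitude.\<close>
 define \<sigma> where "\<sigma> = min \<sigma>a (min \<rho> (\<epsilon> / (2 * B * (C + 1))))"
 have \<sigma>: "0 < \<sigma>" "\<sigma> \<le> \<sigma>a" "\<sigma> \<le> 1/8" "\<sigma> \<le> \<rho>p" "\<sigma> \<le> \<epsilon> / (2 * B * (C + 1))"
 proof -
  have "0 < \<epsilon> / (2 * B * (C + 1))" using B C \<epsilon> by simp
  then show "0 < \<sigma>" unfolding \<sigma>_def using \<sigma>a \<rho> by simp
  show "\<sigma> \<le> \<sigma>a" "\<sigma> \<le> \<epsilon> / (2 * B * (C + 1))" unfolding \<sigma>_def by auto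
  then show "\<sigma> \<le> 1/8" using \<sigma>a by linarith
  have "\<sigma> \<le> \<rho>" unfolding \<sigma>_def by auto
  then show "\<sigma> \<le> \<rho>p" using \<rho> by linarith
 qed
 have main: "\<exists>E y. compact E \<and> \<kappa> * R powr (- (real CARD('n) - 1) / 2) \<le> measure lborel E \<and>
   (\<forall>x\<in>E. \<exists>t. nearly_constant_on V \<Phi> a (plank \<omega> \<sigma> R) y (a ((x0, t0), R *\<^sub>R \<omega>)) (\<epsilon> * R powr m) (x, t))"
  if R: "4 \<le> R" for R
 proof -
  obtain E y where E: "compact E" "\<kappa> * R powr (- (real CARD('n) - 1) / 2) \<le> measure lborel E"
   and Ey: "\<And>x. x \<in> E ==> \<exists>t. (x, t) \<in> cball (x0, t0) \<rho> \<and> \<Phi> ((x, t), \<omega>) = y \<bullet> \<omega> \<and> (\<forall>\<theta>. \<theta> \<bullet> \<omega> = 0 --> \<bar>(G (x, t) - y) \<bullet> \<theta>\<bar> \<le> n * norm \<theta> / sqrt R)"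
   using cell[of R] R unfolding n_def by auto
  have "\<exists>t. nearly_constant_on V \<Phi> a (plank \<omega> \<sigma> R) y (a ((x0, t0), R *\<^sub>R \<omega>)) (\<epsilon> * R powr m) (x, t)"
   if x: "x \<in> E" for x
  proof -
   obtain t where t: "(x, t) \<in> cball (x0, t0) \<rho>" "\<Phi> ((x, t), \<omega>) = y \<bullet> \<omega>" "\<And>\<theta>. \<theta> \<bullet> \<omega> = 0 ==> \<bar>(G (x, t) - y) \<bullet> \<theta>\<bar> \<le> n * norm \<theta> / sqrt R"
    using Ey[OF x] by blast
   have tp: "(x, t) \<in> cball (x0, t0) \<rho>p" using t(1) sub\<rho> by blast
   have "((x, t), \<eta>) \<in> V \<and> norm (iexp (\<Phi> ((x, t), \<eta>)) * a ((x, t), \<eta>) * exp (- \<i> * of_real (\<eta> \<bullet> y)) - a ((x0, t0), R *\<^sub>R \<omega>)) \<le> \<epsilon> * R powr m"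
    if \<eta>: "\<eta> \<in> plank \<omega> \<sigma> R" for \<eta>
   proof -
    obtain h \<theta> where h: "0 < h" "h \<le> 2 * R" "\<eta> = h *\<^sub>R (\<omega> + \<theta>)" and \<theta>: "\<theta> \<bullet> \<omega> = 0" "norm \<theta> \<le> 2 * \<sigma> / sqrt R"
     using plank_rescale[OF \<omega>(1) less_imp_le[OF \<sigma>(1)] \<sigma>(3) R \<eta>] by blast
    have sR: "2 \<le> sqrt R" using R by (simp add: real_le_rsqrt)
    have "2 * \<sigma> / sqrt R \<le> 2 * \<sigma> / 2" using sR R \<sigma>(1) by (intro divide_left_mono) auto
    then have \<theta>\<rho>: "norm \<theta> \<le> \<rho>p" using \<theta>(2) \<sigma>(4) by linarith
    have inV: "((x, t), \<omega> + \<theta>) \<in> V" using sub tp \<theta>\<rho> by (auto simp: dist_norm)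
    then have \<eta>V: "((x, t), \<eta>) \<in> V" unfolding h(3) by (rule fiber_conicD[OF V(2) _ h(1)])
    have \<Phi>\<eta>: "\<Phi> ((x, t), \<eta>) = h * \<Phi> ((x, t), \<omega> + \<theta>)" unfolding h(3) by (rule hom[OF inV h(1)])
    define P where "P = \<Phi> ((x, t), \<eta>) - \<eta> \<bullet> y"
    have "\<eta> \<bullet> y = h * (y \<bullet> (\<omega> + \<theta>))" unfolding h(3) by (simp add: inner_commute)
    then have Pe: "P = h * (\<Phi> ((x, t), \<omega> + \<theta>) - y \<bullet> (\<omega> + \<theta>))" unfolding P_def \<Phi>\<eta> by (simp add: right_diff_distrib)
    have "\<bar>P\<bar> = h * \<bar>\<Phi> ((x, t), \<omega> + \<theta>) - y \<bullet> (\<omega> + \<theta>)\<bar>" unfolding Pe using h(1) by (simp add: abs_mult)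
    also have "... \<le> h * (n * norm \<theta> / sqrt R + K * (norm \<theta>)\<^sup>2)"
     using phase[OF tp \<theta>\<rho> t(2)] t(3)[OF \<theta>(1)] h(1) by (intro mult_left_mono) auto
    also have "... \<le> (2 * R) * (n * (2 * \<sigma> / sqrt R) / sqrt R + K * (2 * \<sigma> / sqrt R)\<^sup>2)"
     using h \<theta> n0 K R \<sigma>(1) by (intro mult_mono add_mono divide_right_mono mult_left_mono power_mono add_nonneg_nonneg mult_nonneg_nonneg divide_nonneg_nonneg) auto
    also have "... = 4 * n * \<sigma> + 8 * K * \<sigma> * \<sigma>"
     using R by (simp add: power2_eq_square field_simps)
    also have "... \<le> 4 * n * \<sigma> + 8 * K * \<sigma> * 1"
     using K \<sigma>(1,3) by (intro add_left_mono mult_left_mono) auto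
    also have "... \<le> B * \<sigma>" unfolding B_def using \<sigma>(1) by (simp add: algebra_simps)
    also have "... \<le> B * (\<epsilon> / (2 * B * (C + 1)))" using B \<sigma>(5) by (intro mult_left_mono) auto
    also have "... = \<epsilon> / 2 / (C + 1)" using B by simp
    finally have P: "\<bar>P\<bar> \<le> \<epsilon> / 2 / (C + 1)" .
    define \<alpha> where "\<alpha> = a ((x0, t0), R *\<^sub>R \<omega>)"
    have "norm ((x, t) - (x0, t0)) \<le> \<rho>a" using t(1) \<rho>(2) by (metis dist_commute dist_norm mem_cball order_trans)
    then have a\<eta>: "norm (a ((x, t), \<eta>) - \<alpha>) \<le> \<epsilon> / 2 * R powr m" unfolding \<alpha>_def using near R \<sigma>(2) \<eta> by blast
    have "iexp (\<Phi> ((x, t), \<eta>)) * exp (- \<i> * of_real (\<eta> \<bullet> y)) = iexp P"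
     unfolding P_def exp_add[symmetric] by (simp add: algebra_simps)
    then have "iexp (\<Phi> ((x, t), \<eta>)) * a ((x, t), \<eta>) * exp (- \<i> * of_real (\<eta> \<bullet> y)) - \<alpha> = iexp P * a ((x, t), \<eta>) - \<alpha>"
     by (simp only: mult_ac)
    also have "... = iexp P * (a ((x, t), \<eta>) - \<alpha>) + (iexp P - 1) * \<alpha>" by (simp add: algebra_simps)
    also have "norm ... \<le> norm (a ((x, t), \<eta>) - \<alpha>) + \<bar>P\<bar> * norm \<alpha>"
     by (rule order_trans[OF norm_triangle_ineq]) (simp add: norm_mult norm_exp_i_minus_one mult_right_mono)
    also have "... \<le> \<epsilon> / 2 * R powr m + \<epsilon> / 2 / (C + 1) * (C * R powr m)"
     using a\<eta> P aR[OF R] \<epsilon> C unfolding \<alpha>_def by (intro add_mono mult_mono) auto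
    also have "... = \<epsilon> / 2 * R powr m + (C / (C + 1)) * (\<epsilon> / 2 * R powr m)" by (simp add: algebra_simps)
    also have "... \<le> \<epsilon> / 2 * R powr m + 1 * (\<epsilon> / 2 * R powr m)"
     using C \<epsilon> by (intro add_left_mono mult_right_mono) auto
    finally have "norm (iexp (\<Phi> ((x, t), \<eta>)) * a ((x, t), \<eta>) * exp (- \<i> * of_real (\<eta> \<bullet> y)) - \<alpha>) \<le> \<epsilon> * R powr m" by simp
    then show ?thesis using \<eta>V unfolding \<alpha>_def by blast
   qed
   then show ?thesis unfolding nearly_constant_on_def by blast
  qed
  then show ?thesis using E by blast
 qed
 show ?thesis by (rule that[OF \<sigma>(1,3) \<kappa> main])
qed

text \<open>Without oscillation there is no cancellation: the integral differs from \<open>\<alpha>\<close> times the integral of the profile by at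
most half of its modulus.\<close>

lemma fio_packet_lower:
 fixes \<Phi> :: "((real^'n) \<times> real) \<times> (real^'n) => real" and a :: "((real^'n) \<times> real) \<times> (real^'n) => complex" and \<zeta> :: "real^'n => real"
 assumes b: "1 \<le> b" and \<zeta>: "smooth (\<lambda>x. complex_of_real (\<zeta> x))" "\<And>x. 0 \<le> \<zeta> x" "\<And>x. norm x \<le> 1 ==> \<zeta> x = 1" "\<And>x. b < norm x ==> \<zeta> x = 0"
  and \<delta>: "0 < \<delta>" "\<delta> * b \<le> \<sigma>" and \<omega>: "norm \<omega> = 1" and R: "4 \<le> R"
  and \<Phi>: "continuous_on V \<Phi>" and a: "continuous_on UNIV a" and A: "0 \<le> A" "2 * A \<le> norm \<alpha>"
  and locked: "nearly_constant_on V \<Phi> a (plank \<omega> \<sigma> R) y \<alpha> A (x, t)"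
  and f: "fourier f = (\<lambda>\<eta>. packet \<zeta> \<omega> \<delta> R \<eta> * exp (- \<i> * of_real (\<eta> \<bullet> y)))"
 shows "A * (\<delta> ^ CARD('n) * measure lborel (cball (0::real^'n) 1) * R powr ((real CARD('n) + 1) / 2)) \<le> norm (fio \<Phi> a t f x)"
proof -
 have close: "((x, t), \<eta>) \<in> V \<and> norm (iexp (\<Phi> ((x, t), \<eta>)) * a ((x, t), \<eta>) * exp (- \<i> * of_real (\<eta> \<bullet> y)) - \<alpha>) \<le> A"
  if "\<eta> \<in> plank \<omega> \<sigma> R" for \<eta> using locked that unfolding nearly_constant_on_def by blast
 define w where "w \<eta> = \<zeta> (aniso \<omega> (1 / (\<delta> * R)) (1 / (\<delta> * sqrt R)) (\<eta> - R *\<^sub>R \<omega>))" for \<eta>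
 have pw: "packet \<zeta> \<omega> \<delta> R \<eta> = of_real (w \<eta>)" for \<eta> unfolding packet_def w_def ..
 have w0: "0 \<le> w \<eta>" for \<eta> unfolding w_def by (rule \<zeta>(2))
 define S where "S r = {\<eta>. norm (aniso \<omega> (1 / (\<delta> * R)) (1 / (\<delta> * sqrt R)) (\<eta> - R *\<^sub>R \<omega>)) \<le> r}" for r
 have Scl: "closed (S r)" for r
  unfolding S_def aniso_def by (intro closed_Collect_le continuous_intros)
 have Spl: "\<eta> \<in> plank \<omega> \<sigma> R" if "\<eta> \<in> S b" for \<eta>
 proof -
  have "\<eta> \<in> plank \<omega> (\<delta> * b) R" using aniso_ball_plank[OF \<omega> \<delta>(1), of R \<eta> b] that R unfolding S_def by simp
  moreover have "\<delta> * b * R \<le> \<sigma> * R" "\<delta> * b * sqrt R \<le> \<sigma> * sqrt R" using \<delta> R by (auto intro: mult_right_mono)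
  ultimately show ?thesis unfolding plank_def by auto
 qed
 have w_out: "w \<eta> = 0" if "\<eta> \<notin> S b" for \<eta> using that \<zeta>(4) unfolding w_def S_def by auto
 have Sc: "compact (S b)"
 proof -
  have "norm \<eta> \<le> (\<sigma> * R + \<sigma> * sqrt R) + R" if "\<eta> \<in> S b" for \<eta>
  proof -
   have "\<bar>\<eta> \<bullet> \<omega> - R\<bar> \<le> \<sigma> * R" "norm (\<eta> - (\<eta> \<bullet> \<omega>) *\<^sub>R \<omega>) \<le> \<sigma> * sqrt R" using Spl[OF that] unfolding plank_def by auto
   moreover have "norm \<eta> \<le> norm (\<eta> - (\<eta> \<bullet> \<omega>) *\<^sub>R \<omega>) + \<bar>\<eta> \<bullet> \<omega>\<bar>"
    using norm_triangle_ineq[of "\<eta> - (\<eta> \<bullet> \<omega>) *\<^sub>R \<omega>" "(\<eta> \<bullet> \<omega>) *\<^sub>R \<omega>"] \<omega> by simp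
   ultimately show ?thesis using R by linarith
  qed
  then have "bounded (S b)" unfolding bounded_iff by blast
  then show ?thesis using Scl by (simp add: compact_eq_bounded_closed)
 qed
 have wc: "continuous_on T (\<lambda>\<eta>. complex_of_real (w \<eta>))" for T
 proof -
  have "continuous_on UNIV (\<lambda>x. complex_of_real (\<zeta> x))" using \<zeta>(1) by (rule smooth_continuous)
  then show ?thesis unfolding w_def aniso_def by (rule continuous_on_compose2) (auto intro!: continuous_intros)
 qed
 have wi: "integrable lborel (\<lambda>\<eta>. complex_of_real (w \<eta>))"
 proof -
  have "integrable lborel (\<lambda>\<eta>. indicator (S b) \<eta> *\<^sub>R complex_of_real (w \<eta>))" by (rule borel_integrable_compact[OF Sc wc])
  moreover have "indicator (S b) \<eta> *\<^sub>R complex_of_real (w \<eta>) = of_real (w \<eta>)" for \<eta> using w_out[of \<eta>] by (auto simp: indicator_def)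
  ultimately show ?thesis by simp
 qed
 have wr: "integrable lborel w" by (rule integrable_Re[OF wi, unfolded Re_complex_of_real])
 define g where "g \<eta> = iexp (\<Phi> ((x, t), \<eta>)) * a ((x, t), \<eta>) * fourier f \<eta>" for \<eta>
 have g: "g \<eta> = (iexp (\<Phi> ((x, t), \<eta>)) * a ((x, t), \<eta>) * exp (- \<i> * of_real (\<eta> \<bullet> y))) * of_real (w \<eta>)" for \<eta>
  unfolding g_def f pw by simp
 have gi: "integrable lborel g"
 proof -
  have inV: "((x, t), \<eta>) \<in> V" if "\<eta> \<in> S b" for \<eta> using close[OF Spl[OF that]] by (rule conjunct1)
  have "continuous_on (S b) g"
   unfolding g
  proof (intro continuous_on_mult continuous_on_exp wc continuous_on_const continuous_on_of_real)
   have "(\<lambda>\<eta>. ((x, t), \<eta>)) ` S b \<subseteq> V" using inV by blast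
   then show "continuous_on (S b) (\<lambda>\<eta>. \<Phi> ((x, t), \<eta>))"
    by (rule continuous_on_compose2[OF \<Phi> continuous_on_Pair[OF continuous_on_const continuous_on_id]])
   show "continuous_on (S b) (\<lambda>\<eta>. a ((x, t), \<eta>))"
    by (rule continuous_on_compose2[OF a continuous_on_Pair[OF continuous_on_const continuous_on_id]]) simp
  qed (intro continuous_intros)
  then have "integrable lborel (\<lambda>\<eta>. indicator (S b) \<eta> *\<^sub>R g \<eta>)" by (rule borel_integrable_compact[OF Sc])
  moreover have "indicator (S b) \<eta> *\<^sub>R g \<eta> = g \<eta>" for \<eta> using w_out[of \<eta>] by (auto simp: indicator_def g)
  ultimately show ?thesis by simp
 qed
 have diff: "norm (g \<eta> - \<alpha> * of_real (w \<eta>)) \<le> A * w \<eta>" for \<eta>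
 proof (cases "\<eta> \<in> S b")
  case True
  have "g \<eta> - \<alpha> * of_real (w \<eta>) = (iexp (\<Phi> ((x, t), \<eta>)) * a ((x, t), \<eta>) * exp (- \<i> * of_real (\<eta> \<bullet> y)) - \<alpha>) * of_real (w \<eta>)"
   unfolding g by (simp only: left_diff_distrib)
  then show ?thesis using close[OF Spl[OF True]] w0[of \<eta>] by (simp only: norm_mult norm_of_real abs_of_nonneg) (intro mult_right_mono, auto)
 qed (simp add: w_out g)
 define I where "I = (\<integral>\<eta>. w \<eta> \<partial>lborel)"
 have "norm ((\<integral>\<eta>. g \<eta> \<partial>lborel) - \<alpha> * of_real I) = norm (\<integral>\<eta>. g \<eta> - \<alpha> * of_real (w \<eta>) \<partial>lborel)"
  unfolding I_def using gi wi by simp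
 also have "... \<le> (\<integral>\<eta>. norm (g \<eta> - \<alpha> * of_real (w \<eta>)) \<partial>lborel)" by (rule integral_norm_bound)
 also have "... \<le> (\<integral>\<eta>. A * w \<eta> \<partial>lborel)"
  using gi wi wr by (intro integral_mono diff) auto
 also have "... = A * I" unfolding I_def by simp
 finally have "norm ((\<integral>\<eta>. g \<eta> \<partial>lborel) - \<alpha> * of_real I) \<le> A * I" .
 moreover have I0: "0 \<le> I" unfolding I_def by (intro integral_nonneg_AE) (simp add: w0)
 moreover have "norm (\<alpha> * of_real I) = norm \<alpha> * I" using I0 by (simp add: norm_mult)
 moreover have "2 * A * I \<le> norm \<alpha> * I" using A I0 by (intro mult_right_mono) auto
 ultimately have 1: "A * I \<le> norm (\<integral>\<eta>. g \<eta> \<partial>lborel)"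
  using norm_triangle_ineq2[of "\<alpha> * of_real I" "\<integral>\<eta>. g \<eta> \<partial>lborel"] by (simp add: norm_minus_commute)
 have "\<delta> ^ CARD('n) * measure lborel (cball (0::real^'n) 1) * R powr ((real CARD('n) + 1) / 2) \<le> I" (is "?v \<le> I")
 proof -
  have v0: "0 \<le> ?v" using \<delta> by simp
  have em: "emeasure lborel (S 1) = ennreal ?v" unfolding S_def using aniso_ball_measure[OF \<omega> \<delta>(1), of R "R *\<^sub>R \<omega>" 1] R by simp
  have "?v = measure lborel (S 1)" using em v0 by (simp add: measure_def)
  also have "... = (\<integral>\<eta>. indicator (S 1) \<eta> \<partial>lborel)" using Scl by simp
  also have "... \<le> I" unfolding I_def
  proof (rule integral_mono)
   show "integrable lborel (indicator (S 1) :: real^'n => real)"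
    using em Scl by (intro integrable_real_indicator) auto
   show "indicator (S 1) \<eta> \<le> w \<eta>" for \<eta>
    using \<zeta>(3) w0[of \<eta>] unfolding S_def w_def by (auto simp: indicator_def)
  qed (rule wr)
  finally show ?thesis .
 qed
 then have "A * ?v \<le> A * I" using A(1) by (rule mult_left_mono)
 then show ?thesis using 1 unfolding fio_def g_def by simp
qed

lemma Lp_norm_fun_lower:
 fixes g :: "'a::euclidean_space => ennreal"
 assumes p: "1 \<le> p" and E: "compact E" "M \<le> measure lborel E" "0 < M" and L: "0 \<le> L" "\<And>x. x \<in> E ==> ennreal L \<le> g x"
 shows "ennreal (L * M powr enn2real (1 / p)) \<le> Lp_norm_fun p g"
proof -
 have Es: "E \<in> sets lborel" using E(1) by (simp add: borel_closed compact_imp_closed)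
 have "emeasure lborel E \<noteq> \<infinity>" using emeasure_compact_finite[OF E(1)] by simp
 then have em: "ennreal M \<le> emeasure lborel E" using E(2) by (simp add: emeasure_eq_ennreal_measure ennreal_leI)
 show ?thesis
 proof (cases "p = \<infinity>")
  case True
  \<comment> \<open>The power of \<open>M\<close> is 1 here because \<open>1 / \<infinity> = 0\<close>.\<close>
  have "ennreal L \<le> esssup lborel g"
  proof (rule ccontr)
   assume "\<not> ?thesis"
   then have lt: "esssup lborel g < ennreal L" by simp
   have "AE x in lborel. g x \<le> esssup lborel g" by (rule esssup_AE)
   then have "AE x in lborel. x \<notin> E" by (rule AE_mp) (use L(2) lt in \<open>auto intro!: AE_I2 dest: leD order_trans\<close>)
   then have "E \<in> null_sets lborel" using AE_iff_null_sets[OF Es] by simp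
   then have "ennreal M \<le> 0" using em by (simp add: null_setsD1)
   then show False using E(3) by (simp add: ennreal_eq_0_iff)
  qed
  then show ?thesis unfolding Lp_norm_fun_def using True E(3) by simp
 next
  case False
  define P where "P = enn2real p"
  have P: "1 \<le> P" unfolding P_def using enn2real_mono[of 1 p] p False by (simp add: less_top[symmetric])
  have pP: "p = ennreal P" unfolding P_def using False by (simp add: less_top[symmetric])
  have P1: "enn2real (1 / p) = 1 / P" unfolding pP using P by (simp add: ennreal_1[symmetric] divide_ennreal del: ennreal_1)
  have "ennreal (L powr P * M) = ennreal (L powr P) * ennreal M" using E(3) by (intro ennreal_mult) auto
  also have "... \<le> ennreal (L powr P) * emeasure lborel E" by (intro mult_left_mono em) simp
  also have "... = (\<integral>\<^sup>+x. ennreal (L powr P) * indicator E x \<partial>lborel)" using Es by (simp add: nn_integral_cmult_indicator)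
  also have "... \<le> (\<integral>\<^sup>+x. epowr (g x) P \<partial>lborel)"
  proof (rule nn_integral_mono)
   fix x
   show "ennreal (L powr P) * indicator E x \<le> epowr (g x) P"
    using epowr_mono[OF L(2), of x P] P L(1) by (cases "x \<in> E") (auto simp: epowr_ennreal)
  qed
  finally have "epowr (ennreal (L powr P * M)) (1 / P) \<le> epowr (\<integral>\<^sup>+x. epowr (g x) P \<partial>lborel) (1 / P)"
   using P by (intro epowr_mono) auto
  moreover have "epowr (ennreal (L powr P * M)) (1 / P) = ennreal (L * M powr (1 / P))"
   using E(3) L(1) P by (simp add: epowr_ennreal powr_mult powr_powr)
  ultimately show ?thesis unfolding Lp_norm_fun_def P1 using False by (simp add: P_def[symmetric])
 qed
qed

lemma powr_growth_le:
 fixes c C A B :: real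
 assumes c: "0 < c" and le: "\<And>R. R0 \<le> R ==> c * R powr A \<le> C * R powr B"
 shows "A \<le> B"
proof (rule ccontr)
 assume "\<not> A \<le> B"
 then have d: "0 < A - B" by simp
 define M where "M = \<bar>C\<bar> / c + 1"
 have M: "1 \<le> M" unfolding M_def using c by simp
 define R where "R = max (max R0 1) (M powr (1 / (A - B)))"
 have R: "R0 \<le> R" "1 \<le> R" "M powr (1 / (A - B)) \<le> R" unfolding R_def by auto
 have "M = (M powr (1 / (A - B))) powr (A - B)" using d M by (simp add: powr_powr)
 also have "... \<le> R powr (A - B)" using d R(3) by (intro powr_mono2) auto
 also have "R powr (A - B) = R powr A / R powr B" by (rule powr_diff)
 finally have "M * R powr B \<le> R powr A" using R by (simp add: field_simps)
 then have "c * (M * R powr B) \<le> c * R powr A" using c by (intro mult_left_mono) auto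
 also have "... \<le> C * R powr B" by (rule le[OF R(1)])
 finally have "(c * M) * R powr B \<le> C * R powr B" by simp
 then have "c * M \<le> C" using R by (simp add: mult_le_cancel_right)
 moreover have "c * M = \<bar>C\<bar> + c" unfolding M_def using c by (simp add: field_simps)
 ultimately show False using c by linarith
qed

theorem theorem4p5:
  fixes q :: "real^'n \<Rightarrow> complex"
    and \<phi> :: "real^'n \<Rightarrow> real^'n \<Rightarrow> complex"
    and V :: "(((real^'n) \<times> real) \<times> (real^'n)) set"
    and \<Phi> :: "((real^'n) \<times> real) \<times> (real^'n) \<Rightarrow> real"
    and a :: "((real^'n) \<times> real) \<times> (real^'n) \<Rightarrow> complex"
    and m s t0 c' C' :: real
    and p :: ennreal
    and x0 :: "real^'n"
    and V' :: "(real^'n) set"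
  assumes n: "CARD('n) \<ge> 2"
    and q: "low_freq_cutoff q"
    and \<phi>: "wave_packets \<phi>"
    and V: "open V" "V \<subseteq> UNIV \<times> (- {0})" "fiber_conic V"
    and \<Phi>_smooth: "smooth_on V \<Phi>"
    and \<Phi>_homogeneous: "\<And>z \<eta> r. (z, \<eta>) \<in> V \<Longrightarrow> r > 0 \<Longrightarrow> \<Phi> (z, r *\<^sub>R \<eta>) = r * \<Phi> (z, \<eta>)"
    and a_symbol: "a \<in> symbol_class m"
    and a_supp: "\<And>z \<eta>. (z, \<eta>) \<in> supp a \<Longrightarrow> \<eta> \<noteq> 0 \<Longrightarrow> (z, \<eta>) \<in> V"
    and rank: "\<And>z \<eta>. (z, \<eta>) \<in> supp a \<Longrightarrow> \<eta> \<noteq> 0 \<Longrightarrow> rank (mixed_hessian \<Phi> (z, \<eta>)) = CARD('n)"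
    and p: "1 \<le> p"
    and V': "V' \<noteq> {}" "open V'" "V' \<subseteq> - {0}" "pos_conic V'"
    and pos: "c' > 0" "C' > 0"
    and a_elliptic: "\<And>\<eta>. \<eta> \<in> V' \<Longrightarrow> norm \<eta> \<ge> C' \<Longrightarrow> norm (a ((x0, t0), \<eta>)) \<ge> c' * norm \<eta> powr m"
    and dt_nonzero: "\<And>\<eta>. \<eta> \<in> V' \<Longrightarrow> norm \<eta> \<ge> C' \<Longrightarrow> deriv (\<lambda>t. \<Phi> ((x0, t), \<eta>)) t0 \<noteq> 0"
    and bound: "\<exists>C::real. C \<ge> 0 \<and> (\<forall>f\<in>schwartz.
      Lp_norm_fun p (\<lambda>x. SUP t. ennreal (norm (fio \<Phi> a t f x)))
        \<le> ennreal C * HFIO_norm q \<phi> s p (distr_of f))"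
  shows "s \<ge> (real CARD('n) - 1) / 2 * (enn2real (1 / p) - 1 / 2) + enn2real (1 / p) + m"
proof -
 define n where "n = real CARD('n)"
 define ip where "ip = enn2real (1 / p)"
 obtain \<zeta> :: "real^'n => real" and b where b: "1 \<le> b" and \<zeta>: "smooth (\<lambda>x. complex_of_real (\<zeta> x))" "\<And>x. 0 \<le> \<zeta> x"
   "\<And>x. norm x \<le> 1 ==> \<zeta> x = 1" "\<And>x. b < norm x ==> \<zeta> x = 0" and q0: "\<And>x. b < norm x ==> q x = 0"
  by (rule low_freq_cutoff_bump[OF q]) (assumption | rule that)+
 have qs: "q \<in> schwartz" by (rule schwartz_compact_support[of q b]) (use q q0 in \<open>auto simp: low_freq_cutoff_def\<close>)
 obtain \<eta>1 where \<eta>1: "\<eta>1 \<in> V'" using V'(1) by blast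
 define \<omega> where "\<omega> = sgn \<eta>1"
 have \<eta>1n: "\<eta>1 \<noteq> 0" using \<eta>1 V'(3) by auto
 have \<omega>: "norm \<omega> = 1" unfolding \<omega>_def using \<eta>1n by (simp add: norm_sgn)
 have \<omega>V': "r *\<^sub>R \<omega> \<in> V'" if "0 < r" for r
  using V'(4) \<eta>1 that \<eta>1n unfolding pos_conic_def \<omega>_def sgn_div_norm by simp
 have ell: "c' * R powr m \<le> norm (a ((x0, t0), R *\<^sub>R \<omega>))" if "C' \<le> R" for R
  using a_elliptic[OF \<omega>V', of R] that pos \<omega> by simp
 \<comment> \<open>The amplitude is known to be nonzero at large frequencies only; homogeneity transports the conclusions to \<open>\<omega>\<close>.\<close>
 have C'V: "((x0, t0), C' *\<^sub>R \<omega>) \<in> V"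
 proof (rule a_supp)
  have "0 < c' * C' powr m" using pos by simp
  then have "a ((x0, t0), C' *\<^sub>R \<omega>) \<noteq> 0" using ell[of C'] by auto
  then show "((x0, t0), C' *\<^sub>R \<omega>) \<in> supp a" unfolding supp_def by (intro subsetD[OF closure_subset]) simp
  show "C' *\<^sub>R \<omega> \<noteq> 0" using pos \<omega> by auto
 qed
 have \<omega>V: "((x0, t0), \<omega>) \<in> V"
 proof -
  have "((x0, t0), (1 / C') *\<^sub>R (C' *\<^sub>R \<omega>)) \<in> V" by (rule fiber_conicD[OF V(3) C'V]) (use pos in simp)
  then show ?thesis using pos by simp
 qed
 have dt: "deriv (\<lambda>t. \<Phi> ((x0, t), \<omega>)) t0 \<noteq> 0"
 proof
  assume 0: "deriv (\<lambda>t. \<Phi> ((x0, t), \<omega>)) t0 = 0"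
  have V1: "open ((\<lambda>t. ((x0, t), \<omega>)) -` V)" by (intro continuous_open_vimage V(1) continuous_intros)
  then have "\<forall>\<^sub>F t in nhds t0. t \<in> (\<lambda>t. ((x0, t), \<omega>)) -` V" using \<omega>V by (intro eventually_nhds_in_open) auto
  then have ev: "\<forall>\<^sub>F t in nhds t0. \<Phi> ((x0, t), C' *\<^sub>R \<omega>) = C' * \<Phi> ((x0, t), \<omega>)"
   by eventually_elim (use \<Phi>_homogeneous pos in auto)
  have "((\<lambda>t. \<Phi> ((x0, t), \<omega>)) has_real_derivative 0) (at t0)"
   using smooth_on_fiber_derivative[OF \<Phi>_smooth V(1) \<omega>V] unfolding 0 .
  then have "((\<lambda>t. C' * \<Phi> ((x0, t), \<omega>)) has_real_derivative C' * 0) (at t0)" by (rule DERIV_cmult)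
  then have "((\<lambda>t. \<Phi> ((x0, t), C' *\<^sub>R \<omega>)) has_real_derivative 0) (at t0)"
   using DERIV_cong_ev[OF refl ev refl] by simp
  then have "deriv (\<lambda>t. \<Phi> ((x0, t), C' *\<^sub>R \<omega>)) t0 = 0" by (rule DERIV_imp_deriv)
  moreover have "norm (C' *\<^sub>R \<omega>) \<ge> C'" using pos \<omega> by simp
  ultimately show False using dt_nonzero[OF \<omega>V'[OF pos(2)]] by blast
 qed
 obtain \<sigma> \<kappa> where \<sigma>: "0 < \<sigma>" "\<sigma> \<le> 1/8" and \<kappa>: "0 < \<kappa>"
  and cell: "\<And>R. 4 \<le> R ==> \<exists>E y. compact E \<and> \<kappa> * R powr (- (real CARD('n) - 1) / 2) \<le> measure lborel E \<and>
   (\<forall>x\<in>E. \<exists>t. nearly_constant_on V \<Phi> a (plank \<omega> \<sigma> R) y (a ((x0, t0), R *\<^sub>R \<omega>)) (c' / 2 * R powr m) (x, t))"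
  by (rule oscillation_controlled_on_cell[OF V(1,3) \<Phi>_smooth \<Phi>_homogeneous a_symbol \<omega> \<omega>V dt half_gt_zero[OF pos(1)]]) (assumption | rule that)+
 obtain \<sigma>1 c1 \<kappa>1 where \<sigma>1: "0 < \<sigma>1" "\<sigma>1 \<le> 1/8" and c1: "0 < c1" "0 < \<kappa>1"
  and lower: "\<And>\<theta> R. norm \<theta> = 1 ==> 4 \<le> R ==> \<exists>\<Omega>. \<Omega> \<in> sets sphere_measure \<and>
   ennreal (\<kappa>1 * R powr (- (real CARD('n) - 1) / 2)) \<le> emeasure sphere_measure \<Omega> \<and>
   (\<forall>\<omega>\<in>\<Omega>. \<forall>\<xi>\<in>plank \<theta> \<sigma>1 R. c1 * R powr ((real CARD('n) - 1) / 4) \<le> norm (\<phi> \<omega> \<xi>))"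
  by (rule wave_packets_lower[OF \<phi>]) (assumption | rule that)+
 \<comment> \<open>The bump then lives on the narrower of the two planks.\<close>
 define \<delta> where "\<delta> = min \<sigma> \<sigma>1 / b"
 have \<delta>: "0 < \<delta>" "\<delta> * b \<le> 1/8" "\<delta> * b \<le> \<sigma>" "\<delta> * b \<le> \<sigma>1" unfolding \<delta>_def using \<sigma> \<sigma>1 b by auto
 define F where "F R y = (\<lambda>\<eta>. packet \<zeta> \<omega> \<delta> R \<eta> * exp (- \<i> * of_real (\<eta> \<bullet> y)))" for R y
 define X where "X = (n - 1) / 4 + s + (n + 1) / 2 - n * ip"
 obtain C1 R1 where C1: "0 \<le> C1" "4 \<le> R1" and upper: "\<And>R y. R1 \<le> R ==> HFIO_norm q \<phi> s p (distr_of (inv_fourier (F R y))) \<le> ennreal (C1 * R powr X)"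
 proof (cases "p = \<infinity>")
  case True
  obtain C R0 where C: "0 \<le> C" "4 \<le> R0" and u: "\<And>R y. R0 \<le> R ==>
    HFIO_norm q \<phi> s \<infinity> (distr_of (inv_fourier (\<lambda>\<eta>. packet \<zeta> \<omega> \<delta> R \<eta> * exp (- \<i> * of_real (\<eta> \<bullet> y)))))
     \<le> ennreal (C * R powr ((real CARD('n) - 1) / 4 + s + (real CARD('n) + 1) / 2))"
   by (rule HFIO_inf_upper[OF b \<zeta>(1,4) \<delta>(1,2) \<omega> \<phi> qs q0 \<delta>(4) c1 lower]) (assumption | rule that)+
  have "ip = 0" unfolding ip_def True by simp
  then show ?thesis by (intro that[OF C]) (use u in \<open>simp add: F_def X_def n_def True\<close>)
 next
  case False
  obtain C R0 where C: "0 \<le> C" "4 \<le> R0" and u: "\<And>R y. R0 \<le> R ==>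
    HFIO_norm q \<phi> s p (distr_of (inv_fourier (\<lambda>\<eta>. packet \<zeta> \<omega> \<delta> R \<eta> * exp (- \<i> * of_real (\<eta> \<bullet> y)))))
     \<le> ennreal (C * R powr ((real CARD('n) - 1) / 4 + s + (real CARD('n) + 1) / 2 - real CARD('n) * enn2real (1 / p)))"
   by (rule HFIO_fin_upper[OF b \<zeta>(1,4) \<delta>(1,2) \<omega> \<phi> qs q0 p False]) (assumption | rule that)+
  show ?thesis by (rule that[OF C]) (use u in \<open>simp add: F_def X_def n_def ip_def\<close>)
 qed
 obtain C2 where C2: "0 \<le> C2" and T: "\<And>f. f \<in> schwartz ==>
   Lp_norm_fun p (\<lambda>x. SUP t. ennreal (norm (fio \<Phi> a t f x))) \<le> ennreal C2 * HFIO_norm q \<phi> s p (distr_of f)"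
  using bound by blast
 define v where "v = c' / 2 * (\<delta> ^ CARD('n) * measure lborel (cball (0::real^'n) 1))"
 have "0 < measure lborel (cball (0::real^'n) 1)" by (rule content_cball_pos) simp
 then have v: "0 < v" unfolding v_def using pos \<delta> by simp
 have main: "(v * \<kappa> powr ip) * R powr (m + (n + 1) / 2 - (n - 1) / 2 * ip) \<le> (C2 * C1) * R powr X"
  if R: "max R1 C' \<le> R" for R
 proof -
  have R': "R1 \<le> R" "C' \<le> R" "4 \<le> R" using R C1 by auto
  obtain E y where E: "compact E" "\<kappa> * R powr (- (n - 1) / 2) \<le> measure lborel E"
   and close: "\<And>x. x \<in> E ==> \<exists>t. nearly_constant_on V \<Phi> a (plank \<omega> \<sigma> R) y (a ((x0, t0), R *\<^sub>R \<omega>)) (c' / 2 * R powr m) (x, t)"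
   using cell[OF R'(3)] unfolding n_def by blast
  have Fs: "F R y \<in> schwartz" unfolding F_def
   by (rule modulated_packet_schwartz[OF b \<zeta>(1,4) \<delta>(1,2) \<omega> \<phi> qs q0 R'(3)])
  define f where "f = inv_fourier (F R y)"
  have f: "f \<in> schwartz" unfolding f_def using Fs by (rule schwartz_inv_fourier)
  have ff: "fourier f = (\<lambda>\<eta>. packet \<zeta> \<omega> \<delta> R \<eta> * exp (- \<i> * of_real (\<eta> \<bullet> y)))"
   unfolding f_def fourier_inv_fourier[OF Fs] unfolding F_def by (rule refl)
  define L where "L = v * R powr (m + (n + 1) / 2)"
  have L: "ennreal L \<le> (SUP t. ennreal (norm (fio \<Phi> a t f x)))" if x: "x \<in> E" for x
  proof -
   obtain t where t: "nearly_constant_on V \<Phi> a (plank \<omega> \<sigma> R) y (a ((x0, t0), R *\<^sub>R \<omega>)) (c' / 2 * R powr m) (x, t)"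
    using close[OF x] by blast
   have \<Phi>c: "continuous_on V \<Phi>" using smooth_on_continuous_pderivs[OF \<Phi>_smooth, of "[]"] by simp
   have ac: "continuous_on UNIV a" using a_symbol unfolding symbol_class_def by (auto intro: smooth_continuous)
   have "(c' / 2 * R powr m) * (\<delta> ^ CARD('n) * measure lborel (cball (0::real^'n) 1) * R powr ((real CARD('n) + 1) / 2)) \<le> norm (fio \<Phi> a t f x)"
    by (rule fio_packet_lower[OF b \<zeta> \<delta>(1,3) \<omega> R'(3) \<Phi>c ac _ _ t ff])
     (use pos ell[OF R'(2)] in simp_all)
   also have "(c' / 2 * R powr m) * (\<delta> ^ CARD('n) * measure lborel (cball (0::real^'n) 1) * R powr ((real CARD('n) + 1) / 2)) = L"
    unfolding L_def v_def n_def powr_add by simp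
   finally have "ennreal L \<le> ennreal (norm (fio \<Phi> a t f x))" by (rule ennreal_leI)
   then show ?thesis by (rule SUP_upper2[OF UNIV_I])
  qed
  have M0: "0 < \<kappa> * R powr (- (n - 1) / 2)" using \<kappa> R' by simp
  have "ennreal (L * (\<kappa> * R powr (- (n - 1) / 2)) powr ip) \<le> Lp_norm_fun p (\<lambda>x. SUP t. ennreal (norm (fio \<Phi> a t f x)))"
   unfolding ip_def using v by (intro Lp_norm_fun_lower[OF p E M0 _ L]) (auto simp: L_def)
  also have "... \<le> ennreal C2 * HFIO_norm q \<phi> s p (distr_of f)" by (rule T[OF f])
  also have "... \<le> ennreal C2 * ennreal (C1 * R powr X)" unfolding f_def by (intro mult_left_mono upper R') simp
  also have "... = ennreal (C2 * (C1 * R powr X))" using C1 C2 by (simp add: ennreal_mult)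
  finally have "L * (\<kappa> * R powr (- (n - 1) / 2)) powr ip \<le> C2 * (C1 * R powr X)"
   using C1 C2 by (simp add: ennreal_le_iff)
  moreover have "L * (\<kappa> * R powr (- (n - 1) / 2)) powr ip = (v * \<kappa> powr ip) * R powr (m + (n + 1) / 2 - (n - 1) / 2 * ip)"
  proof -
   have "(\<kappa> * R powr (- (n - 1) / 2)) powr ip = \<kappa> powr ip * R powr (- (n - 1) / 2 * ip)"
    using \<kappa> by (simp add: powr_mult powr_powr)
   moreover have "R powr (m + (n + 1) / 2) * R powr (- (n - 1) / 2 * ip) = R powr (m + (n + 1) / 2 - (n - 1) / 2 * ip)"
    unfolding powr_add[symmetric] by (rule arg_cong[of _ _ "(powr) R"]) (simp add: field_simps)
   ultimately show ?thesis unfolding L_def by simp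
  qed
  ultimately show ?thesis by (simp only: mult.assoc)
 qed
 have "m + (n + 1) / 2 - (n - 1) / 2 * ip \<le> X"
  by (rule powr_growth_le[OF _ main]) (use v \<kappa> in simp)
 then show ?thesis unfolding X_def n_def[symmetric] ip_def[symmetric] by (simp add: field_simps)
qed

end
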